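(* Let $X$ be a path-connected space and $x_0\in X$. Suppose $\mathbf{w}(X)$ is discrete and $N\trianglelefteq\pi_1(X,x_0)$ is a normal subgroup. Then $N$ is $(D,d_\infty)$-closed if and only if $N$ is $(P,p_\tau)$-closed. In particular, the closure operators $cl_{D,d_\infty}$ and $cl_{P,p_\tau}$ agree on the normal subgroups of $\pi_1(X,x_0)$.
   Context: A map is a continuous function; $f_{\#}$ denotes the homomorphism induced on fundamental groups. For paths, $\alpha\cdot\beta$ is concatenation and $\alpha^{-}(t)=\alpha(1-t)$. $\mathbf{w}(X)\subseteq X$ is the subspace of points at which $X$ is not semilocally simply connected, i.e. points $x$ having no open neighborhood $U$ for which $\pi_1(U,x)\to\pi_1(X,x)$ is trivial. "Discrete" means discrete in the subspace topology. Closed subgroups and closure: for a based space $(\mathbb{T},t_0)$, a subgroup $T\leq\pi_1(\mathbb{T},t_0)$ and $g\in\pi_1(\mathbb{T},t_0)$, a subgroup $H\leq\pi_1(X,x_0)$ is $(T,g)$-closed if for every map $f:(\mathbb{T},t_0)\to(X,x_0)$ with $f_{\#}(T)\leq H$ we have $f_{\#}(g)\in H$. The $(T,g)$-closure $cl_{T,g}(H)$ is the intersection of all $(T,g)$-closed subgroups of $\pi_1(X,x_0)$ containing $H$. The test space $\mathbb{D}$: for integers $n\geq1$, $1\leq j\leq 2^{n-1}$ let $\mathbb{D}(n,j)=\{(x,y)\in\mathbb{R}^2\mid (x-\frac{2j-1}{2^n})^2+y^2=(\frac1{2^n})^2,\ y\geq0\}$, and let $\mathbb{D}=([0,1]\times\{0\})\cup\bigcup_{n,j}\mathbb{D}(n,j)\subseteq\mathbb{R}^2$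 with basepoint $d_0=(0,0)$. Let $\ell_{n,j}(t)=\left(\frac{t+j-1}{2^{n-1}},\frac{1}{2^{n-1}}\sqrt{t-t^2}\right)$, $t\in[0,1]$; the paths $\ell_{n,j}$ and $\ell_{n,j}^{-}$ are called standard. Let $\lambda_1=\ell_{1,1}$ and $\lambda_\infty(t)=(t,0)$. $D\leq\pi_1(\mathbb{D},d_0)$ is the subgroup of homotopy classes of loops at $d_0$ that are finite concatenations of standard paths, and $d_\infty=[\lambda_1\cdot\lambda_\infty^{-}]$. The test space $\mathbb{H}^+$: let $C_n\subseteq\mathbb{R}^2$ be the circle of radius $\frac1n$ centered at $(\frac1n,0)$, $\mathbb{H}=\bigcup_{n\geq1}C_n$, $b_0=(0,0)$, and $\mathbb{H}^+=\mathbb{H}\cup([-1,0]\times\{0\})$ with basepoint $b_0^+=(-1,0)$. Let $\ell_n$ be the loop based at $b_0$ traversing $C_n$ once counterclockwise and $\iota:[0,1]\to\mathbb{H}^+$, $\iota(t)=(t-1,0)$. Let $\mathcal{C}\subseteq[0,1]$ be the standard middle third Cantor set and write $[0,1]\setminus\mathcal{C}=\bigcup_{n\geq1}\bigcup_{k=1}^{2^{n-1}}I_n^k$, where $I_n^k$ are the components of length $\frac{1}{3^n}$, indexed by $k$ in their natural order. Let $\ell_\tau:[0,1]\to\mathbb{H}$ be the loop with $\ell_\tau(\mathcal{C})=\{b_0\}$ and equal to $\ell_{2^{n-1}+k-1}$ (linearly reparametrized) on $\overline{I_n^k}$. Let $f_{odd},f_{even}:\mathbb{H}\to\mathbb{H}$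 be the maps with $f_{odd}\circ\ell_n=\ell_{2n-1}$ and $f_{even}\circ\ell_n=\ell_{2n}$. Put $p_n=[\iota\cdot\ell_{2n-1}\cdot\ell_{2n}^{-}\cdot\iota^{-}]$, $P=\langle p_n\mid n\in\mathbb{N}\rangle\leq\pi_1(\mathbb{H}^+,b_0^+)$, and $p_\tau=[\iota\cdot(f_{odd}\circ\ell_\tau)\cdot(f_{even}\circ\ell_\tau)^{-}\cdot\iota^{-}]$. *)

theory Defs
  imports "HOL-Analysis.Analysis" "HOL-Algebra.Generated_Groups"
begin

section \<open>Fundamental groups\<close>

text \<open>
  A space is a subset \<open>X\<close> of a type of class \<^class>\<open>topological_space\<close>, carrying the subspace
  topology. Paths are functions on all of \<^typ>\<open>real\<close> of which only the restriction to \<open>[0,1]\<close>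
  matters: \<^const>\<open>homotopic_paths\<close> identifies functions that agree there.
\<close>

definition path_class :: "'a::topological_space set \<Rightarrow> (real \<Rightarrow> 'a) \<Rightarrow> (real \<Rightarrow> 'a) set" where
  "path_class X p = {q. homotopic_paths X p q}"

definition loops_at :: "'a::topological_space set \<Rightarrow> 'a \<Rightarrow> (real \<Rightarrow> 'a) set" where
  "loops_at X x = {p. path p \<and> path_image p \<subseteq> X \<and> pathstart p = x \<and> pathfinish p = x}"

definition fundamental_group :: "'a::topological_space set \<Rightarrow> 'a \<Rightarrow> (real \<Rightarrow> 'a) set monoid" where
  "fundamental_group X x =
     \<lparr>carrier = path_class X ` loops_at X x,
      mult = (\<lambda>A B. \<Union>p\<in>A. \<Union>q\<in>B. path_class X (p +++ q)),
      one = path_class X (\<lambda>_. x)\<rparr>"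

text \<open>
  The union is over representatives of one class and yields a single class; the domain space needs
  no mention, since \<open>A\<close> is a class of paths in it.
\<close>

definition induced_hom ::
    "'b::topological_space set \<Rightarrow> ('a::topological_space \<Rightarrow> 'b) \<Rightarrow> (real \<Rightarrow> 'a) set \<Rightarrow> (real \<Rightarrow> 'b) set"
  where "induced_hom Y f A = (\<Union>p\<in>A. path_class Y (f \<circ> p))"

lemma path_class_eqI: "homotopic_paths X p q \<Longrightarrow> path_class X p = path_class X q"
  unfolding path_class_def using homotopic_paths_sym homotopic_paths_trans by blast

lemma loops_atD:
  assumes "p \<in> loops_at X x"
  shows "path p" "path_image p \<subseteq> X" "pathstart p = x" "pathfinish p = x"
  using assms by (auto simp: loops_at_def)

lemma fundamental_group_mult:
  assumes "p \<in> loops_at X x" "q \<in> loops_at X x"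
  shows "path_class X p \<otimes>\<^bsub>fundamental_group X x\<^esub> path_class X q = path_class X (p +++ q)"
proof -
  note P = loops_atD[OF assms(1)] and Q = loops_atD[OF assms(2)]
  have "path_class X (p' +++ q') = path_class X (p +++ q)"
    if "p' \<in> path_class X p" "q' \<in> path_class X q" for p' q'
  proof -
    have "homotopic_paths X (p +++ q) (p' +++ q')"
      using that P Q by (intro homotopic_paths_join) (auto simp: path_class_def)
    then show ?thesis
      by (rule path_class_eqI[symmetric])
  qed
  moreover have "p \<in> path_class X p" "q \<in> path_class X q"
    using P Q by (auto simp: path_class_def)
  ultimately have "(\<Union>p'\<in>path_class X p. \<Union>q'\<in>path_class X q. path_class X (p' +++ q')) =
      path_class X (p +++ q)"
    by blast
  then show ?thesis by (simp add: fundamental_group_def)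
qed

lemma induced_hom_path_class:
  assumes "p \<in> loops_at X x" "continuous_on X f" "f \<in> X \<rightarrow> Y"
  shows "induced_hom Y f (path_class X p) = path_class Y (f \<circ> p)"
proof -
  note P = loops_atD[OF assms(1)]
  have "path_class Y (f \<circ> q) = path_class Y (f \<circ> p)" if "q \<in> path_class X p" for q
  proof -
    have "homotopic_paths Y (f \<circ> p) (f \<circ> q)"
      using that assms by (intro homotopic_paths_continuous_image) (auto simp: path_class_def)
    then show ?thesis
      by (rule path_class_eqI[symmetric])
  qed
  moreover have "p \<in> path_class X p"
    using P by (auto simp: path_class_def)
  ultimately show ?thesis
    unfolding induced_hom_def by blast
qed

text \<open>
  The unit and inverse laws in the library are stated with \<^const>\<open>linepath\<close> and hence only for
  normed spaces; they transfer along \<open>p\<close>, regarded as a map out of \<open>[0,1]\<close>.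
\<close>

lemma homotopic_paths_lid_gen:
  assumes "path p" "path_image p \<subseteq> X"
  shows "homotopic_paths X ((\<lambda>_. pathstart p) +++ p) p"
proof -
  have eq: "p \<circ> (linepath 0 0 +++ linepath 0 1) = (\<lambda>_. pathstart p) +++ p"
    by (auto simp: joinpaths_def linepath_def pathstart_def)
  have "homotopic_paths {0..1::real} (linepath 0 0 +++ linepath 0 1) (linepath 0 1)"
    by (rule homotopic_paths_lid') (auto simp: path_image_linepath closed_segment_eq_real_ivl)
  then have "homotopic_paths X (p \<circ> (linepath 0 0 +++ linepath 0 1)) (p \<circ> linepath 0 1)"
    by (rule homotopic_paths_continuous_image) (use assms in \<open>auto simp: path_def path_image_def\<close>)
  moreover have "p \<circ> linepath 0 1 = p" by (auto simp: linepath_def)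
  ultimately show ?thesis using eq by simp
qed

lemma homotopic_paths_linv_gen:
  assumes "path p" "path_image p \<subseteq> X"
  shows "homotopic_paths X (reversepath p +++ p) (\<lambda>_. pathfinish p)"
proof -
  have eq: "p \<circ> (reversepath (linepath 0 1) +++ linepath 0 1) = reversepath p +++ p"
    by (auto simp: joinpaths_def linepath_def reversepath_def)
  have "homotopic_paths {0..1::real} (reversepath (linepath 0 1) +++ linepath 0 1) (linepath 1 1)"
    using homotopic_paths_linv[of "linepath 0 (1::real)" "{0..1}"]
    by (auto simp: path_image_linepath closed_segment_eq_real_ivl)
  then have "homotopic_paths X (p \<circ> (reversepath (linepath 0 1) +++ linepath 0 1)) (p \<circ> linepath 1 1)"
    by (rule homotopic_paths_continuous_image) (use assms in \<open>auto simp: path_def path_image_def\<close>)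
  moreover have "p \<circ> linepath 1 1 = (\<lambda>_. pathfinish p)" by (auto simp: linepath_def pathfinish_def)
  ultimately show ?thesis using eq by simp
qed

lemma group_fundamental_group:
  assumes "x \<in> X"
  shows "group (fundamental_group X x)"
proof (rule groupI)
  let ?G = "fundamental_group X x"
  have carr: "carrier ?G = path_class X ` loops_at X x" by (simp add: fundamental_group_def)
  have join: "p +++ q \<in> loops_at X x" if "p \<in> loops_at X x" "q \<in> loops_at X x" for p q
    using that by (auto simp: loops_at_def path_image_join)
  have const: "(\<lambda>_. x) \<in> loops_at X x"
    using assms by (auto simp: loops_at_def path_def path_image_def pathstart_def pathfinish_def)
  have one: "\<one>\<^bsub>?G\<^esub> = path_class X (\<lambda>_. x)" by (simp add: fundamental_group_def)
  show "a \<otimes>\<^bsub>?G\<^esub> b \<in> carrier ?G" if ab: "a \<in> carrier ?G" "b \<in> carrier ?G" for a b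
  proof -
    from ab obtain p q where "p \<in> loops_at X x" "q \<in> loops_at X x"
      "a = path_class X p" "b = path_class X q" unfolding carr by auto
    then show ?thesis by (auto simp: carr fundamental_group_mult intro: join)
  qed
  show "\<one>\<^bsub>?G\<^esub> \<in> carrier ?G"
    using const by (auto simp: carr one)
  show "a \<otimes>\<^bsub>?G\<^esub> b \<otimes>\<^bsub>?G\<^esub> c = a \<otimes>\<^bsub>?G\<^esub> (b \<otimes>\<^bsub>?G\<^esub> c)"
    if abc: "a \<in> carrier ?G" "b \<in> carrier ?G" "c \<in> carrier ?G" for a b c
  proof -
    from abc obtain p q r where *: "p \<in> loops_at X x" "q \<in> loops_at X x" "r \<in> loops_at X x"
      "a = path_class X p" "b = path_class X q" "c = path_class X r" unfolding carr by auto
    have "homotopic_paths X (p +++ (q +++ r)) ((p +++ q) +++ r)"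
      using *(1-3)[THEN loops_atD(1)] *(1-3)[THEN loops_atD(2)] *(1-3)[THEN loops_atD(3)]
        *(1-3)[THEN loops_atD(4)] by (intro homotopic_paths_assoc) auto
    then have "path_class X (p +++ (q +++ r)) = path_class X ((p +++ q) +++ r)"
      by (rule path_class_eqI)
    then show ?thesis using * join by (simp add: fundamental_group_mult)
  qed
  show "\<one>\<^bsub>?G\<^esub> \<otimes>\<^bsub>?G\<^esub> a = a" if a: "a \<in> carrier ?G" for a
  proof -
    from a obtain p where *: "p \<in> loops_at X x" "a = path_class X p" unfolding carr by auto
    have "homotopic_paths X ((\<lambda>_. x) +++ p) p"
      using homotopic_paths_lid_gen[of p X] loops_atD[OF *(1)] by simp
    then have "path_class X ((\<lambda>_. x) +++ p) = path_class X p"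
      by (rule path_class_eqI)
    then show ?thesis using * const by (simp add: one fundamental_group_mult)
  qed
  show "\<exists>b\<in>carrier ?G. b \<otimes>\<^bsub>?G\<^esub> a = \<one>\<^bsub>?G\<^esub>" if a: "a \<in> carrier ?G" for a
  proof -
    from a obtain p where *: "p \<in> loops_at X x" "a = path_class X p" unfolding carr by auto
    have rev: "reversepath p \<in> loops_at X x" using *(1) by (simp add: loops_at_def)
    have "homotopic_paths X (reversepath p +++ p) (\<lambda>_. x)"
      using homotopic_paths_linv_gen[of p X] loops_atD[OF *(1)] by simp
    then have "path_class X (reversepath p +++ p) = path_class X (\<lambda>_. x)"
      by (rule path_class_eqI)
    then have "path_class X (reversepath p) \<otimes>\<^bsub>?G\<^esub> a = \<one>\<^bsub>?G\<^esub>"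
      using * rev by (simp add: one fundamental_group_mult)
    then show ?thesis using rev by (auto simp: carr)
  qed
qed


section \<open>The non-semilocally-simply-connected points\<close>

definition semilocally_simply_connected_at :: "'a::topological_space set \<Rightarrow> 'a \<Rightarrow> bool" where
  "semilocally_simply_connected_at X x \<longleftrightarrow>
     (\<exists>U. openin (top_of_set X) U \<and> x \<in> U \<and>
        induced_hom X id ` carrier (fundamental_group U x) \<subseteq> {\<one>\<^bsub>fundamental_group X x\<^esub>})"

definition wild_points :: "'a::topological_space set \<Rightarrow> 'a set" where
  "wild_points X = {x \<in> X. \<not> semilocally_simply_connected_at X x}"


section \<open>Closed subgroups and closure\<close>

text \<open>A test map is a total function of which only the restriction to \<open>S\<close> matters.\<close>

definition test_closed ::
    "'b::topological_space set \<Rightarrow> 'b \<Rightarrow> (real \<Rightarrow> 'b) set set \<Rightarrow> (real \<Rightarrow> 'b) set \<Rightarrow>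
     'a::topological_space set \<Rightarrow> 'a \<Rightarrow> (real \<Rightarrow> 'a) set set \<Rightarrow> bool" where
  "test_closed S s T g X x H \<longleftrightarrow>
     subgroup H (fundamental_group X x) \<and>
     (\<forall>f. continuous_on S f \<and> f \<in> S \<rightarrow> X \<and> f s = x \<and> induced_hom X f ` T \<subseteq> H
        \<longrightarrow> induced_hom X f g \<in> H)"

definition test_closure ::
    "'b::topological_space set \<Rightarrow> 'b \<Rightarrow> (real \<Rightarrow> 'b) set set \<Rightarrow> (real \<Rightarrow> 'b) set \<Rightarrow>
     'a::topological_space set \<Rightarrow> 'a \<Rightarrow> (real \<Rightarrow> 'a) set set \<Rightarrow> (real \<Rightarrow> 'a) set set" where
  "test_closure S s T g X x H = \<Inter>{K. test_closed S s T g X x K \<and> H \<subseteq> K}"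


section \<open>The dyadic arc space\<close>

definition dyadic_arc :: "nat \<Rightarrow> nat \<Rightarrow> (real \<times> real) set" where
  "dyadic_arc n j =
     {(x, y). (x - (2 * real j - 1) / 2 ^ n)\<^sup>2 + y\<^sup>2 = (1 / 2 ^ n)\<^sup>2 \<and> y \<ge> 0}"

definition dyadic_space :: "(real \<times> real) set" where
  "dyadic_space = ({0..1} \<times> {0}) \<union> (\<Union>n\<in>{1..}. \<Union>j\<in>{1..2 ^ (n - 1)}. dyadic_arc n j)"

definition dyadic_base :: "real \<times> real" where
  "dyadic_base = (0, 0)"

definition dyadic_path :: "nat \<Rightarrow> nat \<Rightarrow> real \<Rightarrow> real \<times> real" where
  "dyadic_path n j t = ((t + real j - 1) / 2 ^ (n - 1), 1 / 2 ^ (n - 1) * sqrt (t - t\<^sup>2))"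

definition standard_path :: "(real \<Rightarrow> real \<times> real) \<Rightarrow> bool" where
  "standard_path p \<longleftrightarrow>
     (\<exists>n\<ge>1. \<exists>j\<in>{1..2 ^ (n - 1)}. p = dyadic_path n j \<or> p = reversepath (dyadic_path n j))"

inductive standard_concat :: "(real \<Rightarrow> real \<times> real) \<Rightarrow> bool" where
  single: "standard_path p \<Longrightarrow> standard_concat p"
| join: "\<lbrakk>standard_path p; standard_concat q; pathfinish p = pathstart q\<rbrakk> \<Longrightarrow>
     standard_concat (p +++ q)"

definition dyadic_subgroup :: "(real \<Rightarrow> real \<times> real) set set" where
  "dyadic_subgroup =
     path_class dyadic_space `
       {p. standard_concat p \<and> pathstart p = dyadic_base \<and> pathfinish p = dyadic_base}"

definition base_path :: "real \<Rightarrow> real \<times> real" where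
  "base_path t = (t, 0)"

definition d_infinity :: "(real \<Rightarrow> real \<times> real) set" where
  "d_infinity = path_class dyadic_space (dyadic_path 1 1 +++ reversepath base_path)"


section \<open>The Hawaiian earring with a whisker\<close>

definition hawaiian_circle :: "nat \<Rightarrow> (real \<times> real) set" where
  "hawaiian_circle n = {(x, y). (x - 1 / real n)\<^sup>2 + y\<^sup>2 = (1 / real n)\<^sup>2}"

definition hawaiian_earring :: "(real \<times> real) set" where
  "hawaiian_earring = (\<Union>n\<in>{1..}. hawaiian_circle n)"

definition hawaiian_plus :: "(real \<times> real) set" where
  "hawaiian_plus = hawaiian_earring \<union> ({-1..0} \<times> {0})"

definition hawaiian_plus_base :: "real \<times> real" where
  "hawaiian_plus_base = (-1, 0)"

text \<open>The counterclockwise loop starts at the leftmost point of the circle, at angle \<open>\<pi>\<close>.\<close>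

definition hawaiian_loop :: "nat \<Rightarrow> real \<Rightarrow> real \<times> real" where
  "hawaiian_loop n t =
     (1 / real n + cos (pi + 2 * pi * t) / real n, sin (pi + 2 * pi * t) / real n)"

definition whisker :: "real \<Rightarrow> real \<times> real" where
  "whisker t = (t - 1, 0)"

text \<open>
  For positive \<open>\<phi>\<close>, the self-map of the earring determined by sending the \<open>n\<close>-th loop to the
  \<open>\<phi> n\<close>-th one.
\<close>

definition hawaiian_map :: "(nat \<Rightarrow> nat) \<Rightarrow> real \<times> real \<Rightarrow> real \<times> real" where
  "hawaiian_map \<phi> z =
     (THE w. \<exists>n\<ge>1. \<exists>t\<in>{0..1}. z = hawaiian_loop n t \<and> w = hawaiian_loop (\<phi> n) t)"

definition f_odd :: "real \<times> real \<Rightarrow> real \<times> real" where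
  "f_odd = hawaiian_map (\<lambda>n. 2 * n - 1)"

definition f_even :: "real \<times> real \<Rightarrow> real \<times> real" where
  "f_even = hawaiian_map (\<lambda>n. 2 * n)"


subsection \<open>The Cantor set and its gaps\<close>

primrec cantor_stage :: "nat \<Rightarrow> real set" where
  "cantor_stage 0 = {0..1}"
| "cantor_stage (Suc m) =
     (\<lambda>x. x / 3) ` cantor_stage m \<union> (\<lambda>x. 2 / 3 + x / 3) ` cantor_stage m"

definition cantor_set :: "real set" where
  "cantor_set = (\<Inter>m. cantor_stage m)"

definition cantor_gaps :: "nat \<Rightarrow> real set set" where
  "cantor_gaps n = {I \<in> components ({0..1} - cantor_set). measure lborel I = 1 / 3 ^ n}"

text \<open>
  The \<open>k\<close>-th gap of length \<open>1 / 3 ^ n\<close> from the left: exactly \<open>k\<close> gaps of this length, itself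
  included, start no later than it does.
\<close>

definition cantor_gap :: "nat \<Rightarrow> nat \<Rightarrow> real set" where
  "cantor_gap n k =
     (THE I. I \<in> cantor_gaps n \<and> card {J \<in> cantor_gaps n. Inf J \<le> Inf I} = k)"

text \<open>
  At the endpoints of a gap, which belong to the Cantor set, the linearly reparametrized loop has
  the value \<open>(0, 0)\<close> too, so it suffices to use it on the open gap.
\<close>

definition tau_loop :: "real \<Rightarrow> real \<times> real" where
  "tau_loop t =
     (if t \<in> {0..1} - cantor_set
      then (let (n, k) = (THE (n, k). 1 \<le> n \<and> k \<in> {1..2 ^ (n - 1)} \<and> t \<in> cantor_gap n k);
                I = cantor_gap n k
            in hawaiian_loop (2 ^ (n - 1) + k - 1) ((t - Inf I) / (Sup I - Inf I)))
      else (0, 0))"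


subsection \<open>The test subgroup and the test element\<close>

definition p_elem :: "nat \<Rightarrow> (real \<Rightarrow> real \<times> real) set" where
  "p_elem n =
     path_class hawaiian_plus
       (whisker +++ hawaiian_loop (2 * n - 1) +++ reversepath (hawaiian_loop (2 * n))
          +++ reversepath whisker)"

definition P_subgroup :: "(real \<Rightarrow> real \<times> real) set set" where
  "P_subgroup =
     generate (fundamental_group hawaiian_plus hawaiian_plus_base) (p_elem ` {1..})"

definition p_tau :: "(real \<Rightarrow> real \<times> real) set" where
  "p_tau =
     path_class hawaiian_plus
       (whisker +++ (f_odd \<circ> tau_loop) +++ reversepath (f_even \<circ> tau_loop) +++ reversepath whisker)"

end

theory Submission
  imports Defs
begin

text \<open>
  The fundamental group of \<open>X\<close> is divided by \<open>N\<close> throughout. Closing a path of \<open>X\<close> up along chosen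
  paths from \<open>x0\<close> gives its holonomy \<open>hol\<close>, an element of the quotient \<open>Q\<close>. It is invariant under
  homotopy, turns concatenation into multiplication, and it is trivial on a loop at \<open>x0\<close> exactly if
  the class of the loop lies in \<open>N\<close>. A test map can be moved to another base point by prefixing a
  path, so both kinds of closedness become conditions on maps with arbitrary base value:
  
  \<^item> \<open>N\<close> is closed for the dyadic test iff the top arc and the base have the same holonomy under every
  map of the dyadic space for which the holonomy of each arc is the product of those of the two arcs
  below it (\<open>dyadic_closed_iff\<close>; such maps are called additive);
  
  \<^item> \<open>N\<close> is closed for the Hawaiian test iff, under every map of the earring that gives the circles
  \<open>2 * n - 1\<close> and \<open>2 * n\<close> the same holonomy for all \<open>n\<close>, the infinite products of the odd and of the
  even circles along the Cantor set have the same holonomy (\<open>hawaiian_closed_iff\<close>).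
  
  The dyadic arcs and the Cantor gaps are both indexed by the nodes \<open>k \<ge> 1\<close> of one binary tree, with
  children \<open>2 * k\<close> on the left and \<open>2 * k + 1\<close> on the right.
  
  The first criterion implies the second for every \<open>X\<close>. There is a map of the dyadic space to the
  earring (\<open>dyadic_to_earring\<close>) whose base runs through the odd circles and whose top arc runs through
  the even circles, in the order of the Cantor gaps, and where replacing an arc by the two arcs below
  it exchanges at most one even circle for its odd partner. Composing it with a map of the earring as
  in the second criterion yields an additive map.
  
  The converse rests on telescoping. Let one loop \<open>A k\<close> at a point \<open>w\<close> be given for every node, such
  that the loops shrink to \<open>w\<close>. Then \<open>A 1\<close> is homotopic to the product, in the order of the Cantor
  gaps, of all quotients of \<open>A k\<close> by \<open>A (2 * k)\<close> on the left and \<open>A (2 * k + 1)\<close> on the right: every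
  loop is replaced by its two children with the quotient between them, and the process converges
  (\<open>telescoping\<close>). So under the second criterion the holonomies of the quotients determine that of
  \<open>A 1\<close> (\<open>hol_null_trees_eq\<close>). Now let an additive \<open>f\<close> have an arc whose holonomy differs from that of
  the base below it. By additivity the same is true of one of the two arcs below it, and so on; these
  arcs shrink to a point \<open>t\<close> of the base. If \<open>f\<close> takes \<open>t\<close> to a point where \<open>X\<close> is semilocally simply
  connected, small arcs over \<open>t\<close> do not have this defect. Otherwise, \<open>wild_points X\<close> being discrete, the
  base near \<open>t\<close> meets wild points only in the value \<open>w\<close> of \<open>t\<close>. Over each dyadic interval one cuts the
  arc and the base off at the first and the last time at which the base is at \<open>w\<close>; this gives two
  families of loops at \<open>w\<close> that shrink to \<open>w\<close> and have equal quotient holonomies, which contradicts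
  the defect (\<open>base_parallel_near_wild\<close>).
  
  Conjugates of closed subgroups are closed, so the closures of a normal subgroup are normal. The
  equivalence then applies to the closures themselves and shows that they contain each other.
\<close>

section \<open>Holonomy modulo a normal subgroup\<close>

lemma homotopic_paths_in_interval:
  fixes u v :: "real \<Rightarrow> real"
  assumes "continuous_on T f" "f ` T \<subseteq> X" "convex T"
    "path u" "path v" "path_image u \<subseteq> T" "path_image v \<subseteq> T"
    "pathstart u = pathstart v" "pathfinish u = pathfinish v"
  shows "homotopic_paths X (f \<circ> u) (f \<circ> v)"
proof (rule homotopic_paths_continuous_image)
  show "homotopic_paths T u v"
    using convex_imp_simply_connected[OF assms(3)] assms(4-9) unfolding simply_connected_eq_homotopic_paths by metis
qed (use assms in auto)

lemma path_class_eq_iff: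
  assumes "path p" "path_image p \<subseteq> X"
  shows "path_class X p = path_class X q \<longleftrightarrow> homotopic_paths X p q"
proof
  assume "path_class X p = path_class X q"
  moreover have "p \<in> path_class X p" using assms by (simp add: path_class_def)
  ultimately show "homotopic_paths X p q" by (simp add: path_class_def homotopic_paths_sym)
qed (rule path_class_eqI)


lemma path_constant [simp]: "path (\<lambda>_. x)" by (simp add: path_def)
lemma path_image_constant [simp]: "path_image (\<lambda>_. x) = {x}" by (auto simp: path_image_def)
lemma pathstart_const [simp]: "pathstart (\<lambda>_. x) = x" by (simp add: pathstart_def)
lemma pathfinish_const [simp]: "pathfinish (\<lambda>_. x) = x" by (simp add: pathfinish_def)

lemma homotopic_paths_join_left:
  assumes "homotopic_paths X q q'" "path p" "path_image p \<subseteq> X" "pathfinish p = pathstart q"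
  shows "homotopic_paths X (p +++ q) (p +++ q')"
  using assms by (intro homotopic_paths_join) auto

lemma homotopic_paths_cancel_middle:
  assumes "path b" "path p" "path r" "path q" "path s"
    "path_image b \<subseteq> X" "path_image p \<subseteq> X" "path_image r \<subseteq> X" "path_image q \<subseteq> X" "path_image s \<subseteq> X"
    "pathfinish b = pathstart p" "pathfinish p = pathfinish r" "pathstart q = pathfinish r"
    "pathfinish q = pathstart s"
  shows "homotopic_paths X ((b +++ (p +++ reversepath r)) +++ (r +++ (q +++ s))) (b +++ ((p +++ q) +++ s))"
proof -
  note [simp] = assms path_image_join subset_path_image_join
  have 1: "homotopic_paths X ((b +++ (p +++ reversepath r)) +++ (r +++ (q +++ s)))
      (b +++ ((p +++ reversepath r) +++ (r +++ (q +++ s))))"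
    by (intro homotopic_paths_sym[OF homotopic_paths_assoc]) auto
  have 2: "homotopic_paths X ((p +++ reversepath r) +++ (r +++ (q +++ s))) (p +++ (reversepath r +++ (r +++ (q +++ s))))"
    by (intro homotopic_paths_sym[OF homotopic_paths_assoc]) auto
  have 3: "homotopic_paths X (reversepath r +++ (r +++ (q +++ s))) ((reversepath r +++ r) +++ (q +++ s))"
    by (intro homotopic_paths_assoc) auto
  have 4: "homotopic_paths X ((reversepath r +++ r) +++ (q +++ s)) ((\<lambda>_. pathstart (q +++ s)) +++ (q +++ s))"
    using homotopic_paths_linv_gen[of r X]
    by (intro homotopic_paths_join) auto
  have 5: "homotopic_paths X ((\<lambda>_. pathstart (q +++ s)) +++ (q +++ s)) (q +++ s)"
    by (intro homotopic_paths_lid_gen) auto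
  have 6: "homotopic_paths X (reversepath r +++ (r +++ (q +++ s))) (q +++ s)"
    using 3 4 5 homotopic_paths_trans by blast
  have 7: "homotopic_paths X (p +++ (reversepath r +++ (r +++ (q +++ s)))) (p +++ (q +++ s))"
    by (intro homotopic_paths_join_left[OF 6]) auto
  have 8: "homotopic_paths X (p +++ (q +++ s)) ((p +++ q) +++ s)"
    by (intro homotopic_paths_assoc) auto
  have "homotopic_paths X ((p +++ reversepath r) +++ (r +++ (q +++ s))) ((p +++ q) +++ s)"
    using 2 7 8 homotopic_paths_trans by blast
  then have "homotopic_paths X (b +++ ((p +++ reversepath r) +++ (r +++ (q +++ s)))) (b +++ ((p +++ q) +++ s))"
    by (intro homotopic_paths_join_left) auto
  then show ?thesis using 1 homotopic_paths_trans by blast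
qed

lemma path_class_inv:
  assumes "p \<in> loops_at X x" "x \<in> X"
  shows "inv\<^bsub>fundamental_group X x\<^esub> (path_class X p) = path_class X (reversepath p)"
proof -
  interpret group "fundamental_group X x" by (rule group_fundamental_group[OF assms(2)])
  note P = loops_atD[OF assms(1)]
  have rp: "reversepath p \<in> loops_at X x" using P by (auto simp: loops_at_def)
  have c: "path_class X p \<in> carrier (fundamental_group X x)" "path_class X (reversepath p) \<in> carrier (fundamental_group X x)"
    using assms rp by (auto simp: fundamental_group_def)
  have "homotopic_paths X (reversepath p +++ p) (\<lambda>_. x)"
    using homotopic_paths_linv_gen[of p X] P by simp
  then have "path_class X (reversepath p) \<otimes>\<^bsub>fundamental_group X x\<^esub> path_class X p = \<one>\<^bsub>fundamental_group X x\<^esub>"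
    using path_class_eqI fundamental_group_mult[OF rp assms(1)] by (auto simp: fundamental_group_def)
  then show ?thesis using c inv_equality by blast
qed

locale normal_pi1 =
  fixes X :: "'a::topological_space set" and x0 :: 'a and N :: "(real \<Rightarrow> 'a) set set"
  assumes conn: "path_connected X" and x0: "x0 \<in> X"
    and normal_N: "N \<lhd> fundamental_group X x0"
begin

abbreviation "G \<equiv> fundamental_group X x0"
definition "Q = G Mod N"

definition chosen_path :: "'a \<Rightarrow> real \<Rightarrow> 'a" where
  "chosen_path x = (SOME g. path g \<and> path_image g \<subseteq> X \<and> pathstart g = x0 \<and> pathfinish g = x)"

definition close_up :: "(real \<Rightarrow> 'a) \<Rightarrow> real \<Rightarrow> 'a" where
  "close_up p = chosen_path (pathstart p) +++ (p +++ reversepath (chosen_path (pathfinish p)))"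

text \<open>
  The choice of paths matters only up to factors that depend on the end points of \<open>p\<close>, so it does
  not affect the comparison of two paths with common ends.
\<close>

definition hol :: "(real \<Rightarrow> 'a) \<Rightarrow> (real \<Rightarrow> 'a) set set" where
  "hol p = N #>\<^bsub>G\<^esub> path_class X (close_up p)"

abbreviation path_in :: "(real \<Rightarrow> 'a) \<Rightarrow> bool" where
  "path_in p \<equiv> path p \<and> path_image p \<subseteq> X"

lemma chosen_path: 
  assumes "x \<in> X"
  shows "path (chosen_path x)" "path_image (chosen_path x) \<subseteq> X" "pathstart (chosen_path x) = x0" "pathfinish (chosen_path x) = x"
proof -
  have "\<exists>g. path g \<and> path_image g \<subseteq> X \<and> pathstart g = x0 \<and> pathfinish g = x"
    using conn x0 assms unfolding path_connected_def by blast
  from someI_ex[OF this] show "path (chosen_path x)" "path_image (chosen_path x) \<subseteq> X" "pathstart (chosen_path x) = x0" "pathfinish (chosen_path x) = x"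
    unfolding chosen_path_def by blast+
qed

lemma path_in_ends: "path_in p \<Longrightarrow> pathstart p \<in> X \<and> pathfinish p \<in> X"
  using pathstart_in_path_image pathfinish_in_path_image by blast

lemma close_up_loop: "path_in p \<Longrightarrow> close_up p \<in> loops_at X x0"
  using path_in_ends[of p] chosen_path[of "pathstart p"] chosen_path[of "pathfinish p"]
  by (auto simp: close_up_def loops_at_def path_image_join)

sublocale G: group G by (rule group_fundamental_group[OF x0])
sublocale N: normal N G by (rule normal_N)
sublocale Q: group Q unfolding Q_def by (rule N.factorgroup_is_group)

lemma class_carrier: "p \<in> loops_at X x0 \<Longrightarrow> path_class X p \<in> carrier G"
  by (simp add: fundamental_group_def)

lemma hol_carrier [simp]: "path_in p \<Longrightarrow> hol p \<in> carrier Q"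
  unfolding hol_def FactGroup_def Q_def using class_carrier[OF close_up_loop]
  by (auto simp: RCOSETS_def)

lemma hol_homotopic: 
  assumes "homotopic_paths X p q"
  shows "hol p = hol q"
proof -
  have 1: "path p" "path q" "path_image p \<subseteq> X" "path_image q \<subseteq> X" "pathstart p = pathstart q" "pathfinish p = pathfinish q"
    using assms homotopic_paths_imp_path homotopic_paths_imp_subset homotopic_paths_imp_pathstart homotopic_paths_imp_pathfinish by blast+
  note 2 = path_in_ends[of p] path_in_ends[of q]
  have "homotopic_paths X (close_up p) (close_up q)"
    unfolding close_up_def using assms 1 2 chosen_path[of "pathstart p"] chosen_path[of "pathfinish p"]
    by (intro homotopic_paths_join) auto
  then show ?thesis unfolding hol_def by (metis path_class_eqI)
qed

lemma hol_join:
  assumes "path_in p" "path_in q" "pathfinish p = pathstart q"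
  shows "hol (p +++ q) = hol p \<otimes>\<^bsub>Q\<^esub> hol q"
proof -
  note e = path_in_ends[OF assms(1)] path_in_ends[OF assms(2)]
  have pq: "path_in (p +++ q)" using assms by (auto simp: path_image_join)
  have "homotopic_paths X (close_up p +++ close_up q) (close_up (p +++ q))"
    unfolding close_up_def pathstart_join pathfinish_join assms(3)
    using assms chosen_path e by (intro homotopic_paths_cancel_middle) auto
  then have "path_class X (close_up (p +++ q)) = path_class X (close_up p) \<otimes>\<^bsub>G\<^esub> path_class X (close_up q)"
    using fundamental_group_mult[OF close_up_loop[OF assms(1)] close_up_loop[OF assms(2)]] path_class_eqI by fastforce
  then show ?thesis unfolding hol_def FactGroup_def Q_def
    using N.rcos_sum[OF class_carrier[OF close_up_loop[OF assms(1)]] class_carrier[OF close_up_loop[OF assms(2)]]]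
    by simp
qed

lemma hol_const [simp]:
  assumes "x \<in> X"
  shows "hol (\<lambda>_. x) = \<one>\<^bsub>Q\<^esub>"
proof -
  have p: "path_in (\<lambda>_. x)" using assms by simp
  have "(\<lambda>_. x) +++ (\<lambda>_. x) = (\<lambda>_::real. x)" by (auto simp: joinpaths_def)
  then have "hol (\<lambda>_. x) = hol (\<lambda>_. x) \<otimes>\<^bsub>Q\<^esub> hol (\<lambda>_. x)"
    using hol_join[OF p p] by simp
  then show ?thesis using Q.l_cancel_one'[OF hol_carrier[OF p] hol_carrier[OF p]] by blast
qed

lemma hol_reverse:
  assumes "path_in p"
  shows "hol (reversepath p) = inv\<^bsub>Q\<^esub> (hol p)"
proof -
  have "hol (reversepath p) \<otimes>\<^bsub>Q\<^esub> hol p = hol (reversepath p +++ p)"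
    using assms by (subst hol_join) auto
  also have "\<dots> = hol (\<lambda>_. pathfinish p)"
    using assms by (intro hol_homotopic homotopic_paths_linv_gen) auto
  also have "\<dots> = \<one>\<^bsub>Q\<^esub>" using assms path_in_ends by simp
  finally show ?thesis using assms by (intro Q.inv_equality[symmetric]) auto
qed

text \<open>
  The path chosen for \<open>x0\<close> is itself a loop, so that closing \<open>p\<close> up conjugates its class; a normal
  subgroup does not see this.
\<close>

lemma hol_one_iff:
  assumes "p \<in> loops_at X x0"
  shows "path_class X p \<in> N \<longleftrightarrow> hol p = \<one>\<^bsub>Q\<^esub>"
proof -
  let ?b = "chosen_path x0"
  note b = chosen_path[OF x0] and P = loops_atD[OF assms]
  have bl: "?b \<in> loops_at X x0" "reversepath ?b \<in> loops_at X x0" using b by (auto simp: loops_at_def)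
  have pb: "p +++ reversepath ?b \<in> loops_at X x0" using b P by (auto simp: loops_at_def path_image_join)
  have eq: "path_class X (close_up p) = path_class X ?b \<otimes>\<^bsub>G\<^esub> (path_class X p \<otimes>\<^bsub>G\<^esub> inv\<^bsub>G\<^esub> (path_class X ?b))"
    unfolding close_up_def P path_class_inv[OF bl(1) x0]
    by (simp add: fundamental_group_mult bl pb assms)
  note c = class_carrier[OF bl(1)] class_carrier[OF assms]
  have "path_class X p \<in> N \<longleftrightarrow> path_class X (close_up p) \<in> N"
  proof
    assume "path_class X p \<in> N"
    then show "path_class X (close_up p) \<in> N"
      using N.inv_op_closed2[OF c(1)] c unfolding eq by (simp add: G.m_assoc)
  next
    assume "path_class X (close_up p) \<in> N"
    then have "inv\<^bsub>G\<^esub> (path_class X ?b) \<otimes>\<^bsub>G\<^esub> path_class X (close_up p) \<otimes>\<^bsub>G\<^esub> path_class X ?b \<in> N"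
      using N.inv_op_closed1[OF c(1)] by blast
    moreover have "inv\<^bsub>G\<^esub> (path_class X ?b) \<otimes>\<^bsub>G\<^esub> path_class X (close_up p) \<otimes>\<^bsub>G\<^esub> path_class X ?b = path_class X p"
      unfolding eq using c by (simp add: G.m_assoc G.inv_solve_left')
    ultimately show "path_class X p \<in> N" by simp
  qed
  also have "\<dots> \<longleftrightarrow> N #>\<^bsub>G\<^esub> path_class X (close_up p) = N"
    using P class_carrier[OF close_up_loop] G.coset_join1 G.coset_join2 N.subgroup_axioms by (metis)
  finally show ?thesis by (simp add: hol_def FactGroup_def Q_def)
qed

text \<open>
  Along a map defined on an interval only the end points of a path matter, because intervals are
  simply connected. This covers reparametrisation, and in \<open>hol_segments\<close> subdivision, of paths.
\<close>

lemma hol_in_interval: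
  fixes u v :: "real \<Rightarrow> real"
  assumes "continuous_on T f" "f ` T \<subseteq> X" "convex T"
    "path u" "path v" "path_image u \<subseteq> T" "path_image v \<subseteq> T"
    "pathstart u = pathstart v" "pathfinish u = pathfinish v"
  shows "hol (f \<circ> u) = hol (f \<circ> v)"
  by (rule hol_homotopic[OF homotopic_paths_in_interval[OF assms]])

lemma path_in_compose: "\<lbrakk>continuous_on T f; f ` T \<subseteq> X; path u; path_image u \<subseteq> T\<rbrakk> \<Longrightarrow> path_in (f \<circ> u)"
  by (metis continuous_on_subset path_continuous_image path_image_compose subset_trans image_mono)

lemma segment_real: 
  assumes "convex (T::real set)" "r \<in> T" "s \<in> T" shows "path_image (linepath r s) \<subseteq> T"
  using assms closed_segment_subset by (simp add: path_image_linepath) 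

lemma hol_segments:
  fixes r s t :: real
  assumes "continuous_on T f" "f ` T \<subseteq> X" "convex T" "r \<in> T" "s \<in> T" "t \<in> T"
  shows "hol (f \<circ> linepath r s) \<otimes>\<^bsub>Q\<^esub> hol (f \<circ> linepath s t) = hol (f \<circ> linepath r t)"
proof -
  note im = segment_real[OF assms(3)]
  have "hol (f \<circ> linepath r s) \<otimes>\<^bsub>Q\<^esub> hol (f \<circ> linepath s t) = hol ((f \<circ> linepath r s) +++ (f \<circ> linepath s t))"
    using assms im by (intro hol_join[symmetric] path_in_compose[of T]) (auto simp: pathfinish_compose pathstart_compose)
  also have "(f \<circ> linepath r s) +++ (f \<circ> linepath s t) = f \<circ> (linepath r s +++ linepath s t)"
    by (simp add: path_compose_join)
  also have "hol \<dots> = hol (f \<circ> linepath r t)"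
    using assms im by (intro hol_in_interval[of T]) (auto simp: path_image_join)
  finally show ?thesis .
qed

lemma hol_cong: "path_in p \<Longrightarrow> (\<And>t. t \<in> {0..1} \<Longrightarrow> p t = q t) \<Longrightarrow> hol p = hol q"
  by (intro hol_homotopic homotopic_paths_eq) auto

end

section \<open>Dyadic arcs as nodes of a binary tree\<close>

text \<open>
  Node \<open>1\<close> stands for the unit interval, and \<open>2 * k\<close> and \<open>2 * k + 1\<close> stand for the left and the right
  half of the interval of \<open>k\<close>. The \<open>r\<close>-th interval of length \<open>1 / 2 ^ d\<close>, counted from \<open>0\<close>, is node
  \<open>2 ^ d + r\<close>. Node \<open>0\<close> is not part of the tree.
\<close>

fun tree_len :: "nat \<Rightarrow> real" where
  "tree_len k = (if k \<le> 1 then 1 else tree_len (k div 2) / 2)"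

fun tree_lo :: "nat \<Rightarrow> real" where
  "tree_lo k = (if k \<le> 1 then 0 else tree_lo (k div 2) + (if odd k then tree_len k else 0))"

declare tree_len.simps [simp del] tree_lo.simps [simp del]

definition tree_hi :: "nat \<Rightarrow> real" where
  "tree_hi k = tree_lo k + tree_len k"

definition tree_arc :: "nat \<Rightarrow> real \<Rightarrow> real \<times> real" where
  "tree_arc k t = (tree_lo k + tree_len k * t, tree_len k * sqrt (t - t\<^sup>2))"

lemma tree_child:
  assumes "k \<ge> 1"
  shows "tree_len (2 * k) = tree_len k / 2" "tree_len (Suc (2 * k)) = tree_len k / 2"
    "tree_lo (2 * k) = tree_lo k" "tree_lo (Suc (2 * k)) = tree_lo k + tree_len k / 2"
    "tree_hi (2 * k) = tree_lo k + tree_len k / 2" "tree_hi (Suc (2 * k)) = tree_hi k"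
  using assms tree_len.simps[of "2 * k"] tree_len.simps[of "Suc (2 * k)"] tree_lo.simps[of "2 * k"] tree_lo.simps[of "Suc (2 * k)"]
  by (auto simp: tree_hi_def)

lemma tree_one [simp]: "tree_len (Suc 0) = 1" "tree_lo (Suc 0) = 0" "tree_hi (Suc 0) = 1"
  using tree_len.simps[of 1] tree_lo.simps[of 1] by (auto simp: tree_hi_def)

lemma index_ge_1: "(1::nat) \<le> 2 ^ d + m" by (simp add: trans_le_add1)

lemma real_less_power2: "r < 2 ^ d \<Longrightarrow> real r + 1 \<le> 2 ^ d"
  using of_nat_mono[of "Suc r" "2 ^ d", where ?'a = real] by simp

lemma tree_level:
  assumes "r < 2 ^ d"
  shows "tree_len (2 ^ d + r) = 1 / 2 ^ d" "tree_lo (2 ^ d + r) = real r / 2 ^ d"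
proof -
  have "tree_len (2 ^ d + r) = 1 / 2 ^ d \<and> tree_lo (2 ^ d + r) = real r / 2 ^ d"
    using assms
  proof (induction d arbitrary: r)
    case 0
    then show ?case by simp
  next
    case (Suc d)
    have *: "(2 ^ Suc d + r) div 2 = 2 ^ d + r div 2" by simp
    have "r div 2 < 2 ^ d" using Suc.prems by simp
    note IH = Suc.IH[OF this]
    have pos: "(2::nat) ^ d > 0" by simp
    have big: "\<not> (2 ^ Suc d + r \<le> 1)" using pos unfolding power_Suc by linarith
    have 1: "tree_len (2 ^ Suc d + r) = 1 / 2 ^ Suc d"
      using IH tree_len.simps[of "2 ^ Suc d + r"] big unfolding * by simp
    have 2: "tree_lo (2 ^ Suc d + r) = real (r div 2) / 2 ^ d + (if odd r then 1 / 2 ^ Suc d else 0)"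
      using 1 IH tree_lo.simps[of "2 ^ Suc d + r"] big unfolding * by simp
    have "real r = 2 * real (r div 2) + (if odd r then 1 else 0)"
    proof -
      have "r = 2 * (r div 2) + (if odd r then 1 else 0)" by presburger
      then have "real r = real (2 * (r div 2) + (if odd r then 1 else 0))" by presburger
      then show ?thesis by (simp split: if_splits)
    qed
    then show ?case using 1 2 by (auto simp: field_simps)
  qed
  then show "tree_len (2 ^ d + r) = 1 / 2 ^ d" "tree_lo (2 ^ d + r) = real r / 2 ^ d" by auto
qed

lemma tree_hi_level:
  assumes "r < 2 ^ d" shows "tree_hi (2 ^ d + r) = real (Suc r) / 2 ^ d"
  using tree_level[OF assms] by (simp add: tree_hi_def field_simps)

lemma tree_index_cases:
  assumes "k \<ge> (1::nat)"
  obtains d r where "r < 2 ^ d" "k = 2 ^ d + r"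
proof -
  have "\<exists>d. 2 ^ d \<le> k \<and> k < 2 ^ Suc d"
    using ex_power_ivl1[of 2 k] assms by auto
  then obtain d where "2 ^ d \<le> k" "k < 2 ^ Suc d" by blast
  then show ?thesis by (intro that[of "k - 2 ^ d" d]) auto
qed

lemma dyadic_path_eq_tree_arc:
  assumes "n \<ge> 1" "j \<in> {1..2 ^ (n - 1)}"
  shows "dyadic_path n j = tree_arc (2 ^ (n - 1) + (j - 1))"
proof
  fix t
  define r where "r = j - 1"
  have "r < 2 ^ (n - 1)" "real j = real r + 1" using assms by (auto simp: r_def)
  then show "dyadic_path n j t = tree_arc (2 ^ (n - 1) + (j - 1)) t"
    unfolding r_def[symmetric] dyadic_path_def tree_arc_def by (simp add: tree_level add_divide_distrib)
qed

lemma standard_path_iff: "standard_path p \<longleftrightarrow> (\<exists>k\<ge>1. p = tree_arc k \<or> p = reversepath (tree_arc k))"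
proof
  assume "standard_path p"
  then obtain n j where nj: "n \<ge> 1" "j \<in> {1..2 ^ (n - 1)}" "p = dyadic_path n j \<or> p = reversepath (dyadic_path n j)"
    unfolding standard_path_def by blast
  have "(1::nat) \<le> 2 ^ (n - 1)" by simp
  then have "2 ^ (n - 1) + (j - 1) \<ge> 1" by linarith
  with nj show "\<exists>k\<ge>1. p = tree_arc k \<or> p = reversepath (tree_arc k)"
    using dyadic_path_eq_tree_arc[OF nj(1,2)] by metis
next
  assume "\<exists>k\<ge>1. p = tree_arc k \<or> p = reversepath (tree_arc k)"
  then obtain k where k: "k \<ge> 1" "p = tree_arc k \<or> p = reversepath (tree_arc k)" by blast
  obtain d r where dr: "r < 2 ^ d" "k = 2 ^ d + r" using tree_index_cases[OF k(1)] .
  then have "dyadic_path (Suc d) (Suc r) = tree_arc k" "Suc r \<in> {1..2 ^ (Suc d - 1)}"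
    using dyadic_path_eq_tree_arc[of "Suc d" "Suc r"] by auto
  then show "standard_path p" unfolding standard_path_def using k(2) by (metis One_nat_def Suc_le_mono le0)
qed

lemma tree_arc_one: "dyadic_path 1 1 = tree_arc 1"
  using dyadic_path_eq_tree_arc[of 1 1] by simp

lemma tree_arc_ends [simp]: "pathstart (tree_arc k) = (tree_lo k, 0)" "pathfinish (tree_arc k) = (tree_hi k, 0)"
  by (auto simp: tree_arc_def pathstart_def pathfinish_def tree_hi_def)

section \<open>Dyadic arcs as graphs of height functions\<close>

text \<open>
  The graph of \<open>height d\<close> is the union of the arcs over the intervals of length \<open>1 / 2 ^ d\<close>. Pieces of
  the dyadic space can then be cut out by inequalities between continuous functions.
\<close>

primrec height :: "nat \<Rightarrow> real \<Rightarrow> real" where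
  "height 0 x = sqrt (x - x\<^sup>2)"
| "height (Suc d) x = (if x \<le> 1 / 2 then height d (2 * x) / 2 else height d (2 * x - 1) / 2)"

lemma height_ends [simp]: "height d 0 = 0" "height d 1 = 0"
  by (induction d) auto

lemma height_level:
  assumes "r < 2 ^ d" "0 \<le> t" "t \<le> 1"
  shows "height d ((real r + t) / 2 ^ d) = sqrt (t - t\<^sup>2) / 2 ^ d"
  using assms(1)
proof (induction d arbitrary: r)
  case 0
  then show ?case by simp
next
  case (Suc d)
  show ?case
  proof (cases "r < 2 ^ d")
    case True
    then have "real r + 1 \<le> 2 ^ d" by (rule real_less_power2)
    then have "(real r + t) / 2 ^ Suc d \<le> 1 / 2" using assms(3) by (simp add: field_simps)
    moreover have "2 * ((real r + t) / 2 ^ Suc d) = (real r + t) / 2 ^ d" by (simp add: field_simps)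
    ultimately show ?thesis using Suc.IH[OF True] by simp
  next
    case False
    define r' where "r' = r - 2 ^ d"
    have r': "r = 2 ^ d + r'" "r' < 2 ^ d" using False Suc.prems by (auto simp: r'_def)
    have x: "2 * ((real r + t) / 2 ^ Suc d) - 1 = (real r' + t) / 2 ^ d"
      by (simp add: r' field_simps)
    show ?thesis
    proof (cases "(real r + t) / 2 ^ Suc d \<le> 1 / 2")
      case True
      then have "real r' + t \<le> 0" using r' by (simp add: field_simps)
      then have "t = 0" "r' = 0" using assms by auto
      then show ?thesis using r' by (simp add: field_simps)
    next
      case False
      then show ?thesis using Suc.IH[OF r'(2)] by (simp only: height.simps if_False x) simp
    qed
  qed
qed

lemma tree_arc_eq_height:
  assumes "r < 2 ^ d" "t \<in> {0..1}"
  shows "tree_arc (2 ^ d + r) t = ((real r + t) / 2 ^ d, height d ((real r + t) / 2 ^ d))"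
  using assms height_level[of r d t] by (simp add: tree_arc_def tree_level add_divide_distrib)

lemma continuous_height: "continuous_on {0..1} (height d)"
proof (induction d)
  case 0
  then show ?case by (auto intro!: continuous_intros)
next
  case (Suc d)
  have un: "{0..1::real} = {0..1/2} \<union> {1/2..1}" by auto
  have eq: "height (Suc d) = (\<lambda>x. if x \<le> 1 / 2 then height d (2 * x) / 2 else height d (2 * x - 1) / 2)"
    by (rule ext) simp
  show ?case unfolding eq un
  proof (rule continuous_on_cases)
    show "continuous_on {0..1/2} (\<lambda>x. height d (2 * x) / 2)"
      by (rule continuous_on_divide[OF continuous_on_compose2[OF Suc]]) (auto intro: continuous_intros)
    show "continuous_on {1/2..1} (\<lambda>x. height d (2 * x - 1) / 2)"
      by (rule continuous_on_divide[OF continuous_on_compose2[OF Suc]]) (auto intro: continuous_intros)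
    have "height d (2 * (1/2)) / 2 = height d (2 * (1/2) - 1) / 2" by simp
    then show "\<forall>x. x \<in> {0..1/2} \<and> \<not> x \<le> 1 / 2 \<or> x \<in> {1/2..1} \<and> x \<le> 1 / 2 \<longrightarrow>
        height d (2 * x) / 2 = height d (2 * x - 1) / 2"
      by (metis atLeastAtMost_iff order.antisym)
  qed auto
qed

lemma height_bounds: "0 \<le> x \<Longrightarrow> x \<le> 1 \<Longrightarrow> 0 \<le> height d x" "0 \<le> x \<Longrightarrow> x \<le> 1 \<Longrightarrow> height d x \<le> 1 / 2 ^ d"
proof -
  have "0 \<le> height d x \<and> height d x \<le> 1 / 2 ^ d" if "0 \<le> x" "x \<le> 1" for x
    using that
  proof (induction d arbitrary: x)
    case 0
    then have "x\<^sup>2 \<le> x" by (simp add: power2_eq_square mult_left_le)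
    moreover have "x - x\<^sup>2 \<le> 1" using 0 by (smt (verit) zero_le_power2)
    ultimately show ?case by (simp add: real_le_lsqrt)
  next
    case (Suc d)
    show ?case using Suc.IH[of "2 * x"] Suc.IH[of "2 * x - 1"] Suc.prems by (auto simp: field_simps)
  qed
  then show "0 \<le> x \<Longrightarrow> x \<le> 1 \<Longrightarrow> 0 \<le> height d x" "0 \<le> x \<Longrightarrow> x \<le> 1 \<Longrightarrow> height d x \<le> 1 / 2 ^ d" by auto
qed

text \<open>
  A semicircle lies above the two semicircles over the halves of its diameter and touches them only
  at the ends.
\<close>

lemma height_Suc:
  assumes "0 \<le> x" "x \<le> 1"
  shows "height (Suc d) x \<le> height d x" "height (Suc d) x = height d x \<Longrightarrow> height d x = 0"
proof -
  have "height (Suc d) x \<le> height d x \<and> (height (Suc d) x = height d x \<longrightarrow> height d x = 0)"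
    using assms
  proof (induction d arbitrary: x)
    case 0
    have half: "sqrt y / 2 = sqrt (y / 4)" for y :: real by (simp add: real_sqrt_divide)
    have sq: "x\<^sup>2 \<le> x" using 0 by (simp add: power2_eq_square mult_left_le)
    show ?case
    proof (cases "x \<le> 1 / 2")
      case True
      have "(2 * x - (2 * x)\<^sup>2) / 4 = x / 2 - x\<^sup>2" by (simp add: power2_eq_square)
      then have h: "height (Suc 0) x = sqrt (x / 2 - x\<^sup>2)" using True by (simp add: half)
      show ?thesis unfolding h using 0 by auto
    next
      case False
      have "(2 * x - 1 - (2 * x - 1)\<^sup>2) / 4 = x - x\<^sup>2 - (1 - x) / 2" by (simp add: power2_eq_square field_simps)
      then have h: "height (Suc 0) x = sqrt (x - x\<^sup>2 - (1 - x) / 2)" using False by (simp add: half)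
      show ?thesis unfolding h using 0 by auto
    qed
  next
    case (Suc d)
    show ?case
    proof (cases "x \<le> 1 / 2")
      case True
      then show ?thesis using Suc.IH[of "2 * x"] Suc.prems by (simp add: True del: height.simps(1))
    next
      case False
      then show ?thesis using Suc.IH[of "2 * x - 1"] Suc.prems by (simp add: False del: height.simps(1))
    qed
  qed
  then show "height (Suc d) x \<le> height d x" "height (Suc d) x = height d x \<Longrightarrow> height d x = 0" by auto
qed

lemma height_antimono:
  assumes "0 \<le> x" "x \<le> 1" "d \<le> e"
  shows "height e x \<le> height d x"
  using assms(3) by (rule lift_Suc_antimono_le[rotated]) (rule height_Suc[OF assms(1,2)])

lemma height_strict:
  assumes "0 \<le> x" "x \<le> 1" "d < e" "height d x \<le> height e x"
  shows "height d x = 0"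
proof -
  have "height e x \<le> height (Suc d) x" using assms by (intro height_antimono) auto
  then show ?thesis using assms height_Suc[OF assms(1,2), of d] by linarith
qed

text \<open>
  In terms of the relative position \<open>t\<close> of \<open>x\<close> in the diameter, the equation of the circle reads
  \<open>(2 ^ d * y)\<^sup>2 = t - t\<^sup>2\<close>.
\<close>

lemma dyadic_arc_iff:
  "(x, y) \<in> dyadic_arc (Suc d) (Suc r) \<longleftrightarrow>
     (let t = 2 ^ d * x - real r in 0 \<le> t \<and> t \<le> 1 \<and> y = sqrt (t - t\<^sup>2) / 2 ^ d)"
proof -
  define t where "t = 2 ^ d * x - real r"
  define z where "z = 2 ^ d * y"
  have y: "y = z / 2 ^ d" by (simp add: z_def)
  have x: "x - (2 * real (Suc r) - 1) / 2 ^ Suc d = (t - 1 / 2) / 2 ^ d"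
    by (simp add: t_def field_simps)
  have pow: "\<not> (2::real) ^ d \<le> 0" by (simp add: not_le)
  have "(x, y) \<in> dyadic_arc (Suc d) (Suc r) \<longleftrightarrow> (t - 1/2)\<^sup>2 / (2 ^ d)\<^sup>2 + z\<^sup>2 / (2 ^ d)\<^sup>2 = (1/2)\<^sup>2 / (2 ^ d)\<^sup>2 \<and> z \<ge> 0"
    unfolding dyadic_arc_def by (simp only: mem_Collect_eq prod.case x) (use pow in \<open>auto simp: y power_divide power_mult_distrib zero_le_divide_iff\<close>)
  also have "\<dots> \<longleftrightarrow> (t - 1/2)\<^sup>2 + z\<^sup>2 = (1/2)\<^sup>2 \<and> z \<ge> 0"
    by (simp add: add_divide_distrib[symmetric])
  also have "\<dots> \<longleftrightarrow> z\<^sup>2 = t - t\<^sup>2 \<and> z \<ge> 0"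
    by (auto simp: power2_eq_square algebra_simps)
  also have "\<dots> \<longleftrightarrow> 0 \<le> t \<and> t \<le> 1 \<and> z = sqrt (t - t\<^sup>2)"
  proof
    assume a: "z\<^sup>2 = t - t\<^sup>2 \<and> z \<ge> 0"
    then have "t * (1 - t) \<ge> 0" by (metis power2_eq_square right_diff_distrib mult.right_neutral zero_le_power2)
    then have "0 \<le> t" "t \<le> 1" by (auto simp: zero_le_mult_iff)
    then show "0 \<le> t \<and> t \<le> 1 \<and> z = sqrt (t - t\<^sup>2)" using a by (metis real_sqrt_unique)
  next
    assume a: "0 \<le> t \<and> t \<le> 1 \<and> z = sqrt (t - t\<^sup>2)"
    then have "t\<^sup>2 \<le> t" by (simp add: power2_eq_square mult_left_le)
    then show "z\<^sup>2 = t - t\<^sup>2 \<and> z \<ge> 0" using a by simp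
  qed
  also have "z = sqrt (t - t\<^sup>2) \<longleftrightarrow> y = sqrt (t - t\<^sup>2) / 2 ^ d" by (auto simp: y field_simps)
  finally show ?thesis by (simp add: t_def Let_def)
qed

lemma dyadic_space_iff:
  "(x, y) \<in> dyadic_space \<longleftrightarrow> 0 \<le> x \<and> x \<le> 1 \<and> (y = 0 \<or> (\<exists>d. y = height d x))"
proof
  assume "(x, y) \<in> dyadic_space"
  then consider "0 \<le> x" "x \<le> 1" "y = 0" | n j where "n \<ge> 1" "j \<in> {1..2 ^ (n - 1)}" "(x, y) \<in> dyadic_arc n j"
    unfolding dyadic_space_def by auto
  then show "0 \<le> x \<and> x \<le> 1 \<and> (y = 0 \<or> (\<exists>d. y = height d x))"
  proof cases
    case 2
    define d r where "d = n - 1" and "r = j - 1"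
    have r: "n = Suc d" "j = Suc r" "r < 2 ^ d" using 2 by (auto simp: d_def r_def)
    define t where "t = 2 ^ d * x - real r"
    have t: "0 \<le> t" "t \<le> 1" "y = sqrt (t - t\<^sup>2) / 2 ^ d"
      using 2(3) dyadic_arc_iff[of x y d r] by (auto simp: r t_def Let_def)
    have x: "x = (real r + t) / 2 ^ d" by (simp add: t_def)
    have "real r + 1 \<le> 2 ^ d" by (rule real_less_power2[OF r(3)])
    then have "0 \<le> x" "x \<le> 1" using t by (auto simp: x)
    then show ?thesis using height_level[OF r(3) t(1,2)] t(3) x by metis
  qed auto
next
  assume a: "0 \<le> x \<and> x \<le> 1 \<and> (y = 0 \<or> (\<exists>d. y = height d x))"
  have "(x, height d x) \<in> dyadic_space" for d
  proof -
    define r where "r = (if x = 1 then 2 ^ d - 1 else nat \<lfloor>2 ^ d * x\<rfloor>)"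
    define t where "t = 2 ^ d * x - real r"
    have "r < 2 ^ d \<and> 0 \<le> t \<and> t \<le> 1"
    proof (cases "x = 1")
      case True
      then show ?thesis by (simp add: r_def t_def of_nat_diff)
    next
      case False
      then have "2 ^ d * x < 2 ^ d" using a by simp
      then have "r < 2 ^ d" unfolding r_def using False a
        by (simp add: nat_less_iff floor_less_iff)
      then show ?thesis using False a unfolding r_def t_def by simp linarith
    qed
    then have t: "r < 2 ^ d" "0 \<le> t" "t \<le> 1" by auto
    have x: "x = (real r + t) / 2 ^ d" by (simp add: t_def)
    have "height d x = sqrt (t - t\<^sup>2) / 2 ^ d" using height_level[OF t] x by simp
    then have "(x, height d x) \<in> dyadic_arc (Suc d) (Suc r)"
      using t by (simp add: dyadic_arc_iff Let_def t_def)
    then show ?thesis using t(1) unfolding dyadic_space_def by fastforce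
  qed
  then show "(x, y) \<in> dyadic_space" using a by (auto simp: dyadic_space_def)
qed

lemma tree_arc_in_dyadic_space:
  assumes "k \<ge> 1" "t \<in> {0..1}"
  shows "tree_arc k t \<in> dyadic_space"
proof -
  obtain d r where dr: "r < 2 ^ d" "k = 2 ^ d + r" using tree_index_cases[OF assms(1)] .
  have "real r + 1 \<le> 2 ^ d" by (rule real_less_power2[OF dr(1)])
  then show ?thesis unfolding dr(2) tree_arc_eq_height[OF dr(1) assms(2)] dyadic_space_iff using assms(2) by (auto simp: field_simps)
qed

lemma path_tree_arc [simp]: "path (tree_arc k)"
  unfolding path_def tree_arc_def by (intro continuous_intros)

lemma path_image_tree_arc: "k \<ge> 1 \<Longrightarrow> path_image (tree_arc k) \<subseteq> dyadic_space"
  using tree_arc_in_dyadic_space by (auto simp: path_image_def)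

lemma base_path: "path base_path" "path_image base_path \<subseteq> dyadic_space"
  "pathstart base_path = (0,0)" "pathfinish base_path = (1,0)"
  by (auto simp: path_def base_path_def[abs_def] path_image_def dyadic_space_iff pathstart_def pathfinish_def intro!: continuous_intros)

lemma standard_path_props:
  assumes "standard_path p"
  shows "path p" "path_image p \<subseteq> dyadic_space" "snd (pathstart p) = 0" "snd (pathfinish p) = 0"
  using assms path_image_tree_arc unfolding standard_path_iff by (auto simp del: path_image_reversepath simp: path_image_reversepath subset_iff)

lemma standard_concat_props:
  assumes "standard_concat p"
  shows "path p" "path_image p \<subseteq> dyadic_space" "snd (pathstart p) = 0" "snd (pathfinish p) = 0"
proof -
  have "path p \<and> path_image p \<subseteq> dyadic_space \<and> snd (pathstart p) = 0 \<and> snd (pathfinish p) = 0"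
    using assms by induction (auto simp: path_image_join dest: standard_path_props)
  then show "path p" "path_image p \<subseteq> dyadic_space" "snd (pathstart p) = 0" "snd (pathfinish p) = 0" by auto
qed

declare height.simps [simp del]

lemma height_0_pos: "0 < x \<Longrightarrow> x < 1 \<Longrightarrow> 0 < height 0 x"
  by (simp add: height.simps(1) power2_eq_square)

section \<open>Prefixing a path to a map of the dyadic space\<close>

lemma (in group) l_cancel_iff:
  "\<lbrakk>x \<in> carrier G; a \<in> carrier G; b \<in> carrier G\<rbrakk> \<Longrightarrow> x \<otimes> a = x \<otimes> b \<longleftrightarrow> a = b"
  by (metis Units_eq Units_l_cancel)

lemma (in group) inv_mult_cancel:
  "\<lbrakk>x \<in> carrier G; a \<in> carrier G\<rbrakk> \<Longrightarrow> inv x \<otimes> (x \<otimes> a) = a"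
  "\<lbrakk>x \<in> carrier G; a \<in> carrier G\<rbrakk> \<Longrightarrow> x \<otimes> (inv x \<otimes> a) = a"
  by (simp_all add: m_assoc[symmetric])

lemma dyadic_base_in: "(0, 0) \<in> dyadic_space" by (simp add: dyadic_space_iff)

lemma closedin_Collect_le:
  fixes g h :: "'b::topological_space \<Rightarrow> real"
  assumes "continuous_on S g" "continuous_on S h"
  shows "closedin (top_of_set S) {z \<in> S. g z \<le> h z}"
proof -
  have "{z \<in> S. g z \<le> h z} = S \<inter> (\<lambda>z. h z - g z) -` {0..}" by auto
  then show ?thesis using assms by (metis continuous_closedin_preimage continuous_on_diff closed_atLeast)
qed

text \<open>
  Over the left half of the base this map runs through \<open>c\<close>, over the right half it is a copy of \<open>f\<close>.
  Only the arc over the whole base reaches over both halves; it follows \<open>c\<close> and then the top arc of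
  \<open>f\<close>. The value at the base point changes from \<open>f (0, 0)\<close> to \<open>c 0\<close>.
\<close>

definition splice_path :: "(real \<Rightarrow> 'a) \<Rightarrow> (real \<times> real \<Rightarrow> 'a) \<Rightarrow> real \<times> real \<Rightarrow> 'a" where
  "splice_path c f = (\<lambda>(x, y).
     if x \<le> 1 / 2 then c (2 * x)
     else if height 0 x \<le> y then f (2 * x - 1, height 0 (2 * x - 1))
     else f (2 * x - 1, 2 * y))"

lemma height_right_half:
  assumes "1 / 2 \<le> x" "x \<le> 1"
  shows "2 * height (Suc d) x = height d (2 * x - 1)"
proof (cases "x = 1 / 2")
  case True
  show ?thesis unfolding True by (simp add: height.simps(2))
qed (use assms in \<open>auto simp: height.simps(2)\<close>)

lemma splice_path_right:
  assumes "(x, y) \<in> dyadic_space" "1 / 2 \<le> x" "c 1 = f (0, 0)"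
  shows "height 0 x \<le> y \<Longrightarrow> splice_path c f (x, y) = f (2 * x - 1, height 0 (2 * x - 1))"
    "y \<le> height 1 x \<Longrightarrow> splice_path c f (x, y) = f (2 * x - 1, 2 * y)"
proof -
  have x: "0 \<le> x" "x \<le> 1" "0 \<le> y" using assms(1) height_bounds(1) by (auto simp: dyadic_space_iff)
  note h = height_right_half[OF assms(2) x(2), of 0]
  show "splice_path c f (x, y) = f (2 * x - 1, height 0 (2 * x - 1))" if "height 0 x \<le> y"
  proof (cases "x = 1 / 2")
    case True
    show ?thesis using assms(3) unfolding splice_path_def True by simp
  qed (use that assms(2) in \<open>auto simp: splice_path_def\<close>)
  show "splice_path c f (x, y) = f (2 * x - 1, 2 * y)" if y: "y \<le> height 1 x"
  proof (cases "x = 1 / 2")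
    case True
    have "height 1 x = 0" using h unfolding True by simp
    then have "y = 0" using y x by simp
    then show ?thesis using assms(3) unfolding splice_path_def True by simp
  next
    case False
    show ?thesis
    proof (cases "height 0 x \<le> y")
      case True
      then have "height 0 x = 0" using y by (intro height_strict[OF x(1,2), of 0 1]) auto
      then have "height 1 x = 0" "y = 0" using y True x height_Suc(1)[OF x(1,2), of 0] height_bounds(1)[OF x(1,2), of 1] by auto
      then show ?thesis using h False assms(2) True by (simp add: splice_path_def)
    qed (use False assms(2) in \<open>auto simp: splice_path_def\<close>)
  qed
qed

text \<open>
  There are no points strictly between the arcs of level \<open>d\<close> and those of level \<open>d + 1\<close>. The dyadic
  space is hence the union of two closed pieces on which maps can be defined separately.
\<close>

lemma dyadic_space_cases:
  assumes "(x, y) \<in> dyadic_space"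
  shows "height d x \<le> y \<or> y \<le> height (Suc d) x"
proof -
  have x: "0 \<le> x" "x \<le> 1" and y: "y = 0 \<or> (\<exists>e. y = height e x)" using assms by (auto simp: dyadic_space_iff)
  show ?thesis
  proof (cases "y = 0")
    case True
    then show ?thesis using height_bounds(1)[OF x] by simp
  next
    case False
    then obtain e where "y = height e x" using y by blast
    then show ?thesis using height_antimono[OF x, of e d] height_antimono[OF x, of "Suc d" e] by (cases "e \<le> d") auto
  qed
qed

lemma continuous_on_height_fst:
  assumes "S \<subseteq> dyadic_space"
  shows "continuous_on S (\<lambda>z. height d (fst z))"
  using assms by (intro continuous_on_compose2[OF continuous_height] continuous_intros) (auto simp: dyadic_space_iff)

lemma zoom_right_in_dyadic_space:
  assumes "(x, y) \<in> dyadic_space" "1 / 2 \<le> x" "y \<le> height 1 x"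
  shows "(2 * x - 1, 2 * y) \<in> dyadic_space"
proof -
  have x: "0 \<le> x" "x \<le> 1" and y: "y = 0 \<or> (\<exists>e. y = height e x)" using assms(1) by (auto simp: dyadic_space_iff)
  consider "y = 0" | e where "y = height (Suc e) x" | "y = height 0 x" using y not0_implies_Suc by metis
  then show ?thesis
  proof cases
    case 1
    then show ?thesis using x assms(2) by (simp add: dyadic_space_iff)
  next
    case 2
    then have "2 * y = height e (2 * x - 1)" using height_right_half[OF assms(2) x(2), of e] by simp
    then show ?thesis using x assms(2) by (auto simp: dyadic_space_iff)
  next
    case 3
    then have "y = 0" using height_strict[OF x, of 0 1] assms(3) by simp
    then show ?thesis using x assms(2) by (simp add: dyadic_space_iff)
  qed
qed

lemma continuous_splice_path:
  assumes f: "continuous_on dyadic_space f" and c: "path c" "pathfinish c = f (0, 0)"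
  shows "continuous_on dyadic_space (splice_path c f)"
proof -
  let ?g = "splice_path c f"
  let ?A = "{z \<in> dyadic_space. fst z \<le> 1 / 2}"
  let ?B = "{z \<in> dyadic_space. 1 / 2 \<le> fst z \<and> height 0 (fst z) \<le> snd z}"
  let ?C = "{z \<in> dyadic_space. 1 / 2 \<le> fst z \<and> snd z \<le> height 1 (fst z)}"
  have c1: "c 1 = f (0, 0)" using c by (simp add: pathfinish_def)
  have un: "dyadic_space = ?A \<union> (?B \<union> ?C)"
  proof (intro equalityI subsetI)
    fix z assume "z \<in> dyadic_space"
    then show "z \<in> ?A \<union> (?B \<union> ?C)"
      using dyadic_space_cases[of "fst z" "snd z" 0] by auto
  qed auto
  have hc: "continuous_on dyadic_space (\<lambda>z. height d (fst z))" for d by (rule continuous_on_height_fst) simp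
  have conj: "{z \<in> S. P z \<and> R z} = {z \<in> S. P z} \<inter> {z \<in> S. R z}" for S :: "(real \<times> real) set" and P R by auto
  have cl: "closedin (top_of_set dyadic_space) ?A" "closedin (top_of_set dyadic_space) ?B" "closedin (top_of_set dyadic_space) ?C"
    unfolding conj by (intro closedin_Int closedin_Collect_le continuous_intros hc)+
  have A: "continuous_on ?A ?g"
  proof -
    have "continuous_on ?A (\<lambda>z. c (2 * fst z))"
      using c(1) unfolding path_def
      by (rule continuous_on_compose2) (auto intro!: continuous_intros simp: dyadic_space_iff)
    then show ?thesis by (rule continuous_on_eq) (auto simp: splice_path_def)
  qed
  have B: "continuous_on ?B ?g"
  proof -
    have "continuous_on ?B (\<lambda>z. f (2 * fst z - 1, height 0 (2 * fst z - 1)))"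
      by (rule continuous_on_compose2[OF f])
        (auto intro!: continuous_intros continuous_on_compose2[OF continuous_height] simp: dyadic_space_iff)
    then show ?thesis
    proof (rule continuous_on_eq)
      fix z assume z: "z \<in> ?B"
      show "f (2 * fst z - 1, height 0 (2 * fst z - 1)) = ?g z"
        using splice_path_right(1)[of "fst z" "snd z" c f] z c1 by auto
    qed
  qed
  have C: "continuous_on ?C ?g"
  proof -
    have "continuous_on ?C (\<lambda>z. f (2 * fst z - 1, 2 * snd z))"
    proof (rule continuous_on_compose2[OF f])
      show "(\<lambda>z. (2 * fst z - 1, 2 * snd z)) ` ?C \<subseteq> dyadic_space"
        using zoom_right_in_dyadic_space by force
    qed (intro continuous_intros)
    then show ?thesis
    proof (rule continuous_on_eq)
      fix z assume z: "z \<in> ?C"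
      show "f (2 * fst z - 1, 2 * snd z) = ?g z"
        using splice_path_right(2)[of "fst z" "snd z" c f] z c1 by auto
    qed
  qed
  have sub: "?B \<union> ?C \<subseteq> dyadic_space" by auto
  have "continuous_on (?B \<union> ?C) ?g"
    by (intro continuous_on_Un_local B C closedin_subset_trans[OF cl(2) _ sub] closedin_subset_trans[OF cl(3) _ sub]) auto
  moreover have "closedin (top_of_set dyadic_space) (?B \<union> ?C)" using cl by (intro closedin_Un)
  ultimately have "continuous_on (?A \<union> (?B \<union> ?C)) ?g"
    using cl(1) A by (intro continuous_on_Un_local[of ?A "?B \<union> ?C"]) (simp_all only: un[symmetric])
  then show ?thesis by (simp only: un[symmetric])
qed

lemma splice_path_in:
  assumes "f \<in> dyadic_space \<rightarrow> X" "path_image c \<subseteq> X"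
  shows "splice_path c f \<in> dyadic_space \<rightarrow> X"
proof
  fix z assume "z \<in> dyadic_space"
  then obtain x y where z: "z = (x, y)" "(x, y) \<in> dyadic_space" by (cases z) auto
  have x: "0 \<le> x" "x \<le> 1" using z(2) by (auto simp: dyadic_space_iff)
  consider "x \<le> 1 / 2" | "x > 1 / 2" "height 0 x \<le> y" | "x > 1 / 2" "\<not> height 0 x \<le> y" by linarith
  then show "splice_path c f z \<in> X"
  proof cases
    case 1
    then show ?thesis using assms(2) x by (auto simp: z splice_path_def path_image_def)
  next
    case 2
    then have "(2 * x - 1, height 0 (2 * x - 1)) \<in> dyadic_space" using x by (auto simp: dyadic_space_iff)
    then show ?thesis using assms(1) 2 by (auto simp: z splice_path_def)
  next
    case 3
    then have "(2 * x - 1, 2 * y) \<in> dyadic_space"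
      using dyadic_space_cases[OF z(2), of 0] by (intro zoom_right_in_dyadic_space[OF z(2)]) auto
    then show ?thesis using assms(1) 3 by (auto simp: z splice_path_def)
  qed
qed

lemma splice_path_start: "splice_path c f (0, 0) = c 0" by (simp add: splice_path_def)

lemma splice_path_base_path:
  assumes "t \<in> {0..1}"
  shows "(splice_path c f \<circ> base_path) t = (c +++ (f \<circ> base_path)) t"
  using assms height_0_pos[of t]
  by (cases "t = 1") (auto simp: splice_path_def base_path_def joinpaths_def)

lemma splice_path_top:
  assumes "t \<in> {0..1}"
  shows "(splice_path c f \<circ> tree_arc 1) t = (c +++ (f \<circ> tree_arc 1)) t"
  using tree_arc_eq_height[of 0 0] assms
  by (auto simp: splice_path_def joinpaths_def)

lemma splice_path_left:
  assumes "r < 2 ^ e" "t \<in> {0..1}" "k = 2 ^ Suc e + r"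
  shows "(splice_path c f \<circ> tree_arc k) t = (c \<circ> linepath (2 * tree_lo k) (2 * tree_hi k)) t"
proof -
  have r: "r < 2 ^ Suc e" using assms(1) by simp
  have k: "tree_lo k = real r / 2 ^ Suc e" "tree_hi k = real (Suc r) / 2 ^ Suc e"
    using tree_level(2)[OF r] tree_hi_level[OF r] assms(3) by auto
  have "(real r + t) / 2 ^ Suc e \<le> 1 / 2" using real_less_power2[OF assms(1)] assms(2) by (simp add: field_simps)
  moreover have "linepath (2 * tree_lo k) (2 * tree_hi k) t = 2 * ((real r + t) / 2 ^ Suc e)"
    unfolding k linepath_def by (simp add: field_simps)
  ultimately show ?thesis
    using tree_arc_eq_height[OF r assms(2)] assms(3) by (simp add: splice_path_def)
qed

lemma splice_path_right_arc:
  assumes "r < 2 ^ e" "t \<in> {0..1}" "c 1 = f (0, 0)"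
  shows "(splice_path c f \<circ> tree_arc (2 ^ Suc e + (2 ^ e + r))) t = (f \<circ> tree_arc (2 ^ e + r)) t"
proof -
  define x where "x = (real (2 ^ e + r) + t) / 2 ^ Suc e"
  have lt: "2 ^ e + r < 2 ^ Suc e" using assms(1) by simp
  have x2: "2 * x - 1 = (real r + t) / 2 ^ e" by (simp add: x_def field_simps)
  have x: "1 / 2 \<le> x" "x \<le> 1" using real_less_power2[OF assms(1)] assms(2) unfolding x_def by (auto simp: field_simps)
  have "(splice_path c f \<circ> tree_arc (2 ^ Suc e + (2 ^ e + r))) t = splice_path c f (x, height (Suc e) x)"
    using tree_arc_eq_height[OF lt assms(2)] by (simp add: x_def)
  also have "\<dots> = f (2 * x - 1, 2 * height (Suc e) x)"
    using x assms(3) height_antimono[of x 1 "Suc e"]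
    by (intro splice_path_right(2)) (auto simp: dyadic_space_iff)
  also have "\<dots> = f (2 * x - 1, height e (2 * x - 1))" using height_right_half[OF x, of e] by simp
  also have "\<dots> = (f \<circ> tree_arc (2 ^ e + r)) t" using tree_arc_eq_height[OF assms(1,2)] x2 by simp
  finally show ?thesis .
qed

section \<open>Additive maps of the dyadic space\<close>

context normal_pi1
begin

abbreviation dyadic_map :: "(real \<times> real \<Rightarrow> 'a) \<Rightarrow> bool" where
  "dyadic_map f \<equiv> continuous_on dyadic_space f \<and> f \<in> dyadic_space \<rightarrow> X"

text \<open>
  Modulo \<open>N\<close>, every triangle made of an arc and the two arcs below it commutes. This amounts to trivial
  holonomy of all loops composed of standard paths (\<open>hol_standard_loop\<close> and \<open>additiveI\<close>), and
  mentions no base point.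
\<close>

definition additive :: "(real \<times> real \<Rightarrow> 'a) \<Rightarrow> bool" where
  "additive f \<longleftrightarrow> (\<forall>k\<ge>1. hol (f \<circ> tree_arc k) = hol (f \<circ> tree_arc (2 * k)) \<otimes>\<^bsub>Q\<^esub> hol (f \<circ> tree_arc (Suc (2 * k))))"

lemma dyadic_map_path:
  assumes "dyadic_map f" "path p" "path_image p \<subseteq> dyadic_space"
  shows "path_in (f \<circ> p)"
  using path_in_compose[of dyadic_space f p] assms by auto

lemma hol_compose_carrier:
  assumes "dyadic_map f" "path p" "path_image p \<subseteq> dyadic_space"
  shows "hol (f \<circ> p) \<in> carrier Q"
  using dyadic_map_path[OF assms] by (rule hol_carrier)

lemma dyadic_map_arc: "dyadic_map f \<Longrightarrow> k \<ge> 1 \<Longrightarrow> path_in (f \<circ> tree_arc k)"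
  by (intro dyadic_map_path path_tree_arc path_image_tree_arc)

primrec level_prod :: "(real \<times> real \<Rightarrow> 'a) \<Rightarrow> nat \<Rightarrow> nat \<Rightarrow> (real \<Rightarrow> 'a) set set" where
  "level_prod f d 0 = \<one>\<^bsub>Q\<^esub>"
| "level_prod f d (Suc m) = level_prod f d m \<otimes>\<^bsub>Q\<^esub> hol (f \<circ> tree_arc (2 ^ d + m))"

lemma arc_carrier [simp]: "dyadic_map f \<Longrightarrow> k \<ge> 1 \<Longrightarrow> hol (f \<circ> tree_arc k) \<in> carrier Q"
  using dyadic_map_arc hol_carrier by blast

lemma level_prod_carrier [simp]: "dyadic_map f \<Longrightarrow> level_prod f d m \<in> carrier Q"
  by (induction m) (auto intro!: arc_carrier simp: trans_le_add1 Suc_le_eq)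

lemma level_prod_refine:
  assumes "dyadic_map f" "additive f"
  shows "level_prod f (d + e) (2 ^ e * m) = level_prod f d m"
proof (induction e)
  case (Suc e)
  have "level_prod f (Suc n) (2 * i) = level_prod f n i" for n i
  proof (induction i)
    case (Suc i)
    have "level_prod f (Suc n) (2 * Suc i) = level_prod f (Suc n) (2 * i) \<otimes>\<^bsub>Q\<^esub> hol (f \<circ> tree_arc (2 * (2 ^ n + i))) \<otimes>\<^bsub>Q\<^esub> hol (f \<circ> tree_arc (Suc (2 * (2 ^ n + i))))"
      by (simp add: algebra_simps)
    also have "\<dots> = level_prod f n i \<otimes>\<^bsub>Q\<^esub> (hol (f \<circ> tree_arc (2 * (2 ^ n + i))) \<otimes>\<^bsub>Q\<^esub> hol (f \<circ> tree_arc (Suc (2 * (2 ^ n + i)))))"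
      unfolding Suc.IH using index_ge_1[of n i] assms(1) by (intro Q.m_assoc) (auto intro!: arc_carrier)
    also have "\<dots> = level_prod f n (Suc i)"
      using assms(2)[unfolded additive_def, rule_format, OF index_ge_1[of n i]] by simp
    finally show ?case .
  qed simp
  from this[of "d + e" "2 ^ e * m"] Suc show ?case by (simp add: mult.assoc)
qed simp

text \<open>
  The product of the arcs of level \<open>n\<close> from \<open>0\<close> up to a dyadic number serves as a potential: by
  additivity it does not depend on \<open>n\<close>, and the holonomy of an arc is the difference of its values at
  the ends. For large \<open>n\<close> all vertices of \<open>p\<close> are multiples of \<open>1 / 2 ^ n\<close>, and no rounding takes
  place.
\<close>

lemma hol_standard_concat:
  assumes f: "dyadic_map f" "additive f" and p: "standard_concat p"
  shows "\<exists>n0. \<forall>n\<ge>n0. hol (f \<circ> p) =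
    inv\<^bsub>Q\<^esub> (level_prod f n (nat \<lfloor>2 ^ n * fst (pathstart p)\<rfloor>)) \<otimes>\<^bsub>Q\<^esub> level_prod f n (nat \<lfloor>2 ^ n * fst (pathfinish p)\<rfloor>)"
proof -
  define V where "V n z = level_prod f n (nat \<lfloor>2 ^ n * fst z\<rfloor>)" for n and z :: "real \<times> real"
  have Vc [simp]: "V n z \<in> carrier Q" for n z using f by (simp add: V_def)
  have arc: "\<exists>n0. \<forall>n\<ge>n0. hol (f \<circ> tree_arc k) = inv\<^bsub>Q\<^esub> (V n (tree_lo k, 0)) \<otimes>\<^bsub>Q\<^esub> V n (tree_hi k, 0)"
    if k: "k \<ge> 1" for k
  proof -
    obtain d r where dr: "r < 2 ^ d" "k = 2 ^ d + r" using tree_index_cases[OF k] .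
    have "hol (f \<circ> tree_arc k) = inv\<^bsub>Q\<^esub> (V n (tree_lo k, 0)) \<otimes>\<^bsub>Q\<^esub> V n (tree_hi k, 0)" if "n \<ge> d" for n
    proof -
      define e where "e = n - d"
      have e: "n = d + e" using that by (simp add: e_def)
      have *: "nat \<lfloor>2 ^ n * (real m / 2 ^ d)\<rfloor> = 2 ^ e * m" for m
      proof -
        have "2 ^ n * (real m / 2 ^ d) = (2 ^ d * 2 ^ e) * (real m / 2 ^ d)"
          by (simp only: e power_add)
        also have "\<dots> = real (2 ^ e * m)" by simp
        finally have "2 ^ n * (real m / 2 ^ d) = real (2 ^ e * m)" .
        then show ?thesis by (simp only: floor_of_nat nat_int)
      qed
      have "V n (tree_lo k, 0) = level_prod f d r" "V n (tree_hi k, 0) = level_prod f d (Suc r)"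
        unfolding V_def dr(2) tree_level(2)[OF dr(1)] tree_hi_level[OF dr(1)] fst_conv *
        unfolding e level_prod_refine[OF f] by auto
      moreover have "hol (f \<circ> tree_arc k) \<in> carrier Q" using f(1) k by (rule arc_carrier)
      ultimately show ?thesis using f(1) by (simp add: dr(2) Q.inv_solve_left)
    qed
    then show ?thesis by blast
  qed
  have std: "\<exists>n0. \<forall>n\<ge>n0. hol (f \<circ> p) = inv\<^bsub>Q\<^esub> (V n (pathstart p)) \<otimes>\<^bsub>Q\<^esub> V n (pathfinish p)"
    if sp: "standard_path p" for p
  proof -
    obtain k where k: "k \<ge> 1" "p = tree_arc k \<or> p = reversepath (tree_arc k)"
      using sp standard_path_iff by blast
    obtain n0 where n0: "\<forall>n\<ge>n0. hol (f \<circ> tree_arc k) = inv\<^bsub>Q\<^esub> (V n (tree_lo k, 0)) \<otimes>\<^bsub>Q\<^esub> V n (tree_hi k, 0)"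
      using arc[OF k(1)] by blast
    show ?thesis
    proof (rule exI[of _ n0], intro allI impI)
      fix n assume n: "n \<ge> n0"
      show "hol (f \<circ> p) = inv\<^bsub>Q\<^esub> (V n (pathstart p)) \<otimes>\<^bsub>Q\<^esub> V n (pathfinish p)"
      proof (cases "p = tree_arc k")
        case True
        then show ?thesis using n0 n by simp
      next
        case False
        then have p: "p = reversepath (tree_arc k)" using k by blast
        have "hol (f \<circ> p) = inv\<^bsub>Q\<^esub> (hol (f \<circ> tree_arc k))"
          unfolding p path_compose_reversepath by (rule hol_reverse[OF dyadic_map_arc[OF f(1) k(1)]])
        then show ?thesis using n0 n by (simp add: p Q.inv_mult_group)
      qed
    qed
  qed
  have "\<exists>n0. \<forall>n\<ge>n0. hol (f \<circ> p) = inv\<^bsub>Q\<^esub> (V n (pathstart p)) \<otimes>\<^bsub>Q\<^esub> V n (pathfinish p)"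
    using p
  proof induction
    case (single p)
    then show ?case by (rule std)
  next
    case (join p q)
    obtain n1 where n1: "\<forall>n\<ge>n1. hol (f \<circ> p) = inv\<^bsub>Q\<^esub> (V n (pathstart p)) \<otimes>\<^bsub>Q\<^esub> V n (pathfinish p)"
      using std[OF join(1)] by blast
    obtain n2 where n2: "\<forall>n\<ge>n2. hol (f \<circ> q) = inv\<^bsub>Q\<^esub> (V n (pathstart q)) \<otimes>\<^bsub>Q\<^esub> V n (pathfinish q)"
      using join(4) by blast
    have "hol (f \<circ> (p +++ q)) = hol (f \<circ> p) \<otimes>\<^bsub>Q\<^esub> hol (f \<circ> q)"
      unfolding path_compose_join using standard_path_props[OF join(1)] standard_concat_props[OF join(2)] join(3)
      by (intro hol_join dyadic_map_path f) (auto simp: pathfinish_compose pathstart_compose)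
    then have "hol (f \<circ> (p +++ q)) = inv\<^bsub>Q\<^esub> (V n (pathstart (p +++ q))) \<otimes>\<^bsub>Q\<^esub> V n (pathfinish (p +++ q))"
      if "n \<ge> max n1 n2" for n
      using n1[rule_format, of n] n2[rule_format, of n] that join(3) by (simp add: Q.m_assoc Q.inv_mult_cancel)
    then show ?case by blast
  qed
  then show ?thesis by (simp add: V_def)
qed

lemma hol_standard_loop:
  assumes "dyadic_map f" "additive f" "standard_concat p" "pathstart p = pathfinish p"
  shows "hol (f \<circ> p) = \<one>\<^bsub>Q\<^esub>"
  using hol_standard_concat[OF assms(1-3)] assms(1,4) by (auto simp: Q.l_inv)

lemma hol_compose_join:
  assumes "dyadic_map f" "path p" "path_image p \<subseteq> dyadic_space" "path q" "path_image q \<subseteq> dyadic_space" "pathfinish p = pathstart q"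
  shows "hol (f \<circ> (p +++ q)) = hol (f \<circ> p) \<otimes>\<^bsub>Q\<^esub> hol (f \<circ> q)"
  unfolding path_compose_join using assms
  by (intro hol_join dyadic_map_path) (auto simp: pathfinish_compose pathstart_compose)

lemma hol_compose_reverse:
  assumes "dyadic_map f" "path p" "path_image p \<subseteq> dyadic_space"
  shows "hol (f \<circ> reversepath p) = inv\<^bsub>Q\<^esub> (hol (f \<circ> p))"
  unfolding path_compose_reversepath by (intro hol_reverse dyadic_map_path assms)

lemma standard_prefix:
  assumes f: "dyadic_map f"
  shows "r \<le> 2 ^ d \<Longrightarrow> standard_concat q \<Longrightarrow> pathstart q = (real r / 2 ^ d, 0) \<Longrightarrow>
    \<exists>q'. standard_concat q' \<and> pathstart q' = (0, 0) \<and> pathfinish q' = pathfinish q \<and>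
      hol (f \<circ> q') = level_prod f d r \<otimes>\<^bsub>Q\<^esub> hol (f \<circ> q)"
proof (induction r arbitrary: q)
  case 0
  have "hol (f \<circ> q) \<in> carrier Q"
    using standard_concat_props[OF 0(2)] f by (intro hol_carrier dyadic_map_path) auto
  then have "hol (f \<circ> q) = level_prod f d 0 \<otimes>\<^bsub>Q\<^esub> hol (f \<circ> q)" by simp
  then show ?case using 0 by (intro exI[of _ q]) (metis div_0 of_nat_0)
next
  case (Suc r)
  let ?a = "tree_arc (2 ^ d + r)"
  have k: "1 \<le> 2 ^ d + r" by (rule index_ge_1)
  have r: "r < 2 ^ d" using Suc.prems(1) by simp
  have sa: "standard_path ?a" using k standard_path_iff by blast
  have e: "pathfinish ?a = pathstart q" "pathstart ?a = (real r / 2 ^ d, 0)"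
    using Suc.prems(3) tree_level(2)[OF r] tree_hi_level[OF r] by auto
  have "standard_concat (?a +++ q)" using sa Suc.prems(2) e by (intro standard_concat.join) auto
  moreover have "pathstart (?a +++ q) = (real r / 2 ^ d, 0)" using e by simp
  ultimately obtain q' where q': "standard_concat q'" "pathstart q' = (0, 0)" "pathfinish q' = pathfinish (?a +++ q)"
      "hol (f \<circ> q') = level_prod f d r \<otimes>\<^bsub>Q\<^esub> hol (f \<circ> (?a +++ q))"
    using Suc.IH[OF less_imp_le[OF r]] by blast
  have qc: "hol (f \<circ> q) \<in> carrier Q"
    using standard_concat_props[OF Suc.prems(2)] f by (intro hol_carrier dyadic_map_path) auto
  have "hol (f \<circ> (?a +++ q)) = hol (f \<circ> ?a) \<otimes>\<^bsub>Q\<^esub> hol (f \<circ> q)"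
    using standard_concat_props[OF Suc.prems(2)] path_image_tree_arc[OF k] e by (intro hol_compose_join f) auto
  then have "hol (f \<circ> q') = level_prod f d (Suc r) \<otimes>\<^bsub>Q\<^esub> hol (f \<circ> q)"
    using q'(4) qc f arc_carrier[OF f k] by (simp add: Q.m_assoc)
  then show ?case using q' pathfinish_join by metis
qed

text \<open>
  For \<open>r = 0\<close> the top arc is traversed back and forth, because a concatenation has at least one factor.
\<close>

lemma standard_return:
  "r \<le> 2 ^ d \<Longrightarrow> \<exists>q. standard_concat q \<and> pathstart q = (real r / 2 ^ d, 0) \<and> pathfinish q = (0, 0)"
proof (induction r)
  case 0
  have "standard_path (tree_arc 1)" "standard_path (reversepath (tree_arc 1))" using standard_path_iff by blast+
  then have "standard_concat (tree_arc 1 +++ reversepath (tree_arc 1))"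
    by (intro standard_concat.join standard_concat.single) auto
  then show ?case by (intro exI[of _ "tree_arc 1 +++ reversepath (tree_arc 1)"]) auto
next
  case (Suc r)
  then obtain q where q: "standard_concat q" "pathstart q = (real r / 2 ^ d, 0)" "pathfinish q = (0, 0)" by auto
  have r: "r < 2 ^ d" using Suc.prems(1) by simp
  let ?a = "reversepath (tree_arc (2 ^ d + r))"
  have sa: "standard_path ?a" using index_ge_1 standard_path_iff by blast
  have e: "pathfinish ?a = pathstart q" "pathstart ?a = (real (Suc r) / 2 ^ d, 0)"
    using q(2) tree_level(2)[OF r] tree_hi_level[OF r] by auto
  have "standard_concat (?a +++ q)" using sa q e by (intro standard_concat.join) auto
  then show ?case using e q by (intro exI[of _ "?a +++ q"]) auto
qed

text \<open>
  Two loops are compared which leave \<open>0\<close> along arcs of one level up to the left end of node \<open>k\<close> and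
  which return from there in the same way. One of them makes a detour around the triangle of \<open>k\<close> in
  between. Since both have trivial holonomy, so has the triangle.
\<close>

lemma additiveI:
  assumes f: "dyadic_map f"
    and loops: "\<And>q. standard_concat q \<Longrightarrow> pathstart q = (0, 0) \<Longrightarrow> pathfinish q = (0, 0) \<Longrightarrow> hol (f \<circ> q) = \<one>\<^bsub>Q\<^esub>"
  shows "additive f"
  unfolding additive_def
proof (intro allI impI)
  fix k :: nat assume k: "k \<ge> 1"
  obtain d r where dr: "r < 2 ^ d" "k = 2 ^ d + r" using tree_index_cases[OF k] .
  obtain s where s: "standard_concat s" "pathstart s = (real r / 2 ^ d, 0)" "pathfinish s = (0, 0)"
    using standard_return[of r d] dr by auto
  let ?a = "tree_arc k" and ?b = "reversepath (tree_arc (Suc (2 * k)))" and ?c = "reversepath (tree_arc (2 * k))"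
  have k2: "1 \<le> 2 * k" "1 \<le> Suc (2 * k)" using k by auto
  have std: "standard_path ?a" "standard_path ?b" "standard_path ?c" using k k2 standard_path_iff by blast+
  have ends: "pathstart ?a = pathstart s" "pathfinish ?a = pathstart ?b" "pathfinish ?b = pathstart ?c" "pathfinish ?c = pathstart s"
    using s(2) tree_level(2)[OF dr(1)] tree_child[OF k] dr(2) by auto
  have cc: "standard_concat (?c +++ s)" "standard_concat (?b +++ (?c +++ s))" "standard_concat (?a +++ (?b +++ (?c +++ s)))"
    using std s ends by (auto intro!: standard_concat.join)
  let ?L = "level_prod f d r"
  have sc: "hol (f \<circ> s) \<in> carrier Q"
    using standard_concat_props[OF s(1)] f by (intro hol_carrier dyadic_map_path) auto
  have closed: "?L \<otimes>\<^bsub>Q\<^esub> hol (f \<circ> q) = \<one>\<^bsub>Q\<^esub>"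
    if q: "standard_concat q" "pathstart q = (real r / 2 ^ d, 0)" "pathfinish q = (0, 0)" for q
  proof -
    obtain q' where q': "standard_concat q'" "pathstart q' = (0, 0)" "pathfinish q' = pathfinish q"
      "hol (f \<circ> q') = ?L \<otimes>\<^bsub>Q\<^esub> hol (f \<circ> q)"
      using standard_prefix[OF f _ q(1,2)] dr(1) less_imp_le by blast
    then show ?thesis using loops[OF q'(1,2)] q(3) by simp
  qed
  have 1: "?L \<otimes>\<^bsub>Q\<^esub> hol (f \<circ> s) = \<one>\<^bsub>Q\<^esub>" by (rule closed[OF s])
  have 2: "?L \<otimes>\<^bsub>Q\<^esub> hol (f \<circ> (?a +++ (?b +++ (?c +++ s)))) = \<one>\<^bsub>Q\<^esub>"
    using s(2,3) ends(1) by (intro closed[OF cc(3)]) auto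
  note im = path_image_tree_arc[OF k] path_image_tree_arc[OF k2(1)] path_image_tree_arc[OF k2(2)]
  have 31: "hol (f \<circ> (?c +++ s)) = inv\<^bsub>Q\<^esub> hol (f \<circ> tree_arc (2 * k)) \<otimes>\<^bsub>Q\<^esub> hol (f \<circ> s)"
    using hol_compose_join[OF f, of ?c s] hol_compose_reverse[OF f, of "tree_arc (2 * k)"] im ends standard_concat_props[OF s(1)]
    by simp
  have 32: "hol (f \<circ> (?b +++ (?c +++ s))) = inv\<^bsub>Q\<^esub> hol (f \<circ> tree_arc (Suc (2 * k))) \<otimes>\<^bsub>Q\<^esub> hol (f \<circ> (?c +++ s))"
    using hol_compose_join[OF f, of ?b "?c +++ s"] hol_compose_reverse[OF f, of "tree_arc (Suc (2 * k))"] im ends standard_concat_props[OF cc(1)]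
    by simp
  have 3: "hol (f \<circ> (?a +++ (?b +++ (?c +++ s)))) =
     hol (f \<circ> ?a) \<otimes>\<^bsub>Q\<^esub> (inv\<^bsub>Q\<^esub> hol (f \<circ> tree_arc (Suc (2 * k))) \<otimes>\<^bsub>Q\<^esub> (inv\<^bsub>Q\<^esub> hol (f \<circ> tree_arc (2 * k)) \<otimes>\<^bsub>Q\<^esub> hol (f \<circ> s)))"
    using hol_compose_join[OF f, of ?a "?b +++ (?c +++ s)"] im ends standard_concat_props[OF cc(2)]
    unfolding 31[symmetric] 32[symmetric] by simp
  have tc: "hol (f \<circ> (?a +++ (?b +++ (?c +++ s)))) \<in> carrier Q"
    using standard_concat_props[OF cc(3)] f by (intro hol_carrier dyadic_map_path) auto
  note c [simp] = sc level_prod_carrier[OF f] arc_carrier[OF f k] arc_carrier[OF f k2(1)] arc_carrier[OF f k2(2)]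
  have "hol (f \<circ> s) = hol (f \<circ> (?a +++ (?b +++ (?c +++ s))))"
    using 1 2 sc tc Q.l_cancel_iff[of ?L "hol (f \<circ> s)" "hol (f \<circ> (?a +++ (?b +++ (?c +++ s))))"] by simp
  then have "hol (f \<circ> s) = (hol (f \<circ> ?a) \<otimes>\<^bsub>Q\<^esub> (inv\<^bsub>Q\<^esub> hol (f \<circ> tree_arc (Suc (2 * k))) \<otimes>\<^bsub>Q\<^esub> inv\<^bsub>Q\<^esub> hol (f \<circ> tree_arc (2 * k)))) \<otimes>\<^bsub>Q\<^esub> hol (f \<circ> s)"
    unfolding 3 by (simp add: Q.m_assoc)
  then have "hol (f \<circ> ?a) \<otimes>\<^bsub>Q\<^esub> (inv\<^bsub>Q\<^esub> hol (f \<circ> tree_arc (Suc (2 * k))) \<otimes>\<^bsub>Q\<^esub> inv\<^bsub>Q\<^esub> hol (f \<circ> tree_arc (2 * k))) = \<one>\<^bsub>Q\<^esub>"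
    using Q.r_cancel_one'[OF sc] by simp
  then have "hol (f \<circ> ?a) = inv\<^bsub>Q\<^esub> (inv\<^bsub>Q\<^esub> hol (f \<circ> tree_arc (Suc (2 * k))) \<otimes>\<^bsub>Q\<^esub> inv\<^bsub>Q\<^esub> hol (f \<circ> tree_arc (2 * k)))"
    by (intro Q.inv_equality[symmetric]) auto
  then show "hol (f \<circ> ?a) = hol (f \<circ> tree_arc (2 * k)) \<otimes>\<^bsub>Q\<^esub> hol (f \<circ> tree_arc (Suc (2 * k)))"
    by (simp add: Q.inv_mult_group)
qed


section \<open>Standard loops of a prefixed map\<close>

text \<open>
  Here \<open>R\<close> collapses the left half of the base and stretches the right half, and \<open>C x\<close> is the holonomy
  of what is left of \<open>c\<close> at the base point \<open>x\<close>; it is trivial from \<open>1 / 2\<close> on. A standard path in the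
  left half collapses to a point under \<open>R\<close>, every other one becomes a standard path for \<open>f\<close>. In
  both cases the correction by \<open>C\<close> at the ends makes the holonomies agree, so that the corrections
  cancel in concatenations.
\<close>

lemma splice_standard_path:
  assumes f: "dyadic_map f" and c: "path_in c" "pathfinish c = f (0, 0)" and p: "standard_path p"
  defines "C \<equiv> \<lambda>x. hol (c \<circ> linepath (min 1 (2 * x)) 1)"
    and "R \<equiv> \<lambda>x. max 0 (2 * x - 1)"
    and "u \<equiv> fst (pathstart p)" and "v \<equiv> fst (pathfinish p)"
  shows "R u = R v \<and> hol (splice_path c f \<circ> p) \<otimes>\<^bsub>Q\<^esub> C v = C u \<or>
    (\<exists>p'. standard_path p' \<and> pathstart p' = (R u, 0) \<and> pathfinish p' = (R v, 0) \<and>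
      hol (splice_path c f \<circ> p) \<otimes>\<^bsub>Q\<^esub> C v = C u \<otimes>\<^bsub>Q\<^esub> hol (f \<circ> p'))"
proof -
  let ?g = "splice_path c f"
  have g: "dyadic_map ?g" using continuous_splice_path[of f c] splice_path_in[of f X c] f c by auto
  have c': "continuous_on {0..1} c" "c ` {0..1} \<subseteq> X" using c by (auto simp: path_def path_image_def)
  have c1: "c 1 = f (0, 0)" using c by (simp add: pathfinish_def)
  have f0: "f (0, 0) \<in> X" using f dyadic_base_in by auto
  have Cc: "C x \<in> carrier Q" if "0 \<le> x" for x
    unfolding C_def using that c' segment_real[of "{0..1}" "min 1 (2 * x)" 1]
    by (intro hol_carrier path_in_compose[of "{0..1}"]) auto
  have C1: "C x = \<one>\<^bsub>Q\<^esub>" if "1 / 2 \<le> x" for x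
  proof -
    have "c \<circ> linepath (min 1 (2 * x)) 1 = (\<lambda>_. f (0, 0))" using that c1 by (auto simp: min_def linepath_def algebra_simps)
    then show ?thesis unfolding C_def using f0 by simp
  qed
  have C0: "C 0 = hol c"
  proof -
    have "c \<circ> linepath (min 1 (2 * 0)) 1 = c" by (auto simp: linepath_def)
    then show ?thesis unfolding C_def by simp
  qed
  have gc: "hol (?g \<circ> tree_arc k) \<in> carrier Q" if "k \<ge> 1" for k by (rule arc_carrier[OF g that])
  have key: "R (tree_lo k) = R (tree_hi k) \<and> hol (?g \<circ> tree_arc k) \<otimes>\<^bsub>Q\<^esub> C (tree_hi k) = C (tree_lo k) \<or>
    (\<exists>k'\<ge>1. tree_lo k' = R (tree_lo k) \<and> tree_hi k' = R (tree_hi k) \<and>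
      hol (?g \<circ> tree_arc k) \<otimes>\<^bsub>Q\<^esub> C (tree_hi k) = C (tree_lo k) \<otimes>\<^bsub>Q\<^esub> hol (f \<circ> tree_arc k'))" if k: "k \<ge> 1" for k
  proof -
    obtain d r where dr: "r < 2 ^ d" "k = 2 ^ d + r" using tree_index_cases[OF k] .
    have pg: "path_in (?g \<circ> tree_arc k)" by (rule dyadic_map_arc[OF g k])
    show ?thesis
    proof (cases d)
      case 0
      then have k1: "k = 1" using dr by simp
      have "hol (?g \<circ> tree_arc 1) = hol (c +++ (f \<circ> tree_arc 1))"
        using splice_path_top pg unfolding k1 by (intro hol_cong) auto
      also have "\<dots> = hol c \<otimes>\<^bsub>Q\<^esub> hol (f \<circ> tree_arc 1)"
        using c dyadic_map_arc[OF f, of 1] by (intro hol_join) (auto simp: pathstart_compose)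
      finally have "hol (?g \<circ> tree_arc k) \<otimes>\<^bsub>Q\<^esub> C (tree_hi k) = C (tree_lo k) \<otimes>\<^bsub>Q\<^esub> hol (f \<circ> tree_arc 1)"
        using C1[of 1] C0 gc[OF k] c f by (simp add: k1)
      then show ?thesis unfolding k1 by (intro disjI2 exI[of _ 1]) (simp add: R_def)
    next
      case (Suc e)
      show ?thesis
      proof (cases "r < 2 ^ e")
        case True
        have lh: "tree_lo k = real r / 2 ^ Suc e" "tree_hi k = (real r + 1) / 2 ^ Suc e"
          using tree_level(2)[OF dr(1)] tree_hi_level[OF dr(1)] by (auto simp: dr(2) Suc add.commute)
        have b: "0 \<le> 2 * tree_lo k" "2 * tree_lo k \<le> 1" "0 \<le> 2 * tree_hi k" "2 * tree_hi k \<le> 1"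
          using real_less_power2[OF True] True[THEN less_imp_le] unfolding lh by (auto simp: field_simps)
        have "hol (?g \<circ> tree_arc k) = hol (c \<circ> linepath (2 * tree_lo k) (2 * tree_hi k))"
          using pg splice_path_left[OF True _ dr(2)[unfolded Suc]] by (intro hol_cong) auto
        then have "hol (?g \<circ> tree_arc k) \<otimes>\<^bsub>Q\<^esub> C (tree_hi k) = C (tree_lo k)"
          unfolding C_def using hol_segments[OF c', of "2 * tree_lo k" "2 * tree_hi k" 1] b by (simp add: min_def)
        moreover have "R (tree_lo k) = R (tree_hi k)" using b by (simp add: R_def)
        ultimately show ?thesis by blast
      next
        case False
        define r' where "r' = r - 2 ^ e"
        have r': "r = 2 ^ e + r'" "r' < 2 ^ e" using False dr(1) by (auto simp: r'_def Suc)
        let ?k = "2 ^ e + r'"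
        have kk: "k = 2 ^ Suc e + (2 ^ e + r')" using dr(2) r' Suc by simp
        have rr: "2 ^ e + r' < 2 ^ Suc e" using r' by simp
        have lh: "tree_lo k = (2 ^ e + real r') / 2 ^ Suc e" "tree_hi k = (2 ^ e + real r' + 1) / 2 ^ Suc e"
          using tree_level(2)[OF rr] tree_hi_level[OF rr] unfolding kk by (auto simp: add_ac)
        have lh': "tree_lo ?k = real r' / 2 ^ e" "tree_hi ?k = (real r' + 1) / 2 ^ e"
          using tree_level(2)[OF r'(2)] tree_hi_level[OF r'(2)] by (auto simp: add_ac)
        have b: "1 / 2 \<le> tree_lo k" "1 / 2 \<le> tree_hi k" unfolding lh by (auto simp: field_simps)
        have "2 * tree_lo k - 1 = tree_lo ?k" "2 * tree_hi k - 1 = tree_hi ?k"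
          unfolding lh lh' by (auto simp: field_simps)
        then have RR: "tree_lo ?k = R (tree_lo k)" "tree_hi ?k = R (tree_hi k)" using b by (auto simp: R_def)
        have "hol (?g \<circ> tree_arc k) = hol (f \<circ> tree_arc ?k)"
          using pg splice_path_right_arc[OF r'(2), of _ c f] c1 unfolding kk by (intro hol_cong) auto
        then have "hol (?g \<circ> tree_arc k) \<otimes>\<^bsub>Q\<^esub> C (tree_hi k) = C (tree_lo k) \<otimes>\<^bsub>Q\<^esub> hol (f \<circ> tree_arc ?k)"
          using C1 b f index_ge_1[of e r'] by (simp del: One_nat_def)
        then show ?thesis using RR index_ge_1[of e r'] by blast
      qed
    qed
  qed
  obtain k where k: "k \<ge> 1" "p = tree_arc k \<or> p = reversepath (tree_arc k)" using p standard_path_iff by blast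
  have nn: "0 \<le> tree_lo k" "0 \<le> tree_hi k"
    using tree_index_cases[OF k(1)] tree_level tree_hi_level by (metis divide_nonneg_nonneg of_nat_0_le_iff zero_le_numeral zero_le_power)+
  have [simp]: "C (tree_lo k) \<in> carrier Q" "C (tree_hi k) \<in> carrier Q" "hol (?g \<circ> tree_arc k) \<in> carrier Q"
    using Cc nn gc[OF k(1)] by auto
  show ?thesis
  proof (cases "p = tree_arc k")
    case True
    show ?thesis using key[OF k(1)]
    proof (elim disjE exE conjE)
      fix k' assume k': "1 \<le> k'" "tree_lo k' = R (tree_lo k)" "tree_hi k' = R (tree_hi k)"
        "hol (?g \<circ> tree_arc k) \<otimes>\<^bsub>Q\<^esub> C (tree_hi k) = C (tree_lo k) \<otimes>\<^bsub>Q\<^esub> hol (f \<circ> tree_arc k')"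
      then show ?thesis unfolding u_def v_def True
        using standard_path_iff by (intro disjI2 exI[of _ "tree_arc k'"]) (simp, blast)
    qed (simp add: True u_def v_def)
  next
    case False
    then have p': "p = reversepath (tree_arc k)" using k(2) by blast
    have uv: "u = tree_hi k" "v = tree_lo k" by (auto simp: u_def v_def p')
    have hp: "hol (?g \<circ> p) = inv\<^bsub>Q\<^esub> (hol (?g \<circ> tree_arc k))"
      unfolding p' using k(1) by (intro hol_compose_reverse g path_image_tree_arc) auto
    show ?thesis using key[OF k(1)]
    proof (elim disjE exE conjE)
      assume a: "R (tree_lo k) = R (tree_hi k)" "hol (?g \<circ> tree_arc k) \<otimes>\<^bsub>Q\<^esub> C (tree_hi k) = C (tree_lo k)"
      have "hol (?g \<circ> p) \<otimes>\<^bsub>Q\<^esub> C v = C u" unfolding hp uv a(2)[symmetric] by (simp add: Q.inv_mult_cancel)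
      then show ?thesis using a(1) uv by simp
    next
      fix k' assume k': "1 \<le> k'" "tree_lo k' = R (tree_lo k)" "tree_hi k' = R (tree_hi k)"
        "hol (?g \<circ> tree_arc k) \<otimes>\<^bsub>Q\<^esub> C (tree_hi k) = C (tree_lo k) \<otimes>\<^bsub>Q\<^esub> hol (f \<circ> tree_arc k')"
      let ?p = "reversepath (tree_arc k')"
      have fc [simp]: "hol (f \<circ> tree_arc k') \<in> carrier Q" using f k'(1) by (rule arc_carrier)
      have "hol (?g \<circ> tree_arc k) = C (tree_lo k) \<otimes>\<^bsub>Q\<^esub> hol (f \<circ> tree_arc k') \<otimes>\<^bsub>Q\<^esub> inv\<^bsub>Q\<^esub> C (tree_hi k)"
        using k'(4) by (simp add: Q.inv_solve_right)
      then have "inv\<^bsub>Q\<^esub> (hol (?g \<circ> tree_arc k)) \<otimes>\<^bsub>Q\<^esub> C (tree_lo k) = C (tree_hi k) \<otimes>\<^bsub>Q\<^esub> inv\<^bsub>Q\<^esub> (hol (f \<circ> tree_arc k'))"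
        by (simp add: Q.inv_mult_group Q.m_assoc)
      then have "hol (?g \<circ> p) \<otimes>\<^bsub>Q\<^esub> C v = C u \<otimes>\<^bsub>Q\<^esub> hol (f \<circ> ?p)"
        unfolding hp uv using hol_compose_reverse[OF f path_tree_arc path_image_tree_arc[OF k'(1)]] by simp
      then show ?thesis using k' standard_path_iff uv by (intro disjI2 exI[of _ ?p]) (simp, blast)
    qed
  qed
qed

text \<open>
  The constant path is a separate alternative because all factors may collapse, while a standard
  concatenation is never empty.
\<close>

lemma splice_standard_concat:
  assumes f: "dyadic_map f" and c: "path_in c" "pathfinish c = f (0, 0)"
    and q: "standard_concat q" "pathfinish q = (0, 0)"
  shows "\<exists>q'. (q' = (\<lambda>_. (0, 0)) \<or> standard_concat q') \<and> pathstart q' = (max 0 (2 * fst (pathstart q) - 1), 0) \<and>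
    pathfinish q' = (0, 0) \<and>
    hol (splice_path c f \<circ> q) \<otimes>\<^bsub>Q\<^esub> hol c = hol (c \<circ> linepath (min 1 (2 * fst (pathstart q))) 1) \<otimes>\<^bsub>Q\<^esub> hol (f \<circ> q')"
  using q
proof induction
  let ?g = "splice_path c f"
  let ?C = "\<lambda>x. hol (c \<circ> linepath (min 1 (2 * x)) 1)"
  have g: "dyadic_map ?g" using continuous_splice_path[of f c] splice_path_in[of f X c] f c by auto
  have c': "continuous_on {0..1} c" "c ` {0..1} \<subseteq> X" using c by (auto simp: path_def path_image_def)
  have f0: "f (0, 0) \<in> X" using f dyadic_base_in by auto
  have Cc: "?C x \<in> carrier Q" if "0 \<le> x" for x
    using that c' segment_real[of "{0..1}" "min 1 (2 * x)" 1]
    by (intro hol_carrier path_in_compose[of "{0..1}"]) auto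
  have C0: "?C 0 = hol c"
  proof -
    have "c \<circ> linepath (min 1 (2 * 0)) 1 = c" by (auto simp: linepath_def)
    then show ?thesis by simp
  qed
  {
    case (single p)
    let ?u = "fst (pathstart p)"
    have "0 \<le> ?u" using standard_path_props[OF single(1)] pathstart_in_path_image[of p] by (cases "pathstart p") (auto simp: dyadic_space_iff subset_iff)
    note Cu = Cc[OF this]
    have fv: "fst (pathfinish p) = 0" using single by simp
    show ?case using splice_standard_path[OF f c single(1)] unfolding fv C0
    proof (elim disjE exE conjE)
      assume "max 0 (2 * ?u - 1) = max 0 (2 * 0 - 1)" "hol (?g \<circ> p) \<otimes>\<^bsub>Q\<^esub> hol c = ?C ?u"
      then show ?case using f0 Cu by (intro exI[of _ "\<lambda>_. (0, 0)"]) (simp add: comp_def)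
    next
      fix p' assume p': "standard_path p'" "pathstart p' = (max 0 (2 * ?u - 1), 0)"
        "pathfinish p' = (max 0 (2 * 0 - 1), 0)" "hol (?g \<circ> p) \<otimes>\<^bsub>Q\<^esub> hol c = ?C ?u \<otimes>\<^bsub>Q\<^esub> hol (f \<circ> p')"
      then have "pathfinish p' = (0, 0)" by simp
      then show ?case using standard_concat.single[OF p'(1)] p'(2,4) by blast
    qed
  next
    case (join p q)
    let ?u = "fst (pathstart p)" and ?v = "fst (pathstart q)"
    have u0: "0 \<le> ?u" using standard_path_props[OF join(1)] pathstart_in_path_image[of p] by (cases "pathstart p") (auto simp: dyadic_space_iff subset_iff)
    have v0: "0 \<le> ?v" using standard_concat_props[OF join(2)] pathstart_in_path_image[of q] by (cases "pathstart q") (auto simp: dyadic_space_iff subset_iff)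
    have fq: "pathfinish q = (0, 0)" using join.prems by simp
    obtain q' where q': "q' = (\<lambda>_. (0, 0)) \<or> standard_concat q'" "pathstart q' = (max 0 (2 * ?v - 1), 0)" "pathfinish q' = (0, 0)"
      "hol (?g \<circ> q) \<otimes>\<^bsub>Q\<^esub> hol c = ?C ?v \<otimes>\<^bsub>Q\<^esub> hol (f \<circ> q')"
      using join.IH[OF fq] by blast
    have q'p: "path q'" "path_image q' \<subseteq> dyadic_space"
      using q'(1) standard_concat_props dyadic_base_in by auto
    have gp: "hol (?g \<circ> p) \<in> carrier Q" "hol (?g \<circ> q) \<in> carrier Q" "hol (f \<circ> q') \<in> carrier Q"
      using standard_path_props[OF join(1)] standard_concat_props[OF join(2)] q'p g f
      by (auto intro: hol_compose_carrier)
    note [simp] = gp Cc[OF u0] Cc[OF v0] hol_carrier[OF c(1)]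
    have "hol (?g \<circ> (p +++ q)) = hol (?g \<circ> p) \<otimes>\<^bsub>Q\<^esub> hol (?g \<circ> q)"
      using standard_path_props[OF join(1)] standard_concat_props[OF join(2)] join(3) by (intro hol_compose_join g) auto
    then have 1: "hol (?g \<circ> (p +++ q)) \<otimes>\<^bsub>Q\<^esub> hol c = (hol (?g \<circ> p) \<otimes>\<^bsub>Q\<^esub> ?C ?v) \<otimes>\<^bsub>Q\<^esub> hol (f \<circ> q')"
      using q'(4) by (simp add: Q.m_assoc)
    show ?case using splice_standard_path[OF f c join(1)] unfolding join(3)
    proof (elim disjE exE conjE)
      assume a: "max 0 (2 * ?u - 1) = max 0 (2 * ?v - 1)" "hol (?g \<circ> p) \<otimes>\<^bsub>Q\<^esub> ?C ?v = ?C ?u"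
      show ?case using q' 1 unfolding a pathstart_join by blast
    next
      fix p' assume p': "standard_path p'" "pathstart p' = (max 0 (2 * ?u - 1), 0)"
        "pathfinish p' = (max 0 (2 * ?v - 1), 0)" "hol (?g \<circ> p) \<otimes>\<^bsub>Q\<^esub> ?C ?v = ?C ?u \<otimes>\<^bsub>Q\<^esub> hol (f \<circ> p')"
      note pp = standard_path_props[OF p'(1)]
      have [simp]: "hol (f \<circ> p') \<in> carrier Q" using pp f by (intro hol_carrier dyadic_map_path) auto
      have 2: "hol (?g \<circ> (p +++ q)) \<otimes>\<^bsub>Q\<^esub> hol c = ?C ?u \<otimes>\<^bsub>Q\<^esub> (hol (f \<circ> p') \<otimes>\<^bsub>Q\<^esub> hol (f \<circ> q'))"
        unfolding 1 p'(4) by (simp add: Q.m_assoc)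
      show ?case
      proof (cases "standard_concat q'")
        case True
        have "hol (f \<circ> (p' +++ q')) = hol (f \<circ> p') \<otimes>\<^bsub>Q\<^esub> hol (f \<circ> q')"
          using pp q'p p'(3) q'(2) by (intro hol_compose_join f) auto
        then have h: "hol (?g \<circ> (p +++ q)) \<otimes>\<^bsub>Q\<^esub> hol c = ?C ?u \<otimes>\<^bsub>Q\<^esub> hol (f \<circ> (p' +++ q'))" using 2 by (simp only:)
        have sc: "standard_concat (p' +++ q')" using standard_concat.join[OF p'(1) True] p'(3) q'(2) by simp
        have e: "pathstart (p' +++ q') = (max 0 (2 * ?u - 1), 0)" "pathfinish (p' +++ q') = (0, 0)" using p'(2) q'(3) by auto
        show ?thesis unfolding pathstart_join
          by (rule exI[of _ "p' +++ q'"], intro conjI disjI2) (fact sc, fact e(1), fact e(2), fact h)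
      next
        case False
        then have q'0: "q' = (\<lambda>_. (0, 0))" using q' by blast
        have "hol (f \<circ> q') = \<one>\<^bsub>Q\<^esub>" unfolding q'0 using f0 by (simp add: comp_def)
        then have h: "hol (?g \<circ> (p +++ q)) \<otimes>\<^bsub>Q\<^esub> hol c = ?C ?u \<otimes>\<^bsub>Q\<^esub> hol (f \<circ> p')"
          using 2 by simp
        have e: "pathfinish p' = (0, 0)" using p'(3) q'(2) q'0 by simp
        show ?thesis unfolding pathstart_join
          by (rule exI[of _ p'], intro conjI disjI2)
            (rule standard_concat.single[OF p'(1)], fact p'(2), fact e, fact h)
      qed
    qed
  }
qed

lemma splice_standard_loop:
  assumes f: "dyadic_map f" and c: "path_in c" "pathfinish c = f (0, 0)"
    and q: "standard_concat q" "pathstart q = (0, 0)" "pathfinish q = (0, 0)"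
  obtains q' where "q' = (\<lambda>_. (0, 0)) \<or> standard_concat q'" "pathstart q' = (0, 0)" "pathfinish q' = (0, 0)"
    "hol (splice_path c f \<circ> q) = hol c \<otimes>\<^bsub>Q\<^esub> hol (f \<circ> q') \<otimes>\<^bsub>Q\<^esub> inv\<^bsub>Q\<^esub> hol c"
proof -
  have "c \<circ> linepath (min 1 (2 * 0)) 1 = c" by (auto simp: linepath_def)
  then obtain q' where q': "q' = (\<lambda>_. (0, 0)) \<or> standard_concat q'" "pathstart q' = (0, 0)" "pathfinish q' = (0, 0)"
    "hol (splice_path c f \<circ> q) \<otimes>\<^bsub>Q\<^esub> hol c = hol c \<otimes>\<^bsub>Q\<^esub> hol (f \<circ> q')"
    using splice_standard_concat[OF f c q(1,3)] q(2) by auto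
  have g: "dyadic_map (splice_path c f)" using continuous_splice_path[of f c] splice_path_in[of f X c] f c by auto
  have "path q'" "path_image q' \<subseteq> dyadic_space"
    using q'(1) standard_concat_props dyadic_base_in by auto
  then have "hol (splice_path c f \<circ> q) \<in> carrier Q" "hol (f \<circ> q') \<in> carrier Q"
    using standard_concat_props[OF q(1)] f g by (auto intro: hol_compose_carrier)
  then have "hol (splice_path c f \<circ> q) = hol c \<otimes>\<^bsub>Q\<^esub> hol (f \<circ> q') \<otimes>\<^bsub>Q\<^esub> inv\<^bsub>Q\<^esub> hol c"
    using q'(4) hol_carrier[OF c(1)] by (simp add: Q.inv_solve_right)
  then show ?thesis using q' by (intro that[of q'])
qed

end

section \<open>The Hawaiian earring\<close>

lemma hawaiian_loop_alt:
  "hawaiian_loop n t = ((1 - cos (2 * pi * t)) / real n, - sin (2 * pi * t) / real n)"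
  by (simp add: hawaiian_loop_def diff_divide_distrib)

lemma hawaiian_loop_circle:
  "n * ((fst (hawaiian_loop n t))\<^sup>2 + (snd (hawaiian_loop n t))\<^sup>2) = 2 * fst (hawaiian_loop n t)"
proof (cases "n = 0")
  case False
  define c where "c = cos (2 * pi * t)"
  define s where "s = sin (2 * pi * t)"
  have "c\<^sup>2 + s\<^sup>2 = 1" by (simp add: c_def s_def)
  then have cs: "s\<^sup>2 = 1 - c\<^sup>2" by simp
  have "((1 - c) / n)\<^sup>2 + (- s / n)\<^sup>2 = ((1 - c)\<^sup>2 + s\<^sup>2) / n\<^sup>2" by (simp add: power_divide add_divide_distrib)
  also have "(1 - c)\<^sup>2 + s\<^sup>2 = 2 * (1 - c)" unfolding cs by (simp add: power2_eq_square algebra_simps)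
  finally show ?thesis using False
    unfolding hawaiian_loop_alt fst_conv snd_conv c_def[symmetric] s_def[symmetric]
    by (simp add: power2_eq_square)
qed (simp add: hawaiian_loop_alt)

lemma hawaiian_circle_iff:
  assumes "n \<ge> 1"
  shows "(x, y) \<in> hawaiian_circle n \<longleftrightarrow> n * (x\<^sup>2 + y\<^sup>2) = 2 * x"
proof -
  have "(x, y) \<in> hawaiian_circle n \<longleftrightarrow> (x - 1 / n)\<^sup>2 + y\<^sup>2 = (1 / n)\<^sup>2" by (simp add: hawaiian_circle_def)
  also have "\<dots> \<longleftrightarrow> x\<^sup>2 + y\<^sup>2 = 2 * x / n" by (auto simp: power2_diff)
  also have "\<dots> \<longleftrightarrow> n * (x\<^sup>2 + y\<^sup>2) = 2 * x" using assms by (auto simp: field_simps)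
  finally show ?thesis .
qed

lemma path_image_hawaiian_loop:
  assumes "n \<ge> 1"
  shows "path_image (hawaiian_loop n) = hawaiian_circle n"
proof
  show "path_image (hawaiian_loop n) \<subseteq> hawaiian_circle n"
    using hawaiian_loop_circle[of n] hawaiian_circle_iff[OF assms] unfolding path_image_def by (metis image_subsetI prod.collapse)
  show "hawaiian_circle n \<subseteq> path_image (hawaiian_loop n)"
  proof
    fix z assume "z \<in> hawaiian_circle n"
    then obtain x y where z: "z = (x, y)" "(x - 1 / n)\<^sup>2 + y\<^sup>2 = (1 / n)\<^sup>2"
      by (auto simp: hawaiian_circle_def)
    have "(1 - n * x)\<^sup>2 + (- n * y)\<^sup>2 = n\<^sup>2 * ((x - 1 / n)\<^sup>2 + y\<^sup>2)"
      using assms by (simp add: power2_eq_square field_simps)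
    also have "\<dots> = 1" unfolding z(2) using assms by (simp add: power_divide)
    finally obtain s where s: "0 \<le> s" "s < 2 * pi" "1 - n * x = cos s" "- n * y = sin s"
      by (rule sincos_total_2pi)
    define t where "t = s / (2 * pi)"
    have t: "2 * pi * t = s" "t \<in> {0..1}" using s by (auto simp: t_def field_simps)
    have "hawaiian_loop n t = z"
      unfolding hawaiian_loop_alt t(1) s(3,4)[symmetric] z(1) using assms by simp
    then show "z \<in> path_image (hawaiian_loop n)" using t(2) by (auto simp: path_image_def)
  qed
qed

lemma path_hawaiian_loop [simp]: "path (hawaiian_loop n)"
  unfolding path_def hawaiian_loop_alt[abs_def] by (cases "n = 0") (auto intro!: continuous_intros)

lemma hawaiian_loop_ends [simp]: "hawaiian_loop n 0 = (0, 0)" "hawaiian_loop n 1 = (0, 0)"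
  "pathstart (hawaiian_loop n) = (0, 0)" "pathfinish (hawaiian_loop n) = (0, 0)"
  by (auto simp: hawaiian_loop_alt pathstart_def pathfinish_def)

lemma hawaiian_loop_in: "n \<ge> 1 \<Longrightarrow> t \<in> {0..1} \<Longrightarrow> hawaiian_loop n t \<in> hawaiian_earring"
  using path_image_hawaiian_loop[of n] by (auto simp: hawaiian_earring_def path_image_def)

lemma hawaiian_loop_image_subset: "n \<ge> 1 \<Longrightarrow> path_image (hawaiian_loop n) \<subseteq> hawaiian_earring"
  using hawaiian_loop_in by (auto simp: path_image_def)

lemma hawaiian_earring_cases:
  assumes "z \<in> hawaiian_earring"
  obtains n t where "n \<ge> 1" "t \<in> {0..1}" "z = hawaiian_loop n t"
proof -
  obtain n where n: "n \<ge> 1" "z \<in> hawaiian_circle n" using assms by (auto simp: hawaiian_earring_def)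
  then have "z \<in> path_image (hawaiian_loop n)" using path_image_hawaiian_loop by blast
  then show ?thesis using n(1) that by (auto simp: path_image_def)
qed

lemma hawaiian_origin_in: "(0, 0) \<in> hawaiian_earring"
  using hawaiian_loop_in[of 1 0] by simp

lemma hawaiian_loop_eq_origin:
  assumes "n \<ge> 1" "t \<in> {0..1}" "hawaiian_loop n t = (0, 0)"
  shows "t = 0 \<or> t = 1"
proof -
  have "cos (2 * pi * t) = 1" using assms by (simp add: hawaiian_loop_alt)
  then obtain m :: int where "2 * pi * t = m * 2 * pi" using cos_one_2pi_int by auto
  then have "t = m" by simp
  moreover have "0 \<le> m" "m \<le> 1" using assms(2) calculation by auto
  ultimately show ?thesis by (metis int_one_le_iff_zero_less of_int_0 of_int_1 order.antisym order.not_eq_order_implies_strict)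
qed

lemma hawaiian_loop_inj:
  assumes "n \<ge> 1" "m \<ge> 1" "t \<in> {0..1}" "s \<in> {0..1}" "hawaiian_loop n t = hawaiian_loop m s" "hawaiian_loop n t \<noteq> (0, 0)"
  shows "n = m" "t = s"
proof -
  obtain x y where xy: "hawaiian_loop n t = (x, y)" by (cases "hawaiian_loop n t")
  have "real n * (x\<^sup>2 + y\<^sup>2) = real m * (x\<^sup>2 + y\<^sup>2)"
    using hawaiian_loop_circle[of n t] hawaiian_loop_circle[of m s] unfolding assms(5)[symmetric] xy by simp
  moreover have "x\<^sup>2 + y\<^sup>2 \<noteq> 0" using assms(6) xy by simp
  ultimately show nm: "n = m" by auto
  have c: "cos (2 * pi * t) = cos (2 * pi * s)" "sin (2 * pi * t) = sin (2 * pi * s)"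
    using assms(1,5) unfolding nm hawaiian_loop_alt by auto
  then obtain k :: int where "2 * pi * t = 2 * pi * s + 2 * pi * k" using sin_cos_eq_iff by blast
  then have "2 * pi * t = 2 * pi * (s + k)" by (simp add: algebra_simps)
  then have k: "t = s + k" by (simp only: mult_cancel_left) simp
  have ne: "t \<noteq> 0" "t \<noteq> 1" "s \<noteq> 0" "s \<noteq> 1" using assms(5,6) by auto
  then have "\<bar>real_of_int k\<bar> < 1" using k assms(3,4) by auto
  then show "t = s" using k by simp
qed

text \<open>
  The definite description in \<open>hawaiian_map\<close> denotes: away from the origin \<open>n\<close> and \<open>t\<close> are determined
  by the point, and at the origin all candidates for the value agree.
\<close>

lemma hawaiian_map_loop:
  assumes "n \<ge> 1" "t \<in> {0..1}"
  shows "hawaiian_map \<phi> (hawaiian_loop n t) = hawaiian_loop (\<phi> n) t"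
  unfolding hawaiian_map_def
proof (rule the_equality)
  show "\<exists>m\<ge>1. \<exists>s\<in>{0..1}. hawaiian_loop n t = hawaiian_loop m s \<and> hawaiian_loop (\<phi> n) t = hawaiian_loop (\<phi> m) s"
    using assms by blast
  fix w assume "\<exists>m\<ge>1. \<exists>s\<in>{0..1}. hawaiian_loop n t = hawaiian_loop m s \<and> w = hawaiian_loop (\<phi> m) s"
  then obtain m s where ms: "m \<ge> 1" "s \<in> {0..1}" "hawaiian_loop n t = hawaiian_loop m s" "w = hawaiian_loop (\<phi> m) s" by blast
  show "w = hawaiian_loop (\<phi> n) t"
  proof (cases "hawaiian_loop n t = (0, 0)")
    case True
    then have "t = 0 \<or> t = 1" "s = 0 \<or> s = 1" using assms ms hawaiian_loop_eq_origin by metis+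
    then show ?thesis using ms(4) by auto
  next
    case False
    then show ?thesis using hawaiian_loop_inj[OF assms(1) ms(1) assms(2) ms(2,3)] ms(4) by blast
  qed
qed

lemma norm_hawaiian_loop: "norm (hawaiian_loop n t) \<le> 4 / real n"
proof (cases "n = 0")
  case False
  have c: "cos (2 * pi * t) \<ge> - 1" "cos (2 * pi * t) \<le> 1" "\<bar>sin (2 * pi * t)\<bar> \<le> 1"
    using abs_sin_le_one by auto
  have "norm (hawaiian_loop n t) \<le> \<bar>1 - cos (2 * pi * t)\<bar> / n + \<bar>sin (2 * pi * t)\<bar> / n"
    unfolding hawaiian_loop_alt norm_Pair by (rule order_trans[OF sqrt_sum_squares_le_sum_abs]) simp
  also have "\<dots> = (\<bar>1 - cos (2 * pi * t)\<bar> + \<bar>sin (2 * pi * t)\<bar>) / n" by (simp add: add_divide_distrib)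
  also have "\<dots> \<le> 4 / n"
  proof (intro divide_right_mono)
    show "\<bar>1 - cos (2 * pi * t)\<bar> + \<bar>sin (2 * pi * t)\<bar> \<le> 4" using c by linarith
  qed simp
  finally show ?thesis .
qed (simp add: hawaiian_loop_alt zero_prod_def[symmetric])

text \<open>
  These are the sequences of loops that define a map on the earring, circle by circle.
\<close>

definition null_loops :: "'a::topological_space \<Rightarrow> 'a set \<Rightarrow> (nat \<Rightarrow> real \<Rightarrow> 'a) \<Rightarrow> bool" where
  "null_loops w X a \<longleftrightarrow> (\<forall>n\<ge>1. a n \<in> loops_at X w) \<and>
     (\<forall>V. open V \<longrightarrow> w \<in> V \<longrightarrow> (\<exists>n0. \<forall>n\<ge>n0. path_image (a n) \<subseteq> V))"

lemma hawaiian_extension: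
  fixes X :: "'a::topological_space set"
  assumes "null_loops w X a"
  obtains g where "continuous_on hawaiian_earring g" "g \<in> hawaiian_earring \<rightarrow> X"
    "\<And>n t. n \<ge> 1 \<Longrightarrow> t \<in> {0..1} \<Longrightarrow> g (hawaiian_loop n t) = a n t"
proof -
  have a: "path (a n)" "path_image (a n) \<subseteq> X" "a n 0 = w" "a n 1 = w" if "n \<ge> 1" for n
    using assms that unfolding null_loops_def loops_at_def by (auto simp: pathstart_def pathfinish_def)
  have null: "\<exists>n0. \<forall>n\<ge>n0. path_image (a n) \<subseteq> V" if "open V" "w \<in> V" for V
    using assms that unfolding null_loops_def by blast
  define g where "g z = (THE v. \<exists>n\<ge>1. \<exists>t\<in>{0..1}. z = hawaiian_loop n t \<and> v = a n t)" for z
  have g: "g (hawaiian_loop n t) = a n t" if nt: "n \<ge> 1" "t \<in> {0..1}" for n t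
    unfolding g_def
  proof (rule the_equality)
    show "\<exists>m\<ge>1. \<exists>s\<in>{0..1}. hawaiian_loop n t = hawaiian_loop m s \<and> a n t = a m s" using nt by blast
    fix v assume "\<exists>m\<ge>1. \<exists>s\<in>{0..1}. hawaiian_loop n t = hawaiian_loop m s \<and> v = a m s"
    then obtain m s where ms: "m \<ge> 1" "s \<in> {0..1}" "hawaiian_loop n t = hawaiian_loop m s" "v = a m s" by blast
    show "v = a n t"
    proof (cases "hawaiian_loop n t = (0, 0)")
      case True
      then have "t = 0 \<or> t = 1" "s = 0 \<or> s = 1" using nt ms hawaiian_loop_eq_origin by metis+
      then show ?thesis using ms(4) a[OF nt(1)] a[OF ms(1)] by auto
    next
      case False
      then show ?thesis using hawaiian_loop_inj[OF nt(1) ms(1) nt(2) ms(2,3)] ms(4) by blast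
    qed
  qed
  \<comment> \<open>On circle \<open>m\<close> the ratio of \<open>2 * x\<close> and \<open>x\<^sup>2 + y\<^sup>2\<close> is \<open>m\<close>. Within the earring, \<open>U n\<close> is
    therefore circle \<open>n\<close> without the origin.\<close>
  define U :: "nat \<Rightarrow> (real \<times> real) set" where
    "U n = {z. (n - 1/2) * ((fst z)\<^sup>2 + (snd z)\<^sup>2) < 2 * fst z} \<inter> {z. 2 * fst z < (n + 1/2) * ((fst z)\<^sup>2 + (snd z)\<^sup>2)}" for n
  have openU: "open (U n)" for n
    unfolding U_def by (intro open_Int open_Collect_less continuous_intros)
  have U_iff: "hawaiian_loop m t \<in> U n \<longleftrightarrow> n = m \<and> hawaiian_loop m t \<noteq> (0, 0)" if "m \<ge> 1" for n m t
  proof -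
    obtain x y where xy: "hawaiian_loop m t = (x, y)" by (cases "hawaiian_loop m t")
    have e: "2 * x = m * (x\<^sup>2 + y\<^sup>2)" using hawaiian_loop_circle[of m t] xy by simp
    have "hawaiian_loop m t \<in> U n \<longleftrightarrow> (n - 1/2) * (x\<^sup>2 + y\<^sup>2) < m * (x\<^sup>2 + y\<^sup>2) \<and> m * (x\<^sup>2 + y\<^sup>2) < (n + 1/2) * (x\<^sup>2 + y\<^sup>2)"
      unfolding U_def xy by (simp add: e)
    also have "\<dots> \<longleftrightarrow> x\<^sup>2 + y\<^sup>2 > 0 \<and> real n - 1/2 < m \<and> m < real n + 1/2"
    proof (cases "x\<^sup>2 + y\<^sup>2 = 0")
      case False
      then have "x\<^sup>2 + y\<^sup>2 > 0" by (metis sum_power2_ge_zero order_le_less)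
      then show ?thesis by (simp only: mult_less_cancel_right_pos) simp
    qed simp
    also have "\<dots> \<longleftrightarrow> n = m \<and> (x, y) \<noteq> (0, 0)"
      using sum_power2_gt_zero_iff[of x y] by auto
    finally show ?thesis by (simp add: xy)
  qed
  \<comment> \<open>The part of circle \<open>n\<close> that is not mapped into \<open>B\<close> is compact.\<close>
  define K where "K B n = hawaiian_loop n ` {t \<in> {0..1}. a n t \<notin> B}" for B n
  have K: "closed (K B n)" if "open B" "n \<ge> 1" for B n
  proof -
    have "closedin (top_of_set {0..1}) ({0..1} \<inter> a n -` (- B))"
      using a(1)[OF that(2)] that(1) unfolding path_def by (intro continuous_closedin_preimage) auto
    then have "closed ({0..1} \<inter> a n -` (- B))" by (rule closedin_closed_trans) simp
    then have "compact ({0..1} \<inter> a n -` (- B))"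
      using compact_Int_closed[of "{0..1::real}" "{0..1} \<inter> a n -` (- B)"] by (simp add: Int_absorb1)
    moreover have "{0..1} \<inter> a n -` (- B) = {t \<in> {0..1}. a n t \<notin> B}" by auto
    ultimately have "compact {t \<in> {0..1}. a n t \<notin> B}" by simp
    moreover have "continuous_on {t \<in> {0..1}. a n t \<notin> B} (hawaiian_loop n)"
      using path_hawaiian_loop[of n] unfolding path_def by (rule continuous_on_subset) auto
    ultimately have "compact (K B n)" unfolding K_def by (metis compact_continuous_image)
    then show ?thesis by (rule compact_imp_closed)
  qed
  have "continuous_on hawaiian_earring g"
    unfolding continuous_on_open_invariant
  proof (intro allI impI)
    fix B :: "'a set" assume B: "open B"
    show "\<exists>A. open A \<and> A \<inter> hawaiian_earring = g -` B \<inter> hawaiian_earring"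
    proof (cases "w \<in> B")
      case True
      obtain n0 where n0: "\<forall>n\<ge>n0. path_image (a n) \<subseteq> B" using null[OF B True] by blast
      let ?A = "- (\<Union>n\<in>{1..<n0}. K B n)"
      have "open ?A" using K[OF B] by (intro open_Compl closed_UN) auto
      moreover have "?A \<inter> hawaiian_earring = g -` B \<inter> hawaiian_earring"
      proof (intro equalityI subsetI; elim IntE; intro IntI vimageI2)
        fix z assume z: "z \<in> ?A" "z \<in> hawaiian_earring"
        obtain n t where nt: "n \<ge> 1" "t \<in> {0..1}" "z = hawaiian_loop n t" using hawaiian_earring_cases[OF z(2)] .
        show "g z \<in> B"
        proof (cases "n < n0")
          case True
          then have "z \<notin> K B n" using z(1) nt(1) by auto
          then show ?thesis using nt g unfolding K_def by auto
        next
          case False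
          then have "a n ` {0..1} \<subseteq> B" using n0 by (simp add: path_image_def)
          then show ?thesis using nt g by auto
        qed
      next
        fix z assume z: "z \<in> g -` B" "z \<in> hawaiian_earring"
        show "z \<in> ?A"
        proof (rule ccontr)
          assume "z \<notin> ?A"
          then obtain n t where "n \<ge> 1" "t \<in> {0..1}" "a n t \<notin> B" "z = hawaiian_loop n t" by (auto simp: K_def)
          then show False using z(1) g by auto
        qed
      qed auto
      ultimately show ?thesis by blast
    next
      case False
      let ?A = "\<Union>n\<in>{1..}. U n \<inter> - K B n"
      have "open ?A" using K[OF B] openU by (intro open_UN ballI open_Int open_Compl) auto
      moreover have "?A \<inter> hawaiian_earring = g -` B \<inter> hawaiian_earring"
      proof (intro equalityI subsetI; elim IntE; intro IntI vimageI2)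
        fix z assume z: "z \<in> ?A" "z \<in> hawaiian_earring"
        obtain n t where nt: "n \<ge> 1" "t \<in> {0..1}" "z = hawaiian_loop n t" using hawaiian_earring_cases[OF z(2)] .
        then have "z \<notin> K B n" using z(1) U_iff by auto
        then show "g z \<in> B" using nt g unfolding K_def by auto
      next
        fix z assume z: "z \<in> g -` B" "z \<in> hawaiian_earring"
        obtain n t where nt: "n \<ge> 1" "t \<in> {0..1}" "z = hawaiian_loop n t" using hawaiian_earring_cases[OF z(2)] .
        have gz: "a n t \<in> B" using z nt g by auto
        then have "z \<noteq> (0, 0)" using hawaiian_loop_eq_origin[OF nt(1,2)] a[OF nt(1)] False nt(3) by auto
        moreover have "z \<notin> K B n"
        proof
          assume "z \<in> K B n"
          then obtain s where "s \<in> {0..1}" "a n s \<notin> B" "z = hawaiian_loop n s" by (auto simp: K_def)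
          then show False using gz nt g by metis
        qed
        ultimately show "z \<in> ?A" using U_iff[OF nt(1)] nt(1,3) by auto
      qed auto
      ultimately show ?thesis by blast
    qed
  qed
  moreover have "g \<in> hawaiian_earring \<rightarrow> X"
  proof
    fix z assume "z \<in> hawaiian_earring"
    then obtain n t where nt: "n \<ge> 1" "t \<in> {0..1}" "z = hawaiian_loop n t" using hawaiian_earring_cases by blast
    then show "g z \<in> X" using g a(2)[OF nt(1)] by (auto simp: path_image_def)
  qed
  ultimately show ?thesis using that g by blast
qed

lemma hawaiian_loop_small:
  assumes "open V" "(0, 0) \<in> V"
  obtains n0 where "\<And>n t. n \<ge> n0 \<Longrightarrow> hawaiian_loop n t \<in> V"
proof -
  obtain e where e: "e > 0" "ball (0, 0) e \<subseteq> V" using assms open_contains_ball by blast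
  obtain n0 :: nat where n0: "n0 > 4 / e" using reals_Archimedean2 by blast
  have "hawaiian_loop n t \<in> V" if n: "n \<ge> n0" for n t
  proof -
    have "real n > 4 / e" using n0 n by (meson less_le_trans of_nat_le_iff)
    moreover have "0 < 4 / e" using e(1) by simp
    ultimately have "real n > 0" "4 < n * e" using e(1) by (linarith, simp add: pos_divide_less_eq)
    then have "4 / n < e" by (simp add: pos_divide_less_eq mult.commute)
    then have "norm (hawaiian_loop n t) < e" using norm_hawaiian_loop[of n t] by simp
    then show ?thesis using e(2) by (auto simp: dist_norm norm_minus_commute zero_prod_def[symmetric])
  qed
  then show ?thesis using that by blast
qed

lemma null_loops_reindex:
  assumes "\<And>n. n \<ge> 1 \<Longrightarrow> \<phi> n \<ge> n"
  shows "null_loops (0, 0) hawaiian_earring (\<lambda>n. hawaiian_loop (\<phi> n))"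
  unfolding null_loops_def
proof (intro conjI allI impI)
  fix n :: nat assume "n \<ge> 1"
  then have "\<phi> n \<ge> 1" using assms[of n] by simp
  then show "hawaiian_loop (\<phi> n) \<in> loops_at hawaiian_earring (0, 0)"
    using hawaiian_loop_image_subset by (auto simp: loops_at_def)
next
  fix V :: "(real \<times> real) set" assume "open V" "(0, 0) \<in> V"
  then obtain n0 where n0: "\<And>n t. n \<ge> n0 \<Longrightarrow> hawaiian_loop n t \<in> V" using hawaiian_loop_small by blast
  have "path_image (hawaiian_loop (\<phi> n)) \<subseteq> V" if "n \<ge> max 1 n0" for n
    using n0[of "\<phi> n"] assms[of n] that by (auto simp: path_image_def)
  then show "\<exists>n0. \<forall>n\<ge>n0. path_image (hawaiian_loop (\<phi> n)) \<subseteq> V" by blast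
qed

lemma hawaiian_map_props:
  assumes "\<And>n. n \<ge> 1 \<Longrightarrow> \<phi> n \<ge> n"
  shows "continuous_on hawaiian_earring (hawaiian_map \<phi>)" "hawaiian_map \<phi> \<in> hawaiian_earring \<rightarrow> hawaiian_earring"
proof -
  obtain g where g: "continuous_on hawaiian_earring g" "g \<in> hawaiian_earring \<rightarrow> hawaiian_earring"
    "\<And>n t. n \<ge> 1 \<Longrightarrow> t \<in> {0..1} \<Longrightarrow> g (hawaiian_loop n t) = hawaiian_loop (\<phi> n) t"
    using hawaiian_extension[OF null_loops_reindex[OF assms]] by blast
  have eq: "g z = hawaiian_map \<phi> z" if "z \<in> hawaiian_earring" for z
    using hawaiian_earring_cases[OF that] g(3) hawaiian_map_loop by metis
  show "continuous_on hawaiian_earring (hawaiian_map \<phi>)" using g(1) eq by (rule continuous_on_eq)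
  show "hawaiian_map \<phi> \<in> hawaiian_earring \<rightarrow> hawaiian_earring" using g(2) eq by (metis (mono_tags, lifting) Pi_iff)
qed

lemma f_odd_props: "continuous_on hawaiian_earring f_odd" "f_odd \<in> hawaiian_earring \<rightarrow> hawaiian_earring"
    "\<And>n t. n \<ge> 1 \<Longrightarrow> t \<in> {0..1} \<Longrightarrow> f_odd (hawaiian_loop n t) = hawaiian_loop (2 * n - 1) t"
  and f_even_props: "continuous_on hawaiian_earring f_even" "f_even \<in> hawaiian_earring \<rightarrow> hawaiian_earring"
    "\<And>n t. n \<ge> 1 \<Longrightarrow> t \<in> {0..1} \<Longrightarrow> f_even (hawaiian_loop n t) = hawaiian_loop (2 * n) t"
  unfolding f_odd_def f_even_def using hawaiian_map_loop by (auto intro!: hawaiian_map_props)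

lemma f_odd_even_origin [simp]: "f_odd (0, 0) = (0, 0)" "f_even (0, 0) = (0, 0)"
  using f_odd_props(3)[of 1 0] f_even_props(3)[of 1 0] by auto

section \<open>The Cantor set and the loop along its gaps\<close>

text \<open>
  The nodes of level \<open>d\<close> index the intervals of stage \<open>d\<close> of the construction of the Cantor set, and the
  affine map \<open>in_block k\<close> takes the unit interval onto interval \<open>k\<close>. Its open middle third \<open>gap k\<close> is
  the gap on which the loop \<open>tau_loop\<close> runs through circle \<open>k\<close>.
\<close>

fun block_len :: "nat \<Rightarrow> real" where
  "block_len k = (if k \<le> 1 then 1 else block_len (k div 2) / 3)"

fun block_lo :: "nat \<Rightarrow> real" where
  "block_lo k = (if k \<le> 1 then 0 else block_lo (k div 2) + (if odd k then 2 * block_len k else 0))"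

declare block_len.simps [simp del] block_lo.simps [simp del]

definition in_block :: "nat \<Rightarrow> real \<Rightarrow> real" where
  "in_block k x = block_lo k + block_len k * x"

definition gap :: "nat \<Rightarrow> real set" where
  "gap k = {in_block k (1/3)<..<in_block k (2/3)}"

lemma block_child:
  assumes "k \<ge> 1"
  shows "block_len (2 * k) = block_len k / 3" "block_len (Suc (2 * k)) = block_len k / 3"
    "block_lo (2 * k) = block_lo k" "block_lo (Suc (2 * k)) = block_lo k + 2 * block_len k / 3"
  using assms block_len.simps[of "2 * k"] block_len.simps[of "Suc (2 * k)"] block_lo.simps[of "2 * k"] block_lo.simps[of "Suc (2 * k)"]
  by auto

lemma block_one [simp]: "block_len (Suc 0) = 1" "block_lo (Suc 0) = 0" "in_block (Suc 0) x = x"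
  using block_len.simps[of 1] block_lo.simps[of 1] by (auto simp: in_block_def)

lemma in_block_child:
  assumes "k \<ge> 1"
  shows "in_block (2 * k) x = in_block k (x / 3)" "in_block (Suc (2 * k)) x = in_block k (2 / 3 + x / 3)"
  unfolding in_block_def block_child[OF assms] by (simp_all add: algebra_simps)

lemma block_len_pos: "0 < block_len k"
  by (induction k rule: block_len.induct) (subst block_len.simps, auto)

lemma block_len_level: "r < 2 ^ d \<Longrightarrow> block_len (2 ^ d + r) = 1 / 3 ^ d"
proof (induction d arbitrary: r)
  case (Suc d)
  have "(2 ^ Suc d + r) div 2 = 2 ^ d + r div 2" by simp
  moreover have "\<not> 2 ^ Suc d + r \<le> 1" using one_le_power[of "2::nat" d] unfolding power_Suc by linarith
  ultimately show ?case using Suc.IH[of "r div 2"] Suc.prems block_len.simps[of "2 ^ Suc d + r"] by simp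
qed simp

lemma block_lo_level:
  assumes "r < 2 ^ d"
  shows "block_lo (2 ^ Suc d + r) = block_lo (2 ^ d + r) / 3 \<and>
    block_lo (2 ^ Suc d + (2 ^ d + r)) = 2 / 3 + block_lo (2 ^ d + r) / 3"
  using assms
proof (induction d arbitrary: r)
  case 0
  then show ?case using block_child[of 1] by (simp add: numeral_2_eq_2 numeral_3_eq_3)
next
  case (Suc d)
  define s where "s = r div 2"
  have s: "s < 2 ^ d" using Suc.prems by (simp add: s_def)
  note IH = Suc.IH[OF s]
  let ?k = "2 ^ d + s" and ?l = "2 ^ Suc d + s" and ?m = "2 ^ Suc d + (2 ^ d + s)"
  have k: "1 \<le> ?k" "1 \<le> ?l" "1 \<le> ?m" by (rule index_ge_1)+
  have l: "block_len ?k = 1 / 3 ^ d" "block_len ?l = 1 / 3 ^ Suc d" "block_len ?m = 1 / 3 ^ Suc d"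
    using s by (intro block_len_level; simp)+
  show ?case
  proof (cases "even r")
    case True
    then have r: "r = 2 * s" by (simp add: s_def)
    have e: "2 ^ Suc d + r = 2 * ?k" "2 ^ Suc (Suc d) + r = 2 * ?l" "2 ^ Suc (Suc d) + (2 ^ Suc d + r) = 2 * ?m"
      by (auto simp: r)
    have "block_lo (2 ^ Suc d + r) = block_lo ?k" "block_lo (2 ^ Suc (Suc d) + r) = block_lo ?l"
        "block_lo (2 ^ Suc (Suc d) + (2 ^ Suc d + r)) = block_lo ?m"
      by (subst e, rule block_child(3), rule k)+
    then show ?thesis using IH by simp
  next
    case False
    then have r: "r = Suc (2 * s)" by (simp add: s_def)
    have e: "2 ^ Suc d + r = Suc (2 * ?k)" "2 ^ Suc (Suc d) + r = Suc (2 * ?l)" "2 ^ Suc (Suc d) + (2 ^ Suc d + r) = Suc (2 * ?m)"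
      by (auto simp: r)
    have b1: "block_lo (2 ^ Suc d + r) = block_lo ?k + 2 * block_len ?k / 3"
      by (subst e, rule block_child(4), rule k)
    have b2: "block_lo (2 ^ Suc (Suc d) + r) = block_lo ?l + 2 * block_len ?l / 3"
      by (subst e, rule block_child(4), rule k)
    have b3: "block_lo (2 ^ Suc (Suc d) + (2 ^ Suc d + r)) = block_lo ?m + 2 * block_len ?m / 3"
      by (subst e, rule block_child(4), rule k)
    show ?thesis unfolding b1 b2 b3 l using IH by (simp add: add_divide_distrib)
  qed
qed

lemma in_block_left: "r < 2 ^ d \<Longrightarrow> in_block (2 ^ Suc d + r) x = in_block (2 ^ d + r) x / 3"
  using block_lo_level[of r d] block_len_level[of r d] block_len_level[of r "Suc d"]
  unfolding in_block_def by (simp add: add_divide_distrib)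

lemma in_block_right: "r < 2 ^ d \<Longrightarrow> in_block (2 ^ Suc d + (2 ^ d + r)) x = 2 / 3 + in_block (2 ^ d + r) x / 3"
  using block_lo_level[of r d] block_len_level[of r d] block_len_level[of "2 ^ d + r" "Suc d"]
  unfolding in_block_def by (simp add: add_divide_distrib)

text \<open>
  Passing to a child of a node chooses the innermost third, whereas \<open>cantor_stage\<close> is defined by
  recursion on the outermost one. This case distinction peels off the outermost choice.
\<close>

lemma tree_index_prepend [consumes 1, case_names one left right]:
  assumes "k \<ge> (1::nat)"
  obtains "k = 1" | d r where "r < 2 ^ d" "k = 2 ^ Suc d + r" | d r where "r < 2 ^ d" "k = 2 ^ Suc d + (2 ^ d + r)"
proof -
  obtain d r where dr: "r < 2 ^ d" "k = 2 ^ d + r" using tree_index_cases[OF assms] .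
  show ?thesis
  proof (cases d)
    case 0
    then show ?thesis using dr that(1) by simp
  next
    case (Suc e)
    show ?thesis
    proof (cases "r < 2 ^ e")
      case True
      then show ?thesis using that(2) dr Suc by blast
    next
      case False
      then have "r - 2 ^ e < 2 ^ e" "k = 2 ^ Suc e + (2 ^ e + (r - 2 ^ e))" using dr Suc by auto
      then show ?thesis using that(3) by blast
    qed
  qed
qed

lemma tree_index_inj:
  assumes "r < 2 ^ d" "s < 2 ^ e" "2 ^ d + r = (2 ^ e + s :: nat)"
  shows "d = e" "r = s"
proof -
  have "(3::real) ^ d = 3 ^ e" using block_len_level[OF assms(1)] block_len_level[OF assms(2)] assms(3) by simp
  then show "d = e" by simp
  then show "r = s" using assms(3) by simp
qed

lemma in_block_bounds:
  assumes "r < 2 ^ d" "0 \<le> x" "x \<le> 1"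
  shows "in_block (2 ^ d + r) x \<in> cantor_stage d" "0 \<le> in_block (2 ^ d + r) x" "in_block (2 ^ d + r) x \<le> 1"
proof -
  have "in_block (2 ^ d + r) x \<in> cantor_stage d \<and> 0 \<le> in_block (2 ^ d + r) x \<and> in_block (2 ^ d + r) x \<le> 1"
    using assms(1)
  proof (induction d arbitrary: r)
    case 0
    then show ?case using assms by simp
  next
    case (Suc d)
    show ?case
    proof (cases "r < 2 ^ d")
      case True
      show ?thesis using Suc.IH[OF True] unfolding in_block_left[OF True] by auto
    next
      case False
      define s where "s = r - 2 ^ d"
      have s: "s < 2 ^ d" "r = 2 ^ d + s" using False Suc.prems by (auto simp: s_def)
      show ?thesis using Suc.IH[OF s(1)] unfolding s(2) in_block_right[OF s(1)] by auto
    qed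
  qed
  then show "in_block (2 ^ d + r) x \<in> cantor_stage d" "0 \<le> in_block (2 ^ d + r) x" "in_block (2 ^ d + r) x \<le> 1" by auto
qed

lemma in_block_less: "in_block k x < in_block k y \<longleftrightarrow> x < y" "in_block k x \<le> in_block k y \<longleftrightarrow> x \<le> y"
  using block_len_pos[of k] by (auto simp: in_block_def)

lemma gap_left: "r < 2 ^ d \<Longrightarrow> t \<in> gap (2 ^ Suc d + r) \<longleftrightarrow> 3 * t \<in> gap (2 ^ d + r)"
  by (auto simp: gap_def in_block_left simp del: power_Suc)

lemma gap_right: "r < 2 ^ d \<Longrightarrow> t \<in> gap (2 ^ Suc d + (2 ^ d + r)) \<longleftrightarrow> 3 * t - 2 \<in> gap (2 ^ d + r)"
  by (auto simp: gap_def in_block_right simp del: power_Suc)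

lemma gap_one: "gap 1 = {1/3<..<2/3}" by (simp add: gap_def)

lemma gap_subset:
  assumes "k \<ge> 1" shows "gap k \<subseteq> {0<..<1}"
proof -
  obtain d r where dr: "r < 2 ^ d" "k = 2 ^ d + r" using tree_index_cases[OF assms] .
  have "0 \<le> in_block k 0" "in_block k 0 < in_block k (1/3)" "in_block k (2/3) < in_block k 1" "in_block k 1 \<le> 1"
    using in_block_bounds[OF dr(1)] dr(2) by (auto simp: in_block_less)
  then show ?thesis by (auto simp: gap_def)
qed

lemma cantor_stage_subset: "cantor_stage d \<subseteq> {0..1}"
  by (induction d) auto

lemma cantor_stage_Suc: "t \<in> cantor_stage (Suc d) \<longleftrightarrow> 3 * t \<in> cantor_stage d \<or> 3 * t - 2 \<in> cantor_stage d"
proof -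
  have "t \<in> (\<lambda>x. x / 3) ` cantor_stage d \<longleftrightarrow> 3 * t \<in> cantor_stage d"
    by (auto simp: image_iff mult.commute intro!: bexI[of _ "3 * t"])
  moreover have "t \<in> (\<lambda>x. 2 / 3 + x / 3) ` cantor_stage d \<longleftrightarrow> 3 * t - 2 \<in> cantor_stage d"
    by (auto simp: image_iff diff_divide_distrib intro!: bexI[of _ "3 * t - 2"])
  ultimately show ?thesis by simp
qed

lemma cantor_stage_compl:
  "t \<in> {0..1} - cantor_stage d \<longleftrightarrow> (\<exists>e<d. \<exists>r<2 ^ e. t \<in> gap (2 ^ e + r))"
proof (induction d arbitrary: t)
  case 0
  then show ?case by simp
next
  case (Suc d)
  have sub: "x \<in> cantor_stage d \<Longrightarrow> 0 \<le> x \<and> x \<le> 1" for x using cantor_stage_subset by force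
  show ?case
  proof
    assume t: "t \<in> {0..1} - cantor_stage (Suc d)"
    then have n: "3 * t \<notin> cantor_stage d" "3 * t - 2 \<notin> cantor_stage d" using cantor_stage_Suc by auto
    consider "t \<le> 1/3" | "t \<ge> 2/3" | "1/3 < t" "t < 2/3" by linarith
    then show "\<exists>e<Suc d. \<exists>r<2 ^ e. t \<in> gap (2 ^ e + r)"
    proof cases
      case 1
      then have "3 * t \<in> {0..1} - cantor_stage d" using t n by auto
      then obtain e r where "e < d" "r < 2 ^ e" "3 * t \<in> gap (2 ^ e + r)" using Suc by blast
      then have "Suc e < Suc d" "r < 2 ^ Suc e" "t \<in> gap (2 ^ Suc e + r)" using gap_left by auto
      then show ?thesis by blast
    next
      case 2
      then have "3 * t - 2 \<in> {0..1} - cantor_stage d" using t n by auto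
      then obtain e r where "e < d" "r < 2 ^ e" "3 * t - 2 \<in> gap (2 ^ e + r)" using Suc by blast
      then have "Suc e < Suc d" "2 ^ e + r < 2 ^ Suc e" "t \<in> gap (2 ^ Suc e + (2 ^ e + r))" using gap_right by auto
      then show ?thesis by blast
    next
      case 3
      then show ?thesis using gap_one by (intro exI[of _ 0]) auto
    qed
  next
    assume "\<exists>e<Suc d. \<exists>r<2 ^ e. t \<in> gap (2 ^ e + r)"
    then obtain e r where er: "e < Suc d" "r < 2 ^ e" "t \<in> gap (2 ^ e + r)" by blast
    have t01: "0 < t" "t < 1" using er(3) gap_subset[OF index_ge_1[of e r]] by auto
    have "3 * t \<notin> cantor_stage d \<and> 3 * t - 2 \<notin> cantor_stage d"
    proof (cases e)
      case 0
      then have "1/3 < t" "t < 2/3" using er gap_one by auto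
      then show ?thesis using sub[of "3 * t"] sub[of "3 * t - 2"] by auto
    next
      case (Suc e')
      show ?thesis
      proof (cases "r < 2 ^ e'")
        case True
        then have *: "3 * t \<in> gap (2 ^ e' + r)" using er(3) gap_left Suc by simp
        have "e' < d" using er(1) Suc by simp
        then have "3 * t \<in> {0..1} - cantor_stage d" unfolding Suc.IH using True * by blast
        moreover have "3 * t < 1" using * gap_subset[OF index_ge_1[of e' r]] by auto
        ultimately show ?thesis using sub[of "3 * t - 2"] by auto
      next
        case False
        define s where "s = r - 2 ^ e'"
        have s: "s < 2 ^ e'" "r = 2 ^ e' + s" using False er(2) Suc by (auto simp: s_def)
        then have *: "3 * t - 2 \<in> gap (2 ^ e' + s)" using er(3) gap_right[OF s(1)] Suc by simp
        have "e' < d" using er(1) Suc by simp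
        then have "3 * t - 2 \<in> {0..1} - cantor_stage d" unfolding Suc.IH using s(1) * by blast
        moreover have "3 * t - 2 > 0" using * gap_subset[OF index_ge_1[of e' s]] by auto
        ultimately show ?thesis using sub[of "3 * t"] by auto
      qed
    qed
    then show "t \<in> {0..1} - cantor_stage (Suc d)" using t01 cantor_stage_Suc by auto
  qed
qed

lemma cantor_compl: "t \<in> {0..1} - cantor_set \<longleftrightarrow> (\<exists>k\<ge>1. t \<in> gap k)"
proof
  assume "t \<in> {0..1} - cantor_set"
  then obtain d where "t \<in> {0..1} - cantor_stage d" by (auto simp: cantor_set_def)
  then obtain e r where "t \<in> gap (2 ^ e + r)" using cantor_stage_compl by blast
  then show "\<exists>k\<ge>1. t \<in> gap k" using index_ge_1 by blast
next
  assume "\<exists>k\<ge>1. t \<in> gap k"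
  then obtain k where k: "k \<ge> 1" "t \<in> gap k" by blast
  obtain d r where dr: "r < 2 ^ d" "k = 2 ^ d + r" using tree_index_cases[OF k(1)] .
  then have "t \<in> {0..1} - cantor_stage (Suc d)" using k(2) unfolding cantor_stage_compl by blast
  then show "t \<in> {0..1} - cantor_set" by (auto simp: cantor_set_def simp del: cantor_stage.simps)
qed

lemma gap_disjoint:
  assumes "r < 2 ^ d" "k \<ge> 1" "t \<in> gap (2 ^ d + r)" "t \<in> gap k"
  shows "k = 2 ^ d + r"
  using assms
proof (induction d arbitrary: r k t)
  case 0
  then have t: "1/3 < t" "t < 2/3" using gap_one by auto
  show ?case using 0(2)
  proof (cases k rule: tree_index_prepend)
    case (left e s)
    then have "3 * t \<in> gap (2 ^ e + s)" using 0(4) gap_left by blast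
    then show ?thesis using gap_subset[OF index_ge_1[of e s]] t by auto
  next
    case (right e s)
    then have "3 * t - 2 \<in> gap (2 ^ e + s)" using 0(4) gap_right by blast
    then show ?thesis using gap_subset[OF index_ge_1[of e s]] t by auto
  qed (use 0 in simp)
next
  case (Suc d)
  show ?case
  proof (cases "r < 2 ^ d")
    case True
    have t: "3 * t \<in> gap (2 ^ d + r)" using Suc.prems(3) gap_left[OF True] by blast
    then have t1: "3 * t < 1" "0 < t" using gap_subset[OF index_ge_1[of d r]] by auto
    show ?thesis using Suc.prems(2)
    proof (cases k rule: tree_index_prepend)
      case one
      then show ?thesis using Suc.prems(4) gap_one t1 by auto
    next
      case (left e s)
      then have "3 * t \<in> gap (2 ^ e + s)" using Suc.prems(4) gap_left by blast
      then have "2 ^ e + s = 2 ^ d + r" using Suc.IH[OF True index_ge_1 t] by blast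
      then have "e = d" "s = r" using tree_index_inj[OF left(1) True] by auto
      then show ?thesis using left by simp
    next
      case (right e s)
      then have "3 * t - 2 \<in> gap (2 ^ e + s)" using Suc.prems(4) gap_right by blast
      then show ?thesis using gap_subset[OF index_ge_1[of e s]] t1 by auto
    qed
  next
    case False
    define r' where "r' = r - 2 ^ d"
    have r': "r' < 2 ^ d" "r = 2 ^ d + r'" using False Suc.prems(1) by (auto simp: r'_def)
    have t: "3 * t - 2 \<in> gap (2 ^ d + r')" using Suc.prems(3) gap_right[OF r'(1)] r'(2) by blast
    then have t1: "3 * t > 2" "t < 1" using gap_subset[OF index_ge_1[of d r']] by auto
    show ?thesis using Suc.prems(2)
    proof (cases k rule: tree_index_prepend)
      case one
      then show ?thesis using Suc.prems(4) gap_one t1 by auto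
    next
      case (right e s)
      then have "3 * t - 2 \<in> gap (2 ^ e + s)" using Suc.prems(4) gap_right by blast
      then have "2 ^ e + s = 2 ^ d + r'" using Suc.IH[OF r'(1) index_ge_1 t] by blast
      then have "e = d" "s = r'" using tree_index_inj[OF right(1) r'(1)] by auto
      then show ?thesis using right r' by simp
    next
      case (left e s)
      then have "3 * t \<in> gap (2 ^ e + s)" using Suc.prems(4) gap_left by blast
      then show ?thesis using gap_subset[OF index_ge_1[of e s]] t1 by auto
    qed
  qed
qed

lemma gap_unique: "\<lbrakk>k \<ge> 1; l \<ge> 1; t \<in> gap k; t \<in> gap l\<rbrakk> \<Longrightarrow> k = l"
  using tree_index_cases[of k] gap_disjoint by metis

lemma mid_gap: "in_block k (1/2) \<in> gap k"
  by (auto simp: gap_def in_block_less)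

lemma gap_inj: "\<lbrakk>k \<ge> 1; l \<ge> 1; gap k = gap l\<rbrakk> \<Longrightarrow> k = l"
  using gap_unique mid_gap by metis

lemma components_cantor_compl: "components ({0..1} - cantor_set) = gap ` {1..}"
proof (rule components_open_unique)
  show "pairwise disjnt (gap ` {1..})"
    unfolding pairwise_def disjnt_def using gap_unique by fastforce
  show "\<Union> (gap ` {1..}) = {0..1} - cantor_set"
  proof (rule Set.set_eqI)
    fix x show "x \<in> \<Union> (gap ` {1..}) \<longleftrightarrow> x \<in> {0..1} - cantor_set"
      unfolding cantor_compl by auto
  qed
  show "open X \<and> connected X \<and> X \<noteq> {}" if X: "X \<in> gap ` {1..}" for X
  proof -
    obtain k where "X = gap k" using X by blast
    then show ?thesis using mid_gap[of k] by (auto simp: gap_def)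
  qed
qed

lemma block_lo_less: "r < s \<Longrightarrow> s < 2 ^ d \<Longrightarrow> in_block (2 ^ d + r) x < in_block (2 ^ d + s) x" if x: "0 \<le> x" "x < 1"
proof (induction d arbitrary: r s)
  case (Suc d)
  consider "s < 2 ^ d" | "r < 2 ^ d" "\<not> s < 2 ^ d" | "\<not> r < 2 ^ d" by blast
  then show ?case
  proof cases
    case 1
    then have "r < 2 ^ d" using Suc.prems by simp
    then show ?thesis using Suc.IH[OF Suc.prems(1) 1] in_block_left[of r d x] in_block_left[OF 1, of x] by linarith
  next
    case 2
    define s' where "s' = s - 2 ^ d"
    have s': "s' < 2 ^ d" "s = 2 ^ d + s'" using 2 Suc.prems by (auto simp: s'_def)
    show ?thesis using in_block_left[OF 2(1), of x] in_block_right[OF s'(1), of x]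
       in_block_bounds[OF 2(1), of x] in_block_bounds[OF s'(1), of x] x unfolding s'(2) by linarith
  next
    case 3
    define s' where "s' = s - 2 ^ d"
    define r' where "r' = r - 2 ^ d"
    have s': "s' < 2 ^ d" "s = 2 ^ d + s'" "r' < 2 ^ d" "r = 2 ^ d + r'" "r' < s'" using 3 Suc.prems by (auto simp: s'_def r'_def)
    show ?thesis using Suc.IH[OF s'(5,1)] in_block_right[OF s'(3), of x] in_block_right[OF s'(1), of x]
      unfolding s'(2,4) by linarith
  qed
qed simp

lemma measure_gap: "k \<ge> 1 \<Longrightarrow> measure lborel (gap k) = block_len k / 3"
  using block_len_pos[of k] by (simp add: gap_def in_block_def)

lemma cantor_gaps_eq: "cantor_gaps (Suc d) = (\<lambda>r. gap (2 ^ d + r)) ` {..<2 ^ d}"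
proof
  show "cantor_gaps (Suc d) \<subseteq> (\<lambda>r. gap (2 ^ d + r)) ` {..<2 ^ d}"
  proof
    fix I assume "I \<in> cantor_gaps (Suc d)"
    then obtain k where k: "k \<ge> 1" "I = gap k" "measure lborel (gap k) = 1 / 3 ^ Suc d"
      unfolding cantor_gaps_def components_cantor_compl by auto
    obtain e r where er: "r < 2 ^ e" "k = 2 ^ e + r" using tree_index_cases[OF k(1)] .
    have "(3::real) ^ e = 3 ^ d" using k(3) measure_gap[OF k(1)] block_len_level[OF er(1)] er(2) by simp
    then have "e = d" by simp
    then show "I \<in> (\<lambda>r. gap (2 ^ d + r)) ` {..<2 ^ d}" using k(2) er by auto
  qed
  show "(\<lambda>r. gap (2 ^ d + r)) ` {..<2 ^ d} \<subseteq> cantor_gaps (Suc d)"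
    unfolding cantor_gaps_def components_cantor_compl
  proof safe
    fix r :: nat assume r: "r < 2 ^ d"
    show "gap (2 ^ d + r) \<in> gap ` {1..}" using index_ge_1 by blast
    show "measure lborel (gap (2 ^ d + r)) = 1 / 3 ^ Suc d"
      unfolding measure_gap[OF index_ge_1] block_len_level[OF r] by simp
  qed
qed

lemma Inf_gap: "Inf (gap k) = in_block k (1/3)" and Sup_gap: "Sup (gap k) = in_block k (2/3)"
  unfolding gap_def using in_block_less(1)[of k "1/3" "2/3"] by auto

lemma card_gaps_before:
  assumes "r < 2 ^ d"
  shows "card {J \<in> cantor_gaps (Suc d). Inf J \<le> Inf (gap (2 ^ d + r))} = Suc r"
proof -
  have le: "Inf (gap (2 ^ d + s)) \<le> Inf (gap (2 ^ d + r)) \<longleftrightarrow> s \<le> r" if "s < 2 ^ d" for s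
    using block_lo_less[of "1/3" s r d] block_lo_less[of "1/3" r s d] assms that unfolding Inf_gap
    by (cases s r rule: linorder_cases) auto
  have "{J \<in> cantor_gaps (Suc d). Inf J \<le> Inf (gap (2 ^ d + r))} = (\<lambda>s. gap (2 ^ d + s)) ` {..r}"
    unfolding cantor_gaps_eq using le assms by (auto intro!: imageI)
  moreover have "inj_on (\<lambda>s. gap (2 ^ d + s)) {..r}"
    by (rule inj_onI) (metis add_left_cancel gap_inj index_ge_1)
  ultimately show ?thesis by (simp add: card_image)
qed

text \<open>
  On level \<open>d\<close> the nodes are ordered from left to right, so counting gaps by their left ends recovers
  the node.
\<close>

lemma cantor_gap_eq:
  assumes "r < 2 ^ d"
  shows "cantor_gap (Suc d) (Suc r) = gap (2 ^ d + r)"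
  unfolding cantor_gap_def
proof (rule the_equality)
  show "gap (2 ^ d + r) \<in> cantor_gaps (Suc d) \<and> card {J \<in> cantor_gaps (Suc d). Inf J \<le> Inf (gap (2 ^ d + r))} = Suc r"
    using card_gaps_before[OF assms] assms unfolding cantor_gaps_eq by blast
  fix I assume I: "I \<in> cantor_gaps (Suc d) \<and> card {J \<in> cantor_gaps (Suc d). Inf J \<le> Inf I} = Suc r"
  then obtain s where s: "s < 2 ^ d" "I = gap (2 ^ d + s)" unfolding cantor_gaps_eq by auto
  then show "I = gap (2 ^ d + r)" using I card_gaps_before[OF s(1)] by simp
qed

lemma tau_loop_gap:
  assumes "k \<ge> 1" "t \<in> gap k"
  shows "tau_loop t = hawaiian_loop k ((t - in_block k (1/3)) / (block_len k / 3))"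
proof -
  obtain d r where dr: "r < 2 ^ d" "k = 2 ^ d + r" using tree_index_cases[OF assms(1)] .
  have the: "(THE (n, j). 1 \<le> n \<and> j \<in> {1..2 ^ (n - 1)} \<and> t \<in> cantor_gap n j) = (Suc d, Suc r)"
  proof (rule the_equality)
    show "case (Suc d, Suc r) of (n, j) \<Rightarrow> 1 \<le> n \<and> j \<in> {1..2 ^ (n - 1)} \<and> t \<in> cantor_gap n j"
      using dr assms(2) cantor_gap_eq[OF dr(1)] by auto
    fix p assume "case p of (n, j) \<Rightarrow> 1 \<le> n \<and> j \<in> {1..2 ^ (n - 1)} \<and> t \<in> cantor_gap n j"
    then obtain n j where p: "p = (n, j)" "1 \<le> n" "j \<in> {1..2 ^ (n - 1)}" "t \<in> cantor_gap n j" by (cases p) auto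
    define e s where "e = n - 1" and "s = j - 1"
    have es: "n = Suc e" "j = Suc s" "s < 2 ^ e" using p by (auto simp: e_def s_def)
    then have "t \<in> gap (2 ^ e + s)" using p(4) cantor_gap_eq by simp
    then have "2 ^ d + r = 2 ^ e + s" using gap_unique[OF assms(1) index_ge_1 assms(2)] dr(2) by blast
    then have "d = e" "r = s" using tree_index_inj[OF dr(1) es(3)] by auto
    then show "p = (Suc d, Suc r)" using p(1) es by simp
  qed
  have "t \<in> {0..1} - cantor_set" using cantor_compl assms by blast
  then have "tau_loop t = hawaiian_loop (2 ^ (Suc d - 1) + Suc r - 1) ((t - Inf (gap k)) / (Sup (gap k) - Inf (gap k)))"
    unfolding tau_loop_def the using cantor_gap_eq[OF dr(1)] dr(2) by (simp add: Let_def)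
  also have "Sup (gap k) - Inf (gap k) = block_len k / 3" unfolding Inf_gap Sup_gap by (simp add: in_block_def)
  finally show ?thesis unfolding Inf_gap by (simp add: dr(2))
qed

lemma tau_loop_off: "(\<And>k. k \<ge> 1 \<Longrightarrow> t \<notin> gap k) \<Longrightarrow> tau_loop t = (0, 0)"
  using cantor_compl[of t] by (auto simp: tau_loop_def)

definition closed_gap :: "nat \<Rightarrow> real set" where
  "closed_gap k = {in_block k (1/3)..in_block k (2/3)}"

lemma gap_subset_closed_gap: "gap k \<subseteq> closed_gap k" by (auto simp: gap_def closed_gap_def)

lemma closed_gap_boundary:
  assumes "k \<ge> 1" "l \<ge> 1" "t \<in> closed_gap k" "t \<notin> gap k"
  shows "t \<notin> gap l"
proof
  assume t: "t \<in> gap l"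
  have "closure (gap k) = closed_gap k"
    unfolding gap_def closed_gap_def using in_block_less(1)[of k "1/3" "2/3"] by simp
  then have "gap l \<inter> gap k \<noteq> {}"
    using assms(3) t open_Int_closure_eq_empty[of "gap l" "gap k"] unfolding gap_def by auto
  then have "k = l" using gap_unique assms by blast
  then show False using t assms(4) by simp
qed

lemma tau_loop_closed_gap:
  assumes "k \<ge> 1" "t \<in> closed_gap k"
  shows "tau_loop t = hawaiian_loop k ((t - in_block k (1/3)) / (block_len k / 3))"
proof (cases "t \<in> gap k")
  case False
  then have "t = in_block k (1/3) \<or> t = in_block k (2/3)" using assms(2) by (auto simp: gap_def closed_gap_def)
  then have "(t - in_block k (1/3)) / (block_len k / 3) \<in> {0, 1}"
    using block_len_pos[of k] by (auto simp: in_block_def field_simps)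
  moreover have "tau_loop t = (0, 0)" using closed_gap_boundary[OF assms(1) _ assms(2) False] by (intro tau_loop_off) auto
  ultimately show ?thesis by auto
qed (rule tau_loop_gap[OF assms(1)])

lemma tau_loop_in_block:
  assumes "k \<ge> 1" "1 / 3 \<le> x" "x \<le> 2 / 3"
  shows "tau_loop (in_block k x) = hawaiian_loop k (3 * x - 1)"
proof -
  have "in_block k x \<in> closed_gap k" using assms by (simp add: closed_gap_def in_block_less)
  moreover have "(in_block k x - in_block k (1/3)) / (block_len k / 3) = 3 * x - 1"
    using block_len_pos[of k] by (simp add: in_block_def field_simps)
  ultimately show ?thesis using tau_loop_closed_gap[OF assms(1)] by metis
qed

text \<open>
  The gaps of lower levels do not meet an interval of stage \<open>d\<close>, so over it the loop stays on the
  circles from \<open>2 ^ d\<close> on.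
\<close>

lemma tau_loop_level:
  assumes "r < 2 ^ d" "0 \<le> x" "x \<le> 1"
  obtains n s where "n \<ge> 2 ^ d" "s \<in> {0..1}" "tau_loop (in_block (2 ^ d + r) x) = hawaiian_loop n s"
proof (cases "\<exists>k\<ge>1. in_block (2 ^ d + r) x \<in> gap k")
  case True
  then obtain k where k: "k \<ge> 1" "in_block (2 ^ d + r) x \<in> gap k" by blast
  obtain e q where eq: "q < 2 ^ e" "k = 2 ^ e + q" using tree_index_cases[OF k(1)] .
  have "\<not> e < d" using cantor_stage_compl[of "in_block (2 ^ d + r) x" d] in_block_bounds[OF assms] k(2) eq by auto
  then have "(2::nat) ^ d \<le> 2 ^ e" by (intro power_increasing) auto
  then have "2 ^ d \<le> k" unfolding eq(2) by (rule trans_le_add1)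
  moreover have "(in_block (2 ^ d + r) x - in_block k (1/3)) / (block_len k / 3) \<in> {0..1}"
    using k(2) block_len_pos[of k] by (auto simp: gap_def in_block_def field_simps)
  ultimately show ?thesis using that tau_loop_gap[OF k] by blast
next
  case False
  then have "tau_loop (in_block (2 ^ d + r) x) = hawaiian_loop (2 ^ d) 0" using tau_loop_off by auto
  then show ?thesis using that[of "2 ^ d" 0] by simp
qed

text \<open>
  Truncated to the first \<open>n\<close> gaps, \<open>F\<close> is continuous by pasting along closed sets. The truncations
  converge to \<open>F\<close> uniformly since \<open>F\<close> is of size \<open>C / k\<close> on gap \<open>k\<close>.
\<close>

lemma continuous_on_gap_pasting:
  fixes F :: "'b::topological_space \<Rightarrow> 'c::real_normed_vector" and p :: "'b \<Rightarrow> real"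
  assumes p: "continuous_on Z p"
    and F: "\<And>k. k \<ge> 1 \<Longrightarrow> continuous_on {z \<in> Z. p z \<in> closed_gap k} F"
    and off: "\<And>z. z \<in> Z \<Longrightarrow> (\<And>k. k \<ge> 1 \<Longrightarrow> p z \<notin> gap k) \<Longrightarrow> F z = 0"
    and bound: "\<And>z k. z \<in> Z \<Longrightarrow> k \<ge> 1 \<Longrightarrow> p z \<in> gap k \<Longrightarrow> norm (F z) \<le> C / real k"
  shows "continuous_on Z F"
proof -
  define G where "G n z = (if \<exists>k\<in>{1..n}. p z \<in> gap k then F z else 0)" for n z
  have G: "continuous_on Z (G n)" for n
  proof (induction n)
    case 0
    then show ?case by (simp add: G_def)
  next
    case (Suc n)
    let ?A = "{z \<in> Z. p z \<in> closed_gap (Suc n)}" and ?B = "{z \<in> Z. p z \<notin> gap (Suc n)}"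
    have un: "Z = ?A \<union> ?B" using gap_subset_closed_gap by blast
    have A: "?A = Z \<inter> p -` closed_gap (Suc n)" and B: "?B = Z \<inter> p -` (- gap (Suc n))" by auto
    have cl: "closedin (top_of_set Z) ?A" "closedin (top_of_set Z) ?B"
      unfolding A B by (intro continuous_closedin_preimage p; simp add: closed_gap_def gap_def closed_Compl)+
    have "continuous_on ?A (G (Suc n))"
    proof (rule continuous_on_eq[OF F[of "Suc n"]])
      fix z assume z: "z \<in> ?A"
      show "F z = G (Suc n) z"
      proof (cases "p z \<in> gap (Suc n)")
        case True
        then have "\<exists>k\<in>{1..Suc n}. p z \<in> gap k" by (intro bexI[of _ "Suc n"]) auto
        then show ?thesis by (simp add: G_def)
      next
        case False
        then have "p z \<notin> gap l" if "l \<ge> 1" for l using closed_gap_boundary[of "Suc n" l] z that by auto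
        then show ?thesis using off[of z] z by (auto simp: G_def)
      qed
    qed simp
    moreover have "continuous_on ?B (G (Suc n))"
    proof (rule continuous_on_eq[OF continuous_on_subset[OF Suc]])
      fix z assume z: "z \<in> ?B"
      have "(\<exists>k\<in>{1..Suc n}. p z \<in> gap k) \<longleftrightarrow> (\<exists>k\<in>{1..n}. p z \<in> gap k)"
        using z le_Suc_eq by auto
      then show "G n z = G (Suc n) z" by (simp only: G_def)
    qed auto
    ultimately have "continuous_on (?A \<union> ?B) (G (Suc n))"
      using cl by (intro continuous_on_Un_local) (simp_all only: un[symmetric])
    then show ?case by (simp only: un[symmetric])
  qed
  have close: "norm (G n z - F z) \<le> \<bar>C\<bar> / Suc n" if z: "z \<in> Z" for n z
  proof (cases "\<exists>k\<ge>1. p z \<in> gap k")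
    case True
    then obtain k where k: "k \<ge> 1" "p z \<in> gap k" by blast
    show ?thesis
    proof (cases "k \<le> n")
      case True
      then have "\<exists>k\<in>{1..n}. p z \<in> gap k" using k by (intro bexI[of _ k]) auto
      then show ?thesis by (simp add: G_def)
    next
      case False
      have "norm (G n z - F z) \<le> norm (F z)" by (simp add: G_def)
      also have "\<dots> \<le> C / k" using bound[OF z k] .
      also have "\<dots> \<le> \<bar>C\<bar> / k" by (intro divide_right_mono) auto
      also have "\<dots> \<le> \<bar>C\<bar> / Suc n" using False by (intro divide_left_mono) auto
      finally show ?thesis .
    qed
  next
    case False
    then show ?thesis using off[OF z] by (simp add: G_def)
  qed
  have "uniform_limit Z G F sequentially"
  proof (rule uniform_limitI)
    fix e :: real assume "e > 0"
    have "(\<lambda>n. \<bar>C\<bar> / real (Suc n)) \<longlonglongrightarrow> 0"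
      using LIMSEQ_Suc[OF lim_const_over_n[of "\<bar>C\<bar>"]] by simp
    then have "\<forall>\<^sub>F n in sequentially. \<bar>C\<bar> / real (Suc n) < e" using \<open>e > 0\<close> by (rule order_tendstoD(2))
    then show "\<forall>\<^sub>F n in sequentially. \<forall>z\<in>Z. dist (G n z) (F z) < e"
      by eventually_elim (metis close dist_norm order_le_less_trans)
  qed
  then show ?thesis
    by (rule uniform_limit_theorem[where f = G and F = sequentially, rotated]) (use G in auto)
qed

lemma continuous_on_hawaiian_loop_gap:
  assumes "continuous_on S p" "\<And>z. z \<in> S \<Longrightarrow> p z \<in> closed_gap k"
  shows "continuous_on S (\<lambda>z. hawaiian_loop n ((p z - in_block k (1/3)) / (block_len k / 3)))"
proof (rule continuous_on_compose2[of "{0..1}" "hawaiian_loop n"])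
  show "continuous_on {0..1} (hawaiian_loop n)" using path_hawaiian_loop by (simp add: path_def)
  show "continuous_on S (\<lambda>z. (p z - in_block k (1/3)) / (block_len k / 3))"
    using block_len_pos[of k] by (intro continuous_intros assms) auto
  show "(\<lambda>z. (p z - in_block k (1/3)) / (block_len k / 3)) ` S \<subseteq> {0..1}"
    using assms(2) block_len_pos[of k] by (fastforce simp: closed_gap_def in_block_def field_simps)
qed

lemma tau_loop_in: "tau_loop t \<in> hawaiian_earring"
proof (cases "\<exists>k\<ge>1. t \<in> gap k")
  case True
  then obtain k where k: "k \<ge> 1" "t \<in> gap k" by blast
  have "(t - in_block k (1/3)) / (block_len k / 3) \<in> {0..1}"
    using k(2) block_len_pos[of k] by (auto simp: gap_def in_block_def field_simps)
  then show ?thesis unfolding tau_loop_gap[OF k] by (rule hawaiian_loop_in[OF k(1)])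
next
  case False
  then have "tau_loop t = (0, 0)" using tau_loop_off by blast
  then show ?thesis using hawaiian_origin_in by simp
qed

lemma continuous_tau_loop: "continuous_on UNIV tau_loop"
proof (rule continuous_on_gap_pasting[where p = "\<lambda>t. t" and C = 4])
  fix k :: nat assume k: "k \<ge> 1"
  have "continuous_on {z \<in> UNIV. z \<in> closed_gap k} (\<lambda>z. hawaiian_loop k ((z - in_block k (1/3)) / (block_len k / 3)))"
    by (rule continuous_on_hawaiian_loop_gap) (auto intro: continuous_intros)
  then show "continuous_on {z \<in> UNIV. z \<in> closed_gap k} tau_loop"
    by (rule continuous_on_eq) (use tau_loop_closed_gap[OF k] in auto)
next
  show "tau_loop z = 0" if "\<And>k. k \<ge> 1 \<Longrightarrow> z \<notin> gap k" for z using tau_loop_off[OF that] by (simp add: zero_prod_def)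
  show "norm (tau_loop z) \<le> 4 / real k" if "k \<ge> 1" "z \<in> gap k" for z k
    unfolding tau_loop_gap[OF that] by (rule norm_hawaiian_loop)
qed (auto intro: continuous_intros)

lemma tau_loop_loop: "path tau_loop" "path_image tau_loop \<subseteq> hawaiian_earring" "tau_loop 0 = (0, 0)" "tau_loop 1 = (0, 0)"
proof -
  show "path tau_loop" using continuous_on_subset[OF continuous_tau_loop] by (simp add: path_def)
  show "path_image tau_loop \<subseteq> hawaiian_earring" using tau_loop_in by (auto simp: path_image_def)
  have "0 \<notin> gap k" "1 \<notin> gap k" if "k \<ge> 1" for k using gap_subset[OF that] by auto
  then show "tau_loop 0 = (0, 0)" "tau_loop 1 = (0, 0)" using tau_loop_off by blast+
qed

section \<open>Telescoping along the Cantor set\<close>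

definition earring_tail :: "nat \<Rightarrow> (real \<times> real) set" where
  "earring_tail i = {hawaiian_loop n t | n t. n \<ge> i \<and> t \<in> {0..1}}"

lemma earring_tail_norm: "z \<in> earring_tail i \<Longrightarrow> i \<ge> 1 \<Longrightarrow> norm z \<le> 4 / real i"
proof -
  assume z: "z \<in> earring_tail i" and i: "i \<ge> 1"
  then obtain n t where n: "n \<ge> i" "z = hawaiian_loop n t" by (auto simp: earring_tail_def)
  have "norm z \<le> 4 / real n" unfolding n(2) by (rule norm_hawaiian_loop)
  also have "\<dots> \<le> 4 / real i" using n(1) i by (intro divide_left_mono) auto
  finally show ?thesis .
qed

lemma earring_tail_mono: "i \<le> j \<Longrightarrow> earring_tail j \<subseteq> earring_tail i" by (force simp: earring_tail_def)

lemma earring_tail_subset: "i \<ge> 1 \<Longrightarrow> earring_tail i \<subseteq> hawaiian_earring"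
  unfolding earring_tail_def using hawaiian_loop_in order_trans by blast

lemma loop_in_earring_tail: "n \<ge> i \<Longrightarrow> path_image (hawaiian_loop n) \<subseteq> earring_tail i"
  unfolding earring_tail_def path_image_def by blast


definition quotient_loop :: "nat \<Rightarrow> real \<Rightarrow> real \<times> real" where
  "quotient_loop i = reversepath (hawaiian_loop (2 * i)) +++ (hawaiian_loop i +++ reversepath (hawaiian_loop (Suc (2 * i))))"

lemma quotient_loop_props: 
  "path (quotient_loop i)" "path_image (quotient_loop i) \<subseteq> earring_tail i"
  "pathstart (quotient_loop i) = (0, 0)" "pathfinish (quotient_loop i) = (0, 0)"
proof -
  show "path_image (quotient_loop i) \<subseteq> earring_tail i"
    unfolding quotient_loop_def
    by (intro subset_path_image_join; simp add: loop_in_earring_tail)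
qed (simp_all add: quotient_loop_def)

lemma null_quotient_loops: "null_loops (0, 0) hawaiian_earring quotient_loop"
  unfolding null_loops_def
proof (intro conjI allI impI)
  fix n :: nat assume "n \<ge> 1"
  then show "quotient_loop n \<in> loops_at hawaiian_earring (0, 0)"
    using quotient_loop_props[of n] earring_tail_subset[of n] by (auto simp: loops_at_def)
next
  fix V :: "(real \<times> real) set" assume "open V" "(0, 0) \<in> V"
  then obtain n0 where n0: "\<And>n t. n \<ge> n0 \<Longrightarrow> hawaiian_loop n t \<in> V" using hawaiian_loop_small by blast
  have "path_image (quotient_loop n) \<subseteq> V" if "n \<ge> n0" for n
    using quotient_loop_props(2)[of n] n0 that unfolding earring_tail_def by fastforce
  then show "\<exists>n0. \<forall>n\<ge>n0. path_image (quotient_loop n) \<subseteq> V" by blast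
qed

text \<open>
  Concatenation in three equal parts, which fits the subdivision of an interval of the Cantor set into
  its left child, its gap and its right child.
\<close>

definition thirds :: "(real \<Rightarrow> 'a) \<Rightarrow> (real \<Rightarrow> 'a) \<Rightarrow> (real \<Rightarrow> 'a) \<Rightarrow> real \<Rightarrow> 'a" where
  "thirds p q r t = (if t \<le> 1/3 then p (3 * t) else if t \<le> 2/3 then q (3 * t - 1) else r (3 * t - 2))"

lemma homotopic_thirds:
  assumes "path p" "path q" "path r" "path_image p \<subseteq> X" "path_image q \<subseteq> X" "path_image r \<subseteq> X"
    "pathfinish p = pathstart q" "pathfinish q = pathstart r"
  shows "homotopic_paths X (p +++ (q +++ r)) (thirds p q r)"
proof (rule homotopic_paths_reparametrize[where f = "\<lambda>t. min (3 * t / 2) ((3 * t + 1) / 4)"])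
  show "path (p +++ q +++ r)" using assms by simp
  show "path_image (p +++ q +++ r) \<subseteq> X" using assms by (intro subset_path_image_join)
  show "continuous_on {0..1} (\<lambda>t::real. min (3 * t / 2) ((3 * t + 1) / 4))" by (intro continuous_intros) auto
  show "(\<lambda>t::real. min (3 * t / 2) ((3 * t + 1) / 4)) \<in> {0..1} \<rightarrow> {0..1}" by (auto simp: min_def)
  show "thirds p q r t = (p +++ q +++ r) (min (3 * t / 2) ((3 * t + 1) / 4))" if t: "t \<in> {0..1}" for t
  proof -
    have e: "2 * (2 * ((3 * t + 1) / 4) - 1) = 3 * t - 1" "2 * (2 * ((3 * t + 1) / 4) - 1) - 1 = 3 * t - 2" by (simp_all add: field_simps)
    consider "t \<le> 1/3" | "1/3 < t" "t \<le> 2/3" | "2/3 < t" by linarith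
    then show ?thesis
    proof cases
      case 1
      then have "min (3 * t / 2) ((3 * t + 1) / 4) = 3 * t / 2" by (simp add: min_def)
      then show ?thesis using 1 by (simp add: thirds_def joinpaths_def)
    next
      case 2
      then have m: "min (3 * t / 2) ((3 * t + 1) / 4) = (3 * t + 1) / 4" "\<not> (3 * t + 1) / 4 \<le> 1 / 2" "2 * ((3 * t + 1) / 4) - 1 \<le> 1 / 2" by (auto simp: min_def field_simps)
      show ?thesis unfolding m(1) joinpaths_def using m(2,3) 2 by (simp only: if_False if_True e thirds_def) auto
    next
      case 3
      then have m: "min (3 * t / 2) ((3 * t + 1) / 4) = (3 * t + 1) / 4" "\<not> (3 * t + 1) / 4 \<le> 1 / 2" "\<not> 2 * ((3 * t + 1) / 4) - 1 \<le> 1 / 2" by (auto simp: min_def field_simps)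
      show ?thesis unfolding m(1) joinpaths_def using m(2,3) 3 by (simp only: if_False if_True e thirds_def) auto
    qed
  qed
qed auto

lemma homotopic_cancel_both_sides:
  assumes "b \<in> loops_at X x" "p \<in> loops_at X x" "c \<in> loops_at X x"
  shows "homotopic_paths X p (b +++ ((reversepath b +++ (p +++ reversepath c)) +++ c))"
proof -
  have "x \<in> X" using loops_atD[OF assms(1)] pathstart_in_path_image by blast
  interpret G: group "fundamental_group X x" by (rule group_fundamental_group[OF \<open>x \<in> X\<close>])
  have rev: "reversepath q \<in> loops_at X x" if "q \<in> loops_at X x" for q using that by (auto simp: loops_at_def)
  have join: "q +++ r \<in> loops_at X x" if "q \<in> loops_at X x" "r \<in> loops_at X x" for q r
    using that by (auto simp: loops_at_def path_image_join)
  have car: "path_class X q \<in> carrier (fundamental_group X x)" if "q \<in> loops_at X x" for q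
    using that by (simp add: fundamental_group_def)
  note l1 = join[OF assms(2) rev[OF assms(3)]]
  note l2 = join[OF rev[OF assms(1)] l1]
  have "path_class X (b +++ ((reversepath b +++ (p +++ reversepath c)) +++ c)) = path_class X p"
    unfolding fundamental_group_mult[OF assms(1) join[OF l2 assms(3)], symmetric] fundamental_group_mult[OF l2 assms(3), symmetric]
      fundamental_group_mult[OF rev[OF assms(1)] l1, symmetric] fundamental_group_mult[OF assms(2) rev[OF assms(3)], symmetric]
      path_class_inv[OF assms(1) \<open>x \<in> X\<close>, symmetric] path_class_inv[OF assms(3) \<open>x \<in> X\<close>, symmetric]
    using car[OF assms(1)] car[OF assms(2)] car[OF assms(3)] by (simp add: G.m_assoc G.inv_mult_cancel)
  then show ?thesis using path_class_eq_iff[of p X] loops_atD[OF assms(2)] by metis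
qed

text \<open>
  Circle \<open>i\<close> is the product of its left child, its quotient and its right child. The homotopy stays
  in the circles from \<open>i\<close> on and is thereby as small as they are.
\<close>

lemma homotopic_loop_thirds:
  assumes "i \<ge> 1"
  shows "homotopic_paths (earring_tail i) (hawaiian_loop i) (thirds (hawaiian_loop (2 * i)) (quotient_loop i) (hawaiian_loop (Suc (2 * i))))"
proof -
  have l: "hawaiian_loop i \<in> loops_at (earring_tail i) (0, 0)" "hawaiian_loop (2 * i) \<in> loops_at (earring_tail i) (0, 0)"
     "hawaiian_loop (Suc (2 * i)) \<in> loops_at (earring_tail i) (0, 0)"
    using loop_in_earring_tail[of i] by (auto simp: loops_at_def)
  have "homotopic_paths (earring_tail i) (hawaiian_loop i) (hawaiian_loop (2 * i) +++ (quotient_loop i +++ hawaiian_loop (Suc (2 * i))))"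
    unfolding quotient_loop_def using homotopic_cancel_both_sides[OF l(2,1,3)] .
  also have "homotopic_paths (earring_tail i) \<dots> (thirds (hawaiian_loop (2 * i)) (quotient_loop i) (hawaiian_loop (Suc (2 * i))))"
    using quotient_loop_props[of i] loop_in_earring_tail[of i "2 * i"] loop_in_earring_tail[of i "Suc (2 * i)"]
    by (intro homotopic_thirds) auto
  finally show ?thesis .
qed

definition thirds_homotopy :: "nat \<Rightarrow> real \<times> real \<Rightarrow> real \<times> real" where
  "thirds_homotopy i = (SOME h. continuous_on ({0..1} \<times> {0..1}) h \<and> h \<in> {0..1} \<times> {0..1} \<rightarrow> earring_tail i \<and>
     (\<forall>t\<in>{0..1}. h (0, t) = hawaiian_loop i t) \<and>
     (\<forall>t\<in>{0..1}. h (1, t) = thirds (hawaiian_loop (2 * i)) (quotient_loop i) (hawaiian_loop (Suc (2 * i))) t) \<and>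
     (\<forall>s\<in>{0..1}. h (s, 0) = (0, 0) \<and> h (s, 1) = (0, 0)))"

lemma thirds_homotopy_props:
  assumes "i \<ge> 1"
  shows "continuous_on ({0..1} \<times> {0..1}) (thirds_homotopy i)"
    "\<And>s t. s \<in> {0..1} \<Longrightarrow> t \<in> {0..1} \<Longrightarrow> thirds_homotopy i (s, t) \<in> earring_tail i"
    "\<And>t. t \<in> {0..1} \<Longrightarrow> thirds_homotopy i (0, t) = hawaiian_loop i t"
    "\<And>t. t \<in> {0..1} \<Longrightarrow> thirds_homotopy i (1, t) = thirds (hawaiian_loop (2 * i)) (quotient_loop i) (hawaiian_loop (Suc (2 * i))) t"
    "\<And>s. s \<in> {0..1} \<Longrightarrow> thirds_homotopy i (s, 0) = (0, 0)" "\<And>s. s \<in> {0..1} \<Longrightarrow> thirds_homotopy i (s, 1) = (0, 0)"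
proof -
  have "\<exists>h :: real \<times> real \<Rightarrow> real \<times> real. continuous_on ({0..1} \<times> {0..1}) h \<and> h \<in> {0..1} \<times> {0..1} \<rightarrow> earring_tail i \<and>
     (\<forall>t\<in>{0..1}. h (0, t) = hawaiian_loop i t) \<and>
     (\<forall>t\<in>{0..1}. h (1, t) = thirds (hawaiian_loop (2 * i)) (quotient_loop i) (hawaiian_loop (Suc (2 * i))) t) \<and>
     (\<forall>s\<in>{0..1}. h (s, 0) = (0, 0) \<and> h (s, 1) = (0, 0))"
    using homotopic_loop_thirds[OF assms] unfolding homotopic_paths
    by (simp add: pathstart_def pathfinish_def)
  from someI_ex[OF this] show "continuous_on ({0..1} \<times> {0..1}) (thirds_homotopy i)"
    "\<And>s t. s \<in> {0..1} \<Longrightarrow> t \<in> {0..1} \<Longrightarrow> thirds_homotopy i (s, t) \<in> earring_tail i"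
    "\<And>t. t \<in> {0..1} \<Longrightarrow> thirds_homotopy i (0, t) = hawaiian_loop i t"
    "\<And>t. t \<in> {0..1} \<Longrightarrow> thirds_homotopy i (1, t) = thirds (hawaiian_loop (2 * i)) (quotient_loop i) (hawaiian_loop (Suc (2 * i))) t"
    "\<And>s. s \<in> {0..1} \<Longrightarrow> thirds_homotopy i (s, 0) = (0, 0)" "\<And>s. s \<in> {0..1} \<Longrightarrow> thirds_homotopy i (s, 1) = (0, 0)"
    unfolding thirds_homotopy_def[symmetric] by auto
qed

text \<open>
  The first half of the time replaces circle \<open>i\<close> by its children with the quotient between them; the
  second half unfolds the children in the same way, down to depth \<open>m\<close>.
\<close>

primrec unfold_homotopy :: "nat \<Rightarrow> nat \<Rightarrow> real \<times> real \<Rightarrow> real \<times> real" where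
  "unfold_homotopy 0 i = (\<lambda>z. hawaiian_loop i (snd z))"
| "unfold_homotopy (Suc m) i = (\<lambda>z.
     if fst z \<le> 1/2 then thirds_homotopy i (2 * fst z, snd z)
     else thirds (\<lambda>t. unfold_homotopy m (2 * i) (2 * fst z - 1, t)) (quotient_loop i)
            (\<lambda>t. unfold_homotopy m (Suc (2 * i)) (2 * fst z - 1, t)) (snd z))"

lemma unfold_homotopy_boundary:
  assumes "i \<ge> 1"
  shows "t \<in> {0..1} \<Longrightarrow> unfold_homotopy m i (0, t) = hawaiian_loop i t"
    "s \<in> {0..1} \<Longrightarrow> unfold_homotopy m i (s, 0) = (0, 0)"
    "s \<in> {0..1} \<Longrightarrow> unfold_homotopy m i (s, 1) = (0, 0)"
proof -
  show "t \<in> {0..1} \<Longrightarrow> unfold_homotopy m i (0, t) = hawaiian_loop i t"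
    using assms thirds_homotopy_props(3)[OF assms] by (cases m) auto
  show "s \<in> {0..1} \<Longrightarrow> unfold_homotopy m i (s, 0) = (0, 0)" "s \<in> {0..1} \<Longrightarrow> unfold_homotopy m i (s, 1) = (0, 0)"
    using assms
    by (induction m arbitrary: i s) (auto simp: thirds_def thirds_homotopy_props)
qed

lemma unfold_homotopy_in_tail:
  "i \<ge> 1 \<Longrightarrow> s \<in> {0..1} \<Longrightarrow> t \<in> {0..1} \<Longrightarrow> unfold_homotopy m i (s, t) \<in> earring_tail i"
proof (induction m arbitrary: i s t)
  case 0
  then show ?case using loop_in_earring_tail[of i i] by (auto simp: path_image_def)
next
  case (Suc m)
  show ?case
  proof (cases "s \<le> 1/2")
    case True
    then show ?thesis using thirds_homotopy_props(2)[of i "2 * s" t] Suc.prems by simp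
  next
    case False
    have q: "quotient_loop i (3 * t - 1) \<in> earring_tail i" if "1/3 < t" "t \<le> 2/3"
      using quotient_loop_props(2)[of i] that by (auto simp: path_image_def)
    have l: "unfold_homotopy m (2 * i) (2 * s - 1, 3 * t) \<in> earring_tail i" if "t \<le> 1/3"
      using Suc.IH[of "2 * i" "2 * s - 1" "3 * t"] Suc.prems False that earring_tail_mono[of i "2 * i"] by auto
    have r: "unfold_homotopy m (Suc (2 * i)) (2 * s - 1, 3 * t - 2) \<in> earring_tail i" if "2/3 < t"
      using Suc.IH[of "Suc (2 * i)" "2 * s - 1" "3 * t - 2"] Suc.prems False that earring_tail_mono[of i "Suc (2 * i)"] by auto
    show ?thesis using False q l r by (auto simp: thirds_def)
  qed
qed

lemma continuous_on_thirds:
  fixes P Q R :: "real \<times> real \<Rightarrow> 'b::topological_space"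
  assumes S: "S \<subseteq> {0..1}" and P: "continuous_on (S \<times> {0..1}) P" and Q: "continuous_on (S \<times> {0..1}) Q" and R: "continuous_on (S \<times> {0..1}) R"
    and PQ: "\<And>s. s \<in> S \<Longrightarrow> P (s, 1) = Q (s, 0)" and QR: "\<And>s. s \<in> S \<Longrightarrow> Q (s, 1) = R (s, 0)"
  shows "continuous_on (S \<times> {0..1}) (\<lambda>z. thirds (\<lambda>t. P (fst z, t)) (\<lambda>t. Q (fst z, t)) (\<lambda>t. R (fst z, t)) (snd z))"
proof -
  let ?F = "\<lambda>z. thirds (\<lambda>t. P (fst z, t)) (\<lambda>t. Q (fst z, t)) (\<lambda>t. R (fst z, t)) (snd z)"
  let ?Z = "S \<times> {0..1::real}"
  let ?A = "{z \<in> ?Z. snd z \<le> 1/3}" and ?B = "{z \<in> ?Z. 1/3 \<le> snd z \<and> snd z \<le> 2/3}" and ?C = "{z \<in> ?Z. 2/3 \<le> snd z}"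
  have A: "continuous_on ?A ?F"
  proof (rule continuous_on_eq)
    show "continuous_on ?A (\<lambda>z. P (fst z, 3 * snd z))"
      by (rule continuous_on_compose2[OF P]) (auto intro!: continuous_intros)
  qed (auto simp: thirds_def)
  have B: "continuous_on ?B ?F"
  proof (rule continuous_on_eq)
    show "continuous_on ?B (\<lambda>z. Q (fst z, 3 * snd z - 1))"
      by (rule continuous_on_compose2[OF Q]) (auto intro!: continuous_intros)
    fix z assume z: "z \<in> ?B"
    show "Q (fst z, 3 * snd z - 1) = ?F z"
    proof (cases "snd z = 1/3")
      case True
      then obtain x where x: "z = (x, 1/3)" by (cases z) auto
      then show ?thesis using PQ[of x] z by (simp add: thirds_def)
    qed (use z in \<open>auto simp: thirds_def\<close>)
  qed
  have C: "continuous_on ?C ?F"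
  proof (rule continuous_on_eq)
    show "continuous_on ?C (\<lambda>z. R (fst z, 3 * snd z - 2))"
      by (rule continuous_on_compose2[OF R]) (auto intro!: continuous_intros)
    fix z assume z: "z \<in> ?C"
    show "R (fst z, 3 * snd z - 2) = ?F z"
    proof (cases "snd z = 2/3")
      case True
      then obtain x where x: "z = (x, 2/3)" by (cases z) auto
      then show ?thesis using QR[of x] z by (simp add: thirds_def)
    qed (use z in \<open>auto simp: thirds_def\<close>)
  qed
  have un: "?Z = ?A \<union> (?B \<union> ?C)" by auto
  have conj: "?B = {z \<in> ?Z. 1/3 \<le> snd z} \<inter> {z \<in> ?Z. snd z \<le> 2/3}" by auto
  have cl: "closedin (top_of_set ?Z) ?A" "closedin (top_of_set ?Z) ?B" "closedin (top_of_set ?Z) ?C"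
    unfolding conj by (intro closedin_Int closedin_Collect_le continuous_intros)+
  have sub: "?B \<union> ?C \<subseteq> ?Z" by auto
  have "continuous_on (?B \<union> ?C) ?F"
    by (intro continuous_on_Un_local B C closedin_subset_trans[OF cl(2) _ sub] closedin_subset_trans[OF cl(3) _ sub]) auto
  moreover have "closedin (top_of_set ?Z) (?B \<union> ?C)" using cl by (intro closedin_Un)
  ultimately have "continuous_on (?A \<union> (?B \<union> ?C)) ?F"
    using cl(1) A by (intro continuous_on_Un_local[of ?A "?B \<union> ?C"]) (simp_all only: un[symmetric])
  then show ?thesis by (simp only: un[symmetric])
qed

lemma continuous_unfold_homotopy:
  "i \<ge> 1 \<Longrightarrow> continuous_on ({0..1} \<times> {0..1}) (unfold_homotopy m i)"
proof (induction m arbitrary: i)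
  case 0
  have "continuous_on {0..1} (hawaiian_loop i)" using path_hawaiian_loop by (simp add: path_def)
  then have "continuous_on ({0..1} \<times> {0..1}) (\<lambda>z::real\<times>real. hawaiian_loop i (snd z))"
    by (rule continuous_on_compose2) (auto intro!: continuous_intros)
  then show ?case by simp
next
  case (Suc m)
  have q: "continuous_on {0..1} (quotient_loop i)" using quotient_loop_props(1) by (simp add: path_def)
  have ends: "quotient_loop i 0 = (0, 0)" "quotient_loop i 1 = (0, 0)"
    using quotient_loop_props(3,4)[of i] by (auto simp: pathstart_def pathfinish_def)
  let ?Z = "{0..1::real} \<times> {0..1::real}"
  let ?A = "{0..1/2::real} \<times> {0..1::real}" and ?B = "{1/2..1::real} \<times> {0..1::real}"
  define P where "P z = unfold_homotopy m (2 * i) (2 * fst z - 1, snd z)" for z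
  define R where "R z = unfold_homotopy m (Suc (2 * i)) (2 * fst z - 1, snd z)" for z
  have P: "continuous_on ?B P" unfolding P_def
    by (rule continuous_on_compose2[OF Suc.IH]) (use Suc.prems in \<open>auto intro!: continuous_intros\<close>)
  have R: "continuous_on ?B R" unfolding R_def
    by (rule continuous_on_compose2[OF Suc.IH]) (use Suc.prems in \<open>auto intro!: continuous_intros\<close>)
  have Q: "continuous_on ?B (\<lambda>z. quotient_loop i (snd z))"
    by (rule continuous_on_compose2[OF q]) (auto intro!: continuous_intros)
  have T: "continuous_on ?B (\<lambda>z. thirds (\<lambda>t. P (fst z, t)) (\<lambda>t. quotient_loop i (snd (fst z, t))) (\<lambda>t. R (fst z, t)) (snd z))"
    by (rule continuous_on_thirds[OF _ P Q R])
      (use Suc.prems in \<open>auto simp: P_def R_def ends unfold_homotopy_boundary\<close>)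
  have B: "continuous_on ?B (unfold_homotopy (Suc m) i)"
  proof (rule continuous_on_eq[OF T])
    fix z assume z: "z \<in> ?B"
    show "thirds (\<lambda>t. P (fst z, t)) (\<lambda>t. quotient_loop i (snd (fst z, t))) (\<lambda>t. R (fst z, t)) (snd z) = unfold_homotopy (Suc m) i z"
    proof (cases "fst z = 1/2")
      case True
      have "thirds_homotopy i (1, snd z) = thirds (hawaiian_loop (2 * i)) (quotient_loop i) (hawaiian_loop (Suc (2 * i))) (snd z)"
        using thirds_homotopy_props(4)[OF Suc.prems, of "snd z"] z by auto
      moreover have "thirds (\<lambda>t. P (fst z, t)) (\<lambda>t. quotient_loop i (snd (fst z, t))) (\<lambda>t. R (fst z, t)) (snd z) =
          thirds (hawaiian_loop (2 * i)) (quotient_loop i) (hawaiian_loop (Suc (2 * i))) (snd z)"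
        using z Suc.prems unfolding thirds_def P_def R_def True by (auto simp: unfold_homotopy_boundary)
      moreover have "unfold_homotopy (Suc m) i z = thirds_homotopy i (1, snd z)"
      proof -
        obtain y where "z = (1/2, y)" using True by (cases z) auto
        then show ?thesis by simp
      qed
      ultimately show ?thesis by (simp only:)
    next
      case False
      then have "\<not> fst z \<le> 1/2" using z by auto
      then show ?thesis by (simp add: P_def R_def)
    qed
  qed
  have S: "continuous_on ?A (\<lambda>z. thirds_homotopy i (2 * fst z, snd z))"
    by (rule continuous_on_compose2[OF thirds_homotopy_props(1)[OF Suc.prems]]) (auto intro!: continuous_intros)
  have A: "continuous_on ?A (unfold_homotopy (Suc m) i)"
    by (rule continuous_on_eq[OF S]) auto
  have un: "?Z = ?A \<union> ?B" by auto
  have cl: "closedin (top_of_set ?Z) ?A" "closedin (top_of_set ?Z) ?B"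
    by (intro closed_subset closed_Times; auto)+
  have "continuous_on (?A \<union> ?B) (unfold_homotopy (Suc m) i)"
    using cl A B by (intro continuous_on_Un_local) (simp_all only: un[symmetric])
  then show ?case by (simp only: un[symmetric])
qed

text \<open>
  Depths \<open>m\<close> and \<open>k\<close> differ only inside circles of index at least \<open>2 ^ m * i\<close>, which are small. The
  constant is shared with \<open>unfold_homotopy_end_close\<close>, whose base case accounts for it.
\<close>

lemma unfold_homotopy_close:
  "i \<ge> 1 \<Longrightarrow> m \<le> k \<Longrightarrow> s \<in> {0..1} \<Longrightarrow> t \<in> {0..1} \<Longrightarrow>
     norm (unfold_homotopy m i (s, t) - unfold_homotopy k i (s, t)) \<le> 12 / (2 ^ m * real i)"
proof (induction m arbitrary: i k s t)
  case 0
  have "norm (unfold_homotopy 0 i (s, t) - unfold_homotopy k i (s, t)) \<le> norm (unfold_homotopy 0 i (s, t)) + norm (unfold_homotopy k i (s, t))"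
    by (rule norm_triangle_ineq4)
  also have "\<dots> \<le> 4 / real i + 4 / real i"
    using 0 by (intro add_mono earring_tail_norm unfold_homotopy_in_tail) auto
  also have "\<dots> \<le> 12 / real i" using 0 by (simp add: divide_right_mono)
  finally show ?case by simp
next
  case (Suc m)
  obtain k' where k: "k = Suc k'" "m \<le> k'" using Suc.prems(2) by (cases k) auto
  show ?case
  proof (cases "s \<le> 1/2")
    case True
    then show ?thesis by (simp add: k)
  next
    case False
    have b: "12 / (2 ^ m * real (2 * i)) = 12 / (2 ^ Suc m * real i)" by simp
    have b': "12 / (2 ^ m * real (Suc (2 * i))) \<le> 12 / (2 ^ Suc m * real i)"
      using Suc.prems(1) by (intro frac_le) (auto simp: algebra_simps)
    have s: "2 * s - 1 \<in> {0..1}" using False Suc.prems by auto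
    consider "t \<le> 1/3" | "1/3 < t" "t \<le> 2/3" | "2/3 < t" by linarith
    then show ?thesis
    proof cases
      case 1
      have "norm (unfold_homotopy m (2 * i) (2 * s - 1, 3 * t) - unfold_homotopy k' (2 * i) (2 * s - 1, 3 * t)) \<le> 12 / (2 ^ m * real (2 * i))"
        using Suc.prems k 1 s by (intro Suc.IH) auto
      then show ?thesis using 1 False unfolding b by (simp add: k thirds_def)
    next
      case 2
      then show ?thesis using False by (simp add: k thirds_def)
    next
      case 3
      have "norm (unfold_homotopy m (Suc (2 * i)) (2 * s - 1, 3 * t - 2) - unfold_homotopy k' (Suc (2 * i)) (2 * s - 1, 3 * t - 2)) \<le> 12 / (2 ^ m * real (Suc (2 * i)))"
        using Suc.prems k 3 s by (intro Suc.IH) auto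
      then show ?thesis using 3 False b' by (simp add: k thirds_def)
    qed
  qed
qed

text \<open>
  At the end of the unfolding, depth \<open>m\<close> agrees with the loop along the Cantor gaps on all gaps of the
  first \<open>m\<close> levels below \<open>i\<close>; between them both are in circles of small size. For \<open>m = 0\<close> the circles
  met by \<open>tau_loop\<close> over interval \<open>i\<close> have index at least \<open>i / 2\<close>, so the two parts contribute
  \<open>4 / i\<close> and \<open>8 / i\<close>.
\<close>

lemma unfold_homotopy_end_close:
  assumes \<kappa>: "\<And>n t. n \<ge> 1 \<Longrightarrow> t \<in> {0..1} \<Longrightarrow> \<kappa> (hawaiian_loop n t) = quotient_loop n t"
  shows "i \<ge> 1 \<Longrightarrow> t \<in> {0..1} \<Longrightarrow>
     norm (unfold_homotopy m i (1, t) - \<kappa> (tau_loop (in_block i t))) \<le> 12 / (2 ^ m * real i)"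
proof (induction m arbitrary: i t)
  case 0
  obtain d r where dr: "r < 2 ^ d" "i = 2 ^ d + r" using tree_index_cases[OF 0(1)] .
  obtain n s where n: "n \<ge> 2 ^ d" "s \<in> {0..1}" "tau_loop (in_block i t) = hawaiian_loop n s"
    using tau_loop_level[OF dr(1), of t] 0(2) dr(2) by auto
  have n1: "n \<ge> 1" using n(1) one_le_power[of "2::nat" d] by linarith
  have "\<kappa> (tau_loop (in_block i t)) \<in> earring_tail n"
    using \<kappa>[OF n1 n(2)] quotient_loop_props(2)[of n] n(2,3) by (auto simp: path_image_def)
  then have "norm (\<kappa> (tau_loop (in_block i t))) \<le> 4 / real n" using n1 by (rule earring_tail_norm)
  also have "\<dots> \<le> 4 / (real i / 2)"
  proof (intro divide_left_mono)
    have "i \<le> 2 * n" using n(1) dr by linarith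
    then show "real i / 2 \<le> real n" by linarith
  qed (use n1 0(1) in auto)
  finally have "norm (\<kappa> (tau_loop (in_block i t))) \<le> 8 / real i" by simp
  moreover have "norm (unfold_homotopy 0 i (1, t)) \<le> 4 / real i"
    using 0 by (intro earring_tail_norm unfold_homotopy_in_tail) auto
  ultimately have "norm (unfold_homotopy 0 i (1, t)) + norm (\<kappa> (tau_loop (in_block i t))) \<le> 12 / real i"
    by (simp add: add_divide_distrib[symmetric])
  then show ?case using norm_triangle_ineq4[of "unfold_homotopy 0 i (1, t)" "\<kappa> (tau_loop (in_block i t))"] by simp
next
  case (Suc m)
  have b: "12 / (2 ^ m * real (2 * i)) = 12 / (2 ^ Suc m * real i)" by simp
  have b': "12 / (2 ^ m * real (Suc (2 * i))) \<le> 12 / (2 ^ Suc m * real i)"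
    using Suc.prems(1) by (intro frac_le) (auto simp: algebra_simps)
  consider "t \<le> 1/3" | "1/3 < t" "t \<le> 2/3" | "2/3 < t" by linarith
  then show ?case
  proof cases
    case 1
    have "norm (unfold_homotopy m (2 * i) (1, 3 * t) - \<kappa> (tau_loop (in_block (2 * i) (3 * t)))) \<le> 12 / (2 ^ m * real (2 * i))"
      using Suc.prems 1 by (intro Suc.IH) auto
    then show ?thesis using 1 in_block_child(1)[OF Suc.prems(1), of "3 * t"] unfolding b by (simp add: thirds_def)
  next
    case 2
    have "tau_loop (in_block i t) = hawaiian_loop i (3 * t - 1)" using 2 Suc.prems by (intro tau_loop_in_block) auto
    then show ?thesis using 2 \<kappa>[OF Suc.prems(1), of "3 * t - 1"] by (simp add: thirds_def)
  next
    case 3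
    have "norm (unfold_homotopy m (Suc (2 * i)) (1, 3 * t - 2) - \<kappa> (tau_loop (in_block (Suc (2 * i)) (3 * t - 2)))) \<le> 12 / (2 ^ m * real (Suc (2 * i)))"
      using Suc.prems 3 by (intro Suc.IH) auto
    moreover have "in_block (Suc (2 * i)) (3 * t - 2) = in_block i t"
      using in_block_child(2)[OF Suc.prems(1), of "3 * t - 2"] by (simp add: diff_divide_distrib)
    ultimately show ?thesis using 3 b' by (simp add: thirds_def)
  qed
qed

lemma closed_hawaiian_earring: "closed hawaiian_earring"
  unfolding closed_def
proof (subst open_subopen, intro ballI)
  fix z assume z: "z \<in> - hawaiian_earring"
  then have "z \<noteq> 0" using hawaiian_origin_in by (auto simp: zero_prod_def)
  define e where "e = norm z / 2"
  have e: "e > 0" using \<open>z \<noteq> 0\<close> by (simp add: e_def)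
  obtain M :: nat where M: "4 / e < M" using reals_Archimedean2 by blast
  let ?T = "ball z e \<inter> - (\<Union>n\<in>{1..M}. path_image (hawaiian_loop n))"
  have "open ?T" by (intro open_Int open_Compl closed_UN ballI closed_path_image) auto
  moreover have "z \<notin> path_image (hawaiian_loop n)" if "n \<in> {1..M}" for n
    using that z hawaiian_loop_image_subset[of n] by auto
  then have "z \<in> ?T" using e by auto
  moreover have "?T \<subseteq> - hawaiian_earring"
  proof
    fix w assume w: "w \<in> ?T"
    show "w \<in> - hawaiian_earring"
    proof
      assume "w \<in> hawaiian_earring"
      then obtain n t where n: "n \<ge> 1" "t \<in> {0..1}" "w = hawaiian_loop n t" using hawaiian_earring_cases by blast
      have "norm w > e" using w norm_triangle_ineq2[of z w] unfolding e_def by (auto simp: dist_norm)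
      moreover have "norm w \<le> 4 / n" unfolding n(3) by (rule norm_hawaiian_loop)
      ultimately have "e < 4 / n" by simp
      then have "n < 4 / e" using e n(1) by (simp add: field_simps)
      then have "n \<le> M" using M by linarith
      moreover have "w \<in> path_image (hawaiian_loop n)" using n(2,3) by (simp add: path_image_def)
      ultimately show False using w n(1) by auto
    qed
  qed
  ultimately show "\<exists>T. open T \<and> z \<in> T \<and> T \<subseteq> - hawaiian_earring" by blast
qed

text \<open>
  The unfoldings of circle \<open>1\<close> converge uniformly to a homotopy, which stays in the earring because the
  earring is closed.
\<close>

lemma homotopic_telescope:
  assumes \<kappa>: "\<And>n t. n \<ge> 1 \<Longrightarrow> t \<in> {0..1} \<Longrightarrow> \<kappa> (hawaiian_loop n t) = quotient_loop n t"
  shows "homotopic_paths hawaiian_earring (hawaiian_loop 1) (\<kappa> \<circ> tau_loop)"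
proof -
  let ?Z = "{0..1::real} \<times> {0..1::real}"
  let ?h = "\<lambda>m. unfold_homotopy m 1"
  have close: "norm (?h m z - ?h k z) \<le> 12 / 2 ^ m" if "z \<in> ?Z" "m \<le> k" for m k z
    using that unfold_homotopy_close[of 1 m k "fst z" "snd z"] by auto
  have small: "\<exists>m. 12 / 2 ^ m < e" if "e > 0" for e :: real
  proof -
    have "\<exists>m. (1/2) ^ m < e / 12" using that by (intro real_arch_pow_inv) auto
    then obtain m where "(1/2) ^ m < e / 12" by blast
    then show ?thesis by (intro exI[of _ m]) (simp add: field_simps)
  qed
  have "Cauchy (\<lambda>m. ?h m z)" if z: "z \<in> ?Z" for z
  proof (rule metric_CauchyI)
    fix e :: real assume "e > 0"
    then obtain M where M: "12 / 2 ^ M < e / 2" using small half_gt_zero by blast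
    have "dist (?h m z) (?h n z) < e" if "m \<ge> M" "n \<ge> M" for m n
    proof -
      have "norm (?h M z - ?h m z) < e / 2" "norm (?h M z - ?h n z) < e / 2"
        using close[OF z that(1)] close[OF z that(2)] M by linarith+
      then have "dist (?h m z) (?h M z) < e / 2" "dist (?h n z) (?h M z) < e / 2" by (auto simp: dist_norm norm_minus_commute)
      then show ?thesis by (rule dist_triangle_half_l)
    qed
    then show "\<exists>M. \<forall>m\<ge>M. \<forall>n\<ge>M. dist (?h m z) (?h n z) < e" by blast
  qed
  then have "\<exists>l. (\<lambda>m. ?h m z) \<longlonglongrightarrow> l" if "z \<in> ?Z" for z
    using that Cauchy_convergent unfolding convergent_def by blast
  then obtain L where L: "\<And>z. z \<in> ?Z \<Longrightarrow> (\<lambda>m. ?h m z) \<longlonglongrightarrow> L z" by metis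
  have dL: "norm (?h m z - L z) \<le> 12 / 2 ^ m" if z: "z \<in> ?Z" for m z
  proof (rule Lim_bounded)
    show "(\<lambda>k. norm (?h m z - ?h k z)) \<longlonglongrightarrow> norm (?h m z - L z)" using L[OF z] by (intro tendsto_intros)
    show "\<forall>k\<ge>m. norm (?h m z - ?h k z) \<le> 12 / 2 ^ m" using close[OF z] by blast
  qed
  have "uniform_limit ?Z ?h L sequentially"
  proof (rule uniform_limitI)
    fix e :: real assume "e > 0"
    then obtain M where M: "12 / 2 ^ M < e" using small by blast
    have "dist (?h m z) (L z) < e" if "m \<ge> M" "z \<in> ?Z" for m z
    proof -
      have "norm (?h m z - L z) \<le> 12 / 2 ^ m" by (rule dL[OF that(2)])
      also have "\<dots> \<le> 12 / 2 ^ M" using that(1) by (intro divide_left_mono power_increasing) auto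
      finally show ?thesis using M by (simp add: dist_norm)
    qed
    then show "\<forall>\<^sub>F m in sequentially. \<forall>z\<in>?Z. dist (?h m z) (L z) < e" unfolding eventually_sequentially by blast
  qed
  then have contL: "continuous_on ?Z L"
    by (rule uniform_limit_theorem[where f = ?h and F = sequentially, rotated])
      (use continuous_unfold_homotopy[of 1] in auto)
  have const: "L z = c" if "z \<in> ?Z" "\<And>m. ?h m z = c" for z c
    using LIMSEQ_unique[OF L[OF that(1)]] that(2) by simp
  have L0: "L (0, t) = hawaiian_loop 1 t" if "t \<in> {0..1}" for t
    using that unfold_homotopy_boundary(1)[of 1 t] by (intro const) auto
  have Lends: "L (s, 0) = (0, 0)" "L (s, 1) = (0, 0)" if "s \<in> {0..1}" for s
    using that unfold_homotopy_boundary(2,3)[of 1 s] by (auto intro!: const)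
  have L1: "L (1, t) = \<kappa> (tau_loop t)" if t: "t \<in> {0..1}" for t
  proof (rule LIMSEQ_unique[OF L])
    show "(\<lambda>m. ?h m (1, t)) \<longlonglongrightarrow> \<kappa> (tau_loop t)"
    proof (rule metric_LIMSEQ_I)
      fix e :: real assume "e > 0"
      then obtain M where M: "12 / 2 ^ M < e" using small by blast
      have "dist (?h m (1, t)) (\<kappa> (tau_loop t)) < e" if "m \<ge> M" for m
      proof -
        have "norm (?h m (1, t) - \<kappa> (tau_loop t)) \<le> 12 / 2 ^ m"
          using unfold_homotopy_end_close[of \<kappa> 1 t m, OF \<kappa>] t by simp
        also have "\<dots> \<le> 12 / 2 ^ M" using that by (intro divide_left_mono power_increasing) auto
        finally show ?thesis using M by (simp add: dist_norm)
      qed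
      then show "\<exists>M. \<forall>m\<ge>M. dist (?h m (1, t)) (\<kappa> (tau_loop t)) < e" by blast
    qed
  qed (use t in auto)
  have "L z \<in> hawaiian_earring" if z: "z \<in> ?Z" for z
  proof (rule closed_sequentially[OF closed_hawaiian_earring _ L[OF z]])
    show "?h m z \<in> hawaiian_earring" for m
      using unfold_homotopy_in_tail[of 1 "fst z" "snd z" m] earring_tail_subset[of 1] z by auto
  qed
  then show ?thesis
    unfolding homotopic_paths
    using contL L0 L1 Lends tau_loop_loop(3,4) \<kappa>[of 1 0]
    by (intro exI[of _ L]) (auto simp: pathstart_def pathfinish_def)
qed

text \<open>
  A map of the earring that runs through \<open>A i\<close> on circle \<open>i\<close> carries \<open>homotopic_telescope\<close> over to \<open>A\<close>.
\<close>

lemma telescoping: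
  fixes X :: "'a::topological_space set"
  assumes "null_loops w X A"
  obtains g where "continuous_on hawaiian_earring g" "g \<in> hawaiian_earring \<rightarrow> X"
    "\<And>i t. i \<ge> 1 \<Longrightarrow> t \<in> {0..1} \<Longrightarrow>
      g (hawaiian_loop i t) = (reversepath (A (2 * i)) +++ (A i +++ reversepath (A (Suc (2 * i))))) t"
    "homotopic_paths X (A 1) (g \<circ> tau_loop)"
proof -
  obtain gA where gA: "continuous_on hawaiian_earring gA" "gA \<in> hawaiian_earring \<rightarrow> X"
    "\<And>n t. n \<ge> 1 \<Longrightarrow> t \<in> {0..1} \<Longrightarrow> gA (hawaiian_loop n t) = A n t"
    using hawaiian_extension[OF assms] by blast
  obtain \<kappa> where \<kappa>: "continuous_on hawaiian_earring \<kappa>" "\<kappa> \<in> hawaiian_earring \<rightarrow> hawaiian_earring"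
    "\<And>n t. n \<ge> 1 \<Longrightarrow> t \<in> {0..1} \<Longrightarrow> \<kappa> (hawaiian_loop n t) = quotient_loop n t"
    using hawaiian_extension[OF null_quotient_loops] by blast
  show ?thesis
  proof (rule that[of "gA \<circ> \<kappa>"])
    show "continuous_on hawaiian_earring (gA \<circ> \<kappa>)"
      using \<kappa> by (intro continuous_on_compose continuous_on_subset[OF gA(1)]) auto
    show "gA \<circ> \<kappa> \<in> hawaiian_earring \<rightarrow> X" using gA(2) \<kappa>(2) by auto
    show "(gA \<circ> \<kappa>) (hawaiian_loop i t) = (reversepath (A (2 * i)) +++ (A i +++ reversepath (A (Suc (2 * i))))) t"
      if it: "i \<ge> 1" "t \<in> {0..1}" for i t
      using gA(3)[of "2 * i"] gA(3)[of i] gA(3)[of "Suc (2 * i)"] it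
      by (auto simp: \<kappa>(3) quotient_loop_def joinpaths_def reversepath_def)
    have "homotopic_paths X (gA \<circ> hawaiian_loop 1) (gA \<circ> (\<kappa> \<circ> tau_loop))"
      by (rule homotopic_paths_continuous_image[OF homotopic_telescope[OF \<kappa>(3)] gA(1,2)])
    moreover have "homotopic_paths X (A 1) (gA \<circ> hawaiian_loop 1)"
      using assms gA(3)[of 1] unfolding null_loops_def loops_at_def by (intro homotopic_paths_eq) auto
    ultimately show "homotopic_paths X (A 1) ((gA \<circ> \<kappa>) \<circ> tau_loop)"
      using homotopic_paths_trans by (auto simp: comp_assoc)
  qed
qed

section \<open>Closedness in terms of holonomy\<close>

lemma induced_hom_hom:
  assumes "continuous_on Y F" "F \<in> Y \<rightarrow> X" "F y = x"
  shows "induced_hom X F \<in> hom (fundamental_group Y y) (fundamental_group X x)"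
proof (rule homI)
  have loop: "F \<circ> p \<in> loops_at X x" if "p \<in> loops_at Y y" for p
    using loops_atD[OF that] assms path_continuous_image[of p F] continuous_on_subset[OF assms(1)]
    by (fastforce simp: loops_at_def path_image_compose pathstart_compose pathfinish_compose)
  fix a b assume a: "a \<in> carrier (fundamental_group Y y)" and b: "b \<in> carrier (fundamental_group Y y)"
  then obtain p q where p: "p \<in> loops_at Y y" "a = path_class Y p" and q: "q \<in> loops_at Y y" "b = path_class Y q"
    by (auto simp: fundamental_group_def)
  have pq: "p +++ q \<in> loops_at Y y" using p q by (auto simp: loops_at_def path_image_join)
  show "induced_hom X F a \<in> carrier (fundamental_group X x)"
    using loop[OF p(1)] unfolding p(2) induced_hom_path_class[OF p(1) assms(1,2)] by (simp add: fundamental_group_def)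
  show "induced_hom X F (a \<otimes>\<^bsub>fundamental_group Y y\<^esub> b) = induced_hom X F a \<otimes>\<^bsub>fundamental_group X x\<^esub> induced_hom X F b"
    unfolding p(2) q(2) fundamental_group_mult[OF p(1) q(1)] induced_hom_path_class[OF pq assms(1,2)]
      induced_hom_path_class[OF p(1) assms(1,2)] induced_hom_path_class[OF q(1) assms(1,2)]
      fundamental_group_mult[OF loop[OF p(1)] loop[OF q(1)]] path_compose_join ..
qed

lemma induced_hom_generate_subset:
  assumes F: "continuous_on Y F" "F \<in> Y \<rightarrow> X" "F y = x" and y: "y \<in> Y"
    and K: "subgroup K (fundamental_group X x)" and S: "S \<subseteq> carrier (fundamental_group Y y)"
  shows "induced_hom X F ` generate (fundamental_group Y y) S \<subseteq> K \<longleftrightarrow> induced_hom X F ` S \<subseteq> K"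
proof -
  have "x \<in> X" using F y by auto
  interpret group_hom "fundamental_group Y y" "fundamental_group X x" "induced_hom X F"
    using group_fundamental_group[OF y] group_fundamental_group[OF \<open>x \<in> X\<close>] induced_hom_hom[OF F]
    by (simp add: group_hom_def group_hom_axioms_def)
  have img: "induced_hom X F ` generate (fundamental_group Y y) S = generate (fundamental_group X x) (induced_hom X F ` S)"
    using generate_img[OF S] by simp
  show ?thesis
    unfolding img using H.generate_subgroup_incl[OF _ K] generate.incl[of _ "induced_hom X F ` S"] by blast
qed

lemma (in group) subgroup_conjugate:
  assumes "subgroup K G" and h [simp]: "h \<in> carrier G"
  shows "subgroup {a \<in> carrier G. h \<otimes> a \<otimes> inv h \<in> K} G"
proof -
  interpret K: subgroup K G by fact
  have prod: "h \<otimes> (a \<otimes> b) \<otimes> inv h = (h \<otimes> a \<otimes> inv h) \<otimes> (h \<otimes> b \<otimes> inv h)" if "a \<in> carrier G" "b \<in> carrier G" for a b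
    using that by (simp add: m_assoc inv_mult_cancel)
  have inv: "h \<otimes> inv a \<otimes> inv h = inv (h \<otimes> a \<otimes> inv h)" if "a \<in> carrier G" for a
    using that by (simp add: inv_mult_group m_assoc)
  show ?thesis
  proof (rule subgroupI)
    have "\<one> \<in> {a \<in> carrier G. h \<otimes> a \<otimes> inv h \<in> K}" using K.one_closed by simp
    then show "{a \<in> carrier G. h \<otimes> a \<otimes> inv h \<in> K} \<noteq> {}" by blast
  qed (auto simp: prod inv)
qed

definition dyadic_boundary :: "real \<Rightarrow> real \<times> real" where
  "dyadic_boundary = tree_arc 1 +++ reversepath base_path"

lemma dyadic_boundary_loop: "dyadic_boundary \<in> loops_at dyadic_space (0, 0)"
  using base_path path_image_tree_arc[of 1] unfolding dyadic_boundary_def loops_at_def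
  by (auto simp: path_image_join)

lemma d_infinity_eq: "d_infinity = path_class dyadic_space dyadic_boundary"
  unfolding d_infinity_def dyadic_boundary_def tree_arc_one ..

context normal_pi1
begin

lemma loop_compose:
  assumes "continuous_on S f" "f \<in> S \<rightarrow> X" "f s = x0" "p \<in> loops_at S s"
  shows "f \<circ> p \<in> loops_at X x0"
  using loops_atD[OF assms(4)] assms path_in_compose[of S f p]
  by (auto simp: loops_at_def pathstart_compose pathfinish_compose)

text \<open>
  For the trivial subgroup, holonomy determines homotopy classes of loops.
\<close>

lemma class_eqI:
  assumes "N = {\<one>\<^bsub>G\<^esub>}" "p \<in> loops_at X x0" "q \<in> loops_at X x0" "hol p = hol q"
  shows "path_class X p = path_class X q"
proof -
  note P = loops_atD[OF assms(2)] and R = loops_atD[OF assms(3)]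
  have rq: "reversepath q \<in> loops_at X x0" using R by (auto simp: loops_at_def)
  have pq: "p +++ reversepath q \<in> loops_at X x0" using P R by (auto simp: loops_at_def path_image_join)
  have "hol (p +++ reversepath q) = hol p \<otimes>\<^bsub>Q\<^esub> hol (reversepath q)" using P R by (intro hol_join) auto
  also have "\<dots> = \<one>\<^bsub>Q\<^esub>" using P R hol_carrier[of q] by (simp add: hol_reverse assms(4))
  finally have "path_class X (p +++ reversepath q) \<in> N" using hol_one_iff[OF pq] by blast
  then have "path_class X p \<otimes>\<^bsub>G\<^esub> inv\<^bsub>G\<^esub> (path_class X q) = \<one>\<^bsub>G\<^esub>"
    by (simp add: assms(1) fundamental_group_mult[OF assms(2) rq, symmetric] path_class_inv[OF assms(3) x0])
  then show ?thesis using class_carrier[OF assms(2)] class_carrier[OF assms(3)]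
    by (metis G.inv_closed G.inv_equality G.inv_inv)
qed

lemma dyadic_induced_subset:
  assumes f: "dyadic_map f" "f (0, 0) = x0"
  shows "induced_hom X f ` dyadic_subgroup \<subseteq> K \<longleftrightarrow>
    (\<forall>q. standard_concat q \<and> pathstart q = (0, 0) \<and> pathfinish q = (0, 0) \<longrightarrow> path_class X (f \<circ> q) \<in> K)"
proof -
  have "induced_hom X f (path_class dyadic_space q) = path_class X (f \<circ> q)"
    if "standard_concat q \<and> pathstart q = (0, 0) \<and> pathfinish q = (0, 0)" for q
    using that standard_concat_props[of q] f by (intro induced_hom_path_class[of _ _ "(0,0)"]) (auto simp: loops_at_def)
  then show ?thesis unfolding dyadic_subgroup_def dyadic_base_def by (auto simp: image_subset_iff)
qed

lemma induced_d_infinity: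
  assumes "dyadic_map f"
  shows "induced_hom X f d_infinity = path_class X (f \<circ> dyadic_boundary)"
  unfolding d_infinity_eq using assms dyadic_boundary_loop by (intro induced_hom_path_class) auto

lemma hol_dyadic_boundary:
  assumes f: "dyadic_map f"
  shows "hol (f \<circ> dyadic_boundary) = hol (f \<circ> tree_arc 1) \<otimes>\<^bsub>Q\<^esub> inv\<^bsub>Q\<^esub> hol (f \<circ> base_path)"
  unfolding dyadic_boundary_def
  using hol_compose_join[OF f, of "tree_arc 1" "reversepath base_path"] hol_compose_reverse[OF f, of base_path]
    base_path path_image_tree_arc[of 1] by simp

lemma splice_map:
  assumes "dyadic_map f" "path_in c" "pathfinish c = f (0, 0)"
  shows "dyadic_map (splice_path c f)" "splice_path c f (0, 0) = pathstart c"
    "hol (splice_path c f \<circ> tree_arc 1) = hol c \<otimes>\<^bsub>Q\<^esub> hol (f \<circ> tree_arc 1)"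
    "hol (splice_path c f \<circ> base_path) = hol c \<otimes>\<^bsub>Q\<^esub> hol (f \<circ> base_path)"
proof -
  show g: "dyadic_map (splice_path c f)"
    using continuous_splice_path[of f c] splice_path_in[of f X c] assms by auto
  show "splice_path c f (0, 0) = pathstart c" by (simp add: splice_path_start pathstart_def)
  have "hol (splice_path c f \<circ> tree_arc 1) = hol (c +++ (f \<circ> tree_arc 1))"
    using splice_path_top dyadic_map_arc[OF g, of 1] by (intro hol_cong) auto
  also have "\<dots> = hol c \<otimes>\<^bsub>Q\<^esub> hol (f \<circ> tree_arc 1)"
    using assms dyadic_map_arc[OF assms(1), of 1] by (intro hol_join) (auto simp: pathstart_compose)
  finally show "hol (splice_path c f \<circ> tree_arc 1) = hol c \<otimes>\<^bsub>Q\<^esub> hol (f \<circ> tree_arc 1)" .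
  have "hol (splice_path c f \<circ> base_path) = hol (c +++ (f \<circ> base_path))"
    using splice_path_base_path dyadic_map_path[OF g base_path(1,2)] by (intro hol_cong) auto
  also have "\<dots> = hol c \<otimes>\<^bsub>Q\<^esub> hol (f \<circ> base_path)"
    using assms dyadic_map_path[OF assms(1) base_path(1,2)] base_path by (intro hol_join) (auto simp: pathstart_compose)
  finally show "hol (splice_path c f \<circ> base_path) = hol c \<otimes>\<^bsub>Q\<^esub> hol (f \<circ> base_path)" .
qed

text \<open>
  A test map sends the standard loops into \<open>N\<close> iff it is additive. An additive map with a base value
  other than \<open>x0\<close> is turned into a test map by prefixing a path from \<open>x0\<close>, which multiplies the
  holonomies of the top arc and of the base by the same factor.
\<close>

theorem dyadic_closed_iff:
  "test_closed dyadic_space dyadic_base dyadic_subgroup d_infinity X x0 N \<longleftrightarrow>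
   (\<forall>f. dyadic_map f \<and> additive f \<longrightarrow> hol (f \<circ> tree_arc 1) = hol (f \<circ> base_path))"
    (is "?closed \<longleftrightarrow> ?crit")
proof
  assume closed: ?closed
  show ?crit
  proof (intro allI impI; elim conjE)
    fix f assume f: "continuous_on dyadic_space f" "f \<in> dyadic_space \<rightarrow> X" and add: "additive f"
    then have fm: "dyadic_map f" by simp
    have f0: "f (0, 0) \<in> X" using f dyadic_base_in by auto
    define c where "c = chosen_path (f (0, 0))"
    have c: "path_in c" "pathstart c = x0" "pathfinish c = f (0, 0)" using chosen_path[OF f0] by (auto simp: c_def)
    let ?g = "splice_path c f"
    note g = splice_map[OF fm c(1,3)]
    have cc: "hol c \<in> carrier Q" using c(1) by (rule hol_carrier)
    have "path_class X (?g \<circ> q) \<in> N" if q: "standard_concat q" "pathstart q = (0, 0)" "pathfinish q = (0, 0)" for q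
    proof -
      obtain q' where q': "q' = (\<lambda>_. (0, 0)) \<or> standard_concat q'" "pathstart q' = (0, 0)" "pathfinish q' = (0, 0)"
        "hol (?g \<circ> q) = hol c \<otimes>\<^bsub>Q\<^esub> hol (f \<circ> q') \<otimes>\<^bsub>Q\<^esub> inv\<^bsub>Q\<^esub> hol c"
        using splice_standard_loop[OF fm c(1,3) q] by blast
      have "hol (f \<circ> q') = \<one>\<^bsub>Q\<^esub>"
      proof (cases "standard_concat q'")
        case True
        show ?thesis by (rule hol_standard_loop[OF fm add True]) (simp add: q'(2,3))
      next
        case False
        then have "q' = (\<lambda>_. (0, 0))" using q'(1) by blast
        then show ?thesis using f0 by (simp add: comp_def)
      qed
      then have "hol (?g \<circ> q) = \<one>\<^bsub>Q\<^esub>" using q'(4) cc by simp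
      moreover have "?g \<circ> q \<in> loops_at X x0"
        using standard_concat_props[OF q(1)] q g(1,2) c(2) by (intro loop_compose[of dyadic_space _ "(0,0)"]) (auto simp: loops_at_def)
      ultimately show ?thesis using hol_one_iff by blast
    qed
    then have "induced_hom X ?g ` dyadic_subgroup \<subseteq> N"
      using dyadic_induced_subset[OF g(1)] g(2) c(2) by simp
    then have "induced_hom X ?g d_infinity \<in> N"
      using closed g(1,2) c(2) unfolding test_closed_def dyadic_base_def by simp
    then have "hol (?g \<circ> dyadic_boundary) = \<one>\<^bsub>Q\<^esub>"
      unfolding induced_d_infinity[OF g(1)]
      using hol_one_iff[OF loop_compose[OF _ _ _ dyadic_boundary_loop]] g(1,2) c(2) by simp
    then have "hol (?g \<circ> tree_arc 1) = hol (?g \<circ> base_path)"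
      unfolding hol_dyadic_boundary[OF g(1)]
      using arc_carrier[OF g(1), of 1] hol_compose_carrier[OF g(1) base_path(1,2)] Q.inv_equality by fastforce
    then show "hol (f \<circ> tree_arc 1) = hol (f \<circ> base_path)"
      unfolding g(3,4) using cc arc_carrier[OF fm, of 1] hol_compose_carrier[OF fm base_path(1,2)]
      by (simp add: Q.l_cancel_iff)
  qed
next
  assume crit: ?crit
  show ?closed
    unfolding test_closed_def
  proof (intro conjI allI impI; (elim conjE)?)
    show "subgroup N G" by (rule N.subgroup_axioms)
    fix f assume f: "continuous_on dyadic_space f" "f \<in> dyadic_space \<rightarrow> X" "f dyadic_base = x0"
      and D: "induced_hom X f ` dyadic_subgroup \<subseteq> N"
    then have fm: "dyadic_map f" and f0: "f (0, 0) = x0" by (auto simp: dyadic_base_def)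
    have "additive f"
    proof (rule additiveI[OF fm])
      fix q assume q: "standard_concat q" "pathstart q = (0, 0)" "pathfinish q = (0, 0)"
      have "f \<circ> q \<in> loops_at X x0"
        using standard_concat_props[OF q(1)] q fm f0 by (intro loop_compose[of dyadic_space _ "(0,0)"]) (auto simp: loops_at_def)
      moreover have "path_class X (f \<circ> q) \<in> N" using D q dyadic_induced_subset[OF fm f0] by blast
      ultimately show "hol (f \<circ> q) = \<one>\<^bsub>Q\<^esub>" using hol_one_iff by blast
    qed
    then have "hol (f \<circ> tree_arc 1) = hol (f \<circ> base_path)" using crit fm by blast
    then have "hol (f \<circ> dyadic_boundary) = \<one>\<^bsub>Q\<^esub>"
      unfolding hol_dyadic_boundary[OF fm] using hol_compose_carrier[OF fm base_path(1,2)] by simp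
    then show "induced_hom X f d_infinity \<in> N"
      unfolding induced_d_infinity[OF fm]
      using hol_one_iff[OF loop_compose[OF _ _ _ dyadic_boundary_loop]] fm f0 by simp
  qed
qed

end

lemma hawaiian_plus_cases:
  assumes "z \<in> hawaiian_plus"
  shows "fst z \<le> 0 \<Longrightarrow> - 1 \<le> fst z \<and> snd z = 0" "0 \<le> fst z \<Longrightarrow> z \<in> hawaiian_earring"
proof -
  have H: "0 \<le> fst z \<and> (fst z = 0 \<longrightarrow> z = (0, 0))" if zH: "z \<in> hawaiian_earring"
  proof -
    obtain n t where n: "n \<ge> 1" "t \<in> {0..1}" "z = hawaiian_loop n t" using hawaiian_earring_cases[OF zH] .
    obtain x y where xy: "z = (x, y)" by (cases z)
    have e: "n * (x\<^sup>2 + y\<^sup>2) = 2 * x" using hawaiian_loop_circle[of n t] unfolding n(3)[symmetric] xy by simp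
    have "0 \<le> real n * (x\<^sup>2 + y\<^sup>2)" by simp
    then show ?thesis using e n(1) xy by auto
  qed
  show "fst z \<le> 0 \<Longrightarrow> - 1 \<le> fst z \<and> snd z = 0" using assms H by (auto simp: hawaiian_plus_def)
  show "0 \<le> fst z \<Longrightarrow> z \<in> hawaiian_earring" using assms hawaiian_origin_in by (auto simp: hawaiian_plus_def)
qed

lemma hawaiian_plus_base_in: "hawaiian_plus_base \<in> hawaiian_plus"
  by (simp add: hawaiian_plus_def hawaiian_plus_base_def)

lemma earring_subset_plus: "hawaiian_earring \<subseteq> hawaiian_plus" by (simp add: hawaiian_plus_def)

text \<open>
  The whisker is there to move the base point: this map runs through \<open>c\<close> along the whisker.
\<close>

definition whisker_map :: "(real \<Rightarrow> 'a) \<Rightarrow> (real \<times> real \<Rightarrow> 'a) \<Rightarrow> real \<times> real \<Rightarrow> 'a" where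
  "whisker_map c f z = (if fst z \<le> 0 then c (fst z + 1) else f z)"

lemma whisker_map_earring:
  assumes "c 1 = f (0, 0)" "z \<in> hawaiian_earring"
  shows "whisker_map c f z = f z"
proof (cases "fst z \<le> 0")
  case True
  have z: "z \<in> hawaiian_plus" using assms(2) earring_subset_plus by blast
  have "fst z \<ge> 0"
  proof -
    obtain n t where nt: "n \<ge> 1" "t \<in> {0..1}" and n: "z = hawaiian_loop n t" using hawaiian_earring_cases[OF assms(2)] .
    have "cos (2 * pi * t) \<le> 1" by simp
    then show ?thesis unfolding n hawaiian_loop_alt by (simp only: fst_conv) (intro divide_nonneg_nonneg, auto)
  qed
  then have "z = (0, 0)" using True hawaiian_plus_cases(1)[OF z True] by (cases z) auto
  then show ?thesis using assms(1) by (simp add: whisker_map_def)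
qed (simp add: whisker_map_def)

lemma continuous_whisker_map:
  assumes f: "continuous_on hawaiian_earring f" and c: "path c" "pathfinish c = f (0, 0)"
  shows "continuous_on hawaiian_plus (whisker_map c f)"
proof -
  let ?A = "{z \<in> hawaiian_plus. fst z \<le> 0}" and ?B = "{z \<in> hawaiian_plus. 0 \<le> fst z}"
  have c1: "c 1 = f (0, 0)" using c(2) by (simp add: pathfinish_def)
  have "continuous_on ?A (\<lambda>z. c (fst z + 1))"
  proof (rule continuous_on_compose2[of "{0..1}" c])
    show "continuous_on {0..1} c" using c(1) by (simp add: path_def)
    show "(\<lambda>z. fst z + 1) ` ?A \<subseteq> {0..1}"
    proof (rule image_subsetI)
      fix z assume "z \<in> ?A"
      then show "fst z + 1 \<in> {0..1}" using hawaiian_plus_cases(1)[of z] by simp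
    qed
  qed (intro continuous_intros)
  then have A: "continuous_on ?A (whisker_map c f)" by (rule continuous_on_eq) (simp add: whisker_map_def)
  have "?B \<subseteq> hawaiian_earring" using hawaiian_plus_cases(2) by blast
  then have B: "continuous_on ?B (whisker_map c f)"
    using whisker_map_earring[of c f, OF c1] by (intro continuous_on_eq[OF continuous_on_subset[OF f]]) auto
  have un: "hawaiian_plus = ?A \<union> ?B" by auto
  have cl: "closedin (top_of_set hawaiian_plus) ?A" "closedin (top_of_set hawaiian_plus) ?B"
    by (intro closedin_Collect_le continuous_intros)+
  have "continuous_on (?A \<union> ?B) (whisker_map c f)"
    using cl A B by (intro continuous_on_Un_local) (simp_all only: un[symmetric])
  then show ?thesis by (simp only: un[symmetric])
qed

lemma whisker_props: "path whisker" "path_image whisker \<subseteq> hawaiian_plus" "pathstart whisker = hawaiian_plus_base" "pathfinish whisker = (0, 0)"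
  unfolding whisker_def[abs_def] path_def path_image_def pathstart_def pathfinish_def
  by (auto intro!: continuous_intros simp: hawaiian_plus_def hawaiian_plus_base_def)

definition lasso :: "(real \<Rightarrow> real \<times> real) \<Rightarrow> (real \<Rightarrow> real \<times> real) \<Rightarrow> real \<Rightarrow> real \<times> real" where
  "lasso p q = whisker +++ p +++ reversepath q +++ reversepath whisker"

lemma lasso_loop:
  assumes "p \<in> loops_at hawaiian_earring (0, 0)" "q \<in> loops_at hawaiian_earring (0, 0)"
  shows "lasso p q \<in> loops_at hawaiian_plus hawaiian_plus_base"
  using loops_atD[OF assms(1)] loops_atD[OF assms(2)] whisker_props earring_subset_plus
  unfolding lasso_def loops_at_def by (auto simp: path_image_join)

lemma hawaiian_loop_in_loops: "n \<ge> 1 \<Longrightarrow> hawaiian_loop n \<in> loops_at hawaiian_earring (0, 0)"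
  using hawaiian_loop_image_subset[of n] by (simp add: loops_at_def)

lemma tau_in_loops: "f_odd \<circ> tau_loop \<in> loops_at hawaiian_earring (0, 0)" "f_even \<circ> tau_loop \<in> loops_at hawaiian_earring (0, 0)"
proof -
  have "f \<circ> tau_loop \<in> loops_at hawaiian_earring (0, 0)"
    if "continuous_on hawaiian_earring f" "f \<in> hawaiian_earring \<rightarrow> hawaiian_earring" "f (0, 0) = (0, 0)" for f
    using that tau_loop_loop path_continuous_image[of tau_loop f] continuous_on_subset[OF that(1), of "path_image tau_loop"]
    by (auto simp: loops_at_def path_image_compose pathstart_compose pathfinish_compose) (auto simp: pathstart_def pathfinish_def)
  then show "f_odd \<circ> tau_loop \<in> loops_at hawaiian_earring (0, 0)" "f_even \<circ> tau_loop \<in> loops_at hawaiian_earring (0, 0)"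
    using f_odd_props f_even_props by auto
qed

lemma p_elem_eq: "p_elem n = path_class hawaiian_plus (lasso (hawaiian_loop (2 * n - 1)) (hawaiian_loop (2 * n)))"
  by (simp add: p_elem_def lasso_def)

lemma p_tau_eq: "p_tau = path_class hawaiian_plus (lasso (f_odd \<circ> tau_loop) (f_even \<circ> tau_loop))"
  by (simp add: p_tau_def lasso_def)

context normal_pi1
begin

lemma P_induced_subset:
  assumes f: "continuous_on hawaiian_plus f" "f \<in> hawaiian_plus \<rightarrow> X" "f hawaiian_plus_base = x0" and K: "subgroup K G"
  shows "induced_hom X f ` P_subgroup \<subseteq> K \<longleftrightarrow>
    (\<forall>n\<ge>1. path_class X (f \<circ> lasso (hawaiian_loop (2 * n - 1)) (hawaiian_loop (2 * n))) \<in> K)"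
proof -
  have l: "lasso (hawaiian_loop (2 * n - 1)) (hawaiian_loop (2 * n)) \<in> loops_at hawaiian_plus hawaiian_plus_base" if "n \<ge> 1" for n
    using that by (intro lasso_loop hawaiian_loop_in_loops) simp_all
  have sub: "p_elem ` {1..} \<subseteq> carrier (fundamental_group hawaiian_plus hawaiian_plus_base)"
    using l by (auto simp: p_elem_eq fundamental_group_def)
  have "induced_hom X f ` P_subgroup \<subseteq> K \<longleftrightarrow> induced_hom X f ` p_elem ` {1..} \<subseteq> K"
    unfolding P_subgroup_def by (rule induced_hom_generate_subset[OF f hawaiian_plus_base_in K sub])
  also have "\<dots> \<longleftrightarrow> (\<forall>n\<ge>1. induced_hom X f (p_elem n) \<in> K)" by blast
  also have "\<dots> \<longleftrightarrow> (\<forall>n\<ge>1. path_class X (f \<circ> lasso (hawaiian_loop (2 * n - 1)) (hawaiian_loop (2 * n))) \<in> K)"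
    unfolding p_elem_eq using induced_hom_path_class[OF l f(1,2)] by (metis (no_types, lifting))
  finally show ?thesis .
qed

lemma induced_p_tau:
  assumes "continuous_on hawaiian_plus f" "f \<in> hawaiian_plus \<rightarrow> X"
  shows "induced_hom X f p_tau = path_class X (f \<circ> lasso (f_odd \<circ> tau_loop) (f_even \<circ> tau_loop))"
  unfolding p_tau_eq using assms by (intro induced_hom_path_class[OF lasso_loop[OF tau_in_loops]])

lemma hol_lasso:
  assumes f: "continuous_on hawaiian_plus f" "f \<in> hawaiian_plus \<rightarrow> X"
    and p: "p \<in> loops_at hawaiian_earring (0, 0)" and q: "q \<in> loops_at hawaiian_earring (0, 0)"
  shows "hol (f \<circ> lasso p q) = hol (f \<circ> whisker) \<otimes>\<^bsub>Q\<^esub> (hol (f \<circ> p) \<otimes>\<^bsub>Q\<^esub> (inv\<^bsub>Q\<^esub> hol (f \<circ> q) \<otimes>\<^bsub>Q\<^esub> inv\<^bsub>Q\<^esub> hol (f \<circ> whisker)))"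
    "path_in (f \<circ> whisker)" "path_in (f \<circ> p)" "path_in (f \<circ> q)"
proof -
  note P = loops_atD[OF p] and R = loops_atD[OF q] and W = whisker_props
  show pin: "path_in (f \<circ> whisker)" "path_in (f \<circ> p)" "path_in (f \<circ> q)"
    using f P R W earring_subset_plus by (intro path_in_compose[of hawaiian_plus f]; auto)+
  have "f \<circ> lasso p q = (f \<circ> whisker) +++ ((f \<circ> p) +++ (reversepath (f \<circ> q) +++ reversepath (f \<circ> whisker)))"
    by (simp add: lasso_def path_compose_join path_compose_reversepath)
  moreover have "hol ((f \<circ> whisker) +++ ((f \<circ> p) +++ (reversepath (f \<circ> q) +++ reversepath (f \<circ> whisker)))) =
     hol (f \<circ> whisker) \<otimes>\<^bsub>Q\<^esub> hol ((f \<circ> p) +++ (reversepath (f \<circ> q) +++ reversepath (f \<circ> whisker)))"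
    using pin P R W by (intro hol_join) (auto simp: path_image_join pathstart_compose pathfinish_compose)
  moreover have "hol ((f \<circ> p) +++ (reversepath (f \<circ> q) +++ reversepath (f \<circ> whisker))) =
      hol (f \<circ> p) \<otimes>\<^bsub>Q\<^esub> hol (reversepath (f \<circ> q) +++ reversepath (f \<circ> whisker))"
    using pin P R W by (intro hol_join) (auto simp: path_image_join pathstart_compose pathfinish_compose)
  moreover have "hol (reversepath (f \<circ> q) +++ reversepath (f \<circ> whisker)) = hol (reversepath (f \<circ> q)) \<otimes>\<^bsub>Q\<^esub> hol (reversepath (f \<circ> whisker))"
    using pin P R W by (intro hol_join) (auto simp: path_image_join pathstart_compose pathfinish_compose)
  ultimately show "hol (f \<circ> lasso p q) = hol (f \<circ> whisker) \<otimes>\<^bsub>Q\<^esub> (hol (f \<circ> p) \<otimes>\<^bsub>Q\<^esub> (inv\<^bsub>Q\<^esub> hol (f \<circ> q) \<otimes>\<^bsub>Q\<^esub> inv\<^bsub>Q\<^esub> hol (f \<circ> whisker)))"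
    using hol_reverse[OF pin(1)] hol_reverse[OF pin(3)] by simp
qed

text \<open>
  The whisker conjugates, and \<open>N\<close> is normal.
\<close>

lemma lasso_in_N_iff:
  assumes f: "continuous_on hawaiian_plus f" "f \<in> hawaiian_plus \<rightarrow> X" "f hawaiian_plus_base = x0"
    and p: "p \<in> loops_at hawaiian_earring (0, 0)" and q: "q \<in> loops_at hawaiian_earring (0, 0)"
  shows "path_class X (f \<circ> lasso p q) \<in> N \<longleftrightarrow> hol (f \<circ> p) = hol (f \<circ> q)"
proof -
  note h = hol_lasso[OF f(1,2) p q]
  have c [simp]: "hol (f \<circ> whisker) \<in> carrier Q" "hol (f \<circ> p) \<in> carrier Q" "hol (f \<circ> q) \<in> carrier Q"
    using h(2-4) hol_carrier by auto
  have "path_class X (f \<circ> lasso p q) \<in> N \<longleftrightarrow> hol (f \<circ> lasso p q) = \<one>\<^bsub>Q\<^esub>"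
    by (rule hol_one_iff[OF loop_compose[OF f lasso_loop[OF p q]]])
  also have "\<dots> \<longleftrightarrow> hol (f \<circ> p) = hol (f \<circ> q)"
  proof
    assume "hol (f \<circ> lasso p q) = \<one>\<^bsub>Q\<^esub>"
    then have "hol (f \<circ> whisker) \<otimes>\<^bsub>Q\<^esub> (hol (f \<circ> p) \<otimes>\<^bsub>Q\<^esub> inv\<^bsub>Q\<^esub> hol (f \<circ> q)) = hol (f \<circ> whisker)"
      unfolding h(1) using Q.inv_equality[of "hol (f \<circ> whisker) \<otimes>\<^bsub>Q\<^esub> (hol (f \<circ> p) \<otimes>\<^bsub>Q\<^esub> inv\<^bsub>Q\<^esub> hol (f \<circ> q))" "inv\<^bsub>Q\<^esub> hol (f \<circ> whisker)"]
      by (simp add: Q.m_assoc)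
    then have "hol (f \<circ> p) \<otimes>\<^bsub>Q\<^esub> inv\<^bsub>Q\<^esub> hol (f \<circ> q) = \<one>\<^bsub>Q\<^esub>" by (subst (asm) Q.l_cancel_one) auto
    then show "hol (f \<circ> p) = hol (f \<circ> q)" using Q.inv_equality[of "hol (f \<circ> p)" "inv\<^bsub>Q\<^esub> hol (f \<circ> q)"] by simp
  next
    assume "hol (f \<circ> p) = hol (f \<circ> q)"
    then show "hol (f \<circ> lasso p q) = \<one>\<^bsub>Q\<^esub>" unfolding h(1) by (simp add: Q.inv_mult_cancel)
  qed
  finally show ?thesis .
qed

abbreviation earring_map :: "(real \<times> real \<Rightarrow> 'a) \<Rightarrow> bool" where
  "earring_map f \<equiv> continuous_on hawaiian_earring f \<and> f \<in> hawaiian_earring \<rightarrow> X"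

lemma whisker_map_props:
  assumes f: "earring_map f" and c: "path_in c" "pathfinish c = f (0, 0)"
  shows "continuous_on hawaiian_plus (whisker_map c f)" "whisker_map c f \<in> hawaiian_plus \<rightarrow> X"
    "whisker_map c f hawaiian_plus_base = pathstart c"
    "p \<in> loops_at hawaiian_earring (0, 0) \<Longrightarrow> hol (whisker_map c f \<circ> p) = hol (f \<circ> p)"
    "hol (whisker_map c f \<circ> whisker) = hol c"
proof -
  have c1: "c 1 = f (0, 0)" using c(2) by (simp add: pathfinish_def)
  show g: "continuous_on hawaiian_plus (whisker_map c f)" using continuous_whisker_map[of f c] f c by blast
  show "whisker_map c f \<in> hawaiian_plus \<rightarrow> X"
  proof
    fix z assume z: "z \<in> hawaiian_plus"
    show "whisker_map c f z \<in> X"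
    proof (cases "fst z \<le> 0")
      case True
      then show ?thesis using hawaiian_plus_cases(1)[OF z True] c(1) by (auto simp: whisker_map_def path_image_def)
    next
      case False
      then show ?thesis using hawaiian_plus_cases(2)[OF z] f by (auto simp: whisker_map_def)
    qed
  qed
  show "whisker_map c f hawaiian_plus_base = pathstart c" by (simp add: whisker_map_def hawaiian_plus_base_def pathstart_def)
  show "hol (whisker_map c f \<circ> p) = hol (f \<circ> p)" if "p \<in> loops_at hawaiian_earring (0, 0)"
  proof -
    note P = loops_atD[OF that]
    have "path_in (f \<circ> p)" using f P by (intro path_in_compose[of hawaiian_earring f]) auto
    then have "hol (f \<circ> p) = hol (whisker_map c f \<circ> p)"
      using whisker_map_earring[of c f, OF c1] P(2) by (intro hol_cong) (auto simp: path_image_def image_subset_iff)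
    then show ?thesis by simp
  qed
  have "hol c = hol (whisker_map c f \<circ> whisker)"
    using c(1) by (intro hol_cong) (auto simp: whisker_map_def whisker_def)
  then show "hol (whisker_map c f \<circ> whisker) = hol c" by simp
qed

text \<open>
  Attaching a whisker from \<open>x0\<close> turns any map of the earring into a test map, and the lassos compare
  the two loops that they contain.
\<close>

theorem hawaiian_closed_iff:
  "test_closed hawaiian_plus hawaiian_plus_base P_subgroup p_tau X x0 N \<longleftrightarrow>
   (\<forall>f. earring_map f \<and> (\<forall>n\<ge>1. hol (f \<circ> hawaiian_loop (2 * n - 1)) = hol (f \<circ> hawaiian_loop (2 * n))) \<longrightarrow>
      hol (f \<circ> (f_odd \<circ> tau_loop)) = hol (f \<circ> (f_even \<circ> tau_loop)))"
    (is "?closed \<longleftrightarrow> ?crit")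
proof
  assume closed: ?closed
  show ?crit
  proof (intro allI impI; elim conjE)
    fix f assume f: "continuous_on hawaiian_earring f" "f \<in> hawaiian_earring \<rightarrow> X"
      and eq: "\<forall>n\<ge>1. hol (f \<circ> hawaiian_loop (2 * n - 1)) = hol (f \<circ> hawaiian_loop (2 * n))"
    have f0: "f (0, 0) \<in> X" using f hawaiian_origin_in by auto
    define c where "c = chosen_path (f (0, 0))"
    have c: "path_in c" "pathstart c = x0" "pathfinish c = f (0, 0)" using chosen_path[OF f0] by (auto simp: c_def)
    have fm: "earring_map f" using f by simp
    note g = whisker_map_props[OF fm c(1,3)]
    let ?g = "whisker_map c f"
    have g3: "?g hawaiian_plus_base = x0" using g(3) c(2) by simp
    have "path_class X (?g \<circ> lasso (hawaiian_loop (2 * n - 1)) (hawaiian_loop (2 * n))) \<in> N" if n: "n \<ge> 1" for n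
    proof -
      have l: "hawaiian_loop (2 * n - 1) \<in> loops_at hawaiian_earring (0, 0)" "hawaiian_loop (2 * n) \<in> loops_at hawaiian_earring (0, 0)"
        using n by (intro hawaiian_loop_in_loops; simp)+
      show ?thesis unfolding lasso_in_N_iff[OF g(1,2) g3 l] g(4)[OF l(1)] g(4)[OF l(2)] using eq n by blast
    qed
    then have "induced_hom X ?g ` P_subgroup \<subseteq> N"
      using P_induced_subset[OF g(1,2) g3 N.subgroup_axioms] by blast
    then have "induced_hom X ?g p_tau \<in> N" using closed g(1,2) g3 unfolding test_closed_def by blast
    then show "hol (f \<circ> (f_odd \<circ> tau_loop)) = hol (f \<circ> (f_even \<circ> tau_loop))"
      unfolding induced_p_tau[OF g(1,2)] lasso_in_N_iff[OF g(1,2) g3 tau_in_loops] g(4)[OF tau_in_loops(1)] g(4)[OF tau_in_loops(2)] .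
  qed
next
  assume crit: ?crit
  show ?closed
    unfolding test_closed_def
  proof (intro conjI allI impI; (elim conjE)?)
    show "subgroup N G" by (rule N.subgroup_axioms)
    fix f assume f: "continuous_on hawaiian_plus f" "f \<in> hawaiian_plus \<rightarrow> X" "f hawaiian_plus_base = x0"
      and P: "induced_hom X f ` P_subgroup \<subseteq> N"
    have "hol (f \<circ> hawaiian_loop (2 * n - 1)) = hol (f \<circ> hawaiian_loop (2 * n))" if n: "n \<ge> 1" for n
    proof -
      have l: "hawaiian_loop (2 * n - 1) \<in> loops_at hawaiian_earring (0, 0)" "hawaiian_loop (2 * n) \<in> loops_at hawaiian_earring (0, 0)"
        using n by (intro hawaiian_loop_in_loops; simp)+
      show ?thesis unfolding lasso_in_N_iff[OF f l, symmetric] using P n P_induced_subset[OF f N.subgroup_axioms] by blast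
    qed
    moreover have "earring_map f" using f continuous_on_subset[OF f(1) earring_subset_plus] earring_subset_plus by auto
    ultimately have "hol (f \<circ> (f_odd \<circ> tau_loop)) = hol (f \<circ> (f_even \<circ> tau_loop))" using crit by blast
    then show "induced_hom X f p_tau \<in> N"
      unfolding induced_p_tau[OF f(1,2)] lasso_in_N_iff[OF f tau_in_loops] .
  qed
qed

end

section \<open>From the dyadic space to the earring\<close>

definition fits :: "nat \<Rightarrow> nat \<Rightarrow> bool" where
  "fits d k \<longleftrightarrow> (\<exists>r<2 ^ d. real r / 2 ^ d \<le> in_block k (1/3) \<and> in_block k (2/3) \<le> real (Suc r) / 2 ^ d)"

definition fit_level :: "nat \<Rightarrow> nat" where
  "fit_level k = Max {d. fits d k}"

lemma fits_0: "k \<ge> 1 \<Longrightarrow> fits 0 k"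
proof -
  assume k: "k \<ge> 1"
  obtain d r where dr: "r < 2 ^ d" "k = 2 ^ d + r" using tree_index_cases[OF k] .
  then show ?thesis using in_block_bounds[OF dr(1), of "1/3"] in_block_bounds[OF dr(1), of "2/3"] by (simp add: fits_def)
qed

lemma fits_Suc:
  assumes "fits (Suc d) k" shows "fits d k"
proof -
  obtain r where r: "r < 2 ^ Suc d" "real r / 2 ^ Suc d \<le> in_block k (1/3)" "in_block k (2/3) \<le> real (Suc r) / 2 ^ Suc d"
    using assms by (auto simp: fits_def simp del: power_Suc)
  define s where "s = r div 2"
  have s: "s < 2 ^ d" using r(1) by (simp add: s_def)
  have "2 * s \<le> r" "Suc r \<le> 2 * Suc s" by (auto simp: s_def)
  then have "2 * real s \<le> real r" "real (Suc r) \<le> 2 * real (Suc s)" by linarith+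
  then have "2 * real s / 2 ^ Suc d \<le> real r / 2 ^ Suc d" "real (Suc r) / 2 ^ Suc d \<le> 2 * real (Suc s) / 2 ^ Suc d"
    by (intro divide_right_mono; simp only: zero_le_power zero_le_numeral)+
  moreover have "2 * real s / 2 ^ Suc d = real s / 2 ^ d" "2 * real (Suc s) / 2 ^ Suc d = real (Suc s) / 2 ^ d"
    by (simp_all del: of_nat_Suc)
  ultimately have "real s / 2 ^ d \<le> in_block k (1/3)" "in_block k (2/3) \<le> real (Suc s) / 2 ^ d" using r by linarith+
  then show ?thesis using s unfolding fits_def by blast
qed

text \<open>
  A gap fits at all levels up to some maximal one, for it is longer than the dyadic intervals of high
  level.
\<close>

lemma fits_iff:
  assumes "k \<ge> 1" shows "fits d k \<longleftrightarrow> d \<le> fit_level k"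
proof -
  have down: "fits e k" if "fits d k" "e \<le> d" for d e
    using that(2,1) by (induction rule: inc_induct) (auto intro: fits_Suc)
  obtain M where M: "(1/2) ^ M < block_len k / 3"
    using real_arch_pow_inv[of "block_len k / 3" "1/2"] block_len_pos[of k] by auto
  have "d \<le> M" if "fits d k" for d
  proof (rule ccontr)
    assume "\<not> d \<le> M"
    then have "fits M k" using down that by simp
    then obtain r where "real r / 2 ^ M \<le> in_block k (1/3)" "in_block k (2/3) \<le> real (Suc r) / 2 ^ M" by (auto simp: fits_def)
    then have "in_block k (2/3) - in_block k (1/3) \<le> real (Suc r) / 2 ^ M - real r / 2 ^ M" by linarith
    also have "\<dots> = (1/2) ^ M" by (simp add: field_simps)
    finally show False using M by (simp add: in_block_def)
  qed
  then have fin: "finite {d. fits d k}" using finite_subset[of "{d. fits d k}" "{..M}"] by auto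
  have "fits (fit_level k) k" unfolding fit_level_def using Max_in[OF fin] fits_0[OF assms] by auto
  then have "d \<le> fit_level k \<Longrightarrow> fits d k" by (rule down)
  moreover have "fits d k \<Longrightarrow> d \<le> fit_level k" unfolding fit_level_def by (rule Max_ge[OF fin]) simp
  ultimately show ?thesis by blast
qed

lemma gap_in_dyadic_interior:
  assumes "real r / 2 ^ d \<le> in_block k (1/3)" "in_block k (2/3) \<le> real (Suc r) / 2 ^ d" "x \<in> gap k"
  shows "real r < 2 ^ d * x" "2 ^ d * x < real (Suc r)"
proof -
  have "real r / 2 ^ d < x" "x < real (Suc r) / 2 ^ d" using assms by (auto simp: gap_def simp del: of_nat_Suc)
  then show "real r < 2 ^ d * x" "2 ^ d * x < real (Suc r)" by (simp_all add: field_simps del: of_nat_Suc)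
qed

lemma height_pos_in_gap:
  assumes "k \<ge> 1" "x \<in> gap k" "d \<le> fit_level k"
  shows "0 < height d x"
proof -
  obtain r where r: "r < 2 ^ d" "real r / 2 ^ d \<le> in_block k (1/3)" "in_block k (2/3) \<le> real (Suc r) / 2 ^ d"
    using assms(3) fits_iff[OF assms(1)] by (auto simp: fits_def)
  define t where "t = 2 ^ d * x - real r"
  have t: "0 < t" "t < 1" using gap_in_dyadic_interior[OF r(2,3) assms(2)] by (auto simp: t_def)
  have x: "x = (real r + t) / 2 ^ d" by (simp add: t_def)
  have "t\<^sup>2 < t" using t by (simp add: power2_eq_square)
  then show ?thesis using height_level[OF r(1), of t] t x by simp
qed

definition arc_over :: "nat \<Rightarrow> real \<Rightarrow> real \<times> real" where
  "arc_over d x = (if \<exists>k\<ge>1. x \<in> gap k \<and> d \<le> fit_level k then f_even (tau_loop x) else f_odd (tau_loop x))"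

text \<open>
  On an arc of level \<open>d\<close>, a gap \<open>k\<close> below the arc is mapped to the even circle \<open>2 * k\<close> if \<open>d\<close> is at most
  \<open>fit_level k\<close>, and to its odd partner \<open>2 * k - 1\<close> otherwise; this is \<open>arc_over d\<close>. So all circles are
  even on the top arc and odd on the base. Heights decrease with the level, strictly at the interior
  points of a dyadic interval, hence comparing heights compares levels.
\<close>

definition dyadic_to_earring :: "real \<times> real \<Rightarrow> real \<times> real" where
  "dyadic_to_earring z = (if \<exists>k\<ge>1. fst z \<in> gap k \<and> height (fit_level k) (fst z) \<le> snd z
     then f_even (tau_loop (fst z)) else f_odd (tau_loop (fst z)))"

lemma f_tau_gap:
  assumes "k \<ge> 1" "x \<in> closed_gap k"
  defines "t \<equiv> (x - in_block k (1/3)) / (block_len k / 3)"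
  shows "t \<in> {0..1}" "f_even (tau_loop x) = hawaiian_loop (2 * k) t" "f_odd (tau_loop x) = hawaiian_loop (2 * k - 1) t"
proof -
  show t: "t \<in> {0..1}" using assms(2) block_len_pos[of k] unfolding t_def by (auto simp: closed_gap_def in_block_def field_simps)
  show "f_even (tau_loop x) = hawaiian_loop (2 * k) t" "f_odd (tau_loop x) = hawaiian_loop (2 * k - 1) t"
    using tau_loop_closed_gap[OF assms(1,2)] f_even_props(3)[OF assms(1) t] f_odd_props(3)[OF assms(1) t] by (auto simp: t_def)
qed

lemma f_tau_off: "(\<And>k. k \<ge> 1 \<Longrightarrow> x \<notin> gap k) \<Longrightarrow> f_even (tau_loop x) = (0, 0) \<and> f_odd (tau_loop x) = (0, 0)"
  using tau_loop_off by simp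

lemma dyadic_to_earring_lower:
  assumes "k \<ge> 1" "(x, y) \<in> dyadic_space" "x \<in> gap k" "y \<le> height (Suc (fit_level k)) x"
  shows "\<not> height (fit_level k) x \<le> y"
proof
  assume "height (fit_level k) x \<le> y"
  then have "height (fit_level k) x = 0"
    using assms(2,4) by (intro height_strict[of x _ "Suc (fit_level k)"]) (auto simp: dyadic_space_iff)
  then show False using height_pos_in_gap[OF assms(1,3) order_refl] by simp
qed

lemma continuous_dyadic_to_earring: "continuous_on dyadic_space dyadic_to_earring"
proof (rule continuous_on_gap_pasting[where p = fst and C = 4])
  have ft: "continuous_on S (\<lambda>z::real\<times>real. f (tau_loop (fst z)))" if "continuous_on hawaiian_earring f" for S f
    by (rule continuous_on_compose2[OF that continuous_on_compose2[OF continuous_tau_loop]])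
      (auto intro!: continuous_intros tau_loop_in)
  fix k :: nat assume k: "k \<ge> 1"
  let ?Z = "{z \<in> dyadic_space. fst z \<in> closed_gap k}"
  let ?A = "{z \<in> ?Z. height (fit_level k) (fst z) \<le> snd z}" and ?B = "{z \<in> ?Z. snd z \<le> height (Suc (fit_level k)) (fst z)}"
  have un: "?Z = ?A \<union> ?B"
  proof (intro equalityI subsetI)
    fix z assume "z \<in> ?Z"
    then show "z \<in> ?A \<union> ?B" using dyadic_space_cases[of "fst z" "snd z" "fit_level k"] by auto
  qed auto
  have hc: "continuous_on ?Z (\<lambda>z. height d (fst z))" for d by (rule continuous_on_height_fst) auto
  have cl: "closedin (top_of_set ?Z) ?A" "closedin (top_of_set ?Z) ?B"
    by (intro closedin_Collect_le continuous_intros hc)+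
  have off: "dyadic_to_earring z = (0, 0)" "f_even (tau_loop (fst z)) = (0, 0)" "f_odd (tau_loop (fst z)) = (0, 0)"
    if "fst z \<in> closed_gap k" "fst z \<notin> gap k" for z
    using f_tau_off[of "fst z"] closed_gap_boundary[OF k _ that] by (auto simp: dyadic_to_earring_def)
  have A: "continuous_on ?A dyadic_to_earring"
  proof (rule continuous_on_eq[OF ft[OF f_even_props(1)]])
    fix z assume z: "z \<in> ?A"
    show "f_even (tau_loop (fst z)) = dyadic_to_earring z"
    proof (cases "fst z \<in> gap k")
      case True
      then show ?thesis using z k by (auto simp: dyadic_to_earring_def)
    qed (use off z in auto)
  qed
  have B: "continuous_on ?B dyadic_to_earring"
  proof (rule continuous_on_eq[OF ft[OF f_odd_props(1)]])
    fix z assume z: "z \<in> ?B"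
    show "f_odd (tau_loop (fst z)) = dyadic_to_earring z"
    proof (cases "fst z \<in> gap k")
      case True
      have "\<not> height (fit_level l) (fst z) \<le> snd z" if "l \<ge> 1" "fst z \<in> gap l" for l
        using dyadic_to_earring_lower[OF k, of "fst z" "snd z"] gap_unique[OF k that(1) True that(2)] z True by auto
      then show ?thesis by (auto simp: dyadic_to_earring_def)
    qed (use off z in auto)
  qed
  have "continuous_on (?A \<union> ?B) dyadic_to_earring"
    using cl A B by (intro continuous_on_Un_local) (simp_all only: un[symmetric])
  then show "continuous_on ?Z dyadic_to_earring" by (simp only: un[symmetric])
next
  fix z :: "real \<times> real"
  show "dyadic_to_earring z = 0" if "\<And>k. k \<ge> 1 \<Longrightarrow> fst z \<notin> gap k"
    using f_tau_off[OF that] by (auto simp: dyadic_to_earring_def zero_prod_def)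
  fix k :: nat assume k: "k \<ge> 1" "fst z \<in> gap k"
  note f = f_tau_gap[OF k(1) subsetD[OF gap_subset_closed_gap k(2)]]
  have "4 / real (2 * k) \<le> 4 / real k" "4 / real (2 * k - 1) \<le> 4 / real k"
    using k(1) by (intro divide_left_mono; simp)+
  then have "norm (f_even (tau_loop (fst z))) \<le> 4 / real k" "norm (f_odd (tau_loop (fst z))) \<le> 4 / real k"
    unfolding f using norm_hawaiian_loop order_trans by blast+
  then show "norm (dyadic_to_earring z) \<le> 4 / real k" by (simp add: dyadic_to_earring_def)
qed (auto intro: continuous_intros)

lemma dyadic_to_earring_in: "dyadic_to_earring z \<in> hawaiian_earring"
  using f_even_props(2) f_odd_props(2) tau_loop_in by (auto simp: dyadic_to_earring_def)

lemma dyadic_to_earring_height: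
  assumes "0 \<le> x" "x \<le> 1"
  shows "dyadic_to_earring (x, height d x) = arc_over d x"
proof -
  have "height (fit_level k) x \<le> height d x \<longleftrightarrow> d \<le> fit_level k" if k: "k \<ge> 1" "x \<in> gap k" for k
  proof
    assume le: "height (fit_level k) x \<le> height d x"
    show "d \<le> fit_level k"
    proof (rule ccontr)
      assume "\<not> d \<le> fit_level k"
      then have "height (fit_level k) x = 0" using height_strict[OF assms, of "fit_level k" d] le by simp
      then show False using height_pos_in_gap[OF k order_refl] by simp
    qed
  qed (rule height_antimono[OF assms])
  then have "(\<exists>k\<ge>1. x \<in> gap k \<and> height (fit_level k) x \<le> height d x) \<longleftrightarrow> (\<exists>k\<ge>1. x \<in> gap k \<and> d \<le> fit_level k)" by blast
  then show ?thesis by (simp only: dyadic_to_earring_def arc_over_def fst_conv snd_conv)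
qed

lemma dyadic_to_earring_base:
  "dyadic_to_earring (x, 0) = f_odd (tau_loop x)"
proof -
  have "\<not> height (fit_level k) x \<le> 0" if "k \<ge> 1" "x \<in> gap k" for k
    using height_pos_in_gap[OF that order_refl] by simp
  then show ?thesis by (auto simp: dyadic_to_earring_def)
qed

lemma arc_over_0: "arc_over 0 x = f_even (tau_loop x)"
proof (cases "\<exists>k\<ge>1. x \<in> gap k")
  case False
  then show ?thesis using f_tau_off[of x] by (auto simp: arc_over_def)
qed (auto simp: arc_over_def)

lemma continuous_arc_over: "continuous_on {0..1} (arc_over d)"
proof (rule continuous_on_eq)
  show "continuous_on {0..1} (\<lambda>x. dyadic_to_earring (x, height d x))"
    by (rule continuous_on_compose2[OF continuous_dyadic_to_earring])
      (auto intro!: continuous_intros continuous_height simp: dyadic_space_iff)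
qed (use dyadic_to_earring_height in auto)

lemma arc_over_in: "arc_over d x \<in> hawaiian_earring"
  using f_even_props(2) f_odd_props(2) tau_loop_in by (auto simp: arc_over_def)

text \<open>
  A gap with \<open>fit_level k = d\<close> lies in one dyadic interval of level \<open>d\<close> but in neither of its halves, so
  it contains the midpoint. At most one gap can do this.
\<close>

lemma arc_over_Suc:
  assumes r: "r < 2 ^ d" and x: "real r / 2 ^ d \<le> x" "x \<le> real (Suc r) / 2 ^ d" and ne: "arc_over d x \<noteq> arc_over (Suc d) x"
  obtains k where "k \<ge> 1" "x \<in> gap k" "(real r + 1/2) / 2 ^ d \<in> gap k" "fit_level k = d"
    "real r / 2 ^ d \<le> in_block k (1/3)" "in_block k (2/3) \<le> real (Suc r) / 2 ^ d"
proof -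
  have "\<exists>k\<ge>1. x \<in> gap k \<and> d \<le> fit_level k"
  proof (rule ccontr)
    assume no: "\<not> (\<exists>k\<ge>1. x \<in> gap k \<and> d \<le> fit_level k)"
    then have "\<not> (\<exists>k\<ge>1. x \<in> gap k \<and> Suc d \<le> fit_level k)" using Suc_leD by blast
    then show False using ne no by (simp only: arc_over_def if_False)
  qed
  then obtain k where k: "k \<ge> 1" "x \<in> gap k" "d \<le> fit_level k" by blast
  have "\<not> Suc d \<le> fit_level k"
  proof
    assume "Suc d \<le> fit_level k"
    then have "\<exists>k\<ge>1. x \<in> gap k \<and> d \<le> fit_level k" "\<exists>k\<ge>1. x \<in> gap k \<and> Suc d \<le> fit_level k"
      using k by blast+
    then show False using ne by (simp only: arc_over_def if_True)
  qed
  then have lev: "fit_level k = d" using k(3) by simp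
  obtain s where s: "s < 2 ^ d" "real s / 2 ^ d \<le> in_block k (1/3)" "in_block k (2/3) \<le> real (Suc s) / 2 ^ d"
    using fits_iff[OF k(1), of d] k(3) by (auto simp: fits_def)
  have "real s < 2 ^ d * x" "2 ^ d * x < real (Suc s)" using gap_in_dyadic_interior[OF s(2,3) k(2)] .
  moreover have "real r \<le> 2 ^ d * x" "2 ^ d * x \<le> real (Suc r)" using x by (simp_all add: field_simps del: of_nat_Suc)
  ultimately have "s = r" by linarith
  have nf: "\<not> fits (Suc d) k" using fits_iff[OF k(1)] lev by simp
  let ?m = "(real r + 1/2) / 2 ^ d"
  have m: "real (2 * r) / 2 ^ Suc d = real r / 2 ^ d" "real (Suc (2 * r)) / 2 ^ Suc d = ?m" "real (Suc (Suc (2 * r))) / 2 ^ Suc d = real (Suc r) / 2 ^ d"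
    by (simp_all add: field_simps)
  have "in_block k (1/3) < ?m"
  proof (rule ccontr)
    assume "\<not> in_block k (1/3) < ?m"
    then have "fits (Suc d) k" unfolding fits_def using s r \<open>s = r\<close> m by (intro exI[of _ "Suc (2 * r)"]) (simp del: of_nat_Suc power_Suc, simp)
    then show False using nf by blast
  qed
  moreover have "?m < in_block k (2/3)"
  proof (rule ccontr)
    assume "\<not> ?m < in_block k (2/3)"
    then have "fits (Suc d) k" unfolding fits_def using s r \<open>s = r\<close> m by (intro exI[of _ "2 * r"]) (simp del: of_nat_Suc power_Suc of_nat_mult, simp)
    then show False using nf by blast
  qed
  ultimately have "?m \<in> gap k" by (simp add: gap_def)
  then show ?thesis using that k lev s \<open>s = r\<close> by blast
qed

context normal_pi1
begin

lemma earring_map_compose: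
  assumes "earring_map f" "continuous_on S g" "g ` S \<subseteq> hawaiian_earring"
  shows "continuous_on S (f \<circ> g)" "(f \<circ> g) ` S \<subseteq> X"
proof -
  show "continuous_on S (f \<circ> g)"
    by (rule continuous_on_compose[OF assms(2) continuous_on_subset[OF conjunct1[OF assms(1)] assms(3)]])
  show "(f \<circ> g) ` S \<subseteq> X" using assms(1,3) by fastforce
qed

text \<open>
  The two paths differ at most by the exchange of one even circle for its odd partner.
\<close>

lemma hol_arc_over_Suc:
  assumes f: "earring_map f" and eq: "\<And>n. n \<ge> 1 \<Longrightarrow> hol (f \<circ> hawaiian_loop (2 * n - 1)) = hol (f \<circ> hawaiian_loop (2 * n))"
    and r: "r < 2 ^ d"
  defines "a \<equiv> real r / 2 ^ d" and "b \<equiv> real (Suc r) / 2 ^ d"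
  shows "hol ((f \<circ> arc_over d) \<circ> linepath a b) = hol ((f \<circ> arc_over (Suc d)) \<circ> linepath a b)"
proof -
  let ?p = "f \<circ> arc_over d" and ?q = "f \<circ> arc_over (Suc d)"
  have ab: "0 \<le> a" "a \<le> b" "b \<le> 1" using real_less_power2[OF r] unfolding a_def b_def by (auto simp: field_simps)
  have cont: "continuous_on {0..1} (f \<circ> arc_over e)" for e
    using arc_over_in by (intro earring_map_compose(1)[OF f] continuous_arc_over image_subsetI)
  have img: "(f \<circ> arc_over e) ` {0..1} \<subseteq> X" for e
    using arc_over_in by (intro earring_map_compose(2)[OF f] continuous_arc_over image_subsetI)
  have pin: "path_in ((f \<circ> arc_over e) \<circ> linepath u v)" if "u \<in> {0..1}" "v \<in> {0..1}" for e u v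
    using that segment_real[of "{0..1}" u v] by (intro path_in_compose[OF cont img]) auto
  have between: "linepath u v t \<in> {u..v}" if "u \<le> v" "t \<in> {0..1}" for u v t :: real
    using that linepath_in_path[of t u v] closed_segment_eq_real_ivl1[of u v] by (auto simp: path_image_linepath)
  have same: "hol (?p \<circ> linepath u v) = hol (?q \<circ> linepath u v)"
    if uv: "0 \<le> u" "u \<le> v" "v \<le> 1" and e: "\<And>x. u \<le> x \<Longrightarrow> x \<le> v \<Longrightarrow> arc_over d x = arc_over (Suc d) x" for u v
    using pin[of u v d] between[OF uv(2)] uv e by (intro hol_cong) auto
  show ?thesis
  proof (cases "\<exists>x\<in>{a..b}. arc_over d x \<noteq> arc_over (Suc d) x")
    case False
    then show ?thesis using ab by (intro same) auto
  next
    case True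
    then obtain x where x: "a \<le> x" "x \<le> b" "arc_over d x \<noteq> arc_over (Suc d) x" by auto
    obtain k where k: "k \<ge> 1" "(real r + 1/2) / 2 ^ d \<in> gap k" "fit_level k = d" "a \<le> in_block k (1/3)" "in_block k (2/3) \<le> b"
      using arc_over_Suc[OF r x[unfolded a_def b_def]] unfolding a_def b_def by metis
    have other: "arc_over d y = arc_over (Suc d) y" if y: "a \<le> y" "y \<le> b" "y \<notin> gap k" for y
    proof (rule ccontr)
      assume "arc_over d y \<noteq> arc_over (Suc d) y"
      then obtain l where "l \<ge> 1" "y \<in> gap l" "(real r + 1/2) / 2 ^ d \<in> gap l"
        using arc_over_Suc[OF r y(1,2)[unfolded a_def b_def]] by metis
      then show False using gap_unique[OF k(1) _ k(2)] y(3) by blast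
    qed
    let ?c = "in_block k (1/3)" and ?e = "in_block k (2/3)"
    have ce: "?c \<le> ?e" by (simp add: in_block_less)
    have left: "hol (?p \<circ> linepath a ?c) = hol (?q \<circ> linepath a ?c)"
      using ab k ce other by (intro same) (auto simp: gap_def)
    have right: "hol (?p \<circ> linepath ?e b) = hol (?q \<circ> linepath ?e b)"
      using ab k ce other by (intro same) (auto simp: gap_def)
    have on_gap: "arc_over d y = f_even (tau_loop y)" "arc_over (Suc d) y = f_odd (tau_loop y)" if y: "y \<in> closed_gap k" for y
    proof -
      have "arc_over d y = f_even (tau_loop y) \<and> arc_over (Suc d) y = f_odd (tau_loop y)"
      proof (cases "y \<in> gap k")
        case True
        then have "l = k" if "l \<ge> 1" "y \<in> gap l" for l using gap_unique[OF that(1) k(1) that(2)] by blast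
        then show ?thesis using k(1,3) True unfolding arc_over_def by (metis not_less_eq_eq order_refl)
      next
        case False
        then show ?thesis using f_tau_off[of y] closed_gap_boundary[OF k(1) _ y False] by (auto simp: arc_over_def)
      qed
      then show "arc_over d y = f_even (tau_loop y)" "arc_over (Suc d) y = f_odd (tau_loop y)" by auto
    qed
    have lin: "linepath ?c ?e t \<in> closed_gap k" "(linepath ?c ?e t - ?c) / (block_len k / 3) = t" if "t \<in> {0..1}" for t
    proof -
      show "linepath ?c ?e t \<in> closed_gap k" using between[OF ce that] by (simp add: closed_gap_def)
      show "(linepath ?c ?e t - ?c) / (block_len k / 3) = t"
        using block_len_pos[of k] by (simp add: linepath_def in_block_def field_simps)
    qed
    have ce01: "?c \<in> {0..1}" "?e \<in> {0..1}" using ab k ce by auto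
    have "hol (?p \<circ> linepath ?c ?e) = hol (f \<circ> hawaiian_loop (2 * k))"
      using pin[OF ce01] lin on_gap(1) f_tau_gap(2)[OF k(1)] by (intro hol_cong) auto
    moreover have "hol (?q \<circ> linepath ?c ?e) = hol (f \<circ> hawaiian_loop (2 * k - 1))"
      using pin[OF ce01] lin on_gap(2) f_tau_gap(3)[OF k(1)] by (intro hol_cong) auto
    ultimately have mid: "hol (?p \<circ> linepath ?c ?e) = hol (?q \<circ> linepath ?c ?e)" using eq[OF k(1)] by simp
    have split: "hol ((f \<circ> arc_over n) \<circ> linepath a b) =
      hol ((f \<circ> arc_over n) \<circ> linepath a ?c) \<otimes>\<^bsub>Q\<^esub> hol ((f \<circ> arc_over n) \<circ> linepath ?c ?e) \<otimes>\<^bsub>Q\<^esub> hol ((f \<circ> arc_over n) \<circ> linepath ?e b)" for n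
      using ab k ce by (subst hol_segments[OF cont img]; simp)+
    show ?thesis unfolding split left mid right ..
  qed
qed

lemma hawaiian_closed_if_dyadic_closed:
  assumes D: "\<And>f. dyadic_map f \<Longrightarrow> additive f \<Longrightarrow> hol (f \<circ> tree_arc 1) = hol (f \<circ> base_path)"
    and f: "earring_map f" and eq: "\<And>n. n \<ge> 1 \<Longrightarrow> hol (f \<circ> hawaiian_loop (2 * n - 1)) = hol (f \<circ> hawaiian_loop (2 * n))"
  shows "hol (f \<circ> (f_odd \<circ> tau_loop)) = hol (f \<circ> (f_even \<circ> tau_loop))"
proof -
  let ?g = "f \<circ> dyadic_to_earring"
  have "dyadic_to_earring ` dyadic_space \<subseteq> hawaiian_earring" using dyadic_to_earring_in by blast
  from earring_map_compose[OF f continuous_dyadic_to_earring this]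
  have g: "dyadic_map ?g" by (simp only: image_subset_iff_funcset simp_thms)
  have cont: "continuous_on {0..1} (f \<circ> arc_over e)" for e
    using arc_over_in by (intro earring_map_compose(1)[OF f] continuous_arc_over image_subsetI)
  have img: "(f \<circ> arc_over e) ` {0..1} \<subseteq> X" for e
    using arc_over_in by (intro earring_map_compose(2)[OF f] continuous_arc_over image_subsetI)
  have arc: "hol (?g \<circ> tree_arc (2 ^ d + r)) = hol ((f \<circ> arc_over d) \<circ> linepath (real r / 2 ^ d) (real (Suc r) / 2 ^ d))" if r: "r < 2 ^ d" for d r
  proof (rule hol_cong)
    show "path_in (?g \<circ> tree_arc (2 ^ d + r))" by (rule dyadic_map_arc[OF g index_ge_1])
    fix t :: real assume t: "t \<in> {0..1}"
    have x: "0 \<le> (real r + t) / 2 ^ d" "(real r + t) / 2 ^ d \<le> 1" using real_less_power2[OF r] t by (auto simp: field_simps)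
    have "linepath (real r / 2 ^ d) (real (Suc r) / 2 ^ d) t = (real r + t) / 2 ^ d"
      by (simp add: linepath_def field_simps)
    then show "(?g \<circ> tree_arc (2 ^ d + r)) t = ((f \<circ> arc_over d) \<circ> linepath (real r / 2 ^ d) (real (Suc r) / 2 ^ d)) t"
      unfolding o_apply tree_arc_eq_height[OF r t] dyadic_to_earring_height[OF x] by simp
  qed
  \<comment> \<open>An arc of level \<open>d\<close> is compared with \<open>arc_over (Suc d)\<close> over the same interval, which is the
    product of the two arcs below it.\<close>
  have "additive ?g"
    unfolding additive_def
  proof (intro allI impI)
    fix k :: nat assume "k \<ge> 1"
    then obtain d r where dr: "r < 2 ^ d" "k = 2 ^ d + r" using tree_index_cases by blast
    let ?a = "real r / 2 ^ d" and ?b = "real (Suc r) / 2 ^ d" and ?m = "real (Suc (2 * r)) / 2 ^ Suc d"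
    have ends: "real (2 * r) / 2 ^ Suc d = ?a" "real (Suc (Suc (2 * r))) / 2 ^ Suc d = ?b" by (simp_all add: field_simps)
    have in01: "?a \<in> {0..1}" "?b \<in> {0..1}" "?m \<in> {0..1}" using real_less_power2[OF dr(1)] less_imp_le[OF dr(1)] by (auto simp: field_simps)
    have k2: "2 * k = 2 ^ Suc d + 2 * r" "Suc (2 * k) = 2 ^ Suc d + Suc (2 * r)" by (simp_all add: dr(2))
    have lt: "2 * r < 2 ^ Suc d" "Suc (2 * r) < 2 ^ Suc d" using dr(1) by auto
    have "hol (?g \<circ> tree_arc k) = hol ((f \<circ> arc_over (Suc d)) \<circ> linepath ?a ?b)"
      unfolding dr(2) arc[OF dr(1)] by (rule hol_arc_over_Suc[OF f eq dr(1)])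
    also have "\<dots> = hol ((f \<circ> arc_over (Suc d)) \<circ> linepath ?a ?m) \<otimes>\<^bsub>Q\<^esub> hol ((f \<circ> arc_over (Suc d)) \<circ> linepath ?m ?b)"
      by (rule hol_segments[OF cont img _ in01(1,3,2), symmetric]) simp
    also have "\<dots> = hol (?g \<circ> tree_arc (2 * k)) \<otimes>\<^bsub>Q\<^esub> hol (?g \<circ> tree_arc (Suc (2 * k)))"
    proof -
      have "hol (?g \<circ> tree_arc (2 * k)) = hol ((f \<circ> arc_over (Suc d)) \<circ> linepath ?a ?m)"
        by (subst k2(1)) (simp only: arc[OF lt(1)] ends)
      moreover have "hol (?g \<circ> tree_arc (Suc (2 * k))) = hol ((f \<circ> arc_over (Suc d)) \<circ> linepath ?m ?b)"
        by (subst k2(2)) (simp only: arc[OF lt(2)] ends)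
      ultimately show ?thesis by simp
    qed
    finally show "hol (?g \<circ> tree_arc k) = hol (?g \<circ> tree_arc (2 * k)) \<otimes>\<^bsub>Q\<^esub> hol (?g \<circ> tree_arc (Suc (2 * k)))" .
  qed
  then have "hol (?g \<circ> tree_arc 1) = hol (?g \<circ> base_path)" using D[OF g] by blast
  moreover have "hol (?g \<circ> tree_arc 1) = hol (f \<circ> (f_even \<circ> tau_loop))"
  proof (rule hol_cong)
    show "path_in (?g \<circ> tree_arc 1)" by (rule dyadic_map_arc[OF g]) simp
    show "(?g \<circ> tree_arc 1) t = (f \<circ> (f_even \<circ> tau_loop)) t" if "t \<in> {0..1}" for t
      using tree_arc_eq_height[of 0 0 t] dyadic_to_earring_height[of t 0] that arc_over_0[of t] by simp
  qed
  moreover have "hol (?g \<circ> base_path) = hol (f \<circ> (f_odd \<circ> tau_loop))"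
  proof (rule hol_cong)
    show "path_in (?g \<circ> base_path)" by (rule dyadic_map_path[OF g base_path(1,2)])
    show "(?g \<circ> base_path) t = (f \<circ> (f_odd \<circ> tau_loop)) t" if "t \<in> {0..1}" for t
      using dyadic_to_earring_base[of t] by (simp add: base_path_def)
  qed
  ultimately show ?thesis by simp
qed

end

section \<open>Families of loops on the tree\<close>

text \<open>
  The node at position \<open>m\<close> of the subtree with root \<open>k\<close>.
\<close>

fun descend :: "nat \<Rightarrow> nat \<Rightarrow> nat" where
  "descend k m = (if m \<le> 1 then k else 2 * descend k (m div 2) + m mod 2)"

declare descend.simps [simp del]

lemma descend_one [simp]: "descend k (Suc 0) = k" by (subst descend.simps) simp

lemma descend_child:
  assumes "m \<ge> 1"
  shows "descend k (2 * m) = 2 * descend k m" "descend k (Suc (2 * m)) = Suc (2 * descend k m)"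
  using assms descend.simps[of k "2 * m"] descend.simps[of k "Suc (2 * m)"] by auto

lemma tree_index_induct [consumes 1, case_names one left right]:
  assumes "m \<ge> (1::nat)" "P 1" "\<And>m. m \<ge> 1 \<Longrightarrow> P m \<Longrightarrow> P (2 * m)" "\<And>m. m \<ge> 1 \<Longrightarrow> P m \<Longrightarrow> P (Suc (2 * m))"
  shows "P m"
  using assms(1)
proof (induction m rule: less_induct)
  case (less m)
  show ?case
  proof (cases "m = 1")
    case False
    then have d: "m div 2 < m" "m div 2 \<ge> 1" using less.prems by auto
    show ?thesis
    proof (cases "even m")
      case True
      then show ?thesis using assms(3)[OF d(2) less.IH[OF d]] by simp
    next
      case False
      then have "m = Suc (2 * (m div 2))" by presburger
      then show ?thesis using assms(4)[OF d(2) less.IH[OF d]] by simp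
    qed
  qed (use assms(2) in simp)
qed

lemma tree_len_pos: "0 < tree_len k"
  by (induction k rule: tree_len.induct) (subst tree_len.simps, auto)

lemma tree_interval_unit: "k \<ge> 1 \<Longrightarrow> 0 \<le> tree_lo k \<and> tree_hi k \<le> 1"
proof (induction k rule: tree_index_induct)
  case (left m)
  then show ?case using tree_child[OF left(1)] tree_len_pos[of m] by (simp add: tree_hi_def)
next
  case (right m)
  then show ?case using tree_child[OF right(1)] tree_len_pos[of m] by (simp add: tree_hi_def)
qed simp

lemma tree_lo_le_hi: "tree_lo k \<le> tree_hi k"
  using tree_len_pos[of k] by (simp add: tree_hi_def)

lemma descend_props:
  assumes "k \<ge> 1"
  shows "m \<ge> 1 \<Longrightarrow> descend k m \<ge> 1 \<and> tree_lo k \<le> tree_lo (descend k m) \<and> tree_hi (descend k m) \<le> tree_hi k \<and>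
    tree_len (descend k m) = tree_len k * tree_len m"
proof (induction m rule: tree_index_induct)
  case (left m)
  then have d: "descend k m \<ge> 1" by blast
  show ?case
    unfolding descend_child(1)[OF left(1)] tree_child(1,3,5)[OF d] tree_child(1)[OF left(1)]
    using left tree_len_pos[of "descend k m"] by (auto simp: tree_hi_def)
next
  case (right m)
  then have d: "descend k m \<ge> 1" by blast
  show ?case
    unfolding descend_child(2)[OF right(1)] tree_child(2,4,6)[OF d] tree_child(2)[OF right(1)]
    using right tree_len_pos[of "descend k m"] by (auto simp: tree_hi_def)
qed (use assms in simp)

lemma tree_len_small:
  assumes "e > 0" obtains n0 where "\<And>m. m \<ge> n0 \<Longrightarrow> m \<ge> 1 \<Longrightarrow> tree_len m < e"
proof -
  obtain M :: nat where M: "2 / e < M" using reals_Archimedean2 by blast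
  have "tree_len m < e" if m: "m \<ge> M" "m \<ge> 1" for m
  proof -
    obtain d r where dr: "r < 2 ^ d" "m = 2 ^ d + r" using tree_index_cases[OF m(2)] .
    have "m < 2 * 2 ^ d" using dr by simp
    then have "real m < 2 * 2 ^ d" by (metis of_nat_less_iff of_nat_mult of_nat_numeral of_nat_power)
    moreover have "2 / e < real m" using M m(1) by linarith
    ultimately have "2 / e < 2 * 2 ^ d" by linarith
    then have "1 / 2 ^ d < e" using assms by (simp add: field_simps)
    then show ?thesis using tree_level(1)[OF dr(1)] dr(2) by simp
  qed
  then show ?thesis using that by blast
qed

lemma tree_len_unit: "m \<ge> 1 \<Longrightarrow> tree_len m \<le> 1"
  by (induction m rule: tree_index_induct) (auto simp: tree_child)

lemma tree_arc_near:
  assumes "k \<ge> 1" "s \<in> {0..1}" "tree_lo k \<le> t" "t \<le> tree_hi k"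
  shows "dist (tree_arc k s) (t, 0) \<le> 2 * tree_len k"
proof -
  have L: "0 < tree_len k" by (rule tree_len_pos)
  have "0 \<le> tree_len k * s" "tree_len k * s \<le> tree_len k" using L assms(2) by (auto simp: mult_left_le)
  then have x: "\<bar>tree_lo k + tree_len k * s - t\<bar> \<le> tree_len k" using assms(3,4) unfolding tree_hi_def by linarith
  have s2: "s\<^sup>2 \<le> s" using assms(2) by (simp add: power2_eq_square mult_left_le)
  have "s - s\<^sup>2 \<le> 1" using assms(2) by (smt (verit) atLeastAtMost_iff zero_le_power2)
  then have "sqrt (s - s\<^sup>2) \<le> 1" "0 \<le> sqrt (s - s\<^sup>2)" using s2 by auto
  then have y: "\<bar>tree_len k * sqrt (s - s\<^sup>2)\<bar> \<le> tree_len k" using L by (simp add: abs_mult mult_left_le)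
  have "dist (tree_arc k s) (t, 0) \<le> \<bar>tree_lo k + tree_len k * s - t\<bar> + \<bar>tree_len k * sqrt (s - s\<^sup>2)\<bar>"
    unfolding tree_arc_def dist_Pair_Pair dist_real_def
    by (rule order_trans[OF sqrt_sum_squares_le_sum_abs]) simp
  then show ?thesis using x y by linarith
qed

context normal_pi1
begin

abbreviation hawaiian_criterion :: bool where
  "hawaiian_criterion \<equiv> \<forall>f. earring_map f \<and> (\<forall>n\<ge>1. hol (f \<circ> hawaiian_loop (2 * n - 1)) = hol (f \<circ> hawaiian_loop (2 * n))) \<longrightarrow>
      hol (f \<circ> (f_odd \<circ> tau_loop)) = hol (f \<circ> (f_even \<circ> tau_loop))"

lemma hol_quotient_loop:
  assumes "A \<in> loops_at X w" "B \<in> loops_at X w" "C \<in> loops_at X w"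
  shows "hol (reversepath B +++ (A +++ reversepath C)) = inv\<^bsub>Q\<^esub> hol B \<otimes>\<^bsub>Q\<^esub> (hol A \<otimes>\<^bsub>Q\<^esub> inv\<^bsub>Q\<^esub> hol C)"
proof -
  note [simp] = loops_atD[OF assms(1)] loops_atD[OF assms(2)] loops_atD[OF assms(3)]
  have "hol (reversepath B +++ (A +++ reversepath C)) = hol (reversepath B) \<otimes>\<^bsub>Q\<^esub> hol (A +++ reversepath C)"
    by (intro hol_join) (auto simp: path_image_join)
  also have "hol (A +++ reversepath C) = hol A \<otimes>\<^bsub>Q\<^esub> hol (reversepath C)"
    by (intro hol_join) auto
  finally show ?thesis by (simp add: hol_reverse)
qed

text \<open>
  Both roots are infinite products of quotients. The quotients of \<open>A\<close> are put on the odd circles of one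
  earring and those of \<open>B\<close> on the even circles; the criterion then compares the products.
\<close>

lemma hol_null_trees_eq:
  assumes crit: hawaiian_criterion
    and A: "null_loops w X A" and B: "null_loops w X B"
    and eq: "\<And>i. i \<ge> 1 \<Longrightarrow> inv\<^bsub>Q\<^esub> hol (A (2 * i)) \<otimes>\<^bsub>Q\<^esub> (hol (A i) \<otimes>\<^bsub>Q\<^esub> inv\<^bsub>Q\<^esub> hol (A (Suc (2 * i)))) =
      inv\<^bsub>Q\<^esub> hol (B (2 * i)) \<otimes>\<^bsub>Q\<^esub> (hol (B i) \<otimes>\<^bsub>Q\<^esub> inv\<^bsub>Q\<^esub> hol (B (Suc (2 * i))))"
  shows "hol (A 1) = hol (B 1)"
proof -
  obtain gA where gA: "continuous_on hawaiian_earring gA" "gA \<in> hawaiian_earring \<rightarrow> X"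
    "\<And>i t. i \<ge> 1 \<Longrightarrow> t \<in> {0..1} \<Longrightarrow> gA (hawaiian_loop i t) = (reversepath (A (2 * i)) +++ (A i +++ reversepath (A (Suc (2 * i))))) t"
    "homotopic_paths X (A 1) (gA \<circ> tau_loop)"
    using telescoping[OF A] by blast
  obtain gB where gB: "continuous_on hawaiian_earring gB" "gB \<in> hawaiian_earring \<rightarrow> X"
    "\<And>i t. i \<ge> 1 \<Longrightarrow> t \<in> {0..1} \<Longrightarrow> gB (hawaiian_loop i t) = (reversepath (B (2 * i)) +++ (B i +++ reversepath (B (Suc (2 * i))))) t"
    "homotopic_paths X (B 1) (gB \<circ> tau_loop)"
    using telescoping[OF B] by blast
  have lA: "A n \<in> loops_at X w" "B n \<in> loops_at X w" if "n \<ge> 1" for n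
    using A B that by (auto simp: null_loops_def)
  have origin: "gA (0, 0) = w" "gB (0, 0) = w"
    using gA(3)[of 1 0] gB(3)[of 1 0] lA[of 2]
    by (auto simp: joinpaths_def reversepath_def loops_at_def pathfinish_def numeral_2_eq_2)
  define a where "a n = (if odd n then gA \<circ> hawaiian_loop (Suc n div 2) else gB \<circ> hawaiian_loop (n div 2))" for n
  have loop: "g \<circ> hawaiian_loop n \<in> loops_at X w"
    if "earring_map g" "g (0, 0) = w" "n \<ge> 1" for g n
    using that path_in_compose[of hawaiian_earring g "hawaiian_loop n"] hawaiian_loop_image_subset[OF that(3)]
    by (auto simp: loops_at_def pathstart_compose pathfinish_compose)
  have gm: "earring_map gA" "earring_map gB" using gA gB by auto
  have small: "\<exists>n0. \<forall>n\<ge>n0. n \<ge> 1 \<longrightarrow> path_image (g \<circ> hawaiian_loop n) \<subseteq> V"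
    if g: "continuous_on hawaiian_earring g" "g (0, 0) = w" and V: "open V" "w \<in> V" for g V
  proof -
    obtain T where T: "open T" "T \<inter> hawaiian_earring = g -` V \<inter> hawaiian_earring"
      using g(1) V(1) unfolding continuous_on_open_invariant by blast
    have "(0, 0) \<in> T" using T(2) g(2) V(2) hawaiian_origin_in by blast
    then obtain n0 where n0: "\<And>n t. n \<ge> n0 \<Longrightarrow> hawaiian_loop n t \<in> T" using hawaiian_loop_small[OF T(1)] by blast
    have "g (hawaiian_loop n t) \<in> V" if "n \<ge> n0" "n \<ge> 1" "t \<in> {0..1}" for n t
      using n0[OF that(1), of t] hawaiian_loop_in[OF that(2,3)] T(2) by blast
    then show ?thesis unfolding path_image_def by (intro exI[of _ n0]) auto
  qed
  have "null_loops w X a"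
    unfolding null_loops_def
  proof (intro conjI allI impI)
    fix n :: nat assume n: "n \<ge> 1"
    show "a n \<in> loops_at X w"
    proof (cases "odd n")
      case True
      then show ?thesis using loop[OF gm(1) origin(1), of "Suc n div 2"] n by (simp add: a_def)
    next
      case False
      then have "n div 2 \<ge> 1" using n by auto
      then show ?thesis using loop[OF gm(2) origin(2)] False by (simp add: a_def)
    qed
  next
    fix V assume V: "open V" "w \<in> V"
    obtain n1 where n1: "\<forall>n\<ge>n1. n \<ge> 1 \<longrightarrow> path_image (gA \<circ> hawaiian_loop n) \<subseteq> V" using small[OF gA(1) origin(1) V] by blast
    obtain n2 where n2: "\<forall>n\<ge>n2. n \<ge> 1 \<longrightarrow> path_image (gB \<circ> hawaiian_loop n) \<subseteq> V" using small[OF gB(1) origin(2) V] by blast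
    have "path_image (a n) \<subseteq> V" if n: "n \<ge> 2 * n1 + 2 * n2 + 2" for n
    proof (cases "odd n")
      case True
      have "Suc n div 2 \<ge> n1" "Suc n div 2 \<ge> 1" using n by auto
      then show ?thesis using n1 True by (simp add: a_def)
    next
      case False
      have "n div 2 \<ge> n2" "n div 2 \<ge> 1" using n by auto
      then show ?thesis using n2 False by (simp add: a_def)
    qed
    then show "\<exists>n0. \<forall>n\<ge>n0. path_image (a n) \<subseteq> V" by blast
  qed
  then obtain f where f: "continuous_on hawaiian_earring f" "f \<in> hawaiian_earring \<rightarrow> X"
    "\<And>n t. n \<ge> 1 \<Longrightarrow> t \<in> {0..1} \<Longrightarrow> f (hawaiian_loop n t) = a n t"
    using hawaiian_extension by blast
  have fo: "f (hawaiian_loop (2 * n - 1) t) = gA (hawaiian_loop n t)" and fe: "f (hawaiian_loop (2 * n) t) = gB (hawaiian_loop n t)"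
    if "n \<ge> 1" "t \<in> {0..1}" for n t
    using that f(3)[of "2 * n - 1" t] f(3)[of "2 * n" t] by (auto simp: a_def)
  have comp: "f (f_odd z) = gA z" "f (f_even z) = gB z" if z: "z \<in> hawaiian_earring" for z
  proof -
    obtain n t where nt: "n \<ge> 1" "t \<in> {0..1}" "z = hawaiian_loop n t" using hawaiian_earring_cases[OF z] .
    show "f (f_odd z) = gA z" "f (f_even z) = gB z"
      unfolding nt(3) f_odd_props(3)[OF nt(1,2)] f_even_props(3)[OF nt(1,2)] using fo fe nt by auto
  qed
  have gl: "hol (f \<circ> hawaiian_loop (2 * n - 1)) = hol (f \<circ> hawaiian_loop (2 * n))" if n: "n \<ge> 1" for n
  proof -
    have l: "f \<circ> hawaiian_loop m \<in> loops_at X (f (0, 0))" if "m \<ge> 1" for m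
      using that f path_in_compose[of hawaiian_earring f "hawaiian_loop m"] hawaiian_loop_image_subset[OF that]
      by (auto simp: loops_at_def pathstart_compose pathfinish_compose)
    have "hol (f \<circ> hawaiian_loop (2 * n - 1)) = hol (reversepath (A (2 * n)) +++ (A n +++ reversepath (A (Suc (2 * n)))))"
      using loops_atD[OF l[of "2 * n - 1"]] n fo[OF n] gA(3)[OF n] by (intro hol_cong) auto
    also have "\<dots> = hol (reversepath (B (2 * n)) +++ (B n +++ reversepath (B (Suc (2 * n)))))"
      using eq[OF n] lA[of n] lA[of "2 * n"] lA[of "Suc (2 * n)"] n by (simp add: hol_quotient_loop)
    also have "\<dots> = hol (f \<circ> hawaiian_loop (2 * n))"
      using loops_atD[OF l[of "2 * n"]] n fe[OF n] gB(3)[OF n] by (intro hol_cong[symmetric]) auto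
    finally show ?thesis .
  qed
  have "hol (A 1) = hol (gA \<circ> tau_loop)" by (rule hol_homotopic[OF gA(4)])
  also have "\<dots> = hol (f \<circ> (f_odd \<circ> tau_loop))"
    using homotopic_paths_imp_path[OF gA(4)] homotopic_paths_imp_subset[OF gA(4)] comp(1)[OF tau_loop_in]
    by (intro hol_cong) auto
  also have "\<dots> = hol (f \<circ> (f_even \<circ> tau_loop))"
    using crit[rule_format, of f] f(1,2) gl by blast
  also have "\<dots> = hol (gB \<circ> tau_loop)"
    using homotopic_paths_imp_path[OF gB(4)] homotopic_paths_imp_subset[OF gB(4)] comp(2)[OF tau_loop_in]
    by (intro hol_cong[symmetric]) auto
  also have "\<dots> = hol (B 1)" by (rule hol_homotopic[OF gB(4), symmetric])
  finally show ?thesis .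
qed

section \<open>Points at which the space is semilocally simply connected\<close>

lemma null_neighbourhood:
  assumes "x \<in> X" "x \<notin> wild_points X"
  obtains V where "open V" "x \<in> V"
    "\<And>p. p \<in> loops_at (X \<inter> V) x \<Longrightarrow> homotopic_paths X p (\<lambda>_. x)"
proof -
  obtain U where U: "openin (top_of_set X) U" "x \<in> U"
    "induced_hom X id ` carrier (fundamental_group U x) \<subseteq> {\<one>\<^bsub>fundamental_group X x\<^esub>}"
    using assms unfolding wild_points_def semilocally_simply_connected_at_def by blast
  obtain V where V: "open V" "U = X \<inter> V" using U(1) by (auto simp: openin_open)
  have "homotopic_paths X p (\<lambda>_. x)" if p: "p \<in> loops_at (X \<inter> V) x" for p
  proof -
    have "path_class (X \<inter> V) p \<in> carrier (fundamental_group U x)" using p by (simp add: fundamental_group_def V(2))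
    then have "induced_hom X id (path_class (X \<inter> V) p) = \<one>\<^bsub>fundamental_group X x\<^esub>" using U(3) by blast
    moreover have "induced_hom X id (path_class (X \<inter> V) p) = path_class X (id \<circ> p)"
      by (rule induced_hom_path_class[OF p]) (auto intro: continuous_on_id)
    ultimately have "path_class X p = path_class X (\<lambda>_. x)" by (simp add: fundamental_group_def)
    then show ?thesis using path_class_eq_iff[of p X] loops_atD[OF p] by auto
  qed
  then show ?thesis using that V U(2) by blast
qed

text \<open>
  A loop at \<open>l s\<close> inside a neighbourhood of \<open>l t\<close> as in \<open>null_neighbourhood\<close> becomes a loop at \<open>l t\<close>
  when conjugated by \<open>l\<close> between \<open>t\<close> and \<open>s\<close>. Only points that are connected to \<open>l t\<close> by a short piece of
  path are reached in this way, hence the formulation along a path.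
\<close>

lemma tame_nearby:
  fixes l :: "real \<Rightarrow> 'a"
  assumes l: "continuous_on {0..1} l" "l ` {0..1} \<subseteq> X" and t: "t \<in> {0..1}" "l t \<notin> wild_points X"
  obtains e :: real where "e > 0" "\<And>s. s \<in> {0..1} \<Longrightarrow> \<bar>s - t\<bar> < e \<Longrightarrow> l s \<notin> wild_points X"
proof -
  have ltX: "l t \<in> X" using l t by auto
  obtain V where V: "open V" "l t \<in> V" "\<And>p. p \<in> loops_at (X \<inter> V) (l t) \<Longrightarrow> homotopic_paths X p (\<lambda>_. l t)"
    using null_neighbourhood[OF ltX t(2)] by blast
  obtain T where T: "open T" "T \<inter> {0..1} = l -` V \<inter> {0..1}" using l(1) V(1) unfolding continuous_on_open_invariant by blast
  have "t \<in> T" using T(2) V(2) t(1) by blast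
  then obtain e where e: "e > 0" "ball t e \<subseteq> T" using T(1) open_contains_ball by blast
  have in_V: "l s \<in> V" if "s \<in> {0..1}" "\<bar>s - t\<bar> < e" for s
    using that e(2) T(2) by (auto simp: dist_real_def abs_minus_commute subset_iff)
  have "l s \<notin> wild_points X" if s: "s \<in> {0..1}" "\<bar>s - t\<bar> < e" for s
  proof -
    have lsX: "l s \<in> X" using l s by auto
    define c where "c = l \<circ> linepath t s"
    have lp: "linepath t s r \<in> {0..1}" "\<bar>linepath t s r - t\<bar> < e" if r: "r \<in> {0..1}" for r
    proof -
      have "linepath t s r \<in> closed_segment t s" using r linepath_in_path by blast
      then have seg: "min t s \<le> linepath t s r" "linepath t s r \<le> max t s" by (auto simp: closed_segment_eq_real_ivl split: if_splits)
      then show "linepath t s r \<in> {0..1}" "\<bar>linepath t s r - t\<bar> < e" using s t(1) by auto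
    qed
    have c: "path c" "path_image c \<subseteq> X \<inter> V" "pathstart c = l t" "pathfinish c = l s"
      using lp in_V l path_in_compose[of "{0..1}" l "linepath t s"]
      by (auto simp: c_def path_image_def pathstart_def pathfinish_def linepath_0' linepath_1' image_subset_iff)
    have "semilocally_simply_connected_at X (l s)"
      unfolding semilocally_simply_connected_at_def
    proof (intro exI[of _ "X \<inter> V"] conjI)
      show "openin (top_of_set X) (X \<inter> V)" using V(1) by (rule openin_open_Int)
      show "l s \<in> X \<inter> V" using lsX in_V s by blast
      show "induced_hom X id ` carrier (fundamental_group (X \<inter> V) (l s)) \<subseteq> {\<one>\<^bsub>fundamental_group X (l s)\<^esub>}"
      proof
        fix a assume "a \<in> induced_hom X id ` carrier (fundamental_group (X \<inter> V) (l s))"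
        then obtain p where p: "p \<in> loops_at (X \<inter> V) (l s)" "a = induced_hom X id (path_class (X \<inter> V) p)"
          by (auto simp: fundamental_group_def)
        note P = loops_atD[OF p(1)]
        have a: "a = path_class X p"
          using induced_hom_path_class[OF p(1), of id X] p(2) by (auto intro: continuous_on_id)
        interpret triv: group "fundamental_group X (l s)" by (rule group_fundamental_group[OF lsX])
        \<comment> \<open>Holonomy modulo the trivial subgroup at the base point \<open>l s\<close> does the computation with
          conjugates in the fundamental groupoid.\<close>
        interpret I: normal_pi1 X "l s" "{\<one>\<^bsub>fundamental_group X (l s)\<^esub>}"
          by (intro normal_pi1.intro conn lsX triv.one_is_normal)
        have "c +++ (p +++ reversepath c) \<in> loops_at (X \<inter> V) (l t)"
          using c P by (auto simp: loops_at_def path_image_join)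
        then have "homotopic_paths X (c +++ (p +++ reversepath c)) (\<lambda>_. l t)" by (rule V(3))
        then have "I.hol (c +++ (p +++ reversepath c)) = \<one>\<^bsub>I.Q\<^esub>" using I.hol_homotopic I.hol_const[OF ltX] by metis
        moreover have "I.hol (c +++ (p +++ reversepath c)) = I.hol c \<otimes>\<^bsub>I.Q\<^esub> (I.hol p \<otimes>\<^bsub>I.Q\<^esub> inv\<^bsub>I.Q\<^esub> I.hol c)"
        proof -
          have "I.hol (c +++ (p +++ reversepath c)) = I.hol c \<otimes>\<^bsub>I.Q\<^esub> I.hol (p +++ reversepath c)"
            using c P by (intro I.hol_join) (auto simp: path_image_join)
          also have "I.hol (p +++ reversepath c) = I.hol p \<otimes>\<^bsub>I.Q\<^esub> I.hol (reversepath c)"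
            using c P by (intro I.hol_join) auto
          also have "I.hol (reversepath c) = inv\<^bsub>I.Q\<^esub> I.hol c" using c by (intro I.hol_reverse) auto
          finally show ?thesis .
        qed
        moreover have cc: "I.hol c \<in> carrier I.Q" "I.hol p \<in> carrier I.Q" using c P by (auto intro!: I.hol_carrier)
        ultimately have "I.hol c \<otimes>\<^bsub>I.Q\<^esub> I.hol p \<otimes>\<^bsub>I.Q\<^esub> inv\<^bsub>I.Q\<^esub> I.hol c = \<one>\<^bsub>I.Q\<^esub>"
          by (simp add: I.Q.m_assoc)
        then have "I.hol c \<otimes>\<^bsub>I.Q\<^esub> I.hol p = I.hol c"
          using cc I.Q.inv_equality[of "I.hol c \<otimes>\<^bsub>I.Q\<^esub> I.hol p" "inv\<^bsub>I.Q\<^esub> I.hol c"] by simp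
        then have "I.hol p = \<one>\<^bsub>I.Q\<^esub>" using cc by (simp add: I.Q.l_cancel_one)
        moreover have "p \<in> loops_at X (l s)" using P by (auto simp: loops_at_def)
        ultimately have "path_class X p \<in> {\<one>\<^bsub>fundamental_group X (l s)\<^esub>}" using I.hol_one_iff by blast
        then show "a \<in> {\<one>\<^bsub>fundamental_group X (l s)\<^esub>}" by (simp only: a)
      qed
    qed
    then show ?thesis by (simp add: wild_points_def)
  qed
  then show ?thesis using that e(1) by blast
qed

lemma closed_wild_times:
  fixes l :: "real \<Rightarrow> 'a"
  assumes l: "continuous_on {0..1} l" "l ` {0..1} \<subseteq> X"
  shows "closed {t \<in> {0..1}. l t \<in> wild_points X}"
proof -
  have "openin (top_of_set {0..1}) {t \<in> {0..1}. l t \<notin> wild_points X}"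
    unfolding openin_contains_ball
  proof (intro conjI ballI)
    fix t assume t: "t \<in> {t \<in> {0..1}. l t \<notin> wild_points X}"
    then obtain e :: real where "e > 0" "\<And>s. s \<in> {0..1} \<Longrightarrow> \<bar>s - t\<bar> < e \<Longrightarrow> l s \<notin> wild_points X"
      using tame_nearby[OF l, of t] by blast
    then show "\<exists>e>0. ball t e \<inter> {0..1} \<subseteq> {t \<in> {0..1}. l t \<notin> wild_points X}"
      by (intro exI[of _ e]) (auto simp: dist_real_def abs_minus_commute)
  qed auto
  then have "closedin (top_of_set {0..1}) ({0..1} - {t \<in> {0..1}. l t \<notin> wild_points X})"
    by (intro closedin_diff) auto
  moreover have "{0..1} - {t \<in> {0..1}. l t \<notin> wild_points X} = {t \<in> {0..1}. l t \<in> wild_points X}" by auto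
  ultimately show ?thesis using closedin_closed_trans[of "{0..1}"] by auto
qed

section \<open>Arcs that are parallel to the base\<close>

text \<open>
  Modulo \<open>N\<close>, the arc of \<open>k\<close> is homotopic to the base below it.
\<close>

definition base_parallel :: "(real \<times> real \<Rightarrow> 'a) \<Rightarrow> nat \<Rightarrow> bool" where
  "base_parallel f k \<longleftrightarrow> hol (f \<circ> tree_arc k) = hol ((f \<circ> base_path) \<circ> linepath (tree_lo k) (tree_hi k))"

lemma base_map:
  assumes "dyadic_map f"
  shows "continuous_on {0..1} (f \<circ> base_path)" "(f \<circ> base_path) ` {0..1} \<subseteq> X"
  using dyadic_map_path[OF assms base_path(1,2)] by (auto simp: path_def path_image_def)

lemma tree_ends_unit: "k \<ge> 1 \<Longrightarrow> tree_lo k \<in> {0..1} \<and> tree_hi k \<in> {0..1}"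
  using tree_interval_unit[of k] tree_lo_le_hi[of k] by auto

lemma base_parallel_parent:
  assumes f: "dyadic_map f" "additive f" and k: "k \<ge> 1" and g: "base_parallel f (2 * k)" "base_parallel f (Suc (2 * k))"
  shows "base_parallel f k"
proof -
  let ?m = "tree_lo k + tree_len k / 2"
  have k2: "2 * k \<ge> 1" using k by simp
  have "hol (f \<circ> tree_arc k) = hol ((f \<circ> base_path) \<circ> linepath (tree_lo k) ?m) \<otimes>\<^bsub>Q\<^esub> hol ((f \<circ> base_path) \<circ> linepath ?m (tree_hi k))"
    using f(2) k g unfolding additive_def base_parallel_def by (metis tree_child)
  also have "\<dots> = hol ((f \<circ> base_path) \<circ> linepath (tree_lo k) (tree_hi k))"
    using tree_ends_unit[OF k] tree_ends_unit[OF k2] tree_child(5)[OF k] by (intro hol_segments[OF base_map[OF f(1)]]) auto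
  finally show ?thesis by (simp add: base_parallel_def)
qed

text \<open>
  Nested intervals: by \<open>base_parallel_parent\<close> one of the children of a node that is not parallel to the
  base is not parallel to the base either.
\<close>

lemma nonparallel_branch:
  assumes f: "dyadic_map f" "additive f" and k: "k \<ge> 1" and bad: "\<not> base_parallel f k"
  obtains t where "tree_lo k \<le> t" "t \<le> tree_hi k"
    "\<And>e. e > 0 \<Longrightarrow> \<exists>j\<ge>1. \<not> base_parallel f j \<and> tree_lo j \<le> t \<and> t \<le> tree_hi j \<and> tree_len j < e"
proof -
  define nxt where "nxt j = (if base_parallel f (2 * j) then Suc (2 * j) else 2 * j)" for j
  define c where "c n = (nxt ^^ n) k" for n
  have c_Suc: "c (Suc n) = 2 * c n \<or> c (Suc n) = Suc (2 * c n)" for n by (simp add: c_def nxt_def)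
  have c: "c n \<ge> 1 \<and> \<not> base_parallel f (c n) \<and> tree_len (c n) = tree_len k / 2 ^ n" for n
  proof (induction n)
    case 0
    then show ?case using k bad by (simp add: c_def)
  next
    case (Suc n)
    have "\<not> base_parallel f (nxt (c n))" using base_parallel_parent[OF f, of "c n"] Suc by (auto simp: nxt_def)
    moreover have "c (Suc n) = nxt (c n)" by (simp add: c_def)
    moreover have "tree_len (nxt (c n)) = tree_len (c n) / 2" "nxt (c n) \<ge> 1" using tree_child(1,2)[of "c n"] Suc by (auto simp: nxt_def)
    ultimately show ?case using Suc by simp
  qed
  have mono: "tree_lo (c n) \<le> tree_lo (c (Suc n)) \<and> tree_hi (c (Suc n)) \<le> tree_hi (c n)" for n
    using c_Suc[of n] tree_child[of "c n"] c[of n] tree_len_pos[of "c n"] by (auto simp: tree_hi_def)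
  have lim0: "(\<lambda>n. tree_len k / 2 ^ n) \<longlonglongrightarrow> 0"
  proof -
    have "(\<lambda>n. tree_len k * (1/2) ^ n) \<longlonglongrightarrow> tree_len k * 0" by (intro tendsto_intros LIMSEQ_realpow_zero) auto
    then show ?thesis by (simp add: power_divide)
  qed
  have "(\<lambda>n. tree_lo (c n) - tree_hi (c n)) = (\<lambda>n. - (tree_len k / 2 ^ n))" using c by (simp add: tree_hi_def)
  then have "(\<lambda>n. tree_lo (c n) - tree_hi (c n)) \<longlonglongrightarrow> 0" using tendsto_minus[OF lim0] by simp
  then obtain t where t: "\<And>n. tree_lo (c n) \<le> t" "\<And>n. t \<le> tree_hi (c n)"
    using nested_sequence_unique[of "\<lambda>n. tree_lo (c n)" "\<lambda>n. tree_hi (c n)"] mono tree_lo_le_hi by blast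
  show ?thesis
  proof (rule that)
    show "tree_lo k \<le> t" "t \<le> tree_hi k" using t[of 0] by (auto simp: c_def)
    fix e :: real assume "e > 0"
    then have "\<forall>\<^sub>F n in sequentially. tree_len k / 2 ^ n < e" using lim0 by (intro order_tendstoD(2)) auto
    then obtain n where "tree_len k / 2 ^ n < e" by (auto simp: eventually_sequentially)
    then show "\<exists>j\<ge>1. \<not> base_parallel f j \<and> tree_lo j \<le> t \<and> t \<le> tree_hi j \<and> tree_len j < e"
      using c[of n] t[of n] by (intro exI[of _ "c n"]) auto
  qed
qed

lemma near_base_point:
  assumes f: "dyadic_map f" and t: "t \<in> {0..1}" and V: "open V" "f (t, 0) \<in> V"
  obtains e :: real where "e > 0" "\<And>z. z \<in> dyadic_space \<Longrightarrow> dist z (t, 0) < e \<Longrightarrow> f z \<in> V"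
proof -
  obtain T where T: "open T" "T \<inter> dyadic_space = f -` V \<inter> dyadic_space"
    using f V(1) unfolding continuous_on_open_invariant by blast
  have "(t, 0) \<in> dyadic_space" using t by (simp add: dyadic_space_iff)
  then have "(t, 0) \<in> T" using T(2) V(2) by blast
  then obtain e where e: "e > 0" "ball (t, 0) e \<subseteq> T" using T(1) open_contains_ball by blast
  have "f z \<in> V" if "z \<in> dyadic_space" "dist z (t, 0) < e" for z
  proof -
    have "z \<in> ball (t, 0) e" using that(2) by (simp add: dist_commute)
    then show ?thesis using that(1) e(2) T(2) by blast
  qed
  then show ?thesis using that e(1) by blast
qed

text \<open>
  A small arc over \<open>t\<close> and the base below it form a loop in a neighbourhood in which all loops are
  contractible in \<open>X\<close>.
\<close>

lemma base_parallel_near_tame: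
  assumes f: "dyadic_map f" and t: "t \<in> {0..1}" "f (t, 0) \<notin> wild_points X"
  obtains e :: real where "e > 0"
    "\<And>j. j \<ge> 1 \<Longrightarrow> tree_lo j \<le> t \<Longrightarrow> t \<le> tree_hi j \<Longrightarrow> tree_len j < e \<Longrightarrow> base_parallel f j"
proof -
  let ?l = "f \<circ> base_path"
  have t0: "(t, 0) \<in> dyadic_space" using t(1) by (simp add: dyadic_space_iff)
  then have ftX: "f (t, 0) \<in> X" using f by auto
  obtain V where V: "open V" "f (t, 0) \<in> V" "\<And>p. p \<in> loops_at (X \<inter> V) (f (t, 0)) \<Longrightarrow> homotopic_paths X p (\<lambda>_. f (t, 0))"
    using null_neighbourhood[OF ftX t(2)] by blast
  obtain e where e: "e > 0" "\<And>z. z \<in> dyadic_space \<Longrightarrow> dist z (t, 0) < e \<Longrightarrow> f z \<in> V"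
    using near_base_point[OF f t(1) V(1,2)] by blast
  have "base_parallel f j" if j: "j \<ge> 1" "tree_lo j \<le> t" "t \<le> tree_hi j" "tree_len j < e / 2" for j
  proof -
    note u = tree_ends_unit[OF j(1)]
    have arcV: "path_image (f \<circ> tree_arc j) \<subseteq> X \<inter> V"
    proof -
      have "f (tree_arc j s) \<in> V" if "s \<in> {0..1}" for s
        using tree_arc_near[OF j(1) that j(2,3)] j(4) by (intro e(2) tree_arc_in_dyadic_space[OF j(1) that]) auto
      then show ?thesis using dyadic_map_arc[OF f j(1)] by (auto simp: path_image_def)
    qed
    have lV: "?l s \<in> V" if s: "tree_lo j \<le> s" "s \<le> tree_hi j" for s
    proof -
      have "dist (s, 0) (t, 0::real) < e" using s j(2-4) tree_len_pos[of j] by (auto simp: dist_Pair_Pair dist_real_def tree_hi_def)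
      moreover have "(s, 0) \<in> dyadic_space" using s u by (auto simp: dyadic_space_iff)
      ultimately show ?thesis using e(2) by (simp add: base_path_def)
    qed
    have seg: "path (?l \<circ> linepath r s) \<and> path_image (?l \<circ> linepath r s) \<subseteq> X \<inter> V"
      if rs: "tree_lo j \<le> r" "r \<le> tree_hi j" "tree_lo j \<le> s" "s \<le> tree_hi j" for r s
    proof -
      have lp: "path_image (linepath r s) \<subseteq> {tree_lo j..tree_hi j}" by (rule segment_real) (use rs in auto)
      have "path_in (?l \<circ> linepath r s)"
        using lp u by (intro path_in_compose[OF base_map[OF f]]) auto
      moreover have "path_image (?l \<circ> linepath r s) \<subseteq> V"
        unfolding path_image_compose
      proof (rule image_subsetI)
        fix x assume "x \<in> path_image (linepath r s)"
        then show "?l x \<in> V" using lp by (intro lV) auto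
      qed
      ultimately show ?thesis by blast
    qed
    let ?a = "tree_lo j" and ?b = "tree_hi j"
    define c where "c = ?l \<circ> linepath t ?a"
    define p where "p = f \<circ> tree_arc j"
    define q where "q = ?l \<circ> linepath ?a ?b"
    have ends: "pathstart c = f (t, 0)" "pathfinish c = ?l ?a" "pathstart p = ?l ?a" "pathfinish p = ?l ?b" "pathstart q = ?l ?a" "pathfinish q = ?l ?b"
      by (auto simp: c_def p_def q_def pathstart_compose pathfinish_compose base_path_def)
    have im: "path c" "path_image c \<subseteq> X \<inter> V" "path p" "path_image p \<subseteq> X \<inter> V" "path q" "path_image q \<subseteq> X \<inter> V"
      using seg[of t ?a] seg[of ?a ?b] j arcV dyadic_map_arc[OF f j(1)] tree_lo_le_hi[of j]
      by (auto simp: c_def p_def q_def)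
    have cc [simp]: "hol c \<in> carrier Q" "hol p \<in> carrier Q" "hol q \<in> carrier Q" using im by (auto intro!: hol_carrier)
    have "c +++ ((p +++ reversepath q) +++ reversepath c) \<in> loops_at (X \<inter> V) (f (t, 0))"
      using im ends by (auto simp: loops_at_def path_image_join)
    then have "homotopic_paths X (c +++ ((p +++ reversepath q) +++ reversepath c)) (\<lambda>_. f (t, 0))" by (rule V(3))
    then have "hol (c +++ ((p +++ reversepath q) +++ reversepath c)) = \<one>\<^bsub>Q\<^esub>" using hol_homotopic hol_const[OF ftX] by metis
    moreover have "hol (c +++ ((p +++ reversepath q) +++ reversepath c)) = hol c \<otimes>\<^bsub>Q\<^esub> (hol p \<otimes>\<^bsub>Q\<^esub> inv\<^bsub>Q\<^esub> hol q \<otimes>\<^bsub>Q\<^esub> inv\<^bsub>Q\<^esub> hol c)"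
    proof -
      have "hol (c +++ ((p +++ reversepath q) +++ reversepath c)) = hol c \<otimes>\<^bsub>Q\<^esub> hol ((p +++ reversepath q) +++ reversepath c)"
        using im ends by (intro hol_join) (auto simp: path_image_join)
      also have "hol ((p +++ reversepath q) +++ reversepath c) = hol (p +++ reversepath q) \<otimes>\<^bsub>Q\<^esub> hol (reversepath c)"
        using im ends by (intro hol_join) (auto simp: path_image_join)
      also have "hol (p +++ reversepath q) = hol p \<otimes>\<^bsub>Q\<^esub> hol (reversepath q)"
        using im ends by (intro hol_join) auto
      finally show ?thesis using im by (simp add: hol_reverse)
    qed
    ultimately have "(hol c \<otimes>\<^bsub>Q\<^esub> (hol p \<otimes>\<^bsub>Q\<^esub> inv\<^bsub>Q\<^esub> hol q)) \<otimes>\<^bsub>Q\<^esub> inv\<^bsub>Q\<^esub> hol c = \<one>\<^bsub>Q\<^esub>"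
      by (simp add: Q.m_assoc)
    then have "hol c \<otimes>\<^bsub>Q\<^esub> (hol p \<otimes>\<^bsub>Q\<^esub> inv\<^bsub>Q\<^esub> hol q) = hol c"
      using Q.inv_equality[of "hol c \<otimes>\<^bsub>Q\<^esub> (hol p \<otimes>\<^bsub>Q\<^esub> inv\<^bsub>Q\<^esub> hol q)" "inv\<^bsub>Q\<^esub> hol c"] by simp
    then have "hol p \<otimes>\<^bsub>Q\<^esub> inv\<^bsub>Q\<^esub> hol q = \<one>\<^bsub>Q\<^esub>" by (simp add: Q.l_cancel_one)
    then have "hol p = hol q" using Q.inv_equality[of "hol p" "inv\<^bsub>Q\<^esub> hol q"] by simp
    then show ?thesis by (simp add: base_parallel_def p_def q_def)
  qed
  then show ?thesis using that[of "e / 2"] e(1) by simp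
qed

lemma base_parallel_if_tame:
  assumes f: "dyadic_map f" "additive f" and k: "k \<ge> 1"
    and tame: "\<And>t. tree_lo k \<le> t \<Longrightarrow> t \<le> tree_hi k \<Longrightarrow> f (t, 0) \<notin> wild_points X"
  shows "base_parallel f k"
proof (rule ccontr)
  assume "\<not> base_parallel f k"
  then obtain t where t: "tree_lo k \<le> t" "t \<le> tree_hi k"
    "\<And>e. e > 0 \<Longrightarrow> \<exists>j\<ge>1. \<not> base_parallel f j \<and> tree_lo j \<le> t \<and> t \<le> tree_hi j \<and> tree_len j < e"
    using nonparallel_branch[OF f k] by metis
  have "t \<in> {0..1}" using t(1,2) tree_ends_unit[OF k] by auto
  then obtain e :: real where "e > 0" "\<And>j. j \<ge> 1 \<Longrightarrow> tree_lo j \<le> t \<Longrightarrow> t \<le> tree_hi j \<Longrightarrow> tree_len j < e \<Longrightarrow> base_parallel f j"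
    using base_parallel_near_tame[OF f(1) _ tame[OF t(1,2)]] by blast
  then show False using t(3) by blast
qed

end

context normal_pi1
begin

text \<open>
  The quotient of a node of the tree \<open>A\<close> in \<open>base_parallel_near_wild\<close>: the defects \<open>a\<close> and \<open>b\<close> of
  the children cancel that of the parent, which is their product.
\<close>

lemma additive_conjugate_telescope:
  assumes "Tu \<in> carrier Q" "a \<in> carrier Q" "Tv \<in> carrier Q" "Tu' \<in> carrier Q" "b \<in> carrier Q" "Tv' \<in> carrier Q"
  shows "inv\<^bsub>Q\<^esub> (inv\<^bsub>Q\<^esub> Tu \<otimes>\<^bsub>Q\<^esub> (a \<otimes>\<^bsub>Q\<^esub> Tv)) \<otimes>\<^bsub>Q\<^esub> ((inv\<^bsub>Q\<^esub> Tu \<otimes>\<^bsub>Q\<^esub> ((a \<otimes>\<^bsub>Q\<^esub> b) \<otimes>\<^bsub>Q\<^esub> Tv')) \<otimes>\<^bsub>Q\<^esub>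
      inv\<^bsub>Q\<^esub> (inv\<^bsub>Q\<^esub> Tu' \<otimes>\<^bsub>Q\<^esub> (b \<otimes>\<^bsub>Q\<^esub> Tv'))) = inv\<^bsub>Q\<^esub> Tv \<otimes>\<^bsub>Q\<^esub> Tu'"
  using assms by (simp add: Q.inv_mult_group Q.m_assoc Q.inv_mult_cancel)

text \<open>
  The base over node \<open>k\<close> meets wild points in \<open>w\<close> only, at a closed set \<open>\<Lambda>\<close> of times. For a descendant
  whose interval meets \<open>\<Lambda>\<close>, let \<open>u\<close> and \<open>v\<close> be its first and last time in \<open>\<Lambda>\<close>. The loop \<open>B\<close> is the base
  from \<open>u\<close> to \<open>v\<close>; the loop \<open>A\<close> goes from \<open>u\<close> back to the left end along the base, follows the arc, and
  goes back to \<open>v\<close>. If the interval misses \<open>\<Lambda>\<close>, both loops are constant, which loses nothing since the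
  arc is then parallel to the base. By additivity the quotients of \<open>A\<close> and \<open>B\<close> have the same
  holonomy, namely that of the base from the last time in the left half to the first time in the right
  half, and trivial holonomy if one of the halves misses \<open>\<Lambda>\<close>. So the roots agree.
\<close>

lemma base_parallel_near_wild:
  assumes crit: hawaiian_criterion
    and f: "dyadic_map f" "additive f" and k: "k \<ge> 1"
    and t: "tree_lo k \<le> t" "t \<le> tree_hi k" "f (t, 0) \<in> wild_points X"
    and isolated: "\<And>s. tree_lo k \<le> s \<Longrightarrow> s \<le> tree_hi k \<Longrightarrow> f (s, 0) \<in> wild_points X \<Longrightarrow> f (s, 0) = f (t, 0)"
  shows "base_parallel f k"
proof -
  define w where "w = f (t, 0)"
  define l where "l = f \<circ> base_path"
  have l: "continuous_on {0..1} l" "l ` {0..1} \<subseteq> X" using base_map[OF f(1)] by (auto simp: l_def)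
  have l_eq: "l s = f (s, 0)" for s by (simp add: l_def base_path_def)
  define \<Lambda> where "\<Lambda> = {s \<in> {0..1}. l s \<in> wild_points X} \<inter> {tree_lo k..tree_hi k}"
  have \<Lambda>_closed: "closed \<Lambda>" unfolding \<Lambda>_def by (intro closed_Int closed_wild_times[OF l]) auto
  have \<Lambda>_w: "l s = w" "s \<in> {0..1}" if "s \<in> \<Lambda>" for s using that isolated by (auto simp: \<Lambda>_def w_def l_eq)
  note u01 = tree_ends_unit[OF k]
  have t\<Lambda>: "t \<in> \<Lambda>" using t u01 by (auto simp: \<Lambda>_def l_eq)
  have wX: "w \<in> X" using \<Lambda>_w[OF t\<Lambda>] l by auto
  define d where "d m = descend k m" for m
  define S where "S m = \<Lambda> \<inter> {tree_lo (d m)..tree_hi (d m)}" for m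
  define u where "u m = Inf (S m)" for m
  define v where "v m = Sup (S m)" for m
  have dm: "d m \<ge> 1" "tree_lo k \<le> tree_lo (d m)" "tree_hi (d m) \<le> tree_hi k" "tree_len (d m) = tree_len k * tree_len m" if "m \<ge> 1" for m
    using descend_props[OF k that] by (auto simp: d_def)
  have d_child: "d (2 * m) = 2 * d m" "d (Suc (2 * m)) = Suc (2 * d m)" if "m \<ge> 1" for m
    using descend_child[OF that] by (auto simp: d_def)
  have S_bdd: "bdd_below (S m)" "bdd_above (S m)" "closed (S m)" for m
    using \<Lambda>_closed by (auto simp: S_def bdd_below_def bdd_above_def intro: exI[of _ "tree_lo (d m)"] exI[of _ "tree_hi (d m)"])
  have uS: "u m \<in> S m" and vS: "v m \<in> S m" if "S m \<noteq> {}" for m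
    unfolding u_def v_def using that S_bdd by (auto intro: closed_contains_Inf closed_contains_Sup)
  have SD: "s \<in> {0..1}" "tree_lo (d m) \<le> s" "s \<le> tree_hi (d m)" "l s = w" if "s \<in> S m" for s m
    using that \<Lambda>_w by (auto simp: S_def)
  have dm01: "tree_lo (d m) \<in> {0..1}" "tree_hi (d m) \<in> {0..1}" if "m \<ge> 1" for m
    using tree_ends_unit[OF dm(1)[OF that]] by auto
  have S_child: "S m = S (2 * m) \<union> S (Suc (2 * m))" and S_order: "x \<in> S (2 * m) \<Longrightarrow> y \<in> S (Suc (2 * m)) \<Longrightarrow> x \<le> y"
    if m: "m \<ge> 1" for m x y
    using tree_child[OF dm(1)[OF m]] d_child[OF m] tree_len_pos[of "d m"] by (auto simp: S_def tree_hi_def)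
  have u_child: "u m = (if S (2 * m) \<noteq> {} then u (2 * m) else u (Suc (2 * m)))"
    and v_child: "v m = (if S (Suc (2 * m)) \<noteq> {} then v (Suc (2 * m)) else v (2 * m))" if m: "m \<ge> 1" for m
  proof -
    show "u m = (if S (2 * m) \<noteq> {} then u (2 * m) else u (Suc (2 * m)))"
    proof (cases "S (2 * m) = {}")
      case False
      have "Inf (S m) = u (2 * m)"
      proof (rule cInf_eq_minimum)
        show "u (2 * m) \<in> S m" using uS[OF False] S_child[OF m] by blast
        fix x assume "x \<in> S m"
        then consider "x \<in> S (2 * m)" | "x \<in> S (Suc (2 * m))" using S_child[OF m] by blast
        then show "u (2 * m) \<le> x"
        proof cases
          case 1
          then show ?thesis unfolding u_def by (rule cInf_lower[OF _ S_bdd(1)])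
        next
          case 2
          then show ?thesis using S_order[OF m uS[OF False]] by blast
        qed
      qed
      then show ?thesis using False by (simp add: u_def)
    qed (use S_child[OF m] in \<open>simp add: u_def\<close>)
    show "v m = (if S (Suc (2 * m)) \<noteq> {} then v (Suc (2 * m)) else v (2 * m))"
    proof (cases "S (Suc (2 * m)) = {}")
      case False
      have "Sup (S m) = v (Suc (2 * m))"
      proof (rule cSup_eq_maximum)
        show "v (Suc (2 * m)) \<in> S m" using vS[OF False] S_child[OF m] by blast
        fix x assume "x \<in> S m"
        then consider "x \<in> S (2 * m)" | "x \<in> S (Suc (2 * m))" using S_child[OF m] by blast
        then show "x \<le> v (Suc (2 * m))"
        proof cases
          case 1
          then show ?thesis using S_order[OF m _ vS[OF False]] by blast
        next
          case 2
          then show ?thesis unfolding v_def by (rule cSup_upper[OF _ S_bdd(2)])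
        qed
      qed
      then show ?thesis using False by (simp add: v_def)
    qed (use S_child[OF m] in \<open>simp add: v_def\<close>)
  qed
  \<comment> \<open>Constant loops where there is no wild time: an infimum of the empty set has no meaning.\<close>
  define A where "A m = (if S m = {} then (\<lambda>_. w) else (l \<circ> linepath (u m) (tree_lo (d m))) +++
      ((f \<circ> tree_arc (d m)) +++ (l \<circ> linepath (tree_hi (d m)) (v m))))" for m
  define B where "B m = (if S m = {} then (\<lambda>_. w) else l \<circ> linepath (u m) (v m))" for m
  have seg: "path_in (l \<circ> linepath r s)" if "r \<in> {0..1}" "s \<in> {0..1}" for r s
    using that segment_real[of "{0..1}" r s] by (intro path_in_compose[OF l]) auto
  have arc_ends: "pathstart (f \<circ> tree_arc j) = l (tree_lo j)" "pathfinish (f \<circ> tree_arc j) = l (tree_hi j)" for j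
    by (auto simp: pathstart_compose pathfinish_compose l_eq)
  have AB_loop: "A m \<in> loops_at X w" "B m \<in> loops_at X w" if m: "m \<ge> 1" for m
  proof -
    have "A m \<in> loops_at X w \<and> B m \<in> loops_at X w"
    proof (cases "S m = {}")
      case True
      then show ?thesis using wX by (auto simp: A_def B_def loops_at_def)
    next
      case False
      note uv = SD[OF uS[OF False]] SD[OF vS[OF False]] dm01[OF m]
      then show ?thesis
        using False seg[of "u m" "tree_lo (d m)"] seg[of "tree_hi (d m)" "v m"] seg[of "u m" "v m"] dyadic_map_arc[OF f(1) dm(1)[OF m]] arc_ends
        by (auto simp: A_def B_def loops_at_def path_image_join pathstart_compose pathfinish_compose)
    qed
    then show "A m \<in> loops_at X w" "B m \<in> loops_at X w" by auto
  qed
  \<comment> \<open>By compactness of \<open>\<Lambda>\<close>, short arcs and base segments that meet it have images near \<open>w\<close>.\<close>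
  have AB_small: "\<exists>n0. \<forall>n\<ge>n0. path_image (A n) \<subseteq> V \<and> path_image (B n) \<subseteq> V" if V: "open V" "w \<in> V" for V
  proof -
    obtain T where T: "open T" "T \<inter> dyadic_space = f -` V \<inter> dyadic_space"
      using f(1) V(1) unfolding continuous_on_open_invariant by blast
    have "bounded \<Lambda>" by (rule bounded_subset[of "{0..1}"]) (use \<Lambda>_w in auto)
    then have "compact \<Lambda>" using \<Lambda>_closed by (simp add: compact_eq_bounded_closed)
    then have "compact (\<Lambda> \<times> {0::real})" by (intro compact_Times) auto
    moreover have "\<Lambda> \<times> {0} \<subseteq> T"
    proof
      fix z assume "z \<in> \<Lambda> \<times> {0::real}"
      then obtain s where s: "z = (s, 0)" "s \<in> \<Lambda>" by auto
      have "z \<in> f -` V \<inter> dyadic_space" using \<Lambda>_w[OF s(2)] V(2) by (auto simp: s(1) l_eq dyadic_space_iff)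
      then show "z \<in> T" using T(2) by blast
    qed
    ultimately obtain e where e: "e > 0" "(\<Union>x\<in>\<Lambda> \<times> {0}. ball x e) \<subseteq> T"
      using compact_subset_open_imp_ball_epsilon_subset[OF _ T(1)] by metis
    have near: "f z \<in> V" if "z \<in> dyadic_space" "s \<in> \<Lambda>" "dist z (s, 0) < e" for z s
    proof -
      have "z \<in> ball (s, 0) e" using that(3) by (simp add: dist_commute)
      then show ?thesis using that(1,2) e(2) T(2) by blast
    qed
    obtain n0 where n0: "\<And>m. m \<ge> n0 \<Longrightarrow> m \<ge> 1 \<Longrightarrow> tree_len m < e / 2" using tree_len_small[of "e / 2"] e(1) by auto
    have "path_image (A m) \<subseteq> V \<and> path_image (B m) \<subseteq> V" if m: "m \<ge> max 1 n0" for m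
    proof (cases "S m = {}")
      case True
      then show ?thesis using V(2) by (simp add: A_def B_def)
    next
      case False
      have m1: "m \<ge> 1" "m \<ge> n0" using m by auto
      have "tree_len k * tree_len m \<le> tree_len m" using tree_len_unit[OF k] tree_len_pos[of m] tree_len_pos[of k] by (simp add: mult_left_le_one_le)
      then have len: "2 * tree_len (d m) < e" using n0[OF m1(2,1)] dm(4)[OF m1(1)] by linarith
      note uu = SD[OF uS[OF False]] and vv = SD[OF vS[OF False]]
      have u\<Lambda>: "u m \<in> \<Lambda>" using uS[OF False] by (simp add: S_def)
      have lV: "l s \<in> V" if s: "tree_lo (d m) \<le> s" "s \<le> tree_hi (d m)" for s
      proof -
        have "(s, 0) \<in> dyadic_space" using s dm01[OF m1(1)] by (auto simp: dyadic_space_iff)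
        moreover have "dist (s, 0) (u m, 0::real) < e"
          using s uu(2,3) len tree_len_pos[of "d m"] by (auto simp: dist_Pair_Pair dist_real_def tree_hi_def)
        ultimately show ?thesis using near[OF _ u\<Lambda>] by (simp add: l_eq)
      qed
      have segV: "path_image (l \<circ> linepath r s) \<subseteq> V"
        if rs: "tree_lo (d m) \<le> r" "r \<le> tree_hi (d m)" "tree_lo (d m) \<le> s" "s \<le> tree_hi (d m)" for r s
        unfolding path_image_compose
      proof (rule image_subsetI)
        fix x assume "x \<in> path_image (linepath r s)"
        moreover have "path_image (linepath r s) \<subseteq> {tree_lo (d m)..tree_hi (d m)}" by (rule segment_real) (use rs in auto)
        ultimately show "l x \<in> V" by (intro lV) auto
      qed
      have arcV: "path_image (f \<circ> tree_arc (d m)) \<subseteq> V"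
        unfolding path_image_def
      proof (rule image_subsetI)
        fix s :: real assume s: "s \<in> {0..1}"
        show "(f \<circ> tree_arc (d m)) s \<in> V"
          using near[OF tree_arc_in_dyadic_space[OF dm(1)[OF m1(1)] s] u\<Lambda>] tree_arc_near[OF dm(1)[OF m1(1)] s uu(2,3)] len by simp
      qed
      have "path_image (A m) \<subseteq> V"
        using False segV arcV uu vv tree_lo_le_hi[of "d m"] unfolding A_def
        by (simp only: if_False) (intro subset_path_image_join; auto)
      moreover have "path_image (B m) \<subseteq> V" using False segV uu vv unfolding B_def by auto
      ultimately show ?thesis by blast
    qed
    then show ?thesis by blast
  qed
  have null: "null_loops w X A" "null_loops w X B"
  proof -
    have "null_loops w X A \<and> null_loops w X B"
      unfolding null_loops_def
    proof (intro conjI allI impI)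
      fix V assume V: "open V" "w \<in> V"
      obtain n0 where "\<forall>n\<ge>n0. path_image (A n) \<subseteq> V \<and> path_image (B n) \<subseteq> V" using AB_small[OF V] by blast
      then show "\<exists>n0. \<forall>n\<ge>n0. path_image (A n) \<subseteq> V" "\<exists>n0. \<forall>n\<ge>n0. path_image (B n) \<subseteq> V" by blast+
    qed (simp_all only: AB_loop)
    then show "null_loops w X A" "null_loops w X B" by auto
  qed
  \<comment> \<open>\<open>T\<close> is a potential for the base, and \<open>a m\<close> is the defect of arc \<open>d m\<close> against the base, carried
    back to \<open>0\<close>. Defects are multiplicative and trivial exactly for arcs parallel to the base.\<close>
  define T where "T s = hol (l \<circ> linepath 0 s)" for s
  have Tc [simp]: "T s \<in> carrier Q" if s: "s \<in> {0..1}" for s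
    unfolding T_def by (rule hol_carrier[OF seg[OF _ s]]) simp
  have hseg: "hol (l \<circ> linepath r s) = inv\<^bsub>Q\<^esub> T r \<otimes>\<^bsub>Q\<^esub> T s" if "r \<in> {0..1}" "s \<in> {0..1}" for r s
  proof -
    have "T r \<otimes>\<^bsub>Q\<^esub> hol (l \<circ> linepath r s) = T s" unfolding T_def
      by (rule hol_segments[OF l convex_real_interval(5) _ that]) simp
    moreover have "hol (l \<circ> linepath r s) \<in> carrier Q" using seg[OF that] by (rule hol_carrier)
    ultimately show ?thesis using Q.inv_mult_cancel(1)[OF Tc[OF that(1)], of "hol (l \<circ> linepath r s)"] by simp
  qed
  define a where "a m = T (tree_lo (d m)) \<otimes>\<^bsub>Q\<^esub> hol (f \<circ> tree_arc (d m)) \<otimes>\<^bsub>Q\<^esub> inv\<^bsub>Q\<^esub> T (tree_hi (d m))" for m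
  have arcc: "hol (f \<circ> tree_arc (d m)) \<in> carrier Q" if "m \<ge> 1" for m by (rule arc_carrier[OF f(1) dm(1)[OF that]])
  have ac [simp]: "a m \<in> carrier Q" if "m \<ge> 1" for m using arcc[OF that] dm01[OF that] by (simp add: a_def)
  have a_trivial_iff: "base_parallel f (d m) \<longleftrightarrow> a m = \<one>\<^bsub>Q\<^esub>" if m: "m \<ge> 1" for m
  proof -
    note c = Tc[OF dm01(1)[OF m]] Tc[OF dm01(2)[OF m]] arcc[OF m]
    have "base_parallel f (d m) \<longleftrightarrow> hol (f \<circ> tree_arc (d m)) = inv\<^bsub>Q\<^esub> T (tree_lo (d m)) \<otimes>\<^bsub>Q\<^esub> T (tree_hi (d m))"
      unfolding base_parallel_def l_def[symmetric] hseg[OF dm01[OF m]] ..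
    also have "\<dots> \<longleftrightarrow> T (tree_lo (d m)) \<otimes>\<^bsub>Q\<^esub> hol (f \<circ> tree_arc (d m)) = T (tree_hi (d m))"
    proof
      assume "hol (f \<circ> tree_arc (d m)) = inv\<^bsub>Q\<^esub> T (tree_lo (d m)) \<otimes>\<^bsub>Q\<^esub> T (tree_hi (d m))"
      then show "T (tree_lo (d m)) \<otimes>\<^bsub>Q\<^esub> hol (f \<circ> tree_arc (d m)) = T (tree_hi (d m))"
        using c by (simp add: Q.inv_mult_cancel)
    next
      assume "T (tree_lo (d m)) \<otimes>\<^bsub>Q\<^esub> hol (f \<circ> tree_arc (d m)) = T (tree_hi (d m))"
      then show "hol (f \<circ> tree_arc (d m)) = inv\<^bsub>Q\<^esub> T (tree_lo (d m)) \<otimes>\<^bsub>Q\<^esub> T (tree_hi (d m))"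
        using Q.inv_mult_cancel(1)[OF c(1,3)] by simp
    qed
    also have "\<dots> \<longleftrightarrow> a m = \<one>\<^bsub>Q\<^esub>"
    proof
      assume "a m = \<one>\<^bsub>Q\<^esub>"
      then have "inv\<^bsub>Q\<^esub> (inv\<^bsub>Q\<^esub> T (tree_hi (d m))) = T (tree_lo (d m)) \<otimes>\<^bsub>Q\<^esub> hol (f \<circ> tree_arc (d m))"
        unfolding a_def by (rule Q.inv_equality) (use c in simp_all)
      then show "T (tree_lo (d m)) \<otimes>\<^bsub>Q\<^esub> hol (f \<circ> tree_arc (d m)) = T (tree_hi (d m))" using c by simp
    qed (use c in \<open>simp add: a_def\<close>)
    finally show ?thesis .
  qed
  have a_child: "a m = a (2 * m) \<otimes>\<^bsub>Q\<^esub> a (Suc (2 * m))" if m: "m \<ge> 1" for m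
  proof -
    have m2: "2 * m \<ge> 1" "Suc (2 * m) \<ge> 1" using m by auto
    note c = Tc[OF dm01(1)[OF m]] Tc[OF dm01(2)[OF m]] arcc[OF m2(1)] arcc[OF m2(2)] Tc[OF dm01(2)[OF m2(1)]]
    have e: "tree_lo (d (2 * m)) = tree_lo (d m)" "tree_hi (d (Suc (2 * m))) = tree_hi (d m)" "tree_lo (d (Suc (2 * m))) = tree_hi (d (2 * m))"
      unfolding d_child[OF m] using tree_child[OF dm(1)[OF m]] by auto
    have "hol (f \<circ> tree_arc (d m)) = hol (f \<circ> tree_arc (d (2 * m))) \<otimes>\<^bsub>Q\<^esub> hol (f \<circ> tree_arc (d (Suc (2 * m))))"
      using f(2)[unfolded additive_def] dm(1)[OF m] unfolding d_child[OF m] by blast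
    then show ?thesis unfolding a_def e using c by (simp add: Q.m_assoc Q.inv_mult_cancel)
  qed
  have hA: "hol (A m) = inv\<^bsub>Q\<^esub> T (u m) \<otimes>\<^bsub>Q\<^esub> (a m \<otimes>\<^bsub>Q\<^esub> T (v m))"
    and hB: "hol (B m) = inv\<^bsub>Q\<^esub> T (u m) \<otimes>\<^bsub>Q\<^esub> T (v m)" if m: "m \<ge> 1" and ne: "S m \<noteq> {}" for m
  proof -
    note uu = SD[OF uS[OF ne]] and vv = SD[OF vS[OF ne]]
    note c = Tc[OF dm01(1)[OF m]] Tc[OF dm01(2)[OF m]] arcc[OF m] Tc[OF uu(1)] Tc[OF vv(1)]
    note p = seg[OF uu(1) dm01(1)[OF m]] seg[OF dm01(2)[OF m] vv(1)] dyadic_map_arc[OF f(1) dm(1)[OF m]]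
    have "hol (A m) = hol (l \<circ> linepath (u m) (tree_lo (d m))) \<otimes>\<^bsub>Q\<^esub> (hol (f \<circ> tree_arc (d m)) \<otimes>\<^bsub>Q\<^esub> hol (l \<circ> linepath (tree_hi (d m)) (v m)))"
    proof -
      have "hol (A m) = hol (l \<circ> linepath (u m) (tree_lo (d m))) \<otimes>\<^bsub>Q\<^esub> hol ((f \<circ> tree_arc (d m)) +++ (l \<circ> linepath (tree_hi (d m)) (v m)))"
        using p ne arc_ends unfolding A_def by (simp only: if_False) (intro hol_join, auto simp: path_image_join pathstart_compose pathfinish_compose)
      also have "hol ((f \<circ> tree_arc (d m)) +++ (l \<circ> linepath (tree_hi (d m)) (v m))) = hol (f \<circ> tree_arc (d m)) \<otimes>\<^bsub>Q\<^esub> hol (l \<circ> linepath (tree_hi (d m)) (v m))"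
        using p arc_ends by (intro hol_join) (auto simp: pathstart_compose pathfinish_compose)
      finally show ?thesis .
    qed
    then show "hol (A m) = inv\<^bsub>Q\<^esub> T (u m) \<otimes>\<^bsub>Q\<^esub> (a m \<otimes>\<^bsub>Q\<^esub> T (v m))"
      unfolding hseg[OF uu(1) dm01(1)[OF m]] hseg[OF dm01(2)[OF m] vv(1)] a_def using c by (simp add: Q.m_assoc)
    show "hol (B m) = inv\<^bsub>Q\<^esub> T (u m) \<otimes>\<^bsub>Q\<^esub> T (v m)"
      using ne hseg[OF uu(1) vv(1)] by (simp add: B_def)
  qed
  have hA0: "hol (A m) = \<one>\<^bsub>Q\<^esub>" "hol (B m) = \<one>\<^bsub>Q\<^esub>" if "S m = {}" for m
    using that wX by (auto simp: A_def B_def)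
  have a_tame: "a m = \<one>\<^bsub>Q\<^esub>" if m: "m \<ge> 1" and empty: "S m = {}" for m
  proof -
    have "base_parallel f (d m)"
    proof (rule base_parallel_if_tame[OF f dm(1)[OF m]])
      fix s assume s: "tree_lo (d m) \<le> s" "s \<le> tree_hi (d m)"
      then have "s \<notin> \<Lambda>" using empty by (auto simp: S_def)
      then show "f (s, 0) \<notin> wild_points X" using s dm(2,3)[OF m] dm01[OF m] by (auto simp: \<Lambda>_def l_eq)
    qed
    then show ?thesis using a_trivial_iff[OF m] by blast
  qed
  have "hol (A 1) = hol (B 1)"
  proof (rule hol_null_trees_eq[OF crit null])
    fix m :: nat assume m: "m \<ge> 1"
    have m2: "2 * m \<ge> 1" "Suc (2 * m) \<ge> 1" using m by auto
    have uc: "T (u n) \<in> carrier Q" "T (v n) \<in> carrier Q" if "S n \<noteq> {}" for n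
      using SD(1)[OF uS[OF that]] SD(1)[OF vS[OF that]] by auto
    let ?lhs = "\<lambda>A. inv\<^bsub>Q\<^esub> hol (A (2 * m)) \<otimes>\<^bsub>Q\<^esub> (hol (A m) \<otimes>\<^bsub>Q\<^esub> inv\<^bsub>Q\<^esub> hol (A (Suc (2 * m))))"
    consider "S (2 * m) = {}" "S (Suc (2 * m)) = {}" | "S (2 * m) \<noteq> {}" "S (Suc (2 * m)) = {}"
      | "S (2 * m) = {}" "S (Suc (2 * m)) \<noteq> {}" | "S (2 * m) \<noteq> {}" "S (Suc (2 * m)) \<noteq> {}" by blast
    then show "?lhs A = ?lhs B"
    proof cases
      case 1
      then show ?thesis using S_child[OF m] hA0 by simp
    next
      case 2
      then have ne: "S m \<noteq> {}" using S_child[OF m] by blast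
      have uv: "u m = u (2 * m)" "v m = v (2 * m)" using 2 u_child[OF m] v_child[OF m] by auto
      have am: "a m = a (2 * m)" using a_child[OF m] a_tame[OF m2(2) 2(2)] ac[OF m2(1)] by simp
      show ?thesis unfolding hA[OF m ne] hB[OF m ne] hA[OF m2(1) 2(1)] hB[OF m2(1) 2(1)] hA0[OF 2(2)] uv am
        using uc[OF 2(1)] ac[OF m2(1)] by simp
    next
      case 3
      then have ne: "S m \<noteq> {}" using S_child[OF m] by blast
      have uv: "u m = u (Suc (2 * m))" "v m = v (Suc (2 * m))" using 3 u_child[OF m] v_child[OF m] by auto
      have am: "a m = a (Suc (2 * m))" using a_child[OF m] a_tame[OF m2(1) 3(1)] ac[OF m2(2)] by simp
      show ?thesis unfolding hA[OF m ne] hB[OF m ne] hA[OF m2(2) 3(2)] hB[OF m2(2) 3(2)] hA0[OF 3(1)] uv am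
        using uc[OF 3(2)] ac[OF m2(2)] by simp
    next
      case 4
      then have ne: "S m \<noteq> {}" using S_child[OF m] by blast
      have uv: "u m = u (2 * m)" "v m = v (Suc (2 * m))" using 4 u_child[OF m] v_child[OF m] by auto
      have "?lhs A = inv\<^bsub>Q\<^esub> T (v (2 * m)) \<otimes>\<^bsub>Q\<^esub> T (u (Suc (2 * m)))"
        unfolding hA[OF m ne] hA[OF m2(1) 4(1)] hA[OF m2(2) 4(2)] uv a_child[OF m]
        using uc[OF 4(1)] uc[OF 4(2)] ac[OF m2(1)] ac[OF m2(2)] by (intro additive_conjugate_telescope)
      moreover have "?lhs B = inv\<^bsub>Q\<^esub> T (v (2 * m)) \<otimes>\<^bsub>Q\<^esub> T (u (Suc (2 * m)))"
        unfolding hB[OF m ne] hB[OF m2(1) 4(1)] hB[OF m2(2) 4(2)] uv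
        using uc[OF 4(1)] uc[OF 4(2)] by (simp add: Q.inv_mult_group Q.m_assoc Q.inv_mult_cancel)
      ultimately show ?thesis by simp
    qed
  qed
  moreover have ne: "S 1 \<noteq> {}" using t\<Lambda> t by (auto simp: S_def d_def)
  ultimately have "inv\<^bsub>Q\<^esub> T (u 1) \<otimes>\<^bsub>Q\<^esub> (a 1 \<otimes>\<^bsub>Q\<^esub> T (v 1)) = inv\<^bsub>Q\<^esub> T (u 1) \<otimes>\<^bsub>Q\<^esub> T (v 1)"
    using hA[of 1] hB[of 1] by simp
  moreover have c1: "T (u 1) \<in> carrier Q" "T (v 1) \<in> carrier Q" "a 1 \<in> carrier Q"
    using SD(1)[OF uS[OF ne]] SD(1)[OF vS[OF ne]] by auto
  ultimately have "a 1 \<otimes>\<^bsub>Q\<^esub> T (v 1) = T (v 1)" by (simp add: Q.l_cancel_iff)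
  then have "a 1 = \<one>\<^bsub>Q\<^esub>" using c1 by (simp add: Q.r_cancel_one)
  then show ?thesis using a_trivial_iff[of 1] by (simp add: d_def)
qed

text \<open>
  An isolated wild point \<open>w\<close> has a neighbourhood with no other wild points, and the base over a small
  interval around \<open>t\<close> stays in it.
\<close>

lemma dyadic_closed_if_hawaiian_closed:
  assumes crit: hawaiian_criterion and disc: "discrete (wild_points X)"
    and f: "dyadic_map f" "additive f"
  shows "hol (f \<circ> tree_arc 1) = hol (f \<circ> base_path)"
proof -
  have "base_parallel f 1"
  proof (rule ccontr)
    assume "\<not> base_parallel f 1"
    then obtain t where t: "tree_lo 1 \<le> t" "t \<le> tree_hi 1"
      and bad: "\<And>e. e > 0 \<Longrightarrow> \<exists>j\<ge>1. \<not> base_parallel f j \<and> tree_lo j \<le> t \<and> t \<le> tree_hi j \<and> tree_len j < e"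
      using nonparallel_branch[OF f, of 1] by (metis order_refl)
    have t01: "t \<in> {0..1}" using t by simp
    show False
    proof (cases "f (t, 0) \<in> wild_points X")
      case False
      then obtain e :: real where "e > 0" "\<And>j. j \<ge> 1 \<Longrightarrow> tree_lo j \<le> t \<Longrightarrow> t \<le> tree_hi j \<Longrightarrow> tree_len j < e \<Longrightarrow> base_parallel f j"
        using base_parallel_near_tame[OF f(1) t01] by blast
      then show False using bad by blast
    next
      case True
      then obtain V where V: "open V" "V \<inter> wild_points X = {f (t, 0)}"
        using disc unfolding discrete_def isolated_in_def by blast
      then obtain e :: real where e: "e > 0" "\<And>z. z \<in> dyadic_space \<Longrightarrow> dist z (t, 0) < e \<Longrightarrow> f z \<in> V"
        using near_base_point[OF f(1) t01] by blast
      obtain j where j: "j \<ge> 1" "\<not> base_parallel f j" "tree_lo j \<le> t" "t \<le> tree_hi j" "tree_len j < e" using bad[OF e(1)] by blast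
      have "base_parallel f j"
      proof (rule base_parallel_near_wild[OF crit f j(1,3,4) True])
        fix s assume s: "tree_lo j \<le> s" "s \<le> tree_hi j" "f (s, 0) \<in> wild_points X"
        have "(s, 0) \<in> dyadic_space" using s tree_ends_unit[OF j(1)] by (auto simp: dyadic_space_iff)
        moreover have "dist (s, 0) (t, 0::real) < e" using s j(3-5) by (auto simp: dist_Pair_Pair dist_real_def tree_hi_def)
        ultimately have "f (s, 0) \<in> V" by (rule e(2))
        then show "f (s, 0) = f (t, 0)" using V(2) s(3) by blast
      qed
      then show False using j(2) by blast
    qed
  qed
  moreover have "(f \<circ> base_path) \<circ> linepath 0 1 = f \<circ> base_path" by (auto simp: linepath_def)
  ultimately show ?thesis by (simp add: base_parallel_def)
qed

theorem dyadic_closed_iff_hawaiian_closed: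
  assumes "discrete (wild_points X)"
  shows "test_closed dyadic_space dyadic_base dyadic_subgroup d_infinity X x0 N \<longleftrightarrow>
    test_closed hawaiian_plus hawaiian_plus_base P_subgroup p_tau X x0 N"
  unfolding dyadic_closed_iff hawaiian_closed_iff
proof (intro iffI allI impI; elim conjE)
  fix f
  assume "\<forall>f. dyadic_map f \<and> additive f \<longrightarrow> hol (f \<circ> tree_arc 1) = hol (f \<circ> base_path)"
    and "continuous_on hawaiian_earring f" "f \<in> hawaiian_earring \<rightarrow> X"
    and "\<forall>n\<ge>1. hol (f \<circ> hawaiian_loop (2 * n - 1)) = hol (f \<circ> hawaiian_loop (2 * n))"
  then show "hol (f \<circ> (f_odd \<circ> tau_loop)) = hol (f \<circ> (f_even \<circ> tau_loop))"
    by (intro hawaiian_closed_if_dyadic_closed) simp_all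
next
  fix f
  assume hawaiian_criterion and "continuous_on dyadic_space f" "f \<in> dyadic_space \<rightarrow> X" "additive f"
  then show "hol (f \<circ> tree_arc 1) = hol (f \<circ> base_path)"
    by (intro dyadic_closed_if_hawaiian_closed[OF _ assms] conjI)
qed

end

section \<open>Closures of normal subgroups\<close>

lemma fundamental_group_conjugate:
  assumes "\<alpha> \<in> loops_at X x" "p \<in> loops_at X x"
  shows "path_class X \<alpha> \<otimes>\<^bsub>fundamental_group X x\<^esub> path_class X p \<otimes>\<^bsub>fundamental_group X x\<^esub> inv\<^bsub>fundamental_group X x\<^esub> path_class X \<alpha>
    = path_class X ((\<alpha> +++ p) +++ reversepath \<alpha>)"
proof -
  have "x \<in> X" using loops_atD[OF assms(1)] pathstart_in_path_image by blast
  have "\<alpha> +++ p \<in> loops_at X x" "reversepath \<alpha> \<in> loops_at X x"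
    using loops_atD[OF assms(1)] loops_atD[OF assms(2)] by (auto simp: loops_at_def path_image_join)
  then show ?thesis
    using fundamental_group_mult[OF assms] fundamental_group_mult[of "\<alpha> +++ p" X x "reversepath \<alpha>"] path_class_inv[OF assms(1) \<open>x \<in> X\<close>] by simp
qed

context normal_pi1
begin

lemma class_conjugate_eqI:
  assumes "N = {\<one>\<^bsub>G\<^esub>}" and loops: "\<alpha> \<in> loops_at X x0" "p \<in> loops_at X x0" "q \<in> loops_at X x0"
    and eq: "hol q = hol \<alpha> \<otimes>\<^bsub>Q\<^esub> hol p \<otimes>\<^bsub>Q\<^esub> inv\<^bsub>Q\<^esub> hol \<alpha>"
  shows "path_class X q = path_class X \<alpha> \<otimes>\<^bsub>G\<^esub> path_class X p \<otimes>\<^bsub>G\<^esub> inv\<^bsub>G\<^esub> path_class X \<alpha>"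
proof -
  note a = loops_atD[OF loops(1)] and p = loops_atD[OF loops(2)]
  have l: "(\<alpha> +++ p) +++ reversepath \<alpha> \<in> loops_at X x0" using a p by (auto simp: loops_at_def path_image_join)
  have "hol ((\<alpha> +++ p) +++ reversepath \<alpha>) = hol (\<alpha> +++ p) \<otimes>\<^bsub>Q\<^esub> hol (reversepath \<alpha>)"
    using a p by (intro hol_join) (auto simp: path_image_join)
  also have "hol (\<alpha> +++ p) = hol \<alpha> \<otimes>\<^bsub>Q\<^esub> hol p" using a p by (intro hol_join) auto
  also have "hol (reversepath \<alpha>) = inv\<^bsub>Q\<^esub> hol \<alpha>" using a by (intro hol_reverse) auto
  finally have "hol q = hol ((\<alpha> +++ p) +++ reversepath \<alpha>)" using eq by simp
  then show ?thesis using class_eqI[OF assms(1) loops(3) l] fundamental_group_conjugate[OF loops(1,2)] by simp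
qed

text \<open>
  The closed subgroup \<open>K\<close> need not be normal. Therefore \<open>N\<close> is trivial here, so that holonomy computes
  homotopy classes: a test map for the conjugate subgroup becomes a test map for \<open>K\<close> when a loop
  representing \<open>h\<close> is prefixed.
\<close>

lemma dyadic_closed_conjugate_trivial:
  assumes triv: "N = {\<one>\<^bsub>G\<^esub>}"
    and closed: "test_closed dyadic_space dyadic_base dyadic_subgroup d_infinity X x0 K" and h: "h \<in> carrier G"
  shows "test_closed dyadic_space dyadic_base dyadic_subgroup d_infinity X x0 {a \<in> carrier G. h \<otimes>\<^bsub>G\<^esub> a \<otimes>\<^bsub>G\<^esub> inv\<^bsub>G\<^esub> h \<in> K}"
proof -
  let ?K = "{a \<in> carrier G. h \<otimes>\<^bsub>G\<^esub> a \<otimes>\<^bsub>G\<^esub> inv\<^bsub>G\<^esub> h \<in> K}"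
  obtain \<alpha> where \<alpha>: "\<alpha> \<in> loops_at X x0" "h = path_class X \<alpha>" using h by (auto simp: fundamental_group_def)
  note a = loops_atD[OF \<alpha>(1)]
  have K: "subgroup K G" using closed by (simp add: test_closed_def)
  interpret K: subgroup K G by (rule K)
  have ac [simp]: "hol \<alpha> \<in> carrier Q" using a by (intro hol_carrier) auto
  show ?thesis
    unfolding test_closed_def
  proof (intro conjI allI impI; (elim conjE)?)
    show "subgroup ?K G" by (rule G.subgroup_conjugate[OF K h])
    fix f assume f: "continuous_on dyadic_space f" "f \<in> dyadic_space \<rightarrow> X" "f dyadic_base = x0"
      and D: "induced_hom X f ` dyadic_subgroup \<subseteq> ?K"
    have fm: "dyadic_map f" and f0: "f (0, 0) = x0" using f by (auto simp: dyadic_base_def)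
    have c: "path_in \<alpha>" "pathfinish \<alpha> = f (0, 0)" using a f0 by auto
    let ?g = "splice_path \<alpha> f"
    note g = splice_map[OF fm c]
    have g0: "?g (0, 0) = x0" using g(2) a by simp
    have "path_class X (?g \<circ> q) \<in> K" if q: "standard_concat q" "pathstart q = (0, 0)" "pathfinish q = (0, 0)" for q
    proof -
      obtain q' where q': "q' = (\<lambda>_. (0, 0)) \<or> standard_concat q'" "pathstart q' = (0, 0)" "pathfinish q' = (0, 0)"
        "hol (?g \<circ> q) = hol \<alpha> \<otimes>\<^bsub>Q\<^esub> hol (f \<circ> q') \<otimes>\<^bsub>Q\<^esub> inv\<^bsub>Q\<^esub> hol \<alpha>"
        using splice_standard_loop[OF fm c q] by blast
      have l': "q' \<in> loops_at dyadic_space (0, 0)" "q \<in> loops_at dyadic_space (0, 0)"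
        using q' q standard_concat_props[of q'] standard_concat_props[of q] dyadic_base_in by (auto simp: loops_at_def)
      have lf: "f \<circ> q' \<in> loops_at X x0" using loop_compose[of dyadic_space f "(0,0)"] fm f0 l' by blast
      have lg: "?g \<circ> q \<in> loops_at X x0" using loop_compose[of dyadic_space ?g "(0,0)"] g(1) g0 l' by blast
      have e: "path_class X (?g \<circ> q) = h \<otimes>\<^bsub>G\<^esub> path_class X (f \<circ> q') \<otimes>\<^bsub>G\<^esub> inv\<^bsub>G\<^esub> h"
        unfolding \<alpha>(2) by (rule class_conjugate_eqI[OF triv \<alpha>(1) lf lg q'(4)])
      show ?thesis
      proof (cases "standard_concat q'")
        case True
        then have "path_class X (f \<circ> q') \<in> ?K"
          using q'(2,3) by (intro dyadic_induced_subset[OF fm f0, THEN iffD1, OF D, rule_format] conjI)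
        then show ?thesis unfolding e by blast
      next
        case False
        then have "q' = (\<lambda>_. (0, 0))" using q' by blast
        then have "path_class X (f \<circ> q') = \<one>\<^bsub>G\<^esub>" using f0 by (simp add: comp_def fundamental_group_def)
        then show ?thesis unfolding e using h K.one_closed by simp
      qed
    qed
    then have "induced_hom X ?g ` dyadic_subgroup \<subseteq> K"
      by (intro dyadic_induced_subset[OF g(1) g0, THEN iffD2] allI impI) simp
    then have gK: "path_class X (?g \<circ> dyadic_boundary) \<in> K"
      using closed g(1) g0 unfolding test_closed_def dyadic_base_def induced_d_infinity[OF g(1), symmetric] by blast
    have lf: "f \<circ> dyadic_boundary \<in> loops_at X x0" using loop_compose[of dyadic_space f, OF _ _ _ dyadic_boundary_loop] fm f0 by blast
    have lg: "?g \<circ> dyadic_boundary \<in> loops_at X x0" using loop_compose[of dyadic_space ?g, OF _ _ _ dyadic_boundary_loop] g(1) g0 by blast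
    have "hol (?g \<circ> dyadic_boundary) = hol \<alpha> \<otimes>\<^bsub>Q\<^esub> hol (f \<circ> dyadic_boundary) \<otimes>\<^bsub>Q\<^esub> inv\<^bsub>Q\<^esub> hol \<alpha>"
      unfolding hol_dyadic_boundary[OF g(1)] hol_dyadic_boundary[OF fm] g(3,4)
      using arc_carrier[OF fm, of 1] hol_compose_carrier[OF fm base_path(1,2)] by (simp add: Q.inv_mult_group Q.m_assoc)
    then have "path_class X (?g \<circ> dyadic_boundary) = h \<otimes>\<^bsub>G\<^esub> path_class X (f \<circ> dyadic_boundary) \<otimes>\<^bsub>G\<^esub> inv\<^bsub>G\<^esub> h"
      unfolding \<alpha>(2) by (rule class_conjugate_eqI[OF triv \<alpha>(1) lf lg])
    then show "induced_hom X f d_infinity \<in> ?K"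
      unfolding induced_d_infinity[OF fm] using gK class_carrier[OF lf] by simp
  qed
qed

lemma hawaiian_closed_conjugate_trivial:
  assumes triv: "N = {\<one>\<^bsub>G\<^esub>}"
    and closed: "test_closed hawaiian_plus hawaiian_plus_base P_subgroup p_tau X x0 K" and h: "h \<in> carrier G"
  shows "test_closed hawaiian_plus hawaiian_plus_base P_subgroup p_tau X x0 {a \<in> carrier G. h \<otimes>\<^bsub>G\<^esub> a \<otimes>\<^bsub>G\<^esub> inv\<^bsub>G\<^esub> h \<in> K}"
proof -
  let ?K = "{a \<in> carrier G. h \<otimes>\<^bsub>G\<^esub> a \<otimes>\<^bsub>G\<^esub> inv\<^bsub>G\<^esub> h \<in> K}"
  obtain \<alpha> where \<alpha>: "\<alpha> \<in> loops_at X x0" "h = path_class X \<alpha>" using h by (auto simp: fundamental_group_def)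
  note a = loops_atD[OF \<alpha>(1)]
  have K: "subgroup K G" using closed by (simp add: test_closed_def)
  have K': "subgroup ?K G" by (rule G.subgroup_conjugate[OF K h])
  have ac [simp]: "hol \<alpha> \<in> carrier Q" using a by (intro hol_carrier) auto
  show ?thesis
    unfolding test_closed_def
  proof (intro conjI allI impI; (elim conjE)?)
    show "subgroup ?K G" by (rule K')
    fix f assume f: "continuous_on hawaiian_plus f" "f \<in> hawaiian_plus \<rightarrow> X" "f hawaiian_plus_base = x0"
      and P: "induced_hom X f ` P_subgroup \<subseteq> ?K"
    have em: "earring_map f" using f continuous_on_subset[OF f(1) earring_subset_plus] earring_subset_plus by auto
    have w: "path_in (f \<circ> whisker)" "pathstart (f \<circ> whisker) = x0" "pathfinish (f \<circ> whisker) = f (0, 0)"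
      using path_in_compose[OF f(1), of whisker] f whisker_props by (auto simp: pathstart_compose pathfinish_compose)
    define c where "c = \<alpha> +++ (f \<circ> whisker)"
    have c: "path_in c" "pathstart c = x0" "pathfinish c = f (0, 0)" using a w by (auto simp: c_def path_image_join)
    have hc: "hol c = hol \<alpha> \<otimes>\<^bsub>Q\<^esub> hol (f \<circ> whisker)" unfolding c_def using a w by (intro hol_join) auto
    let ?g = "whisker_map c f"
    note g = whisker_map_props[OF em c(1,3)]
    have g3: "?g hawaiian_plus_base = x0" using g(3) c(2) by simp
    have key: "path_class X (?g \<circ> lasso p q) = h \<otimes>\<^bsub>G\<^esub> path_class X (f \<circ> lasso p q) \<otimes>\<^bsub>G\<^esub> inv\<^bsub>G\<^esub> h"
      if pq: "p \<in> loops_at hawaiian_earring (0, 0)" "q \<in> loops_at hawaiian_earring (0, 0)" for p q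
    proof -
      note hf = hol_lasso[OF f(1,2) pq] and hg = hol_lasso[OF g(1,2) pq]
      have [simp]: "hol (f \<circ> whisker) \<in> carrier Q" "hol (f \<circ> p) \<in> carrier Q" "hol (f \<circ> q) \<in> carrier Q"
        using hf(2-4) hol_carrier by auto
      have "hol (?g \<circ> lasso p q) = hol \<alpha> \<otimes>\<^bsub>Q\<^esub> hol (f \<circ> lasso p q) \<otimes>\<^bsub>Q\<^esub> inv\<^bsub>Q\<^esub> hol \<alpha>"
        unfolding hf(1) hg(1) g(4)[OF pq(1)] g(4)[OF pq(2)] g(5) hc by (simp add: Q.inv_mult_group Q.m_assoc)
      then show ?thesis unfolding \<alpha>(2)
        by (rule class_conjugate_eqI[OF triv \<alpha>(1) loop_compose[OF f lasso_loop[OF pq]] loop_compose[OF g(1,2) g3 lasso_loop[OF pq]]])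
    qed
    have "path_class X (?g \<circ> lasso (hawaiian_loop (2 * n - 1)) (hawaiian_loop (2 * n))) \<in> K" if n: "n \<ge> 1" for n
    proof -
      have l: "hawaiian_loop (2 * n - 1) \<in> loops_at hawaiian_earring (0, 0)" "hawaiian_loop (2 * n) \<in> loops_at hawaiian_earring (0, 0)"
        using n by (intro hawaiian_loop_in_loops; simp)+
      have "path_class X (f \<circ> lasso (hawaiian_loop (2 * n - 1)) (hawaiian_loop (2 * n))) \<in> ?K"
        using P P_induced_subset[OF f K'] n by blast
      then show ?thesis unfolding key[OF l] by blast
    qed
    then have "induced_hom X ?g ` P_subgroup \<subseteq> K" using P_induced_subset[OF g(1,2) g3 K] by blast
    then have "induced_hom X ?g p_tau \<in> K" using closed g(1,2) g3 unfolding test_closed_def by blast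
    then show "induced_hom X f p_tau \<in> ?K"
      unfolding induced_p_tau[OF g(1,2)] induced_p_tau[OF f(1,2)] key[OF tau_in_loops]
      using class_carrier[OF loop_compose[OF f lasso_loop[OF tau_in_loops]]] by simp
  qed
qed

end

lemma closed_conjugate:
  assumes "path_connected X" "x0 \<in> X" and h: "h \<in> carrier (fundamental_group X x0)"
  defines "G \<equiv> fundamental_group X x0"
  shows "test_closed dyadic_space dyadic_base dyadic_subgroup d_infinity X x0 K \<Longrightarrow>
      test_closed dyadic_space dyadic_base dyadic_subgroup d_infinity X x0 {a \<in> carrier G. h \<otimes>\<^bsub>G\<^esub> a \<otimes>\<^bsub>G\<^esub> inv\<^bsub>G\<^esub> h \<in> K}"
    "test_closed hawaiian_plus hawaiian_plus_base P_subgroup p_tau X x0 K \<Longrightarrow>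
      test_closed hawaiian_plus hawaiian_plus_base P_subgroup p_tau X x0 {a \<in> carrier G. h \<otimes>\<^bsub>G\<^esub> a \<otimes>\<^bsub>G\<^esub> inv\<^bsub>G\<^esub> h \<in> K}"
proof -
  interpret triv: group "fundamental_group X x0" by (rule group_fundamental_group[OF assms(2)])
  interpret I: normal_pi1 X x0 "{\<one>\<^bsub>fundamental_group X x0\<^esub>}"
    by (intro normal_pi1.intro assms triv.one_is_normal)
  show "test_closed dyadic_space dyadic_base dyadic_subgroup d_infinity X x0 K \<Longrightarrow>
      test_closed dyadic_space dyadic_base dyadic_subgroup d_infinity X x0 {a \<in> carrier G. h \<otimes>\<^bsub>G\<^esub> a \<otimes>\<^bsub>G\<^esub> inv\<^bsub>G\<^esub> h \<in> K}"
    unfolding G_def by (rule I.dyadic_closed_conjugate_trivial[OF refl _ h])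
  show "test_closed hawaiian_plus hawaiian_plus_base P_subgroup p_tau X x0 K \<Longrightarrow>
      test_closed hawaiian_plus hawaiian_plus_base P_subgroup p_tau X x0 {a \<in> carrier G. h \<otimes>\<^bsub>G\<^esub> a \<otimes>\<^bsub>G\<^esub> inv\<^bsub>G\<^esub> h \<in> K}"
    unfolding G_def by (rule I.hawaiian_closed_conjugate_trivial[OF refl _ h])
qed

text \<open>
  Conjugation permutes the closed subgroups that contain \<open>N\<close>, hence their intersection is normal.
\<close>

lemma test_closure_normal_closed:
  assumes x: "x \<in> X" and N: "N \<lhd> fundamental_group X x" and g: "g \<in> carrier (fundamental_group S s)"
    and conj: "\<And>h K. h \<in> carrier (fundamental_group X x) \<Longrightarrow> test_closed S s T g X x K \<Longrightarrow>
      test_closed S s T g X x {a \<in> carrier (fundamental_group X x).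
        h \<otimes>\<^bsub>fundamental_group X x\<^esub> a \<otimes>\<^bsub>fundamental_group X x\<^esub> inv\<^bsub>fundamental_group X x\<^esub> h \<in> K}"
  shows "test_closure S s T g X x N \<lhd> fundamental_group X x" (is "?C \<lhd> ?G")
    "test_closed S s T g X x (test_closure S s T g X x N)"
    "N \<subseteq> test_closure S s T g X x N"
proof -
  interpret G: group ?G by (rule group_fundamental_group[OF x])
  interpret N: normal N ?G by (rule N)
  let ?F = "{K. test_closed S s T g X x K \<and> N \<subseteq> K}"
  have "test_closed S s T g X x (carrier ?G)"
    unfolding test_closed_def
  proof (intro conjI allI impI; (elim conjE)?)
    show "subgroup (carrier ?G) ?G" by (rule G.subgroup_self)
    fix f assume "continuous_on S f" "f \<in> S \<rightarrow> X" "f s = x"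
    then show "induced_hom X f g \<in> carrier ?G" using hom_carrier[OF induced_hom_hom[of S f X s x]] g by blast
  qed
  then have ne: "carrier ?G \<in> ?F" using N.subset by blast
  have sub: "subgroup K ?G" if "K \<in> ?F" for K using that by (simp add: test_closed_def)
  have C: "subgroup ?C ?G" unfolding test_closure_def by (rule G.subgroups_Inter) (use ne sub in auto)
  show "test_closed S s T g X x ?C"
    unfolding test_closed_def
  proof (intro conjI allI impI; (elim conjE)?)
    show "subgroup ?C ?G" by (rule C)
    fix f assume f: "continuous_on S f" "f \<in> S \<rightarrow> X" "f s = x" "induced_hom X f ` T \<subseteq> ?C"
    show "induced_hom X f g \<in> ?C"
      unfolding test_closure_def
    proof (rule InterI)
      fix K assume K: "K \<in> ?F"
      then have "induced_hom X f ` T \<subseteq> K" using f(4) unfolding test_closure_def by blast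
      then show "induced_hom X f g \<in> K" using K f(1-3) unfolding test_closed_def by blast
    qed
  qed
  show "N \<subseteq> ?C" unfolding test_closure_def by blast
  show "?C \<lhd> ?G"
  proof (rule G.normal_invI[OF C])
    fix h a assume h: "h \<in> carrier ?G" and a: "a \<in> ?C"
    show "h \<otimes>\<^bsub>?G\<^esub> a \<otimes>\<^bsub>?G\<^esub> inv\<^bsub>?G\<^esub> h \<in> ?C"
      unfolding test_closure_def
    proof (rule InterI)
      fix K assume K: "K \<in> ?F"
      let ?K = "{a \<in> carrier ?G. h \<otimes>\<^bsub>?G\<^esub> a \<otimes>\<^bsub>?G\<^esub> inv\<^bsub>?G\<^esub> h \<in> K}"
      have "N \<subseteq> ?K" using K N.inv_op_closed2[OF h] N.subset by blast
      moreover have "test_closed S s T g X x ?K" using K conj[OF h] by blast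
      ultimately have "a \<in> ?K" using a unfolding test_closure_def by blast
      then show "h \<otimes>\<^bsub>?G\<^esub> a \<otimes>\<^bsub>?G\<^esub> inv\<^bsub>?G\<^esub> h \<in> K" by blast
    qed
  qed
qed

theorem theorem7p13:
  fixes X :: "'a::topological_space set" and x0 :: 'a and N :: "(real \<Rightarrow> 'a) set set"
  assumes "path_connected X" and "x0 \<in> X"
    and "discrete (wild_points X)"
    and "N \<lhd> fundamental_group X x0"
  shows "(test_closed dyadic_space dyadic_base dyadic_subgroup d_infinity X x0 N \<longleftrightarrow>
          test_closed hawaiian_plus hawaiian_plus_base P_subgroup p_tau X x0 N)
       \<and> test_closure dyadic_space dyadic_base dyadic_subgroup d_infinity X x0 N =
         test_closure hawaiian_plus hawaiian_plus_base P_subgroup p_tau X x0 N"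
proof
  have iff: "test_closed dyadic_space dyadic_base dyadic_subgroup d_infinity X x0 M \<longleftrightarrow>
      test_closed hawaiian_plus hawaiian_plus_base P_subgroup p_tau X x0 M" if "M \<lhd> fundamental_group X x0" for M
    using normal_pi1.dyadic_closed_iff_hawaiian_closed[OF normal_pi1.intro[OF assms(1,2) that] assms(3)] .
  show "test_closed dyadic_space dyadic_base dyadic_subgroup d_infinity X x0 N \<longleftrightarrow>
      test_closed hawaiian_plus hawaiian_plus_base P_subgroup p_tau X x0 N" by (rule iff[OF assms(4)])
  have dc: "d_infinity \<in> carrier (fundamental_group dyadic_space dyadic_base)"
    unfolding d_infinity_eq dyadic_base_def using dyadic_boundary_loop by (simp add: fundamental_group_def)
  have pc: "p_tau \<in> carrier (fundamental_group hawaiian_plus hawaiian_plus_base)"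
    unfolding p_tau_eq using lasso_loop[OF tau_in_loops] by (simp add: fundamental_group_def)
  note D = test_closure_normal_closed[OF assms(2,4) dc closed_conjugate(1)[OF assms(1,2)]]
  note P = test_closure_normal_closed[OF assms(2,4) pc closed_conjugate(2)[OF assms(1,2)]]
  show "test_closure dyadic_space dyadic_base dyadic_subgroup d_infinity X x0 N =
      test_closure hawaiian_plus hawaiian_plus_base P_subgroup p_tau X x0 N"
  proof
    show "test_closure dyadic_space dyadic_base dyadic_subgroup d_infinity X x0 N \<subseteq>
        test_closure hawaiian_plus hawaiian_plus_base P_subgroup p_tau X x0 N"
      using iff[OF P(1)] P(2,3) unfolding test_closure_def[of dyadic_space] by blast
    show "test_closure hawaiian_plus hawaiian_plus_base P_subgroup p_tau X x0 N \<subseteq>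
        test_closure dyadic_space dyadic_base dyadic_subgroup d_infinity X x0 N"
      using iff[OF D(1)] D(2,3) unfolding test_closure_def[of hawaiian_plus] by blast
  qed
qed

end
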